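(* Suppose $X$ is a path connected, locally path connected Polish space, $x \in X$, and $\phi: \pi_1(X,x) \to *_{i\in I}G_i$ is an isomorphism, where each $G_i$ is a nontrivial group; identify $\pi_1(X,x)$ with $*_{i\in I}G_i$ via $\phi$. The following hold: (1) $\operatorname{card}(I)\leq \aleph_0$. (2) For each $j \in I$, the retraction map $r_j:*_{i\in I}G_i \rightarrow G_j$ has analytic kernel. (3) Each $G_j$ is of cardinality $\leq \aleph_0$ or $2^{\aleph_0}$. (4) The canonical map $*_{i\in I}G_i \rightarrow \bigoplus_{i\in I}G_i$ has analytic kernel.
   Context: A space is Polish if it is completely metrizable and separable. For a path connected metric space $X$ and $x\in X$, $L_x$ is the set of loops $[0,1]\to X$ based at $x$ with the sup metric. For $G\leq\pi_1(X,x)$, $\bigcup G\subseteq L_x$ is the set of all loops whose homotopy class lies in $G$. A subset of a Polish space is analytic if it is the image of a Polish space under a continuous map; a subgroup $G\leq \pi_1(X,x)$ is analytic if $\bigcup G$ is analytic in $L_x$ (which is Polish when $X$ is). The retraction $r_j$ is the identity on $G_j$ and trivial on $G_i$ for $i\neq j$; $*$ denotes free product and $\bigoplus$ denotes direct sum (restricted direct product) of groups. "Analytic kernel" in (2) and (4) means that the kernel of the composition with $\phi$ is an analytic subgroup of $\pi_1(X,x)$. *)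

theory Defs
  imports "HOL-Analysis.Analysis" "HOL-Algebra.Product_Groups"
begin

section \<open>Polish spaces and analytic sets\<close>

definition polish_topology :: "'a topology \<Rightarrow> bool" where
  "polish_topology T \<longleftrightarrow> completely_metrizable_space T \<and> separable_space T"

text \<open>HOL cannot quantify over types inside a formula, so the parametrising Polish space is
  given as a topology on a subset of one fixed type of continuum cardinality.
  Lemma \<open>analytic_inI\<close> shows that Polish spaces over arbitrary types give nothing more.\<close>

definition analytic_in :: "'a topology \<Rightarrow> 'a set \<Rightarrow> bool" where
  "analytic_in Y A \<longleftrightarrow>
    (\<exists>(Z :: (nat \<Rightarrow> real) topology) f. polish_topology Z \<and> continuous_map Z Y f \<and> f ` topspace Z = A)"

lemma polish_topology_homeomorphic:
  assumes "Z homeomorphic_space Z'" "polish_topology Z"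
  shows "polish_topology Z'"
proof -
  obtain f g where fg: "homeomorphic_maps Z Z' f g"
    using assms(1) by (auto simp: homeomorphic_space_def)
  then have hm: "homeomorphic_map Z Z' f" by (simp add: homeomorphic_maps_map)
  have "continuous_map Z Z' f" "f ` topspace Z = topspace Z'"
    using homeomorphic_imp_continuous_map[OF hm] homeomorphic_imp_surjective_map[OF hm] by simp_all
  then have "separable_space Z'"
    using assms(2) separable_space_continuous_map_image[of Z Z' f]
    by (simp add: polish_topology_def)
  then show ?thesis
    using assms homeomorphic_completely_metrizable_space by (auto simp: polish_topology_def)
qed

lemma polish_topology_inj:
  fixes Z :: "'a topology"
  assumes "polish_topology Z"
  obtains h :: "'a \<Rightarrow> nat \<Rightarrow> real" where "inj_on h (topspace Z)"
proof (cases "topspace Z = {}")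
  case True
  then show ?thesis by (simp add: that)
next
  case False
  obtain M d where M: "Metric_space M d" "Z = Metric_space.mtopology M d"
    using assms by (auto simp: polish_topology_def completely_metrizable_space_def)
  interpret Metric_space M d by (rule M)
  obtain C where C: "countable C" "C \<subseteq> M" "mtopology closure_of C = M"
    using assms M by (auto simp: polish_topology_def separable_space_def)
  have "C \<noteq> {}" using C False M by auto
  then have rc: "range (from_nat_into C) = C" using C by (simp add: range_from_nat_into)
  have "inj_on (\<lambda>z n. d z (from_nat_into C n)) M"
  proof (rule inj_onI, rule ccontr)
    fix y z assume yz: "y \<in> M" "z \<in> M" "(\<lambda>n. d y (from_nat_into C n)) = (\<lambda>n. d z (from_nat_into C n))" "y \<noteq> z"
    then have pos: "d y z / 2 > 0" by simp
    have "y \<in> mtopology closure_of C" using C yz by simp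
    then obtain c where c: "c \<in> C" "c \<in> M" "d y c < d y z / 2"
      using pos unfolding metric_closure_of by (fastforce simp: in_mball)
    then obtain n where "c = from_nat_into C n" using rc by blast
    then have "d y c = d z c" using yz(3) by metis
    moreover have "d y z \<le> d y c + d c z" using yz c triangle by blast
    ultimately show False using c commute[of c z] by simp
  qed
  then show ?thesis using that M by simp
qed

lemma analytic_inI:
  fixes Z :: "'b topology"
  assumes Z: "polish_topology Z" and f: "continuous_map Z Y f"
  shows "analytic_in Y (f ` topspace Z)"
proof -
  obtain h :: "'b \<Rightarrow> nat \<Rightarrow> real" where h: "inj_on h (topspace Z)"
    using polish_topology_inj[OF Z] .
  define g where "g = inv_into (topspace Z) h"
  define Z' where "Z' = pullback_topology (h ` topspace Z) g Z"
  have gh: "g (h z) = z" if "z \<in> topspace Z" for z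
    using that h by (simp add: g_def)
  then have ts: "topspace Z' = h ` topspace Z"
    by (auto simp: Z'_def topspace_pullback_topology)
  have g: "continuous_map Z' Z g"
    using continuous_map_pullback[of Z Z id] by (auto simp: Z'_def)
  have "continuous_map Z Z' h"
    unfolding Z'_def
    by (rule continuous_map_pullback') (auto intro: continuous_map_eq[of Z Z id] simp: gh)
  with g have "homeomorphic_maps Z Z' h g"
    by (auto simp: homeomorphic_maps_def gh ts)
  then have "polish_topology Z'"
    using polish_topology_homeomorphic[OF _ Z] by (auto simp: homeomorphic_space_def)
  moreover have "continuous_map Z' Y (f \<circ> g)"
    using g f by (rule continuous_map_compose)
  moreover have "(f \<circ> g) ` topspace Z' = f ` topspace Z"
    by (auto simp: ts gh image_image)
  ultimately show ?thesis
    unfolding analytic_in_def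
    by - (rule exI[of _ Z'], rule exI[of _ "f \<circ> g"], rule conjI, assumption, rule conjI)
qed


section \<open>Loop spaces and the fundamental group\<close>

text \<open>Paths in the library are functions on all of \<open>real\<close>; extensionality makes a loop determined
  by its values on the unit interval.\<close>

definition loops :: "'a::metric_space set \<Rightarrow> 'a \<Rightarrow> (real \<Rightarrow> 'a) set" where
  "loops X x = {p \<in> extensional {0..1}. path p \<and> path_image p \<subseteq> X \<and> pathstart p = x \<and> pathfinish p = x}"

definition loop_metric :: "'a::metric_space set \<Rightarrow> 'a \<Rightarrow> (real \<Rightarrow> 'a) metric" where
  "loop_metric X x = submetric (cfunspace (top_of_set {0..1}) euclidean_metric) (loops X x)"

lemma mspace_loop_metric: "mspace (loop_metric X x) = loops X x"
proof -
  have "Metric_space.mbounded UNIV dist (p ` {0..1})" if "path p" for p :: "real \<Rightarrow> 'a"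
    using compact_path_image[OF that]
    by (metis Met_TC.compactin_imp_mbounded mtopology_is_euclidean compactin_euclidean_iff path_image_def)
  then show ?thesis by (auto simp: loop_metric_def loops_def path_def)
qed

lemma mdist_loop_metric:
  assumes "p \<in> loops X x" "q \<in> loops X x"
  shows "mdist (loop_metric X x) p q = (SUP t\<in>{0..1}. dist (p t) (q t))"
proof -
  have "p \<in> mspace (loop_metric X x)" "q \<in> mspace (loop_metric X x)"
    using assms by (simp_all only: mspace_loop_metric)
  then show ?thesis
    by (auto simp: loop_metric_def cfunspace_def Met_TC.fdist_def)
qed

definition loop_homotopy :: "'a::metric_space set \<Rightarrow> 'a \<Rightarrow> ((real \<Rightarrow> 'a) \<times> (real \<Rightarrow> 'a)) set" where
  "loop_homotopy X x = {(p, q). p \<in> loops X x \<and> q \<in> loops X x \<and> homotopic_paths X p q}"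

definition fundamental_group :: "'a::metric_space set \<Rightarrow> 'a \<Rightarrow> (real \<Rightarrow> 'a) set monoid" where
  "fundamental_group X x =
    \<lparr>carrier = loops X x // loop_homotopy X x,
     mult = (\<lambda>A B. {r \<in> loops X x. \<exists>p\<in>A. \<exists>q\<in>B. homotopic_paths X (p +++ q) r}),
     one = {r \<in> loops X x. homotopic_paths X (\<lambda>_. x) r}\<rparr>"

text \<open>Elements of the fundamental group are sets of loops, so the set of all loops whose class lies
  in \<open>K\<close> is \<open>\<Union>K\<close>.\<close>

definition analytic_subgroup :: "'a::metric_space set \<Rightarrow> 'a \<Rightarrow> (real \<Rightarrow> 'a) set set \<Rightarrow> bool" where
  "analytic_subgroup X x K \<longleftrightarrow>
     subgroup K (fundamental_group X x) \<and> analytic_in (mtopology_of (loop_metric X x)) (\<Union>K)"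

lemma equiv_loop_homotopy: "equiv (loops X x) (loop_homotopy X x)"
  by (auto simp: loop_homotopy_def loops_def intro!: equivI refl_onI symI transI
      intro: homotopic_paths_sym homotopic_paths_trans)

definition loop_class :: "'a::metric_space set \<Rightarrow> 'a \<Rightarrow> (real \<Rightarrow> 'a) \<Rightarrow> (real \<Rightarrow> 'a) set" where
  "loop_class X x p = {r \<in> loops X x. homotopic_paths X p r}"

definition is_loop :: "'a::metric_space set \<Rightarrow> 'a \<Rightarrow> (real \<Rightarrow> 'a) \<Rightarrow> bool" where
  "is_loop X x p \<longleftrightarrow> path p \<and> path_image p \<subseteq> X \<and> pathstart p = x \<and> pathfinish p = x"

lemma is_loop_join: "is_loop X x p \<Longrightarrow> is_loop X x q \<Longrightarrow> is_loop X x (p +++ q)"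
  by (auto simp: is_loop_def path_image_join)

lemma is_loop_reverse: "is_loop X x p \<Longrightarrow> is_loop X x (reversepath p)"
  by (auto simp: is_loop_def)

lemma is_loop_const: "x \<in> X \<Longrightarrow> is_loop X x (\<lambda>_. x)"
  by (auto simp: is_loop_def path_def path_image_def pathstart_def pathfinish_def)

lemma is_loop_homotopic: "is_loop X x p \<Longrightarrow> homotopic_paths X p q \<Longrightarrow> is_loop X x q"
  using homotopic_paths_imp_path homotopic_paths_imp_subset homotopic_paths_imp_pathstart
    homotopic_paths_imp_pathfinish unfolding is_loop_def by metis

lemma is_loop_if_loops: "p \<in> loops X x \<Longrightarrow> is_loop X x p"
  by (auto simp: loops_def is_loop_def)

lemma restrict_loop:
  assumes "is_loop X x p"
  shows "restrict p {0..1} \<in> loops X x" "homotopic_paths X p (restrict p {0..1})"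
proof -
  show h: "homotopic_paths X p (restrict p {0..1})"
    using assms by (auto simp: is_loop_def intro!: homotopic_paths_eq)
  show "restrict p {0..1} \<in> loops X x"
    using is_loop_homotopic[OF assms h] by (auto simp: loops_def is_loop_def)
qed

lemma loop_class_eq_iff:
  assumes "is_loop X x p" "is_loop X x q"
  shows "loop_class X x p = loop_class X x q \<longleftrightarrow> homotopic_paths X p q"
proof
  assume "loop_class X x p = loop_class X x q"
  then have "restrict p {0..1} \<in> loop_class X x q"
    using restrict_loop[OF assms(1)] unfolding loop_class_def by blast
  then show "homotopic_paths X p q"
    using restrict_loop[OF assms(1)] unfolding loop_class_def
    using homotopic_paths_sym homotopic_paths_trans by blast
next
  assume "homotopic_paths X p q"
  then show "loop_class X x p = loop_class X x q"
    unfolding loop_class_def using homotopic_paths_sym homotopic_paths_trans by blast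
qed

lemma carrier_fundamental_group:
  "carrier (fundamental_group X x) = loop_class X x ` {p. is_loop X x p}"
proof -
  have eq: "loop_homotopy X x `` {p} = loop_class X x p" if "p \<in> loops X x" for p
    using that by (auto simp: loop_homotopy_def loop_class_def)
  have "loops X x // loop_homotopy X x = loop_class X x ` loops X x"
    by (auto simp: quotient_def eq)
  also have "\<dots> = loop_class X x ` {p. is_loop X x p}"
  proof
    show "loop_class X x ` {p. is_loop X x p} \<subseteq> loop_class X x ` loops X x"
    proof clarify
      fix p assume p: "is_loop X x p"
      note r = restrict_loop[OF p]
      have "loop_class X x p = loop_class X x (restrict p {0..1})"
        using r loop_class_eq_iff[OF p is_loop_if_loops] by blast
      then show "loop_class X x p \<in> loop_class X x ` loops X x" using r by blast
    qed
  qed (auto intro: is_loop_if_loops)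
  finally show ?thesis by (simp add: fundamental_group_def)
qed

lemma mult_fundamental_group:
  assumes p: "is_loop X x p" and q: "is_loop X x q"
  shows "loop_class X x p \<otimes>\<^bsub>fundamental_group X x\<^esub> loop_class X x q = loop_class X x (p +++ q)"
    (is "?L = ?R")
proof
  show "?L \<subseteq> ?R"
  proof
    fix r assume "r \<in> ?L"
    then obtain p' q' where r: "r \<in> loops X x" "homotopic_paths X p p'" "homotopic_paths X q q'"
      "homotopic_paths X (p' +++ q') r"
      by (auto simp: fundamental_group_def loop_class_def)
    then have "homotopic_paths X (p +++ q) (p' +++ q')"
      using p q by (auto simp: is_loop_def intro!: homotopic_paths_join)
    with r show "r \<in> ?R" by (auto simp: loop_class_def intro: homotopic_paths_trans)
  qed
  show "?R \<subseteq> ?L"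
  proof
    fix r assume r: "r \<in> ?R"
    note p' = restrict_loop[OF p] and q' = restrict_loop[OF q]
    have "homotopic_paths X (p +++ q) (restrict p {0..1} +++ restrict q {0..1})"
      using p q p' q' by (auto simp: is_loop_def intro!: homotopic_paths_join)
    then have "homotopic_paths X (restrict p {0..1} +++ restrict q {0..1}) r"
      using r homotopic_paths_sym homotopic_paths_trans unfolding loop_class_def by blast
    with r p' q' show "r \<in> ?L"
      unfolding fundamental_group_def loop_class_def by auto
  qed
qed

lemma one_fundamental_group: "\<one>\<^bsub>fundamental_group X x\<^esub> = loop_class X x (\<lambda>_. x)"
  by (simp add: fundamental_group_def loop_class_def)

lemma homotopic_paths_const_left:
  assumes p: "is_loop X x p"
  shows "homotopic_paths X ((\<lambda>_. x) +++ p) p"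
proof (rule homotopic_paths_sym,
    rule homotopic_paths_reparametrize[where f = "\<lambda>t. if t \<le> 1/2 then 0 else 2 * t - 1"])
  show "continuous_on {0..1} (\<lambda>t::real. if t \<le> 1/2 then 0 else 2 * t - 1)"
    unfolding split_01 by (rule continuous_on_cases continuous_intros | force)+
qed (use p in \<open>auto simp: is_loop_def joinpaths_def pathstart_def\<close>)

lemma homotopic_paths_inverse_left:
  assumes p: "is_loop X x p"
  shows "homotopic_paths X (reversepath p +++ p) (\<lambda>_. x)"
proof -
  have c: "continuous_on {0..1} p" and sub: "p ` {0..1} \<subseteq> X" and e: "p 0 = x" "p 1 = x"
    using p by (auto simp: is_loop_def path_def path_image_def pathstart_def pathfinish_def)
  let ?k = "\<lambda>y::real \<times> real. if snd y \<le> 1/2 then 1 - (1 - fst y) * (2 * snd y)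
                     else 1 - (1 - fst y) * (2 - 2 * snd y)"
  have k: "continuous_on ({0..1} \<times> {0..1}) ?k"
    by (rule continuous_on_cases_le) (auto intro!: continuous_intros simp: algebra_simps)
  have kin: "?k y \<in> {0..1}" if "y \<in> {0..1} \<times> {0..1}" for y
    using that by (auto simp: mult_le_one)
  have "continuous_on ({0..1} \<times> {0..1}) (p \<circ> ?k)"
    by (rule continuous_on_compose[OF k continuous_on_subset[OF c]]) (use kin in blast)
  moreover have "p \<circ> ?k \<in> ({0..1} \<times> {0..1}) \<rightarrow> X" using kin sub by auto
  ultimately show ?thesis
    unfolding homotopic_paths
    by (intro exI[of _ "p \<circ> ?k"])
      (auto simp: joinpaths_def reversepath_def pathstart_def pathfinish_def e algebra_simps)
qed

lemma group_fundamental_group: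
  assumes "x \<in> X"
  shows "group (fundamental_group X x)"
proof (rule groupI)
  let ?\<pi> = "fundamental_group X x"
  note [simp] = carrier_fundamental_group one_fundamental_group
  show "A \<otimes>\<^bsub>?\<pi>\<^esub> B \<in> carrier ?\<pi>" if "A \<in> carrier ?\<pi>" "B \<in> carrier ?\<pi>" for A B
    using that by (auto simp: mult_fundamental_group is_loop_join)
  show "\<one>\<^bsub>?\<pi>\<^esub> \<in> carrier ?\<pi>" using is_loop_const[OF assms] by auto
  show "A \<otimes>\<^bsub>?\<pi>\<^esub> B \<otimes>\<^bsub>?\<pi>\<^esub> C = A \<otimes>\<^bsub>?\<pi>\<^esub> (B \<otimes>\<^bsub>?\<pi>\<^esub> C)"
    if "A \<in> carrier ?\<pi>" "B \<in> carrier ?\<pi>" "C \<in> carrier ?\<pi>" for A B C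
  proof -
    obtain p q r where pqr: "is_loop X x p" "is_loop X x q" "is_loop X x r"
      and ABC: "A = loop_class X x p" "B = loop_class X x q" "C = loop_class X x r"
      using \<open>A \<in> _\<close> \<open>B \<in> _\<close> \<open>C \<in> _\<close> by auto
    have "homotopic_paths X (p +++ (q +++ r)) ((p +++ q) +++ r)"
      using pqr by (intro homotopic_paths_assoc) (auto simp: is_loop_def)
    then show ?thesis
      unfolding ABC using pqr
      by (simp add: mult_fundamental_group is_loop_join loop_class_eq_iff homotopic_paths_sym_eq)
  qed
  show "\<one>\<^bsub>?\<pi>\<^esub> \<otimes>\<^bsub>?\<pi>\<^esub> A = A" if "A \<in> carrier ?\<pi>" for A
  proof -
    obtain p where p: "is_loop X x p" "A = loop_class X x p" using \<open>A \<in> _\<close> by auto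
    then show ?thesis
      using is_loop_const[OF assms] homotopic_paths_const_left[OF p(1)]
      by (simp add: mult_fundamental_group loop_class_eq_iff is_loop_join)
  qed
  show "\<exists>B\<in>carrier ?\<pi>. B \<otimes>\<^bsub>?\<pi>\<^esub> A = \<one>\<^bsub>?\<pi>\<^esub>" if "A \<in> carrier ?\<pi>" for A
  proof -
    obtain p where p: "is_loop X x p" "A = loop_class X x p" using \<open>A \<in> _\<close> by auto
    have "loop_class X x (reversepath p) \<otimes>\<^bsub>?\<pi>\<^esub> A = \<one>\<^bsub>?\<pi>\<^esub>"
      using p is_loop_const[OF assms] homotopic_paths_inverse_left[OF p(1)]
      by (simp add: mult_fundamental_group loop_class_eq_iff is_loop_join is_loop_reverse)
    moreover have "loop_class X x (reversepath p) \<in> carrier ?\<pi>"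
      using p is_loop_reverse by auto
    ultimately show ?thesis by blast
  qed
qed


section \<open>Free products of groups\<close>

text \<open>Words in the disjoint union of the groups, modulo the congruence generated by deleting
  identity letters and multiplying adjacent letters from the same group.\<close>

definition fp_words :: "'i set \<Rightarrow> ('i \<Rightarrow> ('g, 'm) monoid_scheme) \<Rightarrow> ('i \<times> 'g) list set" where
  "fp_words I G = lists (SIGMA i:I. carrier (G i))"

inductive_set fp_rel :: "'i set \<Rightarrow> ('i \<Rightarrow> ('g, 'm) monoid_scheme) \<Rightarrow> (('i \<times> 'g) list \<times> ('i \<times> 'g) list) set"
  for I :: "'i set" and G :: "'i \<Rightarrow> ('g, 'm) monoid_scheme"
  where
    fp_one: "\<lbrakk>u \<in> fp_words I G; v \<in> fp_words I G; i \<in> I\<rbrakk>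
      \<Longrightarrow> (u @ [(i, \<one>\<^bsub>G i\<^esub>)] @ v, u @ v) \<in> fp_rel I G"
  | fp_mult: "\<lbrakk>u \<in> fp_words I G; v \<in> fp_words I G; i \<in> I; a \<in> carrier (G i); b \<in> carrier (G i)\<rbrakk>
      \<Longrightarrow> (u @ [(i, a), (i, b)] @ v, u @ [(i, a \<otimes>\<^bsub>G i\<^esub> b)] @ v) \<in> fp_rel I G"
  | fp_refl: "w \<in> fp_words I G \<Longrightarrow> (w, w) \<in> fp_rel I G"
  | fp_sym: "(u, v) \<in> fp_rel I G \<Longrightarrow> (v, u) \<in> fp_rel I G"
  | fp_trans: "(u, v) \<in> fp_rel I G \<Longrightarrow> (v, w) \<in> fp_rel I G \<Longrightarrow> (u, w) \<in> fp_rel I G"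

definition free_product :: "'i set \<Rightarrow> ('i \<Rightarrow> ('g, 'm) monoid_scheme) \<Rightarrow> ('i \<times> 'g) list set monoid" where
  "free_product I G =
    \<lparr>carrier = fp_words I G // fp_rel I G,
     mult = (\<lambda>A B. \<Union>u\<in>A. \<Union>v\<in>B. fp_rel I G `` {u @ v}),
     one = fp_rel I G `` {[]}\<rparr>"

text \<open>The homomorphism to \<open>H\<close> induced by a family of homomorphisms \<open>h i\<close> from \<open>G i\<close> to \<open>H\<close>: all
  words of one class have the same product in \<open>H\<close>.\<close>

definition fp_eval :: "('h, 'n) monoid_scheme \<Rightarrow> ('i \<Rightarrow> 'g \<Rightarrow> 'h) \<Rightarrow> ('i \<times> 'g) list \<Rightarrow> 'h" where
  "fp_eval H h w = foldr (\<lambda>(i, g) y. h i g \<otimes>\<^bsub>H\<^esub> y) w \<one>\<^bsub>H\<^esub>"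

definition free_product_lift ::
    "('h, 'n) monoid_scheme \<Rightarrow> ('i \<Rightarrow> 'g \<Rightarrow> 'h) \<Rightarrow> ('i \<times> 'g) list set \<Rightarrow> 'h" where
  "free_product_lift H h A = the_elem (fp_eval H h ` A)"

definition free_product_retraction ::
    "('i \<Rightarrow> ('g, 'm) monoid_scheme) \<Rightarrow> 'i \<Rightarrow> ('i \<times> 'g) list set \<Rightarrow> 'g" where
  "free_product_retraction G j = free_product_lift (G j) (\<lambda>i g. if i = j then g else \<one>\<^bsub>G j\<^esub>)"

definition free_product_to_sum ::
    "'i set \<Rightarrow> ('i \<Rightarrow> ('g, 'm) monoid_scheme) \<Rightarrow> ('i \<times> 'g) list set \<Rightarrow> 'i \<Rightarrow> 'g" where
  "free_product_to_sum I G =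
    free_product_lift (sum_group I G) (\<lambda>i g. \<lambda>k\<in>I. if k = i then g else \<one>\<^bsub>G k\<^esub>)"

definition free_product_incl ::
    "'i set \<Rightarrow> ('i \<Rightarrow> ('g, 'm) monoid_scheme) \<Rightarrow> 'i \<Rightarrow> 'g \<Rightarrow> ('i \<times> 'g) list set" where
  "free_product_incl I G i g = fp_rel I G `` {[(i, g)]}"

lemma fp_rel_words:
  assumes "\<And>i. i \<in> I \<Longrightarrow> group (G i)" "(u, v) \<in> fp_rel I G"
  shows "u \<in> fp_words I G \<and> v \<in> fp_words I G"
  using assms(2)
proof induction
  case (fp_one u v i)
  interpret group "G i" using assms(1) fp_one by blast
  show ?case using fp_one by (auto simp: fp_words_def)
next
  case (fp_mult u v i a b)
  interpret group "G i" using assms(1) fp_mult by blast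
  show ?case using fp_mult by (auto simp: fp_words_def)
qed auto

lemma equiv_fp_rel:
  assumes "\<And>i. i \<in> I \<Longrightarrow> group (G i)"
  shows "equiv (fp_words I G) (fp_rel I G)"
  using fp_rel_words[of I G, OF assms]
  by (auto intro!: equivI refl_onI symI transI intro: fp_rel.intros)

lemma fp_rel_append_left:
  assumes "(u, v) \<in> fp_rel I G" "w \<in> fp_words I G"
  shows "(w @ u, w @ v) \<in> fp_rel I G"
  using assms
proof induction
  case (fp_one u v i)
  then show ?case using fp_rel.fp_one[of "w @ u" I G v i] by (simp add: fp_words_def)
next
  case (fp_mult u v i a b)
  then show ?case using fp_rel.fp_mult[of "w @ u" I G v i a b] by (simp add: fp_words_def)
qed (auto intro: fp_rel.intros simp: fp_words_def)

lemma fp_rel_append_right: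
  assumes "(u, v) \<in> fp_rel I G" "w \<in> fp_words I G"
  shows "(u @ w, v @ w) \<in> fp_rel I G"
  using assms
proof induction
  case (fp_one u v i)
  then show ?case using fp_rel.fp_one[of u I G "v @ w" i] by (simp add: fp_words_def)
next
  case (fp_mult u v i a b)
  then show ?case using fp_rel.fp_mult[of u I G "v @ w" i a b] by (simp add: fp_words_def)
qed (auto intro: fp_rel.intros simp: fp_words_def)

lemma mult_free_product:
  assumes G: "\<And>i. i \<in> I \<Longrightarrow> group (G i)" and u: "u \<in> fp_words I G" and v: "v \<in> fp_words I G"
  shows "fp_rel I G `` {u} \<otimes>\<^bsub>free_product I G\<^esub> fp_rel I G `` {v} = fp_rel I G `` {u @ v}"
proof -
  have eq: "fp_rel I G `` {u' @ v'} = fp_rel I G `` {u @ v}"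
    if "(u, u') \<in> fp_rel I G" "(v, v') \<in> fp_rel I G" for u' v'
  proof -
    have "(u @ v, u' @ v) \<in> fp_rel I G" using that v by (intro fp_rel_append_right)
    moreover have "(u' @ v, u' @ v') \<in> fp_rel I G"
      using that fp_rel_words[of I G, OF G that(1)] by (intro fp_rel_append_left) auto
    ultimately have "(u @ v, u' @ v') \<in> fp_rel I G" by (rule fp_trans)
    then show ?thesis using equiv_class_eq[OF equiv_fp_rel[of I G, OF G]] by metis
  qed
  have "(u, u) \<in> fp_rel I G" "(v, v) \<in> fp_rel I G" using u v by (simp_all add: fp_refl)
  then have "(\<Union>u'\<in>fp_rel I G `` {u}. \<Union>v'\<in>fp_rel I G `` {v}. fp_rel I G `` {u' @ v'})
      = fp_rel I G `` {u @ v}"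
    using eq by blast
  then show ?thesis by (simp add: free_product_def)
qed

lemma carrier_free_product: "carrier (free_product I G) = (\<lambda>w. fp_rel I G `` {w}) ` fp_words I G"
  by (auto simp: free_product_def quotient_def)

lemma group_free_product:
  assumes G: "\<And>i. i \<in> I \<Longrightarrow> group (G i)"
  shows "group (free_product I G)"
proof (rule groupI)
  let ?F = "free_product I G"
  have one: "\<one>\<^bsub>?F\<^esub> = fp_rel I G `` {[]}" and nil: "[] \<in> fp_words I G"
    by (simp_all add: free_product_def fp_words_def)
  have app: "u @ v \<in> fp_words I G" if "u \<in> fp_words I G" "v \<in> fp_words I G" for u v
    using that by (simp add: fp_words_def)
  note [simp] = carrier_free_product one mult_free_product[of I G, OF G]
  show "A \<otimes>\<^bsub>?F\<^esub> B \<in> carrier ?F" if "A \<in> carrier ?F" "B \<in> carrier ?F" for A B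
    using that by (auto simp: app)
  show "\<one>\<^bsub>?F\<^esub> \<in> carrier ?F" using nil by auto
  show "A \<otimes>\<^bsub>?F\<^esub> B \<otimes>\<^bsub>?F\<^esub> C = A \<otimes>\<^bsub>?F\<^esub> (B \<otimes>\<^bsub>?F\<^esub> C)"
    if "A \<in> carrier ?F" "B \<in> carrier ?F" "C \<in> carrier ?F" for A B C
    using that by (auto simp: app)
  show "\<one>\<^bsub>?F\<^esub> \<otimes>\<^bsub>?F\<^esub> A = A" if "A \<in> carrier ?F" for A
    using that nil by auto
  have inv: "\<exists>v\<in>fp_words I G. (v @ w, []) \<in> fp_rel I G" if "w \<in> fp_words I G" for w
    using that
  proof (induction w)
    case Nil
    then show ?case using fp_refl nil by fastforce
  next
    case (Cons l w)
    obtain i a where l: "l = (i, a)" by fastforce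
    with Cons.prems have w: "w \<in> fp_words I G" and ia: "i \<in> I" "a \<in> carrier (G i)"
      by (auto simp: fp_words_def)
    interpret group "G i" using G ia by blast
    obtain v where v: "v \<in> fp_words I G" "(v @ w, []) \<in> fp_rel I G" using Cons.IH w by blast
    let ?b = "inv\<^bsub>G i\<^esub> a"
    have "(v @ [(i, ?b), (i, a)] @ w, v @ [(i, \<one>\<^bsub>G i\<^esub>)] @ w) \<in> fp_rel I G"
      using fp_mult[OF v(1) w ia(1) inv_closed[OF ia(2)] ia(2)] ia by simp
    moreover have "(v @ [(i, \<one>\<^bsub>G i\<^esub>)] @ w, v @ w) \<in> fp_rel I G"
      by (rule fp_one[OF v(1) w ia(1)])
    ultimately have "((v @ [(i, ?b)]) @ l # w, []) \<in> fp_rel I G"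
      using fp_trans[OF fp_trans v(2)] l by simp
    moreover have "v @ [(i, ?b)] \<in> fp_words I G" using v ia by (auto simp: fp_words_def)
    ultimately show ?case by blast
  qed
  show "\<exists>B\<in>carrier ?F. B \<otimes>\<^bsub>?F\<^esub> A = \<one>\<^bsub>?F\<^esub>" if "A \<in> carrier ?F" for A
  proof -
    obtain w where w: "w \<in> fp_words I G" "A = fp_rel I G `` {w}" using \<open>A \<in> _\<close> by auto
    obtain v where v: "v \<in> fp_words I G" "(v @ w, []) \<in> fp_rel I G" using inv w by blast
    have "fp_rel I G `` {v} \<otimes>\<^bsub>?F\<^esub> A = \<one>\<^bsub>?F\<^esub>"
      using v w equiv_class_eq[OF equiv_fp_rel[of I G, OF G] v(2)] by simp
    then show ?thesis using v by auto
  qed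
qed

lemma fp_eval_closed:
  assumes H: "group H" and h: "\<And>i. i \<in> I \<Longrightarrow> h i \<in> hom (G i) H" and w: "w \<in> fp_words I G"
  shows "fp_eval H h w \<in> carrier H"
proof -
  interpret group H by (rule H)
  show ?thesis
    using w by (induction w) (use h in \<open>auto simp: fp_eval_def fp_words_def hom_def\<close>)
qed

lemma fp_eval_append:
  assumes H: "group H" and h: "\<And>i. i \<in> I \<Longrightarrow> h i \<in> hom (G i) H"
    and u: "u \<in> fp_words I G" and v: "v \<in> fp_words I G"
  shows "fp_eval H h (u @ v) = fp_eval H h u \<otimes>\<^bsub>H\<^esub> fp_eval H h v"
proof -
  interpret group H by (rule H)
  show ?thesis
    using u
  proof (induction u)
    case Nil
    then show ?case using fp_eval_closed[of H I h G, OF H h v] by (simp add: fp_eval_def)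
  next
    case (Cons l u)
    obtain i a where l: "l = (i, a)" by fastforce
    with Cons.prems have u: "u \<in> fp_words I G" and ia: "i \<in> I" "a \<in> carrier (G i)"
      by (auto simp: fp_words_def)
    have "h i a \<in> carrier H" using h[OF ia(1)] ia by (auto simp: hom_def)
    then show ?case
      using Cons.IH[OF u] l m_assoc fp_eval_closed[of H I h G, OF H h u] fp_eval_closed[of H I h G, OF H h v]
      by (simp add: fp_eval_def)
  qed
qed

lemma fp_eval_cong:
  assumes G: "\<And>i. i \<in> I \<Longrightarrow> group (G i)" and H: "group H"
    and h: "\<And>i. i \<in> I \<Longrightarrow> h i \<in> hom (G i) H" and uv: "(u, v) \<in> fp_rel I G"
  shows "fp_eval H h u = fp_eval H h v"
proof -
  interpret group H by (rule H)
  note app = fp_eval_append[of H I h G, OF H h]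
  show ?thesis
    using uv
  proof induction
    case (fp_one u v i)
    interpret Gi: group "G i" using G fp_one by blast
    have "h i \<one>\<^bsub>G i\<^esub> = \<one>\<^bsub>H\<^esub>" using h[OF \<open>i \<in> I\<close>] hom_one Gi.is_group H by blast
    then have "fp_eval H h [(i, \<one>\<^bsub>G i\<^esub>)] = \<one>\<^bsub>H\<^esub>" by (simp add: fp_eval_def)
    moreover have "[(i, \<one>\<^bsub>G i\<^esub>)] \<in> fp_words I G" "[(i, \<one>\<^bsub>G i\<^esub>)] @ v \<in> fp_words I G"
      using fp_one by (auto simp: fp_words_def)
    ultimately show ?case
      using fp_one app[of u] app[of "[(i, \<one>\<^bsub>G i\<^esub>)]" v] fp_eval_closed[of H I h G, OF H h, of v] by simp
  next
    case (fp_mult u v i a b)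
    interpret Gi: group "G i" using G fp_mult by blast
    have "fp_eval H h [(i, a), (i, b)] = fp_eval H h [(i, a \<otimes>\<^bsub>G i\<^esub> b)]"
      using h[OF \<open>i \<in> I\<close>] fp_mult
      by (auto simp: fp_eval_def hom_def Pi_iff m_assoc simp del: r_one intro!: m_assoc[symmetric])
    moreover have "[(i, a), (i, b)] \<in> fp_words I G" "[(i, a \<otimes>\<^bsub>G i\<^esub> b)] \<in> fp_words I G"
      "[(i, a), (i, b)] @ v \<in> fp_words I G" "[(i, a \<otimes>\<^bsub>G i\<^esub> b)] @ v \<in> fp_words I G"
      using fp_mult by (auto simp: fp_words_def)
    ultimately show ?case
      using fp_mult app[of u] app[of "[(i, a), (i, b)]" v] app[of "[(i, a \<otimes>\<^bsub>G i\<^esub> b)]" v] by simp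
  qed auto
qed

lemma free_product_lift_class:
  assumes G: "\<And>i. i \<in> I \<Longrightarrow> group (G i)" and H: "group H"
    and h: "\<And>i. i \<in> I \<Longrightarrow> h i \<in> hom (G i) H" and w: "w \<in> fp_words I G"
  shows "free_product_lift H h (fp_rel I G `` {w}) = fp_eval H h w"
proof -
  have "fp_eval H h ` (fp_rel I G `` {w}) = {fp_eval H h w}"
    using fp_eval_cong[of I G H h, OF G H h] w fp_refl by fastforce
  then show ?thesis by (simp add: free_product_lift_def)
qed

lemma free_product_lift_hom:
  assumes G: "\<And>i. i \<in> I \<Longrightarrow> group (G i)" and H: "group H"
    and h: "\<And>i. i \<in> I \<Longrightarrow> h i \<in> hom (G i) H"
  shows "free_product_lift H h \<in> hom (free_product I G) H"
proof (rule homI)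
  note lift = free_product_lift_class[of I G H h, OF G H h]
  fix A assume "A \<in> carrier (free_product I G)"
  then obtain u where u: "u \<in> fp_words I G" "A = fp_rel I G `` {u}"
    by (auto simp: carrier_free_product)
  then show "free_product_lift H h A \<in> carrier H" using lift fp_eval_closed[of H I h G, OF H h] by simp
  fix B assume "B \<in> carrier (free_product I G)"
  then obtain v where v: "v \<in> fp_words I G" "B = fp_rel I G `` {v}"
    by (auto simp: carrier_free_product)
  have "u @ v \<in> fp_words I G" using u v by (simp add: fp_words_def)
  then show "free_product_lift H h (A \<otimes>\<^bsub>free_product I G\<^esub> B) =
      free_product_lift H h A \<otimes>\<^bsub>H\<^esub> free_product_lift H h B"
    using u v lift mult_free_product[of I G, OF G] fp_eval_append[of H I h G, OF H h] by simp
qed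

lemma free_product_lift_incl:
  assumes G: "\<And>i. i \<in> I \<Longrightarrow> group (G i)" and H: "group H"
    and h: "\<And>i. i \<in> I \<Longrightarrow> h i \<in> hom (G i) H" and i: "i \<in> I" "g \<in> carrier (G i)"
  shows "free_product_lift H h (free_product_incl I G i g) = h i g"
proof -
  interpret group H by (rule H)
  have "h i g \<in> carrier H" using h[OF i(1)] i by (auto simp: hom_def)
  moreover have "[(i, g)] \<in> fp_words I G" using i by (simp add: fp_words_def)
  ultimately show ?thesis
    using free_product_lift_class[of I G H h, OF G H h] by (simp add: free_product_incl_def fp_eval_def)
qed

lemma free_product_retraction:
  assumes G: "\<And>i. i \<in> I \<Longrightarrow> group (G i)" and j: "j \<in> I"
  shows "free_product_retraction G j \<in> hom (free_product I G) (G j)"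
    and "\<And>i g. i \<in> I \<Longrightarrow> g \<in> carrier (G i) \<Longrightarrow>
      free_product_retraction G j (free_product_incl I G i g) = (if i = j then g else \<one>\<^bsub>G j\<^esub>)"
proof -
  interpret group "G j" using G j by blast
  have h: "(\<lambda>g. if i = j then g else \<one>\<^bsub>G j\<^esub>) \<in> hom (G i) (G j)" if "i \<in> I" for i
    by (auto simp: hom_def)
  show "free_product_retraction G j \<in> hom (free_product I G) (G j)"
    unfolding free_product_retraction_def by (rule free_product_lift_hom[of I G "G j" "\<lambda>i g. if i = j then g else \<one>\<^bsub>G j\<^esub>", OF G is_group h])
  show "free_product_retraction G j (free_product_incl I G i g) = (if i = j then g else \<one>\<^bsub>G j\<^esub>)"
    if "i \<in> I" "g \<in> carrier (G i)" for i g
    unfolding free_product_retraction_def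
    by (rule free_product_lift_incl[of I G "G j" "\<lambda>i g. if i = j then g else \<one>\<^bsub>G j\<^esub>", OF G is_group h that])
qed

lemma free_product_to_sum:
  assumes G: "\<And>i. i \<in> I \<Longrightarrow> group (G i)"
  shows "free_product_to_sum I G \<in> hom (free_product I G) (sum_group I G)"
    and "\<And>i g. i \<in> I \<Longrightarrow> g \<in> carrier (G i) \<Longrightarrow>
      free_product_to_sum I G (free_product_incl I G i g) = (\<lambda>k\<in>I. if k = i then g else \<one>\<^bsub>G k\<^esub>)"
proof -
  have h: "(\<lambda>g. \<lambda>k\<in>I. if k = i then g else \<one>\<^bsub>G k\<^esub>) \<in> hom (G i) (sum_group I G)" if i: "i \<in> I" for i
  proof (rule homI)
    note [simp] = group.is_monoid[OF G]
    fix a assume a: "a \<in> carrier (G i)"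
    have "{k \<in> I. (if k = i then a else \<one>\<^bsub>G k\<^esub>) \<noteq> \<one>\<^bsub>G k\<^esub>} \<subseteq> {i}" by auto
    then have "finite {k \<in> I. (if k = i then a else \<one>\<^bsub>G k\<^esub>) \<noteq> \<one>\<^bsub>G k\<^esub>}"
      using finite_subset by blast
    then show "(\<lambda>k\<in>I. if k = i then a else \<one>\<^bsub>G k\<^esub>) \<in> carrier (sum_group I G)"
      using a by (auto simp: carrier_sum_group[of I G, OF G] cong: conj_cong)
    fix b assume "b \<in> carrier (G i)"
    then show "(\<lambda>k\<in>I. if k = i then a \<otimes>\<^bsub>G i\<^esub> b else \<one>\<^bsub>G k\<^esub>) =
      (\<lambda>k\<in>I. if k = i then a else \<one>\<^bsub>G k\<^esub>) \<otimes>\<^bsub>sum_group I G\<^esub> (\<lambda>k\<in>I. if k = i then b else \<one>\<^bsub>G k\<^esub>)"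
      by (auto simp: fun_eq_iff)
  qed
  note H = sum_group[of I G, OF G]
  show "free_product_to_sum I G \<in> hom (free_product I G) (sum_group I G)"
    unfolding free_product_to_sum_def by (rule free_product_lift_hom[of I G "sum_group I G" "\<lambda>i g. \<lambda>k\<in>I. if k = i then g else \<one>\<^bsub>G k\<^esub>", OF G H h])
  show "free_product_to_sum I G (free_product_incl I G i g) = (\<lambda>k\<in>I. if k = i then g else \<one>\<^bsub>G k\<^esub>)"
    if "i \<in> I" "g \<in> carrier (G i)" for i g
    unfolding free_product_to_sum_def by (rule free_product_lift_incl[of I G "sum_group I G" "\<lambda>i g. \<lambda>k\<in>I. if k = i then g else \<one>\<^bsub>G k\<^esub>", OF G H h that])
qed

end

theory Submission imports Defs begin

text \<open>In a free product \<open>F\<close>, syllable length makes \<open>F\<close> a discrete metric space that is hyperbolic with constant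
  \<open>0\<close>. If a decreasing sequence of subgroups \<open>H n\<close> of \<open>F\<close> is closed under solving infinite systems of equations
  \<open>a n = c n \<cdot> a (n+1)\<^sup>k \<cdot> r n \<cdot> a (n+1)\<^sup>-\<^sup>l \<cdot> e n\<close>, then a choice of rapidly growing exponents contradicts the
  finiteness of lengths unless some \<open>H n\<close> is conjugate into a factor. Infinite concatenations of shrinking loops
  show that the images of the loops in small balls around a point form such a sequence, so that small loops
  at any point have classes in a conjugate of one factor. By second countability \<open>\<pi>\<^sub>1\<close> is generated by countably
  many such local groups and countably many further elements, hence only countably many factors occur.

  The retraction onto a factor is, as an endomorphism \<open>\<rho>\<close> of \<open>\<pi>\<^sub>1\<close>, locally inner or trivial. Being idempotent, it
  has the elements \<open>g \<rho>(g)\<^sup>-\<^sup>1\<close> as kernel, and this set can be built from loops by countably many continuous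
  operations and homotopy. Finally, an analytic kernel that does not contain the loops near some point \<open>y\<close> yields,
  through the infinite concatenations of subfamilies of a null sequence of loops at \<open>y\<close>, an analytic equivalence
  relation on Cantor space in which sequences differing at one place are inequivalent; it is meager, and so
  there are continuum many classes.\<close>

text \<open>The isomorphism with the free product is purely algebraic, so topology can act only
  through elements that it forces to exist, the solutions of infinite systems of equations. Length
  is measured in the Cayley graph with all factor elements as generators, a tree of complete graphs;
  an element has an axis there (hyperbolic) or is conjugate into a factor (elliptic). Conjugating
  \<open>r\<close> by a high power of a hyperbolic \<open>a\<close> yields something longer than
  that power unless \<open>a\<close> and \<open>r\<close> commute, and this exception splits the
  argument. If noncommuting hyperbolic elements occur at every level, the equations can make each
  \<open>a n\<close> a conjugate of a prescribed hyperbolic element, which bounds its translation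
  length and rules out commuting. Otherwise hyperbolic elements commute from some level on; plain
  products with powers are used, the elliptic elements turn out to have trivial squares, and even
  exponents remove them. As for analyticity, \<open>\<phi>\<close> is arbitrary, so triviality of
  \<rho>(g) is not visibly an analytic condition on loops; describing the kernel as a range means
  that its members only have to be produced.\<close>

section \<open>Normal forms in a free product\<close>

locale free_product_groups =
  fixes I :: "'i set" and G :: "'i \<Rightarrow> ('g, 'm) monoid_scheme"
  assumes groups: "\<And>i. i \<in> I \<Longrightarrow> group (G i)"
begin

abbreviation "F \<equiv> free_product I G"

definition reduced :: "('i \<times> 'g) list \<Rightarrow> bool" where
  "reduced w \<longleftrightarrow> w \<in> fp_words I G \<and> (\<forall>x\<in>set w. snd x \<noteq> \<one>\<^bsub>G (fst x)\<^esub>) \<and> successively (\<lambda>x y. fst x \<noteq> fst y) w"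

text \<open>Van der Waerden's trick: letters operate on reduced words by left multiplication. Once
  this is known to be an action (\<open>act_act\<close>), equivalent words operate in the same way,
  and uniqueness of normal forms needs no confluence argument.\<close>

fun act :: "'i \<times> 'g \<Rightarrow> ('i \<times> 'g) list \<Rightarrow> ('i \<times> 'g) list" where
  "act (i, a) w = (if a = \<one>\<^bsub>G i\<^esub> then w else case w of [] \<Rightarrow> [(i, a)] | (j, b) # v \<Rightarrow>
     if j = i then (if a \<otimes>\<^bsub>G i\<^esub> b = \<one>\<^bsub>G i\<^esub> then v else (i, a \<otimes>\<^bsub>G i\<^esub> b) # v) else (i, a) # w)"

declare act.simps [simp del]

definition red :: "('i \<times> 'g) list \<Rightarrow> ('i \<times> 'g) list" where
  "red u = foldr act u []"

definition letter_inv :: "'i \<times> 'g \<Rightarrow> 'i \<times> 'g" where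
  "letter_inv x = (fst x, inv\<^bsub>G (fst x)\<^esub> snd x)"

definition word_inv :: "('i \<times> 'g) list \<Rightarrow> ('i \<times> 'g) list" where
  "word_inv w = rev (map letter_inv w)"

lemma fp_words_simps [simp]:
  "[] \<in> fp_words I G"
  "x # w \<in> fp_words I G \<longleftrightarrow> fst x \<in> I \<and> snd x \<in> carrier (G (fst x)) \<and> w \<in> fp_words I G"
  "u @ v \<in> fp_words I G \<longleftrightarrow> u \<in> fp_words I G \<and> v \<in> fp_words I G"
  by (cases x; auto simp: fp_words_def)+

lemma reduced_Nil [simp]: "reduced []"
  by (simp add: reduced_def)

lemma reduced_Cons: "reduced (x # w) \<longleftrightarrow> fst x \<in> I \<and> snd x \<in> carrier (G (fst x)) \<and> snd x \<noteq> \<one>\<^bsub>G (fst x)\<^esub>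
    \<and> reduced w \<and> (w = [] \<or> fst (hd w) \<noteq> fst x)"
  by (auto simp: reduced_def successively_Cons)

lemma reduced_append: "reduced (u @ v) \<longleftrightarrow> reduced u \<and> reduced v \<and> (u = [] \<or> v = [] \<or> fst (last u) \<noteq> fst (hd v))"
  by (auto simp: reduced_def successively_append_iff)

lemma reduced_words: "reduced w \<Longrightarrow> w \<in> fp_words I G"
  by (simp add: reduced_def)

lemma act_reduced:
  assumes "i \<in> I" "a \<in> carrier (G i)" "reduced w"
  shows "reduced (act (i, a) w)"
proof -
  interpret group "G i" using groups assms by blast
  show ?thesis
    using assms by (auto simp: act.simps reduced_Cons split: list.splits)
qed

text \<open>Only the case where \<open>w\<close> starts in factor \<open>i\<close> is delicate: a
  letter may vanish in one order of multiplication and reappear in the other. Facts \<open>5\<close>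
  and \<open>6\<close> and the local \<open>inv\<close> identify the reappearing letter.\<close>

lemma act_act:
  assumes "i \<in> I" "a \<in> carrier (G i)" "b \<in> carrier (G i)" "reduced w"
  shows "act (i, a) (act (i, b) w) = act (i, a \<otimes>\<^bsub>G i\<^esub> b) w"
proof -
  interpret group "G i" using groups assms by blast
  have inv: "a = c" if "a \<otimes>\<^bsub>G i\<^esub> b = \<one>\<^bsub>G i\<^esub>" "b \<otimes>\<^bsub>G i\<^esub> c = \<one>\<^bsub>G i\<^esub>" "c \<in> carrier (G i)" for c
    using that assms by (metis inv_equality inv_inv)
  show ?thesis
  proof (cases w)
    case Nil
    then show ?thesis using assms by (auto simp: act.simps)
  next
    case (Cons y v)
    obtain j c where y: "y = (j, c)" by fastforce
    show ?thesis
    proof (cases "j = i")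
      case False
      then show ?thesis using assms Cons y by (auto simp: act.simps)
    next
      case True
      then have c: "c \<in> carrier (G i)" "c \<noteq> \<one>\<^bsub>G i\<^esub>" and v: "v = [] \<or> fst (hd v) \<noteq> i"
        using assms Cons y by (auto simp: reduced_Cons)
      have 1: "a \<otimes>\<^bsub>G i\<^esub> b \<otimes>\<^bsub>G i\<^esub> c = a \<otimes>\<^bsub>G i\<^esub> (b \<otimes>\<^bsub>G i\<^esub> c)" using assms c by (simp add: m_assoc)
      have 2: "act (i, a) v = (if a = \<one>\<^bsub>G i\<^esub> then v else (i, a) # v)"
        using v by (cases v) (auto simp: act.simps)
      have 5: "a \<otimes>\<^bsub>G i\<^esub> b \<otimes>\<^bsub>G i\<^esub> c = a" if "b \<otimes>\<^bsub>G i\<^esub> c = \<one>\<^bsub>G i\<^esub>" using that 1 assms by simp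
      have 6: "c = a \<otimes>\<^bsub>G i\<^esub> (b \<otimes>\<^bsub>G i\<^esub> c)" if "a \<otimes>\<^bsub>G i\<^esub> b = \<one>\<^bsub>G i\<^esub>" using that 1 c by simp
      have w: "w = (i, c) # v" using Cons y True by simp
      consider (b1) "b = \<one>\<^bsub>G i\<^esub>" | (bc1) "b \<noteq> \<one>\<^bsub>G i\<^esub>" "b \<otimes>\<^bsub>G i\<^esub> c = \<one>\<^bsub>G i\<^esub>"
        | (other) "b \<noteq> \<one>\<^bsub>G i\<^esub>" "b \<otimes>\<^bsub>G i\<^esub> c \<noteq> \<one>\<^bsub>G i\<^esub>" by blast
      then show ?thesis
      proof cases
        case b1
        then show ?thesis using assms by (simp add: act.simps)
      next
        case bc1
        have "a = c" if "a \<otimes>\<^bsub>G i\<^esub> b = \<one>\<^bsub>G i\<^esub>" using inv that bc1 c by blast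
        then show ?thesis using bc1 5 2 w c by (auto simp: act.simps[of i b] act.simps[of i "a \<otimes>\<^bsub>G i\<^esub> b"])
      next
        case other
        then have "act (i, b) w = (i, b \<otimes>\<^bsub>G i\<^esub> c) # v" using w by (simp add: act.simps)
        then show ?thesis using w 1 6 assms c other
          by (auto simp: act.simps[of i a] act.simps[of i "a \<otimes>\<^bsub>G i\<^esub> b"])
      qed
    qed
  qed
qed

lemma foldr_act_reduced:
  assumes "u \<in> fp_words I G" "reduced w"
  shows "reduced (foldr act u w)"
  using assms
proof (induction u)
  case (Cons x u)
  then show ?case using act_reduced[of "fst x" "snd x"] by simp
qed simp

lemma red_reduced: "u \<in> fp_words I G \<Longrightarrow> reduced (red u)"
  by (simp add: red_def foldr_act_reduced)

text \<open>The two sides of each generating relation operate alike on every reduced word, so the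
  normal form is an invariant of the class.\<close>

lemma foldr_act_cong:
  assumes "(u, v) \<in> fp_rel I G" "reduced w"
  shows "foldr act u w = foldr act v w"
  using assms
proof (induction arbitrary: w)
  case (fp_one u v i)
  then show ?case by (simp add: act.simps)
next
  case (fp_mult u v i a b)
  then show ?case by (simp add: act_act foldr_act_reduced)
qed auto

lemma red_cong: "(u, v) \<in> fp_rel I G \<Longrightarrow> red u = red v"
  by (simp add: red_def foldr_act_cong)

lemma act_Cons_reduced:
  assumes "reduced (x # w)"
  shows "act x w = x # w"
proof -
  obtain i a where "x = (i, a)" by fastforce
  then show ?thesis using assms by (cases w) (auto simp: reduced_Cons act.simps)
qed

lemma red_of_reduced: "reduced w \<Longrightarrow> red w = w"
proof (induction w)
  case (Cons x w)
  then have "red w = w" by (simp add: reduced_Cons)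
  then show ?case using act_Cons_reduced[OF Cons.prems] by (simp add: red_def)
qed (simp add: red_def)

lemma foldr_act_reduced_append:
  assumes "reduced (u @ v)"
  shows "foldr act u v = u @ v"
proof -
  have "reduced v" using assms by (simp add: reduced_append)
  then have "foldr act v [] = v" using red_of_reduced by (simp add: red_def)
  then show ?thesis using red_of_reduced[OF assms] by (simp add: red_def)
qed

lemma act_rel:
  assumes "i \<in> I" "a \<in> carrier (G i)" "reduced w"
  shows "((i, a) # w, act (i, a) w) \<in> fp_rel I G"
proof -
  interpret group "G i" using groups assms by blast
  have w: "w \<in> fp_words I G" using assms reduced_words by blast
  show ?thesis
  proof (cases "a = \<one>\<^bsub>G i\<^esub>")
    case True
    then show ?thesis using fp_one[of "[]" I G w i] w assms by (simp add: act.simps)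
  next
    case a: False
    have refl: "((i, a) # w, (i, a) # w) \<in> fp_rel I G" using assms w by (intro fp_refl) simp
    show ?thesis
    proof (cases w)
      case Nil
      then show ?thesis using a refl by (simp add: act.simps)
    next
      case (Cons y v)
      obtain j b where y: "y = (j, b)" by fastforce
      show ?thesis
      proof (cases "j = i")
        case False
        then show ?thesis using a refl y Cons by (simp add: act.simps)
      next
        case True
        then have b: "b \<in> carrier (G i)" and v: "v \<in> fp_words I G"
          using w y Cons by auto
        have m: "((i, a) # w, (i, a \<otimes>\<^bsub>G i\<^esub> b) # v) \<in> fp_rel I G"
          using fp_mult[of "[]" I G v i a b] assms b v y Cons True by simp
        moreover have "((i, \<one>\<^bsub>G i\<^esub>) # v, v) \<in> fp_rel I G"
          using fp_one[of "[]" I G v i] assms v by simp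
        ultimately show ?thesis
          using a y Cons True by (auto simp: act.simps intro: fp_trans)
      qed
    qed
  qed
qed

lemma red_rel: "u \<in> fp_words I G \<Longrightarrow> (u, red u) \<in> fp_rel I G"
proof (induction u)
  case Nil
  then show ?case by (simp add: red_def fp_refl)
next
  case (Cons x u)
  have x: "fst x \<in> I" "snd x \<in> carrier (G (fst x))" and u: "u \<in> fp_words I G" using Cons.prems by auto
  have "([x] @ u, [x] @ red u) \<in> fp_rel I G"
    using Cons u x by (intro fp_rel_append_left) auto
  moreover have "(x # red u, act x (red u)) \<in> fp_rel I G"
    using act_rel[OF x red_reduced[OF u]] by simp
  ultimately show ?case by (auto simp: red_def intro: fp_trans)
qed

abbreviation cls :: "('i \<times> 'g) list \<Rightarrow> ('i \<times> 'g) list set" where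
  "cls w \<equiv> fp_rel I G `` {w}"

definition nf :: "('i \<times> 'g) list set \<Rightarrow> ('i \<times> 'g) list" where
  "nf A = the_elem (red ` A)"

lemma group_F: "group F"
  using group_free_product groups by blast

sublocale F: group F by (rule group_F)

lemma cls_eq_iff:
  assumes "u \<in> fp_words I G" "v \<in> fp_words I G"
  shows "cls u = cls v \<longleftrightarrow> red u = red v"
proof
  assume "cls u = cls v"
  then have "(u, v) \<in> fp_rel I G" using assms fp_refl by blast
  then show "red u = red v" by (rule red_cong)
next
  assume "red u = red v"
  then have "(u, v) \<in> fp_rel I G"
    using red_rel[OF assms(1)] red_rel[OF assms(2)] by (metis fp_sym fp_trans)
  then show "cls u = cls v"
    using equiv_class_eq[OF equiv_fp_rel[of I G, OF groups]] by blast
qed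

lemma nf_cls: 
  assumes "u \<in> fp_words I G" shows "nf (cls u) = red u"
proof -
  have "red ` cls u = {red u}"
  proof
    show "red ` cls u \<subseteq> {red u}"
    proof (rule image_subsetI)
      fix v assume "v \<in> cls u"
      then have "(u, v) \<in> fp_rel I G" by simp
      then have "red v = red u" by (rule red_cong[symmetric])
      then show "red v \<in> {red u}" by simp
    qed
    have "u \<in> cls u" using fp_refl[OF assms] by simp
    then show "{red u} \<subseteq> red ` cls u" by blast
  qed
  then show ?thesis by (simp add: nf_def)
qed

lemma carrierE:
  assumes "A \<in> carrier F"
  shows "reduced (nf A)" "A = cls (nf A)"
proof -
  obtain u where u: "u \<in> fp_words I G" "A = cls u" using assms unfolding carrier_free_product by blast
  show r: "reduced (nf A)" unfolding u(2) nf_cls[OF u(1)] by (rule red_reduced[OF u(1)])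
  have 1: "nf A = red u" by (rule trans[OF arg_cong[OF u(2), of nf] nf_cls[OF u(1)]])
  have "red u = red (nf A)" by (rule trans[OF 1[symmetric] red_of_reduced[OF r, symmetric]])
  then have "cls u = cls (nf A)" by (rule iffD2[OF cls_eq_iff[OF u(1) reduced_words[OF r]]])
  with u(2) show "A = cls (nf A)" by (rule trans)
qed

lemma cls_nf: "A \<in> carrier F \<Longrightarrow> cls (nf A) = A"
  by (rule sym, rule carrierE(2))

lemma cls_carrier [simp]: "u \<in> fp_words I G \<Longrightarrow> cls u \<in> carrier F"
  unfolding carrier_free_product by (rule imageI)

lemma nf_inj: "A \<in> carrier F \<Longrightarrow> B \<in> carrier F \<Longrightarrow> nf A = nf B \<Longrightarrow> A = B"
  by (metis cls_nf)

lemma one_F: "\<one>\<^bsub>F\<^esub> = cls []"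
  by (simp add: free_product_def)

lemma nf_one [simp]: "nf \<one>\<^bsub>F\<^esub> = []"
  by (simp add: one_F nf_cls red_def)

lemma mult_cls: "u \<in> fp_words I G \<Longrightarrow> v \<in> fp_words I G \<Longrightarrow> cls u \<otimes>\<^bsub>F\<^esub> cls v = cls (u @ v)"
  by (rule mult_free_product[of I G, OF groups])

lemma nf_cls_reduced: "reduced u \<Longrightarrow> nf (cls u) = u"
  using nf_cls red_of_reduced reduced_words by metis

lemma letter_inv_simps [simp]: "fst (letter_inv x) = fst x" "snd (letter_inv x) = inv\<^bsub>G (fst x)\<^esub> snd x"
  by (simp_all add: letter_inv_def)

lemma letter_inv_letter_inv:
  assumes "fst x \<in> I" "snd x \<in> carrier (G (fst x))"
  shows "letter_inv (letter_inv x) = x"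
proof -
  interpret group "G (fst x)" using groups assms by blast
  show ?thesis using assms by (simp add: letter_inv_def)
qed

lemma word_inv_words: "u \<in> fp_words I G \<Longrightarrow> word_inv u \<in> fp_words I G"
proof (induction u)
  case (Cons x u)
  then interpret group "G (fst x)" using groups by auto
  show ?case using Cons by (simp add: word_inv_def)
qed (simp add: word_inv_def)

lemma word_inv_Nil [simp]: "word_inv [] = []"
  and word_inv_Cons: "word_inv (x # u) = word_inv u @ [letter_inv x]"
  and word_inv_append: "word_inv (u @ v) = word_inv v @ word_inv u"
  and length_word_inv [simp]: "length (word_inv u) = length u"
  and word_inv_eq_Nil [simp]: "word_inv u = [] \<longleftrightarrow> u = []"
  by (simp_all add: word_inv_def)

lemma last_word_inv: "u \<noteq> [] \<Longrightarrow> last (word_inv u) = letter_inv (hd u)"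
  and hd_word_inv: "u \<noteq> [] \<Longrightarrow> hd (word_inv u) = letter_inv (last u)"
  by (simp_all add: word_inv_def last_rev hd_rev hd_map last_map)

lemma word_inv_reduced: "reduced u \<Longrightarrow> reduced (word_inv u)"
proof (induction u)
  case (Cons x u)
  then interpret group "G (fst x)" using groups by (auto simp: reduced_Cons)
  show ?case using Cons last_word_inv[of u]
    by (auto simp: word_inv_Cons reduced_append reduced_Cons)
qed simp

lemma inv_cls:
  assumes "u \<in> fp_words I G"
  shows "inv\<^bsub>F\<^esub> (cls u) = cls (word_inv u)"
proof (rule F.inv_equality)
  show "cls u \<in> carrier F" "cls (word_inv u) \<in> carrier F" using assms word_inv_words by auto
  have "red (word_inv u @ u) = []"
    using assms
  proof (induction u)
    case (Cons x u)
    then interpret group "G (fst x)" using groups by auto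
    have x: "fst x \<in> I" "snd x \<in> carrier (G (fst x))" "u \<in> fp_words I G" using Cons by auto
    have r: "reduced (foldr act u [])" using x foldr_act_reduced by simp
    have "act (letter_inv x) (act x (foldr act u [])) = foldr act u []"
      using act_act[OF x(1) _ x(2) r, of "inv\<^bsub>G (fst x)\<^esub> snd x"] x
      by (simp add: letter_inv_def act.simps)
    then show ?case using Cons by (simp add: red_def word_inv_Cons)
  qed (simp add: red_def)
  then have "cls (word_inv u @ u) = cls []"
    using assms word_inv_words by (subst cls_eq_iff) (auto simp: red_def)
  then show "cls (word_inv u) \<otimes>\<^bsub>F\<^esub> cls u = \<one>\<^bsub>F\<^esub>"
    using assms word_inv_words by (simp add: mult_cls one_F)
qed

lemma nf_inv: "A \<in> carrier F \<Longrightarrow> nf (inv\<^bsub>F\<^esub> A) = word_inv (nf A)"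
proof -
  assume A: "A \<in> carrier F"
  have "inv\<^bsub>F\<^esub> A = cls (word_inv (nf A))"
    using inv_cls[OF reduced_words[OF carrierE(1)[OF A]]] unfolding cls_nf[OF A] .
  then show ?thesis using nf_cls_reduced word_inv_reduced carrierE(1)[OF A] by simp
qed

section \<open>Cancellation and syllable length\<close>

text \<open>For reduced words this is twice the Gromov product at the identity. An equal letter
  counts 2 since it cancels on both sides; two different letters of one factor count 1 since they
  merge into a single letter.\<close>

fun common :: "('i \<times> 'g) list \<Rightarrow> ('i \<times> 'g) list \<Rightarrow> nat" where
  "common (x # u) (y # v) = (if x = y then 2 + common u v else if fst x = fst y then 1 else 0)"
| "common _ _ = 0"

text \<open>This ultrametric inequality for Gromov products is hyperbolicity with constant
  \<open>0\<close>.\<close>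

lemma common_ultra: "min (common u v) (common v w) \<le> common u w"
proof (induction u w arbitrary: v rule: common.induct)
  case (1 x u y w)
  show ?case
  proof (cases v)
    case (Cons z v')
    show ?thesis
    proof (cases "x = y")
      case True
      then have "min (common u v') (common v' w) \<le> common u w" using 1 by blast
      then show ?thesis using True Cons by (auto simp: min_def split: if_splits)
    next
      case False
      then show ?thesis using Cons by (auto simp: min_def)
    qed
  qed simp
next
  case ("2_1" w)
  then show ?case by simp
next
  case ("2_2" u)
  then show ?case by (cases v) simp_all
qed

text \<open>Cancellation proceeds while the leading letters agree. At the first disagreement they
  either merge or stand side by side, and the remaining word is then already reduced, so nothing
  further collapses.\<close>

lemma length_red_word_inv:
  assumes "reduced u" "reduced v"
  shows "length (red (word_inv u @ v)) + common u v = length u + length v"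
  using assms
proof (induction u v rule: common.induct)
  case (1 x u y v)
  then interpret group "G (fst x)" using groups by (auto simp: reduced_Cons)
  have x: "fst x \<in> I" "snd x \<in> carrier (G (fst x))" "snd x \<noteq> \<one>\<^bsub>G (fst x)\<^esub>"
    and u: "reduced u" "u = [] \<or> fst (hd u) \<noteq> fst x"
    and y: "fst y \<in> I" "snd y \<in> carrier (G (fst y))" "snd y \<noteq> \<one>\<^bsub>G (fst y)\<^esub>"
    and v: "reduced v" "v = [] \<or> fst (hd v) \<noteq> fst y"
    using 1 by (auto simp: reduced_Cons)
  have unit: "inv\<^bsub>G (fst x)\<^esub> snd x \<otimes>\<^bsub>G (fst x)\<^esub> snd y = \<one>\<^bsub>G (fst x)\<^esub> \<longleftrightarrow> y = x" if "fst x = fst y"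
  proof -
    have "snd y \<in> carrier (G (fst x))" using y that by simp
    then have "inv\<^bsub>G (fst x)\<^esub> snd x \<otimes>\<^bsub>G (fst x)\<^esub> snd y = \<one>\<^bsub>G (fst x)\<^esub> \<longleftrightarrow> snd y = snd x"
      using x by (metis inv_closed inv_equality inv_inv l_inv)
    then show ?thesis using that by (simp add: prod_eq_iff)
  qed
  have yv: "foldr act (y # v) [] = y # v" using 1 red_of_reduced red_def by metis
  have "act (letter_inv x) (y # v) =
     (if fst y = fst x then if y = x then v else (fst x, inv\<^bsub>G (fst x)\<^esub> snd x \<otimes>\<^bsub>G (fst x)\<^esub> snd y) # v
      else letter_inv x # y # v)"
  proof -
    have "inv\<^bsub>G (fst x)\<^esub> snd x \<noteq> \<one>\<^bsub>G (fst x)\<^esub>" using x by simp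
    then show ?thesis
      using unit by (cases y) (auto simp: act.simps letter_inv_def)
  qed
  note act_x = this
  have red_eq: "red (word_inv (x # u) @ y # v) = foldr act (word_inv u) (act (letter_inv x) (y # v))"
    using yv by (simp add: red_def word_inv_Cons)
  consider "x = y" | "x \<noteq> y" "fst x = fst y" | "fst x \<noteq> fst y" by blast
  then show ?case
  proof cases
    case eq: 1
    have "foldr act v [] = v" using v red_of_reduced red_def by metis
    then have "foldr act (word_inv u) v = red (word_inv u @ v)" by (simp add: red_def)
    then show ?thesis using 1 red_eq act_x eq u v by simp
  next
    case 2
    let ?z = "(fst x, inv\<^bsub>G (fst x)\<^esub> snd x \<otimes>\<^bsub>G (fst x)\<^esub> snd y)"
    have "inv\<^bsub>G (fst x)\<^esub> snd x \<otimes>\<^bsub>G (fst x)\<^esub> snd y \<noteq> \<one>\<^bsub>G (fst x)\<^esub>"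
      using 2 unit by metis
    moreover have "snd ?z \<in> carrier (G (fst x))"
      using m_closed[OF inv_closed[OF x(2)], of "snd y"] y(2) 2(2) by (metis snd_conv)
    ultimately have "reduced (?z # v)" using x v 2 by (simp add: reduced_Cons)
    then have "reduced (word_inv u @ ?z # v)"
      unfolding reduced_append[of "word_inv u"]
      using u(2) word_inv_reduced[OF u(1)] last_word_inv[of u] by (cases "u = []") auto
    then have "foldr act (word_inv u) (?z # v) = word_inv u @ ?z # v"
      by (rule foldr_act_reduced_append)
    then show ?thesis using 2 red_eq act_x by simp
  next
    case 3
    have "reduced (letter_inv x # y # v)" using x 1 3 by (auto simp: reduced_Cons)
    then have "reduced (word_inv u @ letter_inv x # y # v)"
      unfolding reduced_append[of "word_inv u"]
      using u(2) word_inv_reduced[OF u(1)] last_word_inv[of u] by (cases "u = []") auto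
    then have "foldr act (word_inv u) (letter_inv x # y # v) = word_inv u @ letter_inv x # y # v"
      by (rule foldr_act_reduced_append)
    then show ?thesis using 3 red_eq act_x by auto
  qed
next
  case ("2_1" v)
  then show ?case by (simp add: red_of_reduced)
next
  case ("2_2" u)
  then show ?case by (simp add: red_of_reduced word_inv_reduced)
qed

definition len :: "('i \<times> 'g) list set \<Rightarrow> nat" where
  "len A = length (nf A)"

lemma len_inv_mult:
  assumes "A \<in> carrier F" "B \<in> carrier F"
  shows "len (inv\<^bsub>F\<^esub> A \<otimes>\<^bsub>F\<^esub> B) + common (nf A) (nf B) = len A + len B"
proof -
  have A: "reduced (nf A)" "cls (nf A) = A" and B: "reduced (nf B)" "cls (nf B) = B"
    using assms carrierE(1) cls_nf by auto
  have "inv\<^bsub>F\<^esub> A \<otimes>\<^bsub>F\<^esub> B = cls (word_inv (nf A) @ nf B)"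
    using inv_cls[OF reduced_words[OF A(1)]] mult_cls[OF word_inv_words[OF reduced_words[OF A(1)]] reduced_words[OF B(1)]] A(2) B(2)
    by simp
  then have "nf (inv\<^bsub>F\<^esub> A \<otimes>\<^bsub>F\<^esub> B) = red (word_inv (nf A) @ nf B)"
    using A B nf_cls word_inv_words reduced_words by simp
  then show ?thesis using length_red_word_inv A B by (simp add: len_def)
qed

lemma nf_cls_append:
  assumes "A \<in> carrier F" "B \<in> carrier F" "nf A = [] \<or> nf B = [] \<or> fst (last (nf A)) \<noteq> fst (hd (nf B))"
  shows "nf (A \<otimes>\<^bsub>F\<^esub> B) = nf A @ nf B"
proof -
  have "reduced (nf A @ nf B)" using assms carrierE by (auto simp: reduced_append)
  moreover have "A \<otimes>\<^bsub>F\<^esub> B = cls (nf A @ nf B)"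
    using mult_cls[OF reduced_words[OF carrierE(1)] reduced_words[OF carrierE(1)], OF assms(1,2)]
    unfolding cls_nf[OF assms(1)] cls_nf[OF assms(2)] .
  ultimately show ?thesis by (simp add: nf_cls_reduced)
qed

end

context group
begin

lemma inv_mult_cancel:
  assumes "x \<in> carrier G" "y \<in> carrier G"
  shows "inv x \<otimes> (x \<otimes> y) = y" "x \<otimes> (inv x \<otimes> y) = y"
  using assms by (simp_all add: m_assoc[symmetric])

lemmas word_simps = m_assoc inv_mult_group inv_mult_cancel

end

section \<open>Groups with a length function that is hyperbolic with constant 0\<close>

text \<open>\<open>hyperbolic_ineq\<close> is the four-point inequality with one of the points at
  the identity; left translation gives the general one. \<open>geodesic\<close> supplies a point at
  every integral distance on the way to \<open>x\<close>.\<close>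

locale tree_like_group = group F for F (structure) +
  fixes len :: "'a \<Rightarrow> nat"
  assumes len_eq_0: "x \<in> carrier F \<Longrightarrow> len x = 0 \<longleftrightarrow> x = \<one>"
    and len_inv: "x \<in> carrier F \<Longrightarrow> len (inv x) = len x"
    and hyperbolic_ineq: "\<lbrakk>x \<in> carrier F; y \<in> carrier F; z \<in> carrier F\<rbrakk> \<Longrightarrow>
      len (inv x \<otimes> z) + len y \<le> max (len (inv x \<otimes> y) + len z) (len (inv y \<otimes> z) + len x)"
    and geodesic: "\<lbrakk>x \<in> carrier F; n \<le> len x\<rbrakk> \<Longrightarrow> \<exists>z\<in>carrier F. len z = n \<and> len (inv z \<otimes> x) = len x - n"
begin

definition d :: "'a \<Rightarrow> 'a \<Rightarrow> int" where
  "d x y = int (len (inv x \<otimes> y))"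

lemma d_nonneg: "0 \<le> d x y" by (simp add: d_def)

lemma d_commute: "x \<in> carrier F \<Longrightarrow> y \<in> carrier F \<Longrightarrow> d x y = d y x"
  using len_inv[of "inv x \<otimes> y"] by (simp add: d_def inv_mult_group)

lemma d_eq_0: "x \<in> carrier F \<Longrightarrow> y \<in> carrier F \<Longrightarrow> d x y = 0 \<longleftrightarrow> x = y"
proof -
  assume xy: "x \<in> carrier F" "y \<in> carrier F"
  have "inv x \<otimes> y = \<one> \<longleftrightarrow> x = y"
    using xy by (metis inv_closed inv_equality inv_inv l_inv)
  then show ?thesis using len_eq_0[of "inv x \<otimes> y"] xy by (simp add: d_def)
qed

lemma d_mult_left: "g \<in> carrier F \<Longrightarrow> x \<in> carrier F \<Longrightarrow> y \<in> carrier F \<Longrightarrow> d (g \<otimes> x) (g \<otimes> y) = d x y"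
proof -
  assume "g \<in> carrier F" "x \<in> carrier F" "y \<in> carrier F"
  then have "inv (g \<otimes> x) \<otimes> (g \<otimes> y) = inv x \<otimes> y"
    by (simp add: word_simps)
  then show ?thesis by (simp add: d_def)
qed

lemma four_point:
  assumes "x \<in> carrier F" "y \<in> carrier F" "z \<in> carrier F" "w \<in> carrier F"
  shows "d x y + d z w \<le> max (d x z + d y w) (d x w + d y z)"
proof -
  let ?t = "\<lambda>u. inv w \<otimes> u"
  have "d (?t x) (?t y) + int (len (?t z)) \<le> max (d (?t x) (?t z) + int (len (?t y))) (d (?t z) (?t y) + int (len (?t x)))"
    using hyperbolic_ineq[of "?t x" "?t z" "?t y"] assms by (simp add: d_def)
  moreover have "d (?t u) (?t v) = d u v" if "u \<in> carrier F" "v \<in> carrier F" for u v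
    using that assms by (intro d_mult_left) auto
  moreover have "int (len (?t u)) = d u w" if "u \<in> carrier F" for u
    using that assms d_commute[of u w] by (simp add: d_def)
  ultimately show ?thesis using assms d_commute[of z y] by simp
qed

lemma d_triangle:
  assumes "x \<in> carrier F" "y \<in> carrier F" "z \<in> carrier F"
  shows "d x z \<le> d x y + d y z"
  using four_point[of x z y y] assms d_eq_0[of y y] d_commute[of y z] d_commute[of x y] by simp

lemma len_mult_le: "x \<in> carrier F \<Longrightarrow> y \<in> carrier F \<Longrightarrow> len (x \<otimes> y) \<le> len x + len y"
  using d_triangle[of "inv x" \<one> y] len_inv[of x] by (simp add: d_def)

lemma len_one [simp]: "len \<one> = 0" by (simp add: len_eq_0)

lemma geodesic_point:
  assumes "p \<in> carrier F" "q \<in> carrier F" "0 \<le> t" "t \<le> d p q"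
  shows "\<exists>z\<in>carrier F. d p z = t \<and> d z q = d p q - t"
proof -
  have "nat t \<le> len (inv p \<otimes> q)" using assms by (simp add: d_def)
  then obtain z where z: "z \<in> carrier F" "len z = nat t" "len (inv z \<otimes> (inv p \<otimes> q)) = len (inv p \<otimes> q) - nat t"
    using geodesic[of "inv p \<otimes> q" "nat t"] assms by auto
  have "d p (p \<otimes> z) = t"
    using d_mult_left[of p \<one> z] assms z by (simp add: d_def)
  moreover have "d (p \<otimes> z) q = d p q - t"
    using assms z \<open>nat t \<le> _\<close> by (simp add: d_def inv_mult_group m_assoc)
  ultimately show ?thesis using assms z by blast
qed

text \<open>If an isometry moves the end points of a geodesic by less than its length in total, then it
  translates the middle part of the geodesic along itself.\<close>

lemma geodesics_fellow_travel:
  assumes pts: "p \<in> carrier F" "q \<in> carrier F" "p' \<in> carrier F" "q' \<in> carrier F" "z \<in> carrier F" "z' \<in> carrier F"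
    and M: "d p q = M" "d p' q' = M" and k: "d p p' + d q q' < 2 * M"
    and s: "d p q' = M + s"
    and z': "d p' z' = t" "d z' q' = M - t" and z: "d p z = t + s" "d z q = M - t - s"
    and lo: "d p p' - s \<le> 2 * t" and hi: "2 * t + s + d q q' \<le> 2 * M"
  shows "z = z'"
proof -
  note c = pts d_commute[OF pts(1,2)] d_commute[OF pts(1,3)] d_commute[OF pts(1,4)] d_commute[OF pts(1,5)]
    d_commute[OF pts(1,6)] d_commute[OF pts(2,3)] d_commute[OF pts(2,4)] d_commute[OF pts(2,5)]
    d_commute[OF pts(2,6)] d_commute[OF pts(3,4)] d_commute[OF pts(3,5)] d_commute[OF pts(3,6)]
    d_commute[OF pts(4,5)] d_commute[OF pts(4,6)] d_commute[OF pts(5,6)]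
  \<comment> \<open>Of the three sums of distances between opposite points among \<open>p\<close>,
    \<open>q\<close>, \<open>p'\<close>, \<open>q'\<close> the two largest coincide. One is
    \<open>2 * M\<close>, and \<open>k\<close> says that another is smaller.\<close>
  have 1: "d p q' + d q p' = 2 * M"
    using four_point[OF pts(1,2,3,4)] four_point[OF pts(1,4,2,3)] c k M by linarith
  have 2: "d p z' \<le> t + s"
    using four_point[OF pts(1,6,3,4)] c lo z' s M by linarith
  have 3: "d z q' \<le> M - t"
    using four_point[OF pts(5,4,1,2)] c 1 hi z s M by linarith
  \<comment> \<open>Both points now lie at distance \<open>t + s\<close> from \<open>p\<close> on a
    geodesic to \<open>q'\<close>, and in a tree there is only one such point.\<close>
  have "d z z' \<le> 0"
    using four_point[OF pts(5,6,1,4)] c 2 3 s z z' by linarith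
  then show ?thesis using d_nonneg[of z z'] d_eq_0[OF pts(5,6)] by simp
qed

text \<open>In the tree this says that \<open>g\<close> translates along an axis; for an isometry
  with a fixed point squaring does not increase the length.\<close>

definition hyp :: "'a \<Rightarrow> bool" where
  "hyp g \<longleftrightarrow> g \<in> carrier F \<and> len g < len (g \<otimes> g)"

text \<open>For hyperbolic \<open>g\<close> this is the translation length along the axis, and
  \<open>len g - trans_len g\<close> is twice the distance from the identity to the axis.\<close>

definition trans_len :: "'a \<Rightarrow> int" where
  "trans_len g = int (len (g \<otimes> g)) - int (len g)"

lemma hyp_carrier [simp]: "hyp g \<Longrightarrow> g \<in> carrier F" by (simp add: hyp_def)

lemma trans_len_pos: "hyp g \<Longrightarrow> 1 \<le> trans_len g" by (simp add: hyp_def trans_len_def)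

lemma trans_len_le: "g \<in> carrier F \<Longrightarrow> trans_len g \<le> len g"
  using len_mult_le[of g g] by (simp add: trans_len_def)

text \<open>In the four-point inequality for the identity, \<open>g\<close> and two consecutive
  powers the sum \<open>2 * len g\<close> is too small, so the other two sums agree and the lengths
  form an arithmetic progression. The recursion has order two, hence the pair of lengths in the
  induction.\<close>

lemma len_pow:
  assumes "hyp g"
  shows "int (len (g [^] Suc n)) = len g + int n * trans_len g"
proof -
  have g: "g \<in> carrier F" using assms by simp
  have "int (len (g [^] Suc n)) = len g + int n * trans_len g
      \<and> int (len (g [^] Suc (Suc n))) = len g + (int n + 1) * trans_len g"
  proof (induction n)
    case 0
    then show ?case using g by (simp add: trans_len_def)
  next
    case (Suc n)
    let ?p = "\<lambda>n. g [^] (n::nat)"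
    have s: "?p (Suc k) = g \<otimes> ?p k" for k by (rule nat_pow_Suc2[OF g])
    have 1: "d \<one> (?p k) = len (?p k)" "d g (?p (Suc k)) = len (?p k)" "d (?p k) (?p (Suc k)) = len g" for k
    proof -
      show "d \<one> (?p k) = len (?p k)" using g by (simp add: d_def)
      show "d g (?p (Suc k)) = len (?p k)" unfolding s using d_mult_left[of g \<one> "?p k"] g by (simp add: d_def)
      show "d (?p k) (?p (Suc k)) = len g" using g d_mult_left[of "?p k" \<one> g] by (simp add: d_def)
    qed
    have "d \<one> g = len g" using g by (simp add: d_def)
    have c: "d (?p (Suc (Suc n))) g = d g (?p (Suc (Suc n)))" "d (?p (Suc (Suc (Suc n)))) g = d g (?p (Suc (Suc (Suc n))))"
      "d (?p (Suc (Suc n))) (?p (Suc (Suc (Suc n)))) = d (?p (Suc (Suc (Suc n)))) (?p (Suc (Suc n)))"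
      using g by (intro d_commute; simp)+
    have car: "\<one> \<in> carrier F" "?p (Suc (Suc n)) \<in> carrier F" "?p (Suc (Suc (Suc n))) \<in> carrier F" using g by auto
    have "int (len (?p (Suc (Suc n)))) > len g"
      using Suc trans_len_pos[OF assms] by (smt (verit) mult_nonneg_nonneg of_nat_0_le_iff mult_pos_pos)
    then have "int (len (?p (Suc (Suc (Suc n))))) + len (?p (Suc n)) = 2 * int (len (?p (Suc (Suc n))))"
      using four_point[OF car(1) car(2) g car(3)] four_point[OF car(1) car(3) g car(2)]
        1[of "Suc n"] 1[of "Suc (Suc n)"] 1[of "Suc (Suc (Suc n))"] c \<open>d \<one> g = len g\<close> by linarith
    then show ?case using Suc by (simp add: algebra_simps)
  qed
  then show ?thesis by simp
qed

lemma len_pow_ge: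
  assumes "hyp g" "0 < (k::nat)"
  shows "k \<le> len (g [^] k)" "len g \<le> len (g [^] k)"
proof -
  obtain n where n: "k = Suc n" using assms gr0_conv_Suc by blast
  have g: "g \<in> carrier F" using assms by simp
  have 1: "1 \<le> trans_len g" by (rule trans_len_pos[OF assms(1)])
  then have "int n * 1 \<le> int n * trans_len g" by (intro mult_left_mono) auto
  moreover have "1 \<le> int (len g)" using 1 trans_len_le[OF g] by linarith
  ultimately have "int k \<le> int (len (g [^] k))" "int (len g) \<le> int (len (g [^] k))"
    using len_pow[OF assms(1), of n] trans_len_pos[OF assms(1)] unfolding n by linarith+
  then show "k \<le> len (g [^] k)" "len g \<le> len (g [^] k)" by simp_all
qed

lemma hyp_pow:
  assumes "hyp g" "0 < (k::nat)"
  shows "hyp (g [^] k)"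
proof -
  obtain n where n: "k = Suc n" using assms gr0_conv_Suc by blast
  have g: "g \<in> carrier F" using assms by simp
  have "g [^] k \<otimes> g [^] k = g [^] (k + k)" by (rule nat_pow_mult[OF g])
  moreover have "k + k = Suc (2 * n + 1)" using n by simp
  ultimately have gg: "g [^] k \<otimes> g [^] k = g [^] Suc (2 * n + 1)" by (rule trans[OF _ arg_cong])
  have "int n * trans_len g < int (2 * n + 1) * trans_len g"
    using trans_len_pos[OF assms(1)] by (intro mult_strict_right_mono) auto
  then have "int (len (g [^] Suc n)) < int (len (g [^] k \<otimes> g [^] k))"
    unfolding gg using len_pow[OF assms(1), of n] len_pow[OF assms(1), of "2 * n + 1"] by linarith
  then show ?thesis using g n unfolding hyp_def by simp
qed

lemma hyp_ne_one: "hyp g \<Longrightarrow> g \<noteq> \<one>" by (auto simp: hyp_def)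

text \<open>Unboundedness of the powers characterises hyperbolic elements up to conjugation.\<close>

lemma hyp_inv: "hyp g \<Longrightarrow> hyp (inv g)"
  using len_inv[of g] len_inv[of "g \<otimes> g"] by (simp add: hyp_def inv_mult_group)

lemma conj_pow:
  assumes "g \<in> carrier F" "c \<in> carrier F"
  shows "(c \<otimes> g \<otimes> inv c) [^] (k::nat) = c \<otimes> g [^] k \<otimes> inv c"
proof (induction k)
  case (Suc k)
  have "c \<otimes> g [^] k \<otimes> inv c \<otimes> (c \<otimes> g \<otimes> inv c) = c \<otimes> g [^] k \<otimes> (inv c \<otimes> c) \<otimes> g \<otimes> inv c"
    using assms by (simp only: m_assoc m_closed inv_closed nat_pow_closed)
  then show ?case using Suc assms by (simp add: m_assoc)
qed (use assms in simp)

text \<open>Conjugation changes the length of a power by at most \<open>2 * len c\<close>, whereas a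
  larger translation length would gain at least 1 with each further factor. The exponent is chosen
  so that the gain outweighs the bounded loss.\<close>

lemma trans_len_conj_le:
  assumes "hyp g" "c \<in> carrier F" "hyp (c \<otimes> g \<otimes> inv c)"
  shows "trans_len (c \<otimes> g \<otimes> inv c) \<le> trans_len g"
proof (rule ccontr)
  assume "\<not> ?thesis"
  then have lt: "trans_len g + 1 \<le> trans_len (c \<otimes> g \<otimes> inv c)" by simp
  have g: "g \<in> carrier F" using assms by simp
  define n where "n = 2 * len c + len g"
  have "int n * (trans_len g + 1) \<le> int n * trans_len (c \<otimes> g \<otimes> inv c)"
    using lt by (intro mult_left_mono) auto
  moreover have "len (c \<otimes> g [^] Suc n \<otimes> inv c) \<le> len c + len (g [^] Suc n) + len c"
    using len_mult_le[of "c \<otimes> g [^] Suc n" "inv c"] len_mult_le[of c "g [^] Suc n"] len_inv[of c] assms g by simp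
  moreover have "len (c \<otimes> g \<otimes> inv c) > 0"
    using hyp_ne_one[OF assms(3)] len_eq_0[of "c \<otimes> g \<otimes> inv c"] g assms(2) by simp
  ultimately show False
    using len_pow[OF assms(1), of n] len_pow[OF assms(3), of n] conj_pow[OF g assms(2), of "Suc n"]
    by (simp add: n_def algebra_simps)
qed

text \<open>Commuting hyperbolic elements share their axis. Twice its distance from the identity is
  \<open>len a - trans_len a\<close>, but also \<open>len r - trans_len r\<close>, which is less
  than \<open>len r\<close>.\<close>

lemma commuting_hyp_len:
  assumes a: "hyp a" and r: "hyp r" and comm: "a \<otimes> r = r \<otimes> a"
  shows "int (len a) - trans_len a < len r"
proof -
  have car: "a \<in> carrier F" "r \<in> carrier F" "inv a \<in> carrier F" "inv r \<in> carrier F" "\<one> \<in> carrier F" 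
    "r \<otimes> a \<in> carrier F" using a r by auto
  have d1: "d \<one> a = len a" "d \<one> r = len r" "d \<one> (inv a) = len a" "d \<one> (inv r) = len r"
    using car len_inv by (simp_all add: d_def)
  have x: "d (inv a) r = len (a \<otimes> r)" "d (inv r) a = len (a \<otimes> r)" "d \<one> (r \<otimes> a) = len (a \<otimes> r)"
    using car comm by (simp_all add: d_def)
  have y: "d a r = len (inv a \<otimes> r)" "d r a = len (inv a \<otimes> r)" "d (inv r) (inv a) = len (inv a \<otimes> r)"
  proof -
    show "d a r = len (inv a \<otimes> r)" by (simp add: d_def)
    then show 1: "d r a = len (inv a \<otimes> r)" using d_commute car by simp
    have "r \<otimes> inv a = inv a \<otimes> r"
    proof -
      have "r \<otimes> inv a = inv a \<otimes> (a \<otimes> r) \<otimes> inv a" using car by (simp add: m_assoc[symmetric])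
      also have "\<dots> = inv a \<otimes> r" unfolding comm using car by (simp add: m_assoc)
      finally show ?thesis .
    qed
    then show "d (inv r) (inv a) = len (inv a \<otimes> r)" using car by (simp add: d_def)
  qed
  have aa: "d (inv a) a = len a + trans_len a" "d (inv r) r = len r + trans_len r"
    using car by (simp_all add: d_def trans_len_def)
  have ra: "d r (r \<otimes> a) = len a" "d (r \<otimes> a) a = len r"
    using d_mult_left[of r \<one> a] d_mult_left[of a r \<one>] car comm d1 d_commute[of \<one> r] by simp_all
  have s: "d a \<one> = d \<one> a" "d r \<one> = d \<one> r" "d (inv a) \<one> = d \<one> (inv a)" "d (inv r) \<one> = d \<one> (inv r)"
    "d (r \<otimes> a) \<one> = d \<one> (r \<otimes> a)" "d a (inv a) = d (inv a) a" "d r (inv r) = d (inv r) r"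
    "d r (inv a) = d (inv a) r" "d a (inv r) = d (inv r) a" "d (inv a) (inv r) = d (inv r) (inv a)"
    "d (r \<otimes> a) r = d r (r \<otimes> a)" "d a (r \<otimes> a) = d (r \<otimes> a) a"
    using car by (auto intro!: d_commute)
  have pos: "1 \<le> trans_len a" "1 \<le> trans_len r" "0 < len a" "0 < len r"
    using a r trans_len_pos hyp_ne_one len_eq_0 by (auto simp: hyp_def)
  \<comment> \<open>\<open>?s\<close>, \<open>?t\<close>, \<open>?e\<close>, \<open>?f\<close> are
    twice the Gromov products at the identity of \<open>inv a\<close> and \<open>r\<close>, of
    \<open>a\<close> and \<open>r\<close>, of \<open>inv a\<close> and \<open>a\<close>, and of
    \<open>inv r\<close> and \<open>r\<close>; \<open>11\<close> to \<open>14\<close> are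
    ultrametric inequalities between them.\<close>
  let ?s = "int (len a) + len r - len (a \<otimes> r)"
  let ?t = "int (len a) + len r - len (inv a \<otimes> r)"
  let ?e = "int (len a) - trans_len a"
  let ?f = "int (len r) - trans_len r"
  note eqs = d1 x y aa ra s
  have 11: "?s \<ge> min ?e ?t" using four_point[of "inv a" r a \<one>] car eqs by linarith
  have 12: "?t \<ge> min ?e ?s" using four_point[of a r "inv a" \<one>] car eqs by linarith
  have 13: "?e \<ge> min ?s ?t" using four_point[of "inv a" a r \<one>] car eqs by linarith
  have 14: "?f \<ge> min ?s ?t" using four_point[of "inv r" r a \<one>] car eqs by linarith
  note 1 = 11 12 13 14
  \<comment> \<open>If they were equal, the quadrilateral of the identity, \<open>r\<close>,
    \<open>r \<otimes> a\<close> and \<open>a\<close> would show that \<open>?s\<close> is at least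
    the smaller of the two lengths; then \<open>13\<close> or \<open>14\<close> contradicts that
    \<open>?e\<close> is below \<open>len a\<close> and \<open>?f\<close> below
    \<open>len r\<close>.\<close>
  have "?s \<noteq> ?t"
  proof
    assume st: "?s = ?t"
    have "2 * int (len (a \<otimes> r)) \<le> max (2 * int (len r)) (2 * int (len a))"
      using four_point[of \<one> "r \<otimes> a" r a] car eqs st by linarith
    then show False using 1 st pos by linarith
  qed
  then show ?thesis using 1 pos by linarith
qed

text \<open>The midpoint argument: \<open>r\<close> and \<open>b\<close> both translate a long piece of the geodesic from \<open>inv c\<close> to
  \<open>inv b\<^sup>k c\<close> along itself, so they commute.\<close>

lemma len_conj_pow_gt:
  assumes b: "hyp b" and r: "r \<in> carrier F" and c: "c \<in> carrier F" and nc: "r \<otimes> b \<noteq> b \<otimes> r"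
    and hb: "hyp (c \<otimes> b \<otimes> inv c)"
    and k: "(k::nat) \<ge> 4 + 3 * len (c \<otimes> r \<otimes> inv c) + 2 * len c"
  shows "len (b [^] k) < len (c \<otimes> b [^] k \<otimes> r \<otimes> inv (b [^] k) \<otimes> inv c)"
proof (rule ccontr)
  assume neg: "\<not> ?thesis"
  have bc: "b \<in> carrier F" using b by simp
  define a where "a = inv b"
  have a: "a \<in> carrier F" using bc by (simp add: a_def)
  define p where "p = inv c"
  have p: "p \<in> carrier F" using c by (simp add: p_def)
  define q where "q = a [^] k \<otimes> p"
  have q: "q \<in> carrier F" using a p by (simp add: q_def)
  have akinv: "inv (b [^] k) = a [^] k" using bc by (simp add: a_def nat_pow_inv)
  define h where "h = c \<otimes> a \<otimes> inv c"
  have h: "hyp h"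
  proof -
    have "h = inv (c \<otimes> b \<otimes> inv c)" using c bc by (simp add: h_def a_def inv_mult_group m_assoc)
    then show ?thesis using hyp_inv[OF hb] by simp
  qed
  have dpow: "d p (a [^] (n::nat) \<otimes> p) = len (h [^] n)" for n
    using conj_pow[OF a c, of n] c a by (simp add: d_def p_def h_def m_assoc)
  define l where "l = int (len h)"
  define \<tau> where "\<tau> = trans_len h"
  define \<kappa> where "\<kappa> = d p (r \<otimes> p)"
  have \<kappa>: "\<kappa> = len (c \<otimes> r \<otimes> inv c)" using c r by (simp add: \<kappa>_def p_def d_def m_assoc)
  have \<tau>: "1 \<le> \<tau>" "\<tau> \<le> l" using trans_len_pos[OF h] trans_len_le[of h] h by (auto simp: \<tau>_def l_def)
  have k0: "0 < k" using k by simp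
  then obtain k' where k': "k = Suc k'" using gr0_conv_Suc by blast
  define M where "M = d p q"
  have M: "M = l + (int k - 1) * \<tau>" using dpow[of k] len_pow[OF h, of k'] by (simp add: M_def q_def l_def \<tau>_def k')
  have M2: "d p (a \<otimes> q) = M + \<tau>"
  proof -
    have "a \<otimes> q = a [^] Suc k \<otimes> p" unfolding q_def nat_pow_Suc2[OF a] using a p by (simp add: m_assoc)
    then show ?thesis using dpow[of "Suc k"] len_pow[OF h, of k] M by (simp add: l_def \<tau>_def algebra_simps)
  qed
  have pa: "d p (a \<otimes> p) = l" using dpow[of 1] a h by (simp add: l_def)
  have qa: "d q (a \<otimes> q) = l"
  proof -
    have "a \<otimes> q = a [^] k \<otimes> (a \<otimes> p)"
      unfolding q_def using a p nat_pow_Suc2[OF a, of k] by (simp add: m_assoc[symmetric])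
    then show ?thesis using d_mult_left[of "a [^] k" p "a \<otimes> p"] pa a p by (simp add: q_def)
  qed
  have D: "d q (r \<otimes> q) = len (c \<otimes> b [^] k \<otimes> r \<otimes> inv (b [^] k) \<otimes> inv c)"
  proof -
    have "inv q \<otimes> (r \<otimes> q) = c \<otimes> b [^] k \<otimes> r \<otimes> inv (b [^] k) \<otimes> inv c"
      using a p c r bc by (simp add: q_def p_def akinv[symmetric] inv_mult_group m_assoc)
    then show ?thesis by (simp add: d_def)
  qed
  have "len (b [^] k) \<le> M + 2 * len c"
  proof -
    have "len (b [^] k) = len (a [^] k)" using len_inv[of "b [^] k"] bc akinv by simp
    moreover have "a [^] k = inv c \<otimes> (c \<otimes> a [^] k \<otimes> inv c) \<otimes> c"
      using a c by (simp add: word_simps)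
    moreover have "len (inv c \<otimes> (c \<otimes> a [^] k \<otimes> inv c) \<otimes> c) \<le> len c + len (c \<otimes> a [^] k \<otimes> inv c) + len c"
      using len_mult_le[of "inv c \<otimes> (c \<otimes> a [^] k \<otimes> inv c)" c] len_mult_le[of "inv c" "c \<otimes> a [^] k \<otimes> inv c"]
        len_inv[of c] a c by simp
    ultimately show ?thesis using dpow[of k] conj_pow[OF a c, of k] by (simp add: M_def q_def h_def)
  qed
  then have D_le: "d q (r \<otimes> q) \<le> M + 2 * len c" using neg D by linarith
  have kk: "4 + 3 * \<kappa> + 2 * int (len c) \<le> int k" using k \<kappa> by linarith
  have \<kappa>0: "0 \<le> \<kappa>" by (simp add: \<kappa>)
  \<comment> \<open>The geodesic from \<open>p\<close> to \<open>q\<close> follows the axis of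
    \<open>a\<close> for a length of \<open>int k * \<tau>\<close>. The bound on \<open>k\<close>
    lets this stretch absorb \<open>3 * \<kappa>\<close> from the displacement of \<open>p\<close>
    by \<open>r\<close> and \<open>2 * len c\<close> from \<open>D_le\<close>, besides the
    translations by \<open>a\<close>.\<close>
  have k\<tau>: "(4 + 3 * \<kappa> + 2 * int (len c)) * \<tau> \<le> int k * \<tau>"
    using kk \<tau> by (intro mult_right_mono) auto
  have "(2 + 3 * \<kappa> + 2 * int (len c)) * 1 \<le> (2 + 3 * \<kappa> + 2 * int (len c)) * \<tau>"
    using \<tau> \<kappa>0 by (intro mult_left_mono) auto
  then have big: "2 * \<tau> + 2 + 3 * \<kappa> + 2 * int (len c) \<le> int k * \<tau>" using k\<tau> by (simp add: algebra_simps)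
  define s where "s = d p (r \<otimes> q) - M"
  have rc: "r \<otimes> p \<in> carrier F" "r \<otimes> q \<in> carrier F" "a \<otimes> p \<in> carrier F" "a \<otimes> q \<in> carrier F"
    using r a p q by auto
  have rM: "d (r \<otimes> p) (r \<otimes> q) = M" "d (a \<otimes> p) (a \<otimes> q) = M"
    using d_mult_left r a p q by (simp_all add: M_def)
  have s: "\<bar>s\<bar> \<le> \<kappa>"
    using d_triangle[OF p rc(1) rc(2)] d_triangle[OF rc(1) p rc(2)] d_commute[OF p rc(1)] rM
    by (simp add: s_def \<kappa>_def)
  \<comment> \<open>Half of \<open>l - \<tau>\<close> is the distance from \<open>p\<close> to the
    axis of \<open>a\<close>; the division rounds up, and \<open>\<kappa>\<close> keeps the shifted
    position \<open>t + s\<close> on the axis as well.\<close>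
  define t where "t = (l - \<tau> + 1) div 2 + \<kappa>"
  have t: "l - \<tau> \<le> 2 * (t - \<kappa>)" "2 * (t - \<kappa>) \<le> l - \<tau> + 1" by (auto simp: t_def)
  have M': "M = l - \<tau> + int k * \<tau>" using M by (simp add: algebra_simps)
  have Mk: "2 * l < 2 * M" using M' big \<tau> \<kappa>0 by linarith
  note facts = t M' big \<tau> \<kappa>0 s D_le of_nat_0_le_iff[of "len c", where ?'a = int]
  define K where "K = int k * \<tau>"
  define C where "C = int (len c)"
  define D where "D = d q (r \<otimes> q)"
  have facts: "l - \<tau> \<le> 2 * t - 2 * \<kappa>" "2 * t - 2 * \<kappa> \<le> l - \<tau> + 1" "M = l - \<tau> + K"
    "2 * \<tau> + 2 + 3 * \<kappa> + 2 * C \<le> K" "0 \<le> \<kappa>" "s \<le> \<kappa>" "- \<kappa> \<le> s" "D \<le> M + 2 * C" "0 \<le> C" "1 \<le> \<tau>" "\<tau> \<le> l"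
    using facts \<tau> by (simp_all add: K_def C_def D_def)
  have i1: "0 \<le> t" using facts by linarith
  have i2: "t \<le> M" using facts by linarith
  have i3: "0 \<le> t + \<tau>" using facts by linarith
  have i4: "t + \<tau> \<le> M" using facts by linarith
  have i5: "0 \<le> t + s" using facts by linarith
  have i6: "t + s \<le> M" using facts by linarith
  have i7: "0 \<le> t + s + \<tau>" using facts by linarith
  have i8: "t + s + \<tau> \<le> M" using facts by linarith
  have ex: "\<exists>z\<in>carrier F. d p z = u \<and> d z q = M - u" if "0 \<le> u" "u \<le> M" for u
    using geodesic_point[OF p q, of u] that by (simp add: M_def)
  obtain z where z: "z \<in> carrier F" "d p z = t" "d z q = M - t" using ex i1 i2 by blast
  obtain za where za: "za \<in> carrier F" "d p za = t + \<tau>" "d za q = M - (t + \<tau>)" using ex i3 i4 by blast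
  obtain zr where zr: "zr \<in> carrier F" "d p zr = t + s" "d zr q = M - (t + s)" using ex i5 i6 by blast
  obtain zra where zra: "zra \<in> carrier F" "d p zra = t + s + \<tau>" "d zra q = M - (t + s + \<tau>)" using ex i7 i8 by blast
  \<comment> \<open>Used for both isometries: \<open>a\<close> shifts positions by
    \<open>\<tau>\<close>, \<open>r\<close> shifts them by \<open>s\<close>.\<close>
  have shift: "g \<otimes> w = w'"
    if g: "g \<in> carrier F" and w: "w \<in> carrier F" "d p w = u" "d w q = M - u"
      and w': "w' \<in> carrier F" "d p w' = u + v" "d w' q = M - u - v" and v: "d p (g \<otimes> q) = M + v"
      and cond: "d p (g \<otimes> p) + d q (g \<otimes> q) < 2 * M" "d p (g \<otimes> p) - v \<le> 2 * u" "2 * u + v + d q (g \<otimes> q) \<le> 2 * M"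
    for g w w' u v
  proof -
    have "d (g \<otimes> p) (g \<otimes> w) = u" "d (g \<otimes> w) (g \<otimes> q) = M - u" "d (g \<otimes> p) (g \<otimes> q) = M"
      using d_mult_left g w p q by (auto simp: M_def)
    then show ?thesis
      using geodesics_fellow_travel[of p q "g \<otimes> p" "g \<otimes> q" w' "g \<otimes> w" M v u] g w w' p q v cond
      by (simp add: M_def)
  qed
  have s_eq: "d p (r \<otimes> q) = M + s" by (simp add: s_def)
  have kap: "d p (r \<otimes> p) = \<kappa>" by (simp add: \<kappa>_def)
  have Dq: "d q (r \<otimes> q) = D" by (simp add: D_def)
  have c1: "l - \<tau> \<le> 2 * (t + s)" unfolding distrib_left using facts by linarith
  have c2: "2 * (t + s) + \<tau> + l \<le> 2 * M" unfolding distrib_left using facts by linarith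
  have "a \<otimes> z = za"
    by (rule shift[OF a z za(1) _ _ M2]) (simp only: za pa qa; use facts Mk in linarith)+
  moreover have "a \<otimes> zr = zra"
    by (rule shift[OF a zr zra(1) _ _ M2]) (simp only: zra pa qa; use c1 c2 facts Mk in linarith)+
  moreover have "r \<otimes> z = zr"
    by (rule shift[OF r z zr(1) _ _ s_eq]) (simp only: zr kap Dq; use facts in linarith)+
  moreover have "r \<otimes> za = zra"
    by (rule shift[OF r za zra(1) _ _ s_eq]) (simp only: zra kap Dq; (simp only: distrib_left)?; use facts in linarith)+
  \<comment> \<open>The two shifts commute at the point \<open>z\<close>, and left translations act
    freely.\<close>
  ultimately have "(r \<otimes> a) \<otimes> z = (a \<otimes> r) \<otimes> z" using r a z by (simp add: m_assoc)
  then have "r \<otimes> a = a \<otimes> r" using r a z by simp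
  then have "b \<otimes> (r \<otimes> a) \<otimes> b = b \<otimes> (a \<otimes> r) \<otimes> b" by simp
  then have "r \<otimes> b = b \<otimes> r"
    using r bc by (simp add: a_def word_simps)
  then show False using nc by simp
qed

end

section \<open>Elliptic and hyperbolic elements of a free product\<close>

context free_product_groups
begin

lemma len_cls: "reduced w \<Longrightarrow> len (cls w) = length w"
  by (simp add: len_def nf_cls_reduced)

text \<open>\<open>len_inv_mult\<close> reduces the inequality to \<open>common_ultra\<close>, and
  the prefixes of a normal form are its geodesic points.\<close>

sublocale T: tree_like_group F len
proof
  fix x y z assume x: "x \<in> carrier F"
  show "len x = 0 \<longleftrightarrow> x = \<one>\<^bsub>F\<^esub>"
    using nf_inj[OF x F.one_closed] by (auto simp: len_def)
  show "len (inv\<^bsub>F\<^esub> x) = len x" using nf_inv[OF x] by (simp add: len_def)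
  show "len (inv\<^bsub>F\<^esub> x \<otimes>\<^bsub>F\<^esub> z) + len y \<le> max (len (inv\<^bsub>F\<^esub> x \<otimes>\<^bsub>F\<^esub> y) + len z) (len (inv\<^bsub>F\<^esub> y \<otimes>\<^bsub>F\<^esub> z) + len x)"
    if y: "y \<in> carrier F" and z: "z \<in> carrier F"
    using len_inv_mult[OF x y] len_inv_mult[OF y z] len_inv_mult[OF x z]
      common_ultra[of "nf x" "nf y" "nf z"] by linarith
next
  fix x n assume x: "x \<in> carrier F" and n: "n \<le> len x"
  let ?u = "take n (nf x)" and ?v = "drop n (nf x)"
  have uv: "reduced ?u" "reduced ?v"
    using carrierE(1)[OF x] reduced_append[of ?u ?v] by auto
  have uw: "?u \<in> fp_words I G" "?v \<in> fp_words I G" using uv reduced_words by auto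
  have "cls ?u \<otimes>\<^bsub>F\<^esub> cls ?v = cls (nf x)" using mult_cls[OF uw] by simp
  then have "inv\<^bsub>F\<^esub> (cls ?u) \<otimes>\<^bsub>F\<^esub> x = cls ?v"
    using cls_nf[OF x] uw cls_carrier F.inv_solve_left'[of "cls ?v" "cls ?u" x] x by metis
  then show "\<exists>z\<in>carrier F. len z = n \<and> len (inv\<^bsub>F\<^esub> z \<otimes>\<^bsub>F\<^esub> x) = len x - n"
    using uv uw n cls_carrier[OF uw(1)] len_cls by (intro bexI[of _ "cls ?u"]) (auto simp: len_def)
qed

abbreviation "incl i g \<equiv> free_product_incl I G i g"

lemma incl_cls: "incl i g = cls [(i, g)]"
  by (simp add: free_product_incl_def)

lemma incl_closed [simp]: "i \<in> I \<Longrightarrow> g \<in> carrier (G i) \<Longrightarrow> incl i g \<in> carrier F"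
  unfolding incl_cls by (rule cls_carrier) simp

lemma incl_one: "i \<in> I \<Longrightarrow> incl i \<one>\<^bsub>G i\<^esub> = \<one>\<^bsub>F\<^esub>"
proof -
  assume i: "i \<in> I"
  then interpret group "G i" using groups by blast
  show ?thesis unfolding incl_cls one_F using i by (subst cls_eq_iff) (auto simp: red_def act.simps)
qed

lemma incl_mult:
  assumes "i \<in> I" "g \<in> carrier (G i)" "h \<in> carrier (G i)"
  shows "incl i g \<otimes>\<^bsub>F\<^esub> incl i h = incl i (g \<otimes>\<^bsub>G i\<^esub> h)"
proof -
  interpret group "G i" using groups assms by blast
  have "cls [(i, g), (i, h)] = cls [(i, g \<otimes>\<^bsub>G i\<^esub> h)]"
    using assms act_act[of i g h "[]"] by (subst cls_eq_iff) (auto simp: red_def)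
  then show ?thesis using assms mult_cls[of "[(i, g)]" "[(i, h)]"] by (simp add: incl_cls)
qed

lemma incl_hom: "i \<in> I \<Longrightarrow> free_product_incl I G i \<in> hom (G i) F"
  by (auto intro!: homI simp: incl_mult)

lemma incl_inv:
  assumes "i \<in> I" "g \<in> carrier (G i)"
  shows "inv\<^bsub>F\<^esub> (incl i g) = incl i (inv\<^bsub>G i\<^esub> g)"
proof -
  interpret group "G i" using groups assms by blast
  show ?thesis using assms incl_mult[of i "inv\<^bsub>G i\<^esub> g" g] incl_one
    by (intro F.inv_equality) auto
qed

lemma nf_incl: "i \<in> I \<Longrightarrow> g \<in> carrier (G i) \<Longrightarrow> g \<noteq> \<one>\<^bsub>G i\<^esub> \<Longrightarrow> nf (incl i g) = [(i, g)]"
  unfolding incl_cls by (rule nf_cls_reduced) (simp add: reduced_Cons)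

lemma len_incl: "i \<in> I \<Longrightarrow> g \<in> carrier (G i) \<Longrightarrow> len (incl i g) \<le> 1"
  by (cases "g = \<one>\<^bsub>G i\<^esub>") (simp_all add: incl_one nf_incl len_def)

lemma incl_eq_one_iff: "i \<in> I \<Longrightarrow> g \<in> carrier (G i) \<Longrightarrow> incl i g = \<one>\<^bsub>F\<^esub> \<longleftrightarrow> g = \<one>\<^bsub>G i\<^esub>"
  using nf_incl[of i g] incl_one by (metis list.distinct(1) nf_one)

definition fconj :: "('i \<times> 'g) list set \<Rightarrow> 'i \<Rightarrow> ('i \<times> 'g) list set set" where
  "fconj u i = (\<lambda>g. u \<otimes>\<^bsub>F\<^esub> incl i g \<otimes>\<^bsub>F\<^esub> inv\<^bsub>F\<^esub> u) ` carrier (G i)"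

text \<open>The elliptic elements. The identity is listed separately because \<open>I\<close> may be
  empty.\<close>

definition ell :: "('i \<times> 'g) list set \<Rightarrow> bool" where
  "ell a \<longleftrightarrow> a = \<one>\<^bsub>F\<^esub> \<or> (\<exists>u\<in>carrier F. \<exists>i\<in>I. a \<in> fconj u i)"

lemma ell_incl: "i \<in> I \<Longrightarrow> g \<in> carrier (G i) \<Longrightarrow> ell (incl i g)"
  unfolding ell_def fconj_def by (intro disjI2 bexI[of _ "\<one>\<^bsub>F\<^esub>"] bexI[of _ i] image_eqI[of _ _ g]) auto

lemma conj_conj:
  assumes "u \<in> carrier F" "c \<in> carrier F" "x \<in> carrier F"
  shows "c \<otimes>\<^bsub>F\<^esub> (u \<otimes>\<^bsub>F\<^esub> x \<otimes>\<^bsub>F\<^esub> inv\<^bsub>F\<^esub> u) \<otimes>\<^bsub>F\<^esub> inv\<^bsub>F\<^esub> c = (c \<otimes>\<^bsub>F\<^esub> u) \<otimes>\<^bsub>F\<^esub> x \<otimes>\<^bsub>F\<^esub> inv\<^bsub>F\<^esub> (c \<otimes>\<^bsub>F\<^esub> u)"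
  using assms by (simp add: F.m_assoc F.inv_mult_group)

lemma fconj_conj:
  assumes "u \<in> carrier F" "c \<in> carrier F" "i \<in> I" "a \<in> fconj u i"
  shows "c \<otimes>\<^bsub>F\<^esub> a \<otimes>\<^bsub>F\<^esub> inv\<^bsub>F\<^esub> c \<in> fconj (c \<otimes>\<^bsub>F\<^esub> u) i"
  using assms by (auto simp: fconj_def conj_conj)

lemma fconj_carrier: "u \<in> carrier F \<Longrightarrow> i \<in> I \<Longrightarrow> fconj u i \<subseteq> carrier F"
  by (auto simp: fconj_def)

lemma ell_carrier: "ell a \<Longrightarrow> a \<in> carrier F"
  using fconj_carrier by (auto simp: ell_def)

lemma ell_conj: "ell a \<Longrightarrow> c \<in> carrier F \<Longrightarrow> ell (c \<otimes>\<^bsub>F\<^esub> a \<otimes>\<^bsub>F\<^esub> inv\<^bsub>F\<^esub> c)"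
  unfolding ell_def using fconj_conj by (metis F.m_closed F.r_inv F.r_one)

lemma ell_conj_iff:
  assumes "a \<in> carrier F" "c \<in> carrier F"
  shows "ell (c \<otimes>\<^bsub>F\<^esub> a \<otimes>\<^bsub>F\<^esub> inv\<^bsub>F\<^esub> c) \<longleftrightarrow> ell a"
proof
  assume "ell (c \<otimes>\<^bsub>F\<^esub> a \<otimes>\<^bsub>F\<^esub> inv\<^bsub>F\<^esub> c)"
  then have "ell (inv\<^bsub>F\<^esub> c \<otimes>\<^bsub>F\<^esub> (c \<otimes>\<^bsub>F\<^esub> a \<otimes>\<^bsub>F\<^esub> inv\<^bsub>F\<^esub> c) \<otimes>\<^bsub>F\<^esub> inv\<^bsub>F\<^esub> (inv\<^bsub>F\<^esub> c))"
    by (rule ell_conj) (use assms in simp)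
  then show "ell a" using assms by (simp add: F.word_simps)
qed (use assms ell_conj in blast)

lemma common_same: "common u u = 2 * length u"
  by (induction u) auto

lemma common_append: "length u = length v \<Longrightarrow> u \<noteq> v \<Longrightarrow> common (u @ s) (v @ t) = common u v"
  by (induction u v rule: list_induct2) auto

lemma hyp_iff_common:
  assumes "a \<in> carrier F"
  shows "T.hyp a \<longleftrightarrow> common (word_inv (nf a)) (nf a) < len a"
  using len_inv_mult[of "inv\<^bsub>F\<^esub> a" a] nf_inv[OF assms] assms T.len_inv[OF assms]
  by (simp add: T.hyp_def) linarith

lemma long_cases:
  assumes "2 \<le> length w"
  obtains x m y where "w = x # m @ [y]"
proof -
  have "w \<noteq> []" "tl w \<noteq> []" using assms by (cases w; auto)+
  then have "w = hd w # butlast (tl w) @ [last (tl w)]" by simp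
  then show ?thesis by (rule that)
qed

text \<open>Were the inverse of the last letter different from the first letter,
  \<open>common\<close> would be at most 1 and squaring would lengthen the word. So the word is a
  conjugate by its first letter, which allows induction on length.\<close>

lemma not_hyp_long:
  assumes a: "a \<in> carrier F" and nh: "\<not> T.hyp a" and w: "nf a = x # m @ [y]"
  shows "y = letter_inv x" "a = cls [x] \<otimes>\<^bsub>F\<^esub> cls m \<otimes>\<^bsub>F\<^esub> inv\<^bsub>F\<^esub> (cls [x])" "reduced m" "nf (cls m) = m"
    "fst x \<in> I" "snd x \<in> carrier (G (fst x))" "snd x \<noteq> \<one>\<^bsub>G (fst x)\<^esub>"
proof -
  have r: "reduced (x # m @ [y])" using carrierE(1)[OF a] w by simp
  then show m: "reduced m" and x: "fst x \<in> I" "snd x \<in> carrier (G (fst x))" "snd x \<noteq> \<one>\<^bsub>G (fst x)\<^esub>"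
    by (auto simp: reduced_Cons reduced_append)
  then show "nf (cls m) = m" by (simp add: nf_cls_reduced)
  have y: "fst y \<in> I" "snd y \<in> carrier (G (fst y))" using r by (auto simp: reduced_Cons reduced_append)
  have "letter_inv y = x"
    using nh w unfolding hyp_iff_common[OF a] by (auto simp: word_inv_Cons word_inv_append len_def split: if_splits)
  then show yx: "y = letter_inv x" using letter_inv_letter_inv[OF y] by simp
  have words: "[x] \<in> fp_words I G" "m \<in> fp_words I G" "word_inv [x] \<in> fp_words I G"
    using x reduced_words[OF m] word_inv_words[of "[x]"] by auto
  have "cls (nf a) = cls [x] \<otimes>\<^bsub>F\<^esub> cls m \<otimes>\<^bsub>F\<^esub> cls (word_inv [x])"
    using words by (simp only: mult_cls fp_words_simps(3) w yx) (simp add: word_inv_Cons)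
  then show "a = cls [x] \<otimes>\<^bsub>F\<^esub> cls m \<otimes>\<^bsub>F\<^esub> inv\<^bsub>F\<^esub> (cls [x])"
    using cls_nf[OF a] inv_cls[OF words(1)] by metis
qed

lemma hyp_if_not_ell: "a \<in> carrier F \<Longrightarrow> \<not> ell a \<Longrightarrow> T.hyp a"
proof (induction "len a" arbitrary: a rule: less_induct)
  case less
  note a = \<open>a \<in> carrier F\<close>
  show ?case
  proof (rule ccontr)
    assume nh: "\<not> T.hyp a"
    have "nf a \<noteq> []" using less nf_inj[OF a F.one_closed] by (auto simp: ell_def)
    moreover have "nf a \<noteq> [x]" for x
    proof
      assume w: "nf a = [x]"
      then have "fst x \<in> I" "snd x \<in> carrier (G (fst x))" using carrierE(1)[OF a] by (auto simp: reduced_Cons)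
      then have "ell (cls [x])" using ell_incl[of "fst x" "snd x"] by (simp add: incl_cls)
      then show False using less cls_nf[OF a] w by simp
    qed
    ultimately have "2 \<le> length (nf a)" by (cases "nf a" rule: remdups_adj.cases) auto
    then obtain x m y where w: "nf a = x # m @ [y]" by (rule long_cases)
    note l = not_hyp_long[OF a nh w]
    have x: "cls [x] \<in> carrier F" and m: "cls m \<in> carrier F"
      using l reduced_words by (auto intro!: cls_carrier)
    have lm: "len (cls m) = length m" using l by (simp add: len_def)
    have "T.hyp (cls m)"
      using less(1)[of "cls m"] less(3) l(2) ell_conj_iff[OF m x] m lm w by (simp add: len_def)
    then have c: "common (word_inv m) m < length m" using hyp_iff_common[OF m] l lm by simp
    then have "word_inv m \<noteq> m" using common_same[of m] by auto
    \<comment> \<open>\<open>word_inv m\<close> and \<open>m\<close> differ and have equal length,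
      so the comparison ends before it reaches the appended letters.\<close>
    then have "common (word_inv m @ [letter_inv x]) (m @ [y]) < length m" using c common_append by simp
    then have "T.hyp a"
      unfolding hyp_iff_common[OF a] using w l(1,5,6)
      by (simp add: word_inv_Cons word_inv_append len_def letter_inv_letter_inv)
    then show False using nh by simp
  qed
qed

text \<open>Powers of a conjugate by \<open>u\<close> of a factor element have length at most
  \<open>2 * len u + 1\<close>, while the powers of a hyperbolic element grow without bound.\<close>

lemma not_ell_if_hyp:
  assumes "T.hyp a" shows "\<not> ell a"
proof
  assume "ell a"
  moreover have "a \<noteq> \<one>\<^bsub>F\<^esub>" using T.hyp_ne_one[OF assms] .
  ultimately obtain u i g where u: "u \<in> carrier F" "i \<in> I" "g \<in> carrier (G i)"
    and a: "a = u \<otimes>\<^bsub>F\<^esub> incl i g \<otimes>\<^bsub>F\<^esub> inv\<^bsub>F\<^esub> u" by (auto simp: ell_def fconj_def)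
  interpret Gi: group "G i" using groups u by blast
  have p: "incl i g [^]\<^bsub>F\<^esub> k = incl i (g [^]\<^bsub>G i\<^esub> k)" for k :: nat
    by (induction k) (use u incl_one incl_mult in auto)
  define k where "k = 2 * len u + 2"
  have "a [^]\<^bsub>F\<^esub> k = u \<otimes>\<^bsub>F\<^esub> incl i (g [^]\<^bsub>G i\<^esub> k) \<otimes>\<^bsub>F\<^esub> inv\<^bsub>F\<^esub> u"
    using T.conj_pow[of "incl i g" u k] u a p by simp
  moreover have "len (u \<otimes>\<^bsub>F\<^esub> incl i (g [^]\<^bsub>G i\<^esub> k) \<otimes>\<^bsub>F\<^esub> inv\<^bsub>F\<^esub> u) \<le> len u + 1 + len u"
    using T.len_mult_le[of "u \<otimes>\<^bsub>F\<^esub> incl i (g [^]\<^bsub>G i\<^esub> k)" "inv\<^bsub>F\<^esub> u"] T.len_mult_le[of u "incl i (g [^]\<^bsub>G i\<^esub> k)"]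
      len_incl[of i "g [^]\<^bsub>G i\<^esub> k"] T.len_inv[of u] u by simp
  ultimately show False using T.len_pow_ge(1)[OF assms, of k] by (simp add: k_def)
qed

lemma ell_iff: "a \<in> carrier F \<Longrightarrow> ell a \<longleftrightarrow> \<not> T.hyp a"
  using hyp_if_not_ell not_ell_if_hyp by blast

lemma hyp_conj: "T.hyp a \<Longrightarrow> c \<in> carrier F \<Longrightarrow> T.hyp (c \<otimes>\<^bsub>F\<^esub> a \<otimes>\<^bsub>F\<^esub> inv\<^bsub>F\<^esub> c)"
  using ell_conj_iff[of a c] ell_iff[of a] ell_iff[of "c \<otimes>\<^bsub>F\<^esub> a \<otimes>\<^bsub>F\<^esub> inv\<^bsub>F\<^esub> c"] by simp

text \<open>Two isometries of a tree with disjoint fixed sets have a hyperbolic product, and a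
  nontrivial elliptic element fixes a single vertex of the Bass-Serre tree. In terms of words: if
  \<open>b\<close> starts outside factor \<open>i\<close>, it also ends outside, and the product
  cannot cancel against itself; otherwise conjugation by the first letter shortens
  \<open>b\<close>.\<close>

lemma ell_mult_incl:
  assumes "i \<in> I" "g \<in> carrier (G i)" "g \<noteq> \<one>\<^bsub>G i\<^esub>" "ell b" "ell (incl i g \<otimes>\<^bsub>F\<^esub> b)"
  shows "\<exists>h\<in>carrier (G i). b = incl i h"
  using assms
proof (induction "len b" arbitrary: g b rule: less_induct)
  case less
  interpret Gi: group "G i" using groups less by blast
  have b: "b \<in> carrier F" "\<not> T.hyp b" using less ell_carrier not_ell_if_hyp by blast+
  have rw: "reduced (nf b)" using carrierE(1)[OF b(1)] .
  consider "nf b = []" | "nf b \<noteq> []" "fst (hd (nf b)) \<noteq> i" | x where "nf b = [x]" "fst x = i"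
    | "2 \<le> length (nf b)" "fst (hd (nf b)) = i"
    by (cases "nf b" rule: remdups_adj.cases) auto
  then show ?case
  proof cases
    case 1
    then have "b = \<one>\<^bsub>F\<^esub>" using nf_inj[OF b(1) F.one_closed] by simp
    then show ?thesis using incl_one less by (metis Gi.one_closed)
  next
    case 2
    have "fst (last (nf b)) \<noteq> i"
    proof (cases "2 \<le> length (nf b)")
      case True
      then obtain x m y where w: "nf b = x # m @ [y]" by (rule long_cases)
      then show ?thesis using not_hyp_long(1)[OF b w] 2 by simp
    next
      case False
      then show ?thesis using 2 by (cases "nf b" rule: remdups_adj.cases) auto
    qed
    have nfp: "nf (incl i g \<otimes>\<^bsub>F\<^esub> b) = (i, g) # nf b"
      using nf_cls_append[of "incl i g" b] nf_incl[of i g] less b 2 by simp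
    have "common (word_inv ((i, g) # nf b)) ((i, g) # nf b) = 0"
    proof -
      obtain z v where zv: "word_inv (nf b) = z # v" using 2 by (cases "word_inv (nf b)") auto
      then have "fst z \<noteq> i" using hd_word_inv[OF 2(1)] \<open>fst (last (nf b)) \<noteq> i\<close> by simp
      then show ?thesis using zv by (auto simp: word_inv_Cons)
    qed
    then have "T.hyp (incl i g \<otimes>\<^bsub>F\<^esub> b)"
      using hyp_iff_common[of "incl i g \<otimes>\<^bsub>F\<^esub> b"] nfp less b by (simp add: len_def)
    then show ?thesis using less not_ell_if_hyp by blast
  next
    case 3
    have "cls [x] = b" using cls_nf[OF b(1)] 3 by simp
    moreover have "snd x \<in> carrier (G i)" using rw 3 by (simp add: reduced_Cons)
    moreover have "cls [x] = incl i (snd x)" using 3 by (cases x) (simp add: incl_cls)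
    ultimately show ?thesis by metis
  next
    case 4
    then obtain x m y where w: "nf b = x # m @ [y]" using long_cases by metis
    note l = not_hyp_long[OF b w]
    define p where "p = snd x"
    have p: "p \<in> carrier (G i)" and xp: "cls [x] = incl i p" and "fst x = i"
      using l 4 w by (cases x; simp add: p_def incl_cls)+
    have m: "cls m \<in> carrier F" using l reduced_words by (auto intro!: cls_carrier)
    have bm: "b = incl i p \<otimes>\<^bsub>F\<^esub> cls m \<otimes>\<^bsub>F\<^esub> inv\<^bsub>F\<^esub> (incl i p)" using l(2) xp by simp
    have lm: "len (cls m) < len b" using l w by (simp add: len_def)
    \<comment> \<open>Conjugating by \<open>incl i p\<close> strips the outer letters of
      \<open>b\<close> and keeps the other element inside factor \<open>i\<close>.\<close>
    let ?g = "inv\<^bsub>G i\<^esub> p \<otimes>\<^bsub>G i\<^esub> g \<otimes>\<^bsub>G i\<^esub> p"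
    have g: "?g \<in> carrier (G i)" "?g \<noteq> \<one>\<^bsub>G i\<^esub>"
    proof -
      show "?g \<in> carrier (G i)" using p less by simp
      show "?g \<noteq> \<one>\<^bsub>G i\<^esub>"
      proof
        assume "?g = \<one>\<^bsub>G i\<^esub>"
        then have "p \<otimes>\<^bsub>G i\<^esub> ?g \<otimes>\<^bsub>G i\<^esub> inv\<^bsub>G i\<^esub> p = \<one>\<^bsub>G i\<^esub>" using p by simp
        then show False using p less by (simp add: Gi.word_simps)
      qed
    qed
    have em: "ell (cls m)" using less bm ell_conj_iff[OF m, of "incl i p"] p by simp
    have "incl i g \<otimes>\<^bsub>F\<^esub> b = incl i p \<otimes>\<^bsub>F\<^esub> (incl i ?g \<otimes>\<^bsub>F\<^esub> cls m) \<otimes>\<^bsub>F\<^esub> inv\<^bsub>F\<^esub> (incl i p)"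
    proof -
      have "incl i ?g = inv\<^bsub>F\<^esub> (incl i p) \<otimes>\<^bsub>F\<^esub> incl i g \<otimes>\<^bsub>F\<^esub> incl i p"
        using p less by (simp add: incl_mult incl_inv)
      then show ?thesis unfolding bm using p less m by (simp add: F.word_simps)
    qed
    then have "ell (incl i ?g \<otimes>\<^bsub>F\<^esub> cls m)"
      using less ell_conj_iff[of "incl i ?g \<otimes>\<^bsub>F\<^esub> cls m" "incl i p"] g m p by simp
    then obtain h where h: "h \<in> carrier (G i)" "cls m = incl i h"
      using less(1)[OF lm less(2) g em] by blast
    have "b = incl i (p \<otimes>\<^bsub>G i\<^esub> h \<otimes>\<^bsub>G i\<^esub> inv\<^bsub>G i\<^esub> p)"
      unfolding bm h(2) using p h less by (simp add: incl_mult incl_inv)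
    then show ?thesis using p h by blast
  qed
qed

lemma fconj_iff:
  assumes "u \<in> carrier F" "i \<in> I" "a \<in> carrier F"
  shows "a \<in> fconj u i \<longleftrightarrow> (\<exists>g\<in>carrier (G i). inv\<^bsub>F\<^esub> u \<otimes>\<^bsub>F\<^esub> a \<otimes>\<^bsub>F\<^esub> u = incl i g)"
proof
  assume "a \<in> fconj u i"
  then show "\<exists>g\<in>carrier (G i). inv\<^bsub>F\<^esub> u \<otimes>\<^bsub>F\<^esub> a \<otimes>\<^bsub>F\<^esub> u = incl i g"
    using assms by (auto simp: fconj_def F.word_simps)
next
  assume "\<exists>g\<in>carrier (G i). inv\<^bsub>F\<^esub> u \<otimes>\<^bsub>F\<^esub> a \<otimes>\<^bsub>F\<^esub> u = incl i g"
  then obtain g where g: "g \<in> carrier (G i)" "inv\<^bsub>F\<^esub> u \<otimes>\<^bsub>F\<^esub> a \<otimes>\<^bsub>F\<^esub> u = incl i g" by blast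
  then have "u \<otimes>\<^bsub>F\<^esub> incl i g \<otimes>\<^bsub>F\<^esub> inv\<^bsub>F\<^esub> u = u \<otimes>\<^bsub>F\<^esub> (inv\<^bsub>F\<^esub> u \<otimes>\<^bsub>F\<^esub> a \<otimes>\<^bsub>F\<^esub> u) \<otimes>\<^bsub>F\<^esub> inv\<^bsub>F\<^esub> u" by simp
  also have "\<dots> = a" using assms by (simp add: F.word_simps)
  finally show "a \<in> fconj u i" using g by (auto simp: fconj_def)
qed

lemma ell_mult_fconj:
  assumes u: "u \<in> carrier F" "i \<in> I" and a: "a \<in> fconj u i" "a \<noteq> \<one>\<^bsub>F\<^esub>" and b: "ell b" "ell (a \<otimes>\<^bsub>F\<^esub> b)"
  shows "b \<in> fconj u i"
proof -
  obtain g where g: "g \<in> carrier (G i)" "a = u \<otimes>\<^bsub>F\<^esub> incl i g \<otimes>\<^bsub>F\<^esub> inv\<^bsub>F\<^esub> u" using a by (auto simp: fconj_def)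
  have g1: "g \<noteq> \<one>\<^bsub>G i\<^esub>" using g a u incl_one by auto
  have bc: "b \<in> carrier F" using b ell_carrier by blast
  let ?b = "inv\<^bsub>F\<^esub> u \<otimes>\<^bsub>F\<^esub> b \<otimes>\<^bsub>F\<^esub> inv\<^bsub>F\<^esub> (inv\<^bsub>F\<^esub> u)"
  have "ell ?b" using ell_conj[OF b(1), of "inv\<^bsub>F\<^esub> u"] u by simp
  moreover have "ell (inv\<^bsub>F\<^esub> u \<otimes>\<^bsub>F\<^esub> (a \<otimes>\<^bsub>F\<^esub> b) \<otimes>\<^bsub>F\<^esub> inv\<^bsub>F\<^esub> (inv\<^bsub>F\<^esub> u))" using ell_conj[OF b(2), of "inv\<^bsub>F\<^esub> u"] u by simp
  moreover have "inv\<^bsub>F\<^esub> u \<otimes>\<^bsub>F\<^esub> (a \<otimes>\<^bsub>F\<^esub> b) \<otimes>\<^bsub>F\<^esub> inv\<^bsub>F\<^esub> (inv\<^bsub>F\<^esub> u) = incl i g \<otimes>\<^bsub>F\<^esub> ?b"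
    using u g bc by (simp add: F.word_simps)
  ultimately obtain h where "h \<in> carrier (G i)" "?b = incl i h"
    using ell_mult_incl[OF u(2) g(1) g1, of ?b] by auto
  then show ?thesis using fconj_iff[OF u bc] u by auto
qed

text \<open>The right side starts in factor \<open>i\<close> and is one letter longer than
  \<open>g\<close>. The left side starts like \<open>g\<close>, or it merges with the last letter of
  \<open>g\<close> and is too short.\<close>

lemma incl_malnormal:
  assumes i: "i \<in> I" and s: "s \<in> carrier (G i)" "s \<noteq> \<one>\<^bsub>G i\<^esub>" "s' \<in> carrier (G i)" "s' \<noteq> \<one>\<^bsub>G i\<^esub>"
    and g: "g \<in> carrier F" and eq: "g \<otimes>\<^bsub>F\<^esub> incl i s = incl i s' \<otimes>\<^bsub>F\<^esub> g"
    and hd: "nf g \<noteq> []" "fst (hd (nf g)) \<noteq> i"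
  shows False
proof -
  have 1: "nf (incl i s' \<otimes>\<^bsub>F\<^esub> g) = (i, s') # nf g"
    using nf_cls_append[of "incl i s'" g] nf_incl[of i s'] i s g hd by simp
  show False
  proof (cases "fst (last (nf g)) = i")
    case False
    then have "nf (g \<otimes>\<^bsub>F\<^esub> incl i s) = nf g @ [(i, s)]"
      using nf_cls_append[of g "incl i s"] nf_incl[of i s] i s g by simp
    then have "nf g @ [(i, s)] = (i, s') # nf g" using 1 eq by simp
    then show False using hd by (cases "nf g") auto
  next
    case True
    obtain v x where w: "nf g = v @ [x]" using hd by (cases "nf g" rule: rev_cases) auto
    have r: "reduced v" "reduced [x]" using carrierE(1)[OF g] w reduced_append by auto
    define p where "p = snd x"
    have x: "x = (i, p)" using True w by (cases x) (simp add: p_def)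
    have p: "p \<in> carrier (G i)" using r x by (simp add: reduced_Cons)
    interpret Gi: group "G i" using groups i by blast
    note v = cls_carrier[OF reduced_words[OF r(1)]]
    have "g = cls v \<otimes>\<^bsub>F\<^esub> incl i p"
      using mult_cls[OF reduced_words[OF r(1)] reduced_words[OF r(2)]] cls_nf[OF g] w x by (simp add: incl_cls)
    then have "g \<otimes>\<^bsub>F\<^esub> incl i s = cls v \<otimes>\<^bsub>F\<^esub> incl i (p \<otimes>\<^bsub>G i\<^esub> s)"
      using incl_mult[OF i p s(1)] F.m_assoc[OF v incl_closed[OF i p] incl_closed[OF i s(1)]] by simp
    then have "len (g \<otimes>\<^bsub>F\<^esub> incl i s) \<le> length v + 1"
      using T.len_mult_le[OF v, of "incl i (p \<otimes>\<^bsub>G i\<^esub> s)"]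
        len_cls[OF r(1)] len_incl[OF i, of "p \<otimes>\<^bsub>G i\<^esub> s"] i p s by simp
    moreover have "len (g \<otimes>\<^bsub>F\<^esub> incl i s) = length (nf g) + 1" using 1 eq by (simp add: len_def)
    moreover have "length (nf g) = length v + 1" using w by simp
    ultimately show False by linarith
  qed
qed

lemma incl_malnormal':
  assumes i: "i \<in> I" and s: "s \<in> carrier (G i)" "s \<noteq> \<one>\<^bsub>G i\<^esub>"
    and g: "g \<in> carrier F" and eq: "g \<otimes>\<^bsub>F\<^esub> incl i s = incl i s \<otimes>\<^bsub>F\<^esub> g"
  shows "ell g"
proof (cases "nf g = [] \<or> fst (hd (nf g)) \<noteq> i")
  case True
  then have "nf g = []" using incl_malnormal[OF i s s g eq] by blast
  then show ?thesis using nf_inj[OF g F.one_closed] by (simp add: ell_def)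
next
  case False
  interpret Gi: group "G i" using groups i by blast
  define p where "p = snd (hd (nf g))"
  obtain v where v: "nf g = (i, p) # v" using False by (cases "nf g") (auto simp: p_def)
  have p: "p \<in> carrier (G i)" and rv: "reduced v" and hv: "v = [] \<or> fst (hd v) \<noteq> i"
    using carrierE(1)[OF g] v by (auto simp: reduced_Cons)
  note v' = cls_carrier[OF reduced_words[OF rv]]
  have gv: "g = incl i p \<otimes>\<^bsub>F\<^esub> cls v"
    using mult_cls[of "[(i, p)]" v] cls_nf[OF g] v reduced_words[OF rv] i p by (simp add: incl_cls)
  let ?s = "inv\<^bsub>G i\<^esub> p \<otimes>\<^bsub>G i\<^esub> s \<otimes>\<^bsub>G i\<^esub> p"
  have s': "?s \<in> carrier (G i)" "?s \<noteq> \<one>\<^bsub>G i\<^esub>"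
  proof -
    show "?s \<in> carrier (G i)" using p s by simp
    show "?s \<noteq> \<one>\<^bsub>G i\<^esub>"
    proof
      assume "?s = \<one>\<^bsub>G i\<^esub>"
      then have "p \<otimes>\<^bsub>G i\<^esub> ?s \<otimes>\<^bsub>G i\<^esub> inv\<^bsub>G i\<^esub> p = \<one>\<^bsub>G i\<^esub>" using p by simp
      then show False using p s by (simp add: Gi.word_simps)
    qed
  qed
  have "incl i ?s = inv\<^bsub>F\<^esub> (incl i p) \<otimes>\<^bsub>F\<^esub> incl i s \<otimes>\<^bsub>F\<^esub> incl i p"
    using p s i by (simp add: incl_mult incl_inv)
  moreover have "inv\<^bsub>F\<^esub> (incl i p) \<otimes>\<^bsub>F\<^esub> (g \<otimes>\<^bsub>F\<^esub> incl i s) = inv\<^bsub>F\<^esub> (incl i p) \<otimes>\<^bsub>F\<^esub> (incl i s \<otimes>\<^bsub>F\<^esub> g)" using eq by simp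
  ultimately have eqv: "cls v \<otimes>\<^bsub>F\<^esub> incl i s = incl i ?s \<otimes>\<^bsub>F\<^esub> cls v"
    unfolding gv using p s i v' by (simp add: F.word_simps)
  have "v = []"
    using incl_malnormal[OF i s s' v' eqv] nf_cls_reduced[OF rv] hv by auto
  then have "g = incl i p" using cls_nf[OF g] v by (simp add: incl_cls)
  then show ?thesis using ell_incl[OF i p] by simp
qed

text \<open>Whatever commutes with a nontrivial elliptic element preserves its unique fixed vertex
  and is therefore elliptic itself.\<close>

lemma ell_commute_hyp:
  assumes a: "ell a" and g: "T.hyp g" and c: "g \<otimes>\<^bsub>F\<^esub> a = a \<otimes>\<^bsub>F\<^esub> g"
  shows "a = \<one>\<^bsub>F\<^esub>"
proof (rule ccontr)
  assume "a \<noteq> \<one>\<^bsub>F\<^esub>"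
  then obtain u i s where u: "u \<in> carrier F" "i \<in> I" "s \<in> carrier (G i)"
    and as: "a = u \<otimes>\<^bsub>F\<^esub> incl i s \<otimes>\<^bsub>F\<^esub> inv\<^bsub>F\<^esub> u" using a by (auto simp: ell_def fconj_def)
  then have s1: "s \<noteq> \<one>\<^bsub>G i\<^esub>" using \<open>a \<noteq> \<one>\<^bsub>F\<^esub>\<close> incl_one by auto
  have gc: "g \<in> carrier F" using g by simp
  let ?g = "inv\<^bsub>F\<^esub> u \<otimes>\<^bsub>F\<^esub> g \<otimes>\<^bsub>F\<^esub> u"
  have "inv\<^bsub>F\<^esub> u \<otimes>\<^bsub>F\<^esub> (g \<otimes>\<^bsub>F\<^esub> a) \<otimes>\<^bsub>F\<^esub> u = inv\<^bsub>F\<^esub> u \<otimes>\<^bsub>F\<^esub> (a \<otimes>\<^bsub>F\<^esub> g) \<otimes>\<^bsub>F\<^esub> u" using c by simp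
  then have "?g \<otimes>\<^bsub>F\<^esub> incl i s = incl i s \<otimes>\<^bsub>F\<^esub> ?g"
    unfolding as using u gc by (simp add: F.word_simps)
  then have "ell ?g" using incl_malnormal'[OF u(2,3) s1, of ?g] u gc by simp
  then have "ell g" using ell_conj_iff[OF gc, of "inv\<^bsub>F\<^esub> u"] u by simp
  then show False using g not_ell_if_hyp by blast
qed

end

section \<open>Towers of subgroups with solvable systems of equations\<close>

context free_product_groups
begin

text \<open>Each system of equations below expresses \<open>a n\<close> by \<open>a (Suc n)\<close>; a decreasing sequence of
  subgroups in which all of them are solvable is eventually small.\<close>

definition solvable_tower :: "(nat \<Rightarrow> ('i \<times> 'g) list set set) \<Rightarrow> bool" where
  "solvable_tower H \<longleftrightarrow> (\<forall>n. subgroup (H n) F) \<and> (\<forall>n. H (Suc n) \<subseteq> H n) \<and>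
    (\<forall>c r e k l. (\<forall>n. c n \<in> H n \<and> r n \<in> H n \<and> e n \<in> H n) \<longrightarrow>
      (\<exists>a. \<forall>n. a n \<in> H n \<and> a n = c n \<otimes>\<^bsub>F\<^esub> a (Suc n) [^]\<^bsub>F\<^esub> (k n :: nat) \<otimes>\<^bsub>F\<^esub> r n
         \<otimes>\<^bsub>F\<^esub> (inv\<^bsub>F\<^esub> (a (Suc n))) [^]\<^bsub>F\<^esub> (l n :: nat) \<otimes>\<^bsub>F\<^esub> e n))"

lemma subgroup_nat_pow: "subgroup K F \<Longrightarrow> x \<in> K \<Longrightarrow> x [^]\<^bsub>F\<^esub> (n::nat) \<in> K"
  by (induction n) (simp_all add: subgroup.one_closed subgroup.m_closed)

text \<open>Below \<open>m\<close> the coefficients are padded with the identity and the exponents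
  repeat \<open>k 0\<close> and \<open>l 0\<close>; a solution of the padded system is read from
  index \<open>m\<close> on.\<close>

lemma solvable_tower_shift:
  assumes "solvable_tower H" shows "solvable_tower (\<lambda>n. H (m + n))"
  unfolding solvable_tower_def
proof (intro conjI allI impI)
  note sg = assms[unfolded solvable_tower_def, THEN conjunct1, rule_format]
  note dec = assms[unfolded solvable_tower_def, THEN conjunct2, THEN conjunct1, rule_format]
  note sol = assms[unfolded solvable_tower_def, THEN conjunct2, THEN conjunct2, rule_format]
  show "subgroup (H (m + n)) F" for n by (rule sg)
  show "H (m + Suc n) \<subseteq> H (m + n)" for n using dec[of "m + n"] by simp
  fix c r e :: "nat \<Rightarrow> ('i \<times> 'g) list set" and k l :: "nat \<Rightarrow> nat"
  assume cre: "\<forall>n. c n \<in> H (m + n) \<and> r n \<in> H (m + n) \<and> e n \<in> H (m + n)"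
  let ?s = "\<lambda>f n. if n < m then \<one>\<^bsub>F\<^esub> else f (n - m)"
  have "?s c n \<in> H n \<and> ?s r n \<in> H n \<and> ?s e n \<in> H n" for n
    using cre[rule_format, of "n - m"] subgroup.one_closed[OF sg] by auto
  then obtain a where a: "\<And>n. a n \<in> H n \<and> a n = ?s c n \<otimes>\<^bsub>F\<^esub> a (Suc n) [^]\<^bsub>F\<^esub> k (n - m) \<otimes>\<^bsub>F\<^esub> ?s r n
         \<otimes>\<^bsub>F\<^esub> (inv\<^bsub>F\<^esub> (a (Suc n))) [^]\<^bsub>F\<^esub> l (n - m) \<otimes>\<^bsub>F\<^esub> ?s e n"
    using sol[of "?s c" "?s r" "?s e" "\<lambda>n. k (n - m)" "\<lambda>n. l (n - m)"] by blast
  show "\<exists>a. \<forall>n. a n \<in> H (m + n) \<and> a n = c n \<otimes>\<^bsub>F\<^esub> a (Suc n) [^]\<^bsub>F\<^esub> k n \<otimes>\<^bsub>F\<^esub> r n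
         \<otimes>\<^bsub>F\<^esub> (inv\<^bsub>F\<^esub> (a (Suc n))) [^]\<^bsub>F\<^esub> l n \<otimes>\<^bsub>F\<^esub> e n"
  proof (intro exI[of _ "\<lambda>n. a (m + n)"] allI)
    fix n show "a (m + n) \<in> H (m + n) \<and> a (m + n) = c n \<otimes>\<^bsub>F\<^esub> a (m + Suc n) [^]\<^bsub>F\<^esub> k n \<otimes>\<^bsub>F\<^esub> r n
         \<otimes>\<^bsub>F\<^esub> (inv\<^bsub>F\<^esub> (a (m + Suc n))) [^]\<^bsub>F\<^esub> l n \<otimes>\<^bsub>F\<^esub> e n"
      using conjunct1[OF a[of "m + n"]] conjunct2[OF a[of "m + n"]]
      by (intro conjI) (assumption, simp only: not_add_less1 if_False diff_add_inverse add_Suc_right)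
  qed
qed

text \<open>With equal exponents and \<open>inv c n\<close> as last coefficient, each
  \<open>a n\<close> is a conjugate of \<open>r n\<close> by \<open>c n\<close> and a high power of
  \<open>a (Suc n)\<close>. If \<open>r n\<close> and \<open>a (Suc n)\<close> do not commute,
  \<open>len_conj_pow_gt\<close> makes \<open>a n\<close> longer than that power; so the lengths do
  not increase with \<open>n\<close>, although \<open>len (a n)\<close> is at least
  \<open>n\<close>. The \<open>c n\<close> serve to rule out commuting.\<close>

lemma solvable_tower_noncommuting:
  assumes H: "solvable_tower H"
    and nc: "\<And>n. \<exists>r\<in>H n. \<exists>q\<in>H n. T.hyp r \<and> T.hyp q \<and> r \<otimes>\<^bsub>F\<^esub> q \<noteq> q \<otimes>\<^bsub>F\<^esub> r"
  shows False
proof -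
  note sg = H[unfolded solvable_tower_def, THEN conjunct1, rule_format]
  note sol = H[unfolded solvable_tower_def, THEN conjunct2, THEN conjunct2, rule_format]
  obtain r q where rq: "\<And>n. r n \<in> H n" "\<And>n. q n \<in> H n" "\<And>n. T.hyp (r n)" "\<And>n. T.hyp (q n)"
    "\<And>n. r n \<otimes>\<^bsub>F\<^esub> q n \<noteq> q n \<otimes>\<^bsub>F\<^esub> r n"
    using nc by metis
  have [simp]: "r n \<in> carrier F" "q n \<in> carrier F" for n using rq by simp_all
  \<comment> \<open>The threshold for \<open>commuting_hyp_len\<close>: if \<open>r n\<close>
    commuted with \<open>a (Suc n)\<close>, the length of \<open>a (Suc n)\<close> would be below
    \<open>len (r n) + len (r (Suc n))\<close>, which is \<open>S (Suc n)\<close>.\<close>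
  define S where "S n = len (r n) + len (r (n - 1))" for n
  define j where "j n = 4 + 3 * len (r n) + S n" for n
  define c where "c n = q n [^]\<^bsub>F\<^esub> j n" for n
  have [simp]: "c n \<in> carrier F" for n by (simp add: c_def)
  have cH: "c n \<in> H n" for n
    unfolding c_def by (rule subgroup_nat_pow[OF sg rq(2)])
  define \<kappa> where "\<kappa> n = len (c n \<otimes>\<^bsub>F\<^esub> r n \<otimes>\<^bsub>F\<^esub> inv\<^bsub>F\<^esub> (c n))" for n
  \<comment> \<open>This makes \<open>a n\<close> long even if \<open>r n\<close> commutes with
    \<open>a (Suc n)\<close>, because \<open>a n\<close> is then just \<open>r n\<close> conjugated
    by \<open>c n\<close>.\<close>
  have \<kappa>: "S n < \<kappa> n" for n
  proof -
    have "len (q n [^]\<^bsub>F\<^esub> j n) < len (\<one>\<^bsub>F\<^esub> \<otimes>\<^bsub>F\<^esub> q n [^]\<^bsub>F\<^esub> j n \<otimes>\<^bsub>F\<^esub> r n \<otimes>\<^bsub>F\<^esub> inv\<^bsub>F\<^esub> (q n [^]\<^bsub>F\<^esub> j n) \<otimes>\<^bsub>F\<^esub> inv\<^bsub>F\<^esub> \<one>\<^bsub>F\<^esub>)"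
      by (rule T.len_conj_pow_gt) (use rq[of n] in \<open>simp_all add: j_def\<close>)
    moreover have "j n \<le> len (q n [^]\<^bsub>F\<^esub> j n)" by (rule T.len_pow_ge(1)[OF rq(4)]) (simp add: j_def)
    ultimately show ?thesis by (simp add: \<kappa>_def c_def j_def)
  qed
  \<comment> \<open>The first three summands are the bound of \<open>len_conj_pow_gt\<close>;
    \<open>S n\<close> and \<open>n\<close> make the power of \<open>a (Suc n)\<close> itself
    long.\<close>
  define k where "k n = 4 + 3 * \<kappa> n + 2 * len (c n) + S n + n" for n
  have "\<forall>n. c n \<in> H n \<and> r n \<in> H n \<and> inv\<^bsub>F\<^esub> (c n) \<in> H n"
    using cH rq subgroup.m_inv_closed[OF sg cH] by blast
  then obtain a where aH: "\<And>n. a n \<in> H n" and a_eq: "\<And>n. a n = c n \<otimes>\<^bsub>F\<^esub> a (Suc n) [^]\<^bsub>F\<^esub> k n \<otimes>\<^bsub>F\<^esub> r n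
         \<otimes>\<^bsub>F\<^esub> (inv\<^bsub>F\<^esub> (a (Suc n))) [^]\<^bsub>F\<^esub> k n \<otimes>\<^bsub>F\<^esub> inv\<^bsub>F\<^esub> (c n)"
    using sol[of c r "\<lambda>n. inv\<^bsub>F\<^esub> (c n)" k k] by blast
  have ac [simp]: "a n \<in> carrier F" for n using aH subgroup.mem_carrier[OF sg] by blast
  have a_eq': "a n = c n \<otimes>\<^bsub>F\<^esub> a (Suc n) [^]\<^bsub>F\<^esub> k n \<otimes>\<^bsub>F\<^esub> r n \<otimes>\<^bsub>F\<^esub> inv\<^bsub>F\<^esub> (a (Suc n) [^]\<^bsub>F\<^esub> k n) \<otimes>\<^bsub>F\<^esub> inv\<^bsub>F\<^esub> (c n)" for n
    using a_eq[of n] F.nat_pow_inv[OF ac, of "Suc n" "k n"] by simp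
  have a_conj: "a n = (c n \<otimes>\<^bsub>F\<^esub> a (Suc n) [^]\<^bsub>F\<^esub> k n) \<otimes>\<^bsub>F\<^esub> r n \<otimes>\<^bsub>F\<^esub> inv\<^bsub>F\<^esub> (c n \<otimes>\<^bsub>F\<^esub> a (Suc n) [^]\<^bsub>F\<^esub> k n)" for n
    by (rule trans[OF a_eq']) (simp add: F.word_simps)
  have ah: "T.hyp (a n)" for n
    by (subst a_conj) (rule hyp_conj[OF rq(3)], simp)
  have step: "len (a (Suc n) [^]\<^bsub>F\<^esub> k n) < len (a n)" if "r n \<otimes>\<^bsub>F\<^esub> a (Suc n) \<noteq> a (Suc n) \<otimes>\<^bsub>F\<^esub> r n" for n
  proof -
    have "T.hyp (c n \<otimes>\<^bsub>F\<^esub> a (Suc n) \<otimes>\<^bsub>F\<^esub> inv\<^bsub>F\<^esub> (c n))" by (rule hyp_conj[OF ah]) simp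
    then have "len (a (Suc n) [^]\<^bsub>F\<^esub> k n) < len (c n \<otimes>\<^bsub>F\<^esub> a (Suc n) [^]\<^bsub>F\<^esub> k n \<otimes>\<^bsub>F\<^esub> r n
        \<otimes>\<^bsub>F\<^esub> inv\<^bsub>F\<^esub> (a (Suc n) [^]\<^bsub>F\<^esub> k n) \<otimes>\<^bsub>F\<^esub> inv\<^bsub>F\<^esub> (c n))"
      by (intro T.len_conj_pow_gt[OF ah]) (use that in \<open>simp_all add: k_def \<kappa>_def\<close>)
    then show ?thesis unfolding a_eq'[symmetric] .
  qed
  have kpos: "0 < k n" "n \<le> k n" "S n \<le> k n" for n by (simp_all add: k_def)
  have large: "S n < len (a n)" for n
  proof (cases "r n \<otimes>\<^bsub>F\<^esub> a (Suc n) = a (Suc n) \<otimes>\<^bsub>F\<^esub> r n")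
    case True
    have "r n \<otimes>\<^bsub>F\<^esub> a (Suc n) [^]\<^bsub>F\<^esub> m = a (Suc n) [^]\<^bsub>F\<^esub> m \<otimes>\<^bsub>F\<^esub> r n" for m :: nat
    proof (induction m)
      case (Suc m)
      have "r n \<otimes>\<^bsub>F\<^esub> (a (Suc n) [^]\<^bsub>F\<^esub> m \<otimes>\<^bsub>F\<^esub> a (Suc n)) = a (Suc n) [^]\<^bsub>F\<^esub> m \<otimes>\<^bsub>F\<^esub> (r n \<otimes>\<^bsub>F\<^esub> a (Suc n))"
        using Suc by (simp add: F.m_assoc[symmetric])
      then show ?case using True by (simp add: F.m_assoc)
    qed simp
    note rP = this[of "k n"]
    have "a (Suc n) [^]\<^bsub>F\<^esub> k n \<otimes>\<^bsub>F\<^esub> r n \<otimes>\<^bsub>F\<^esub> inv\<^bsub>F\<^esub> (a (Suc n) [^]\<^bsub>F\<^esub> k n) = r n"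
      unfolding rP[symmetric] by (simp add: F.m_assoc)
    then have "a n = c n \<otimes>\<^bsub>F\<^esub> r n \<otimes>\<^bsub>F\<^esub> inv\<^bsub>F\<^esub> (c n)"
      using a_eq'[of n] by (simp add: F.m_assoc del: F.nat_pow_inv)
    then show ?thesis using \<kappa>[of n] by (simp add: \<kappa>_def)
  next
    case False
    have "k n \<le> len (a (Suc n) [^]\<^bsub>F\<^esub> k n)" by (rule T.len_pow_ge(1)[OF ah kpos(1)])
    then show ?thesis using step[OF False] kpos(3)[of n] by linarith
  qed
  \<comment> \<open>As a conjugate of \<open>r (Suc n)\<close>, the element \<open>a (Suc n)\<close>
    has translation length at most \<open>len (r (Suc n))\<close>; commuting would also keep its
    axis near the identity, so it would be shorter than \<open>large\<close> permits.\<close>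
  have nocomm: "r n \<otimes>\<^bsub>F\<^esub> a (Suc n) \<noteq> a (Suc n) \<otimes>\<^bsub>F\<^esub> r n" for n
  proof
    assume "r n \<otimes>\<^bsub>F\<^esub> a (Suc n) = a (Suc n) \<otimes>\<^bsub>F\<^esub> r n"
    then have "int (len (a (Suc n))) - T.trans_len (a (Suc n)) < len (r n)"
      by (intro T.commuting_hyp_len[OF ah rq(3)]) simp
    moreover have "T.trans_len (a (Suc n)) \<le> T.trans_len (r (Suc n))"
      using T.trans_len_conj_le[OF rq(3)[of "Suc n"], of "c (Suc n) \<otimes>\<^bsub>F\<^esub> a (Suc (Suc n)) [^]\<^bsub>F\<^esub> k (Suc n)"]
        a_conj[of "Suc n"] ah[of "Suc n"] by simp
    moreover have "T.trans_len (r (Suc n)) \<le> len (r (Suc n))" by (rule T.trans_len_le) simp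
    ultimately show False using large[of "Suc n"] by (simp add: S_def)
  qed
  have dec: "len (a (Suc n)) \<le> len (a n)" "n \<le> len (a n)" for n
    using step[OF nocomm, of n] T.len_pow_ge[OF ah[of "Suc n"] kpos(1)[of n]] kpos(2)[of n] by linarith+
  have "len (a n) \<le> len (a 0)" for n by (induction n) (use dec le_trans in blast)+
  from le_trans[OF dec(2) this, of "Suc (len (a 0))"] show False by simp
qed

text \<open>The group now behaves like an infinite cyclic or dihedral one, where conjugation yields
  nothing new. The equations multiply \<open>g n\<close> by an even power of
  \<open>a (Suc n)\<close>: evenness annihilates elliptic elements, and the exponents outgrow the
  sum of the lengths of the \<open>g i\<close>.\<close>

lemma solvable_tower_commuting:
  assumes H: "solvable_tower H"
    and hyp: "\<And>n. \<exists>g\<in>H n. T.hyp g"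
    and comm: "\<And>r q. r \<in> H 0 \<Longrightarrow> q \<in> H 0 \<Longrightarrow> T.hyp r \<Longrightarrow> T.hyp q \<Longrightarrow> r \<otimes>\<^bsub>F\<^esub> q = q \<otimes>\<^bsub>F\<^esub> r"
  shows False
proof -
  note sg = H[unfolded solvable_tower_def, THEN conjunct1, rule_format]
  note dec = H[unfolded solvable_tower_def, THEN conjunct2, THEN conjunct1, rule_format]
  note sol = H[unfolded solvable_tower_def, THEN conjunct2, THEN conjunct2, rule_format]
  have H0: "H n \<subseteq> H 0" for n by (induction n) (use dec in blast)+
  interpret H0: subgroup "H 0" F by (rule sg)
  have square: "a \<otimes>\<^bsub>F\<^esub> a = \<one>\<^bsub>F\<^esub>" if a: "a \<in> H 0" "ell a" for a
  proof (rule ccontr)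
    assume a2: "a \<otimes>\<^bsub>F\<^esub> a \<noteq> \<one>\<^bsub>F\<^esub>"
    then have a1: "a \<noteq> \<one>\<^bsub>F\<^esub>" by auto
    have ac: "a \<in> carrier F" using a H0.mem_carrier by blast
    \<comment> \<open>A hyperbolic product would commute with \<open>g\<close>, hence so would
      \<open>b\<close>, against \<open>ell_commute_hyp\<close>.\<close>
    have e: "ell (g \<otimes>\<^bsub>F\<^esub> b)" if g: "T.hyp g" "g \<in> H 0" and b: "b \<in> H 0" "ell b" "b \<noteq> \<one>\<^bsub>F\<^esub>" for g b
    proof (rule ccontr)
      have c: "g \<in> carrier F" "b \<in> carrier F" using that H0.mem_carrier by auto
      assume "\<not> ell (g \<otimes>\<^bsub>F\<^esub> b)"
      then have "T.hyp (g \<otimes>\<^bsub>F\<^esub> b)" using hyp_if_not_ell c by blast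
      then have "g \<otimes>\<^bsub>F\<^esub> (g \<otimes>\<^bsub>F\<^esub> b) = g \<otimes>\<^bsub>F\<^esub> b \<otimes>\<^bsub>F\<^esub> g"
        using comm[of g "g \<otimes>\<^bsub>F\<^esub> b"] that by simp
      then have "g \<otimes>\<^bsub>F\<^esub> b = b \<otimes>\<^bsub>F\<^esub> g" using c by (simp add: F.m_assoc)
      then show False using ell_commute_hyp[OF b(2) g(1)] b(3) by simp
    qed
    obtain g where g: "g \<in> H 0" "T.hyp g" using hyp by blast
    have gc: "g \<in> carrier F" using g by simp
    have ega: "ell (g \<otimes>\<^bsub>F\<^esub> a)" using e[OF g(2,1) a a1] .
    obtain u i where u: "u \<in> carrier F" "i \<in> I" "a \<in> fconj u i" using a a1 unfolding ell_def by blast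
    have "ell (a \<otimes>\<^bsub>F\<^esub> a)"
    proof (rule ccontr)
      assume n: "\<not> ell (a \<otimes>\<^bsub>F\<^esub> a)"
      then have "a = \<one>\<^bsub>F\<^esub>" using ell_commute_hyp[OF a(2) hyp_if_not_ell[OF _ n]] ac by (simp add: F.m_assoc)
      then show False using a1 by simp
    qed
    \<comment> \<open>The product of the conjugate of \<open>g\<close> by \<open>a\<close> with the
      square of \<open>a\<close> is \<open>a g a\<close>. It is elliptic, so \<open>a\<close> and
      \<open>g a\<close> lie in the same conjugate of a factor, and then so does
      \<open>g\<close>.\<close>
    then have "ell ((a \<otimes>\<^bsub>F\<^esub> g \<otimes>\<^bsub>F\<^esub> inv\<^bsub>F\<^esub> a) \<otimes>\<^bsub>F\<^esub> (a \<otimes>\<^bsub>F\<^esub> a))"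
      using e[of "a \<otimes>\<^bsub>F\<^esub> g \<otimes>\<^bsub>F\<^esub> inv\<^bsub>F\<^esub> a" "a \<otimes>\<^bsub>F\<^esub> a"] hyp_conj[OF g(2) ac] g a a2 by simp
    then have "ell (a \<otimes>\<^bsub>F\<^esub> (g \<otimes>\<^bsub>F\<^esub> a))" using ac gc by (simp add: F.word_simps)
    then have "g \<otimes>\<^bsub>F\<^esub> a \<in> fconj u i" using ell_mult_fconj[OF u a1 ega] by simp
    then obtain h h' where h: "h \<in> carrier (G i)" "h' \<in> carrier (G i)"
      "g \<otimes>\<^bsub>F\<^esub> a = u \<otimes>\<^bsub>F\<^esub> incl i h \<otimes>\<^bsub>F\<^esub> inv\<^bsub>F\<^esub> u" "a = u \<otimes>\<^bsub>F\<^esub> incl i h' \<otimes>\<^bsub>F\<^esub> inv\<^bsub>F\<^esub> u"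
      using u(3) by (auto simp: fconj_def)
    interpret Gi: group "G i" using groups u by blast
    have "g = (g \<otimes>\<^bsub>F\<^esub> a) \<otimes>\<^bsub>F\<^esub> inv\<^bsub>F\<^esub> a" using gc ac by (simp add: F.m_assoc)
    also have "\<dots> = u \<otimes>\<^bsub>F\<^esub> (incl i h \<otimes>\<^bsub>F\<^esub> inv\<^bsub>F\<^esub> (incl i h')) \<otimes>\<^bsub>F\<^esub> inv\<^bsub>F\<^esub> u"
      unfolding h(3) unfolding h(4) using u h(1,2) by (simp add: F.word_simps)
    also have "\<dots> = u \<otimes>\<^bsub>F\<^esub> incl i (h \<otimes>\<^bsub>G i\<^esub> inv\<^bsub>G i\<^esub> h') \<otimes>\<^bsub>F\<^esub> inv\<^bsub>F\<^esub> u"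
      using u h by (simp add: incl_inv incl_mult)
    finally have "ell g" using u h unfolding ell_def fconj_def by blast
    then show False using not_ell_if_hyp g by blast
  qed
  obtain g where g: "\<And>n. g n \<in> H n" "\<And>n. T.hyp (g n)" using hyp by metis
  have [simp]: "g n \<in> carrier F" for n using g by simp
  \<comment> \<open>The sum dominates what \<open>step\<close> can add to the length up to stage
    \<open>n\<close>; the surplus \<open>n + 1\<close> gives the contradiction at
    \<open>n = len (a 0)\<close>.\<close>
  define K where "K n = n + 1 + (\<Sum>i\<le>n. len (g i))" for n
  have "\<forall>n. g n \<in> H n \<and> \<one>\<^bsub>F\<^esub> \<in> H n \<and> \<one>\<^bsub>F\<^esub> \<in> H n" using g subgroup.one_closed[OF sg] by blast
  then obtain a where aH: "\<And>n. a n \<in> H n" and a_eq: "\<And>n. a n = g n \<otimes>\<^bsub>F\<^esub> a (Suc n) [^]\<^bsub>F\<^esub> (2 * K n) \<otimes>\<^bsub>F\<^esub> \<one>\<^bsub>F\<^esub>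
         \<otimes>\<^bsub>F\<^esub> (inv\<^bsub>F\<^esub> (a (Suc n))) [^]\<^bsub>F\<^esub> (0::nat) \<otimes>\<^bsub>F\<^esub> \<one>\<^bsub>F\<^esub>"
    using sol[of g "\<lambda>_. \<one>\<^bsub>F\<^esub>" "\<lambda>_. \<one>\<^bsub>F\<^esub>" "\<lambda>n. 2 * K n" "\<lambda>_. 0"] by blast
  have ac [simp]: "a n \<in> carrier F" for n using aH subgroup.mem_carrier[OF sg] by blast
  have a_eq': "a n = g n \<otimes>\<^bsub>F\<^esub> a (Suc n) [^]\<^bsub>F\<^esub> (2 * K n)" for n
    by (rule trans[OF a_eq]) simp
  have Kg: "len (g n) < 2 * K n" "0 < 2 * K n" for n
    using member_le_sum[of n "{..n}" "\<lambda>i. len (g i)"] by (simp_all add: K_def)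
  \<comment> \<open>If \<open>a (Suc n)\<close> is elliptic, its even power is trivial and
    \<open>a n = g n\<close>. Otherwise \<open>a n\<close> commutes with \<open>g n\<close>, so it
    could be elliptic only as the identity, and then \<open>g n\<close> would be as long as the high
    power.\<close>
  have ah: "T.hyp (a n)" for n
  proof (cases "ell (a (Suc n))")
    case True
    then have "a (Suc n) \<otimes>\<^bsub>F\<^esub> a (Suc n) = \<one>\<^bsub>F\<^esub>" using square aH H0 by blast
    then have "a (Suc n) [^]\<^bsub>F\<^esub> (2::nat) = \<one>\<^bsub>F\<^esub>" by (simp add: numeral_2_eq_2)
    then have "a (Suc n) [^]\<^bsub>F\<^esub> (2 * K n) = \<one>\<^bsub>F\<^esub>" using F.nat_pow_pow[OF ac, of "Suc n" 2 "K n"] by simp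
    then show ?thesis using a_eq'[of n] g by simp
  next
    case False
    define b where "b = a (Suc n) [^]\<^bsub>F\<^esub> (2 * K n)"
    have hb: "T.hyp b" unfolding b_def using hyp_if_not_ell[OF ac False] Kg by (intro T.hyp_pow)
    have bH: "b \<in> H 0"
      unfolding b_def by (rule subgroup_nat_pow[OF sg subsetD[OF H0 aH]])
    have bc: "b \<in> carrier F" using hb by simp
    have gb: "g n \<otimes>\<^bsub>F\<^esub> b = b \<otimes>\<^bsub>F\<^esub> g n" using comm[OF subsetD[OF H0 g(1)] bH g(2) hb] .
    have "g n \<otimes>\<^bsub>F\<^esub> (g n \<otimes>\<^bsub>F\<^esub> b) = g n \<otimes>\<^bsub>F\<^esub> (b \<otimes>\<^bsub>F\<^esub> g n)" unfolding gb ..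
    also have "\<dots> = (g n \<otimes>\<^bsub>F\<^esub> b) \<otimes>\<^bsub>F\<^esub> g n" using bc by (simp add: F.m_assoc)
    finally have c: "g n \<otimes>\<^bsub>F\<^esub> a n = a n \<otimes>\<^bsub>F\<^esub> g n" unfolding a_eq'[of n] b_def .
    show ?thesis
    proof (rule ccontr)
      assume "\<not> T.hyp (a n)"
      then have "ell (a n)" using ell_iff by simp
      then have "a n = \<one>\<^bsub>F\<^esub>" using ell_commute_hyp g(2) c by blast
      then have "g n \<otimes>\<^bsub>F\<^esub> b = \<one>\<^bsub>F\<^esub>" using a_eq'[of n] by (simp add: b_def)
      then have "inv\<^bsub>F\<^esub> b = g n" using F.inv_equality[of "g n" b] bc by simp
      then have "len (g n) = len b" using T.len_inv[OF bc] by simp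
      moreover have "2 * K n \<le> len b" unfolding b_def by (rule T.len_pow_ge(1)[OF hyp_if_not_ell[OF ac False] Kg(2)])
      ultimately show False using Kg(1)[of n] by simp
    qed
  qed
  have step: "len (a (Suc n) [^]\<^bsub>F\<^esub> (2 * K n)) \<le> len (a n) + len (g n)" for n
  proof -
    have "a (Suc n) [^]\<^bsub>F\<^esub> (2 * K n) = inv\<^bsub>F\<^esub> (g n) \<otimes>\<^bsub>F\<^esub> a n" using a_eq'[of n] by (simp add: F.word_simps)
    then show ?thesis using T.len_mult_le[of "inv\<^bsub>F\<^esub> (g n)" "a n"] T.len_inv[of "g n"] by simp
  qed
  have le: "len (a n) \<le> len (a 0) + (\<Sum>i<n. len (g i))" for n
  proof (induction n)
    case (Suc n)
    then show ?case using step[of n] T.len_pow_ge(2)[OF ah[of "Suc n"] Kg(2)[of n]] by simp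
  qed simp
  have "K n \<le> len (a 0) + (\<Sum>i\<le>n. len (g i))" for n
    using le[of n] step[of n] T.len_pow_ge(1)[OF ah[of "Suc n"] Kg(2)[of n]]
    by (simp add: lessThan_Suc_atMost[symmetric])
  from this[of "len (a 0)"] show False unfolding K_def by linarith
qed

text \<open>The two lemmas refute that every level contains a hyperbolic element; the commuting one
  is applied from the level where all hyperbolic elements commute. A subgroup of elliptic elements
  lies in one conjugate of a factor, namely in that of any fixed nontrivial member, by
  \<open>ell_mult_fconj\<close>.\<close>

theorem solvable_tower_elliptic:
  assumes H: "solvable_tower H"
  shows "\<exists>n. H n \<subseteq> {\<one>\<^bsub>F\<^esub>} \<or> (\<exists>u\<in>carrier F. \<exists>i\<in>I. H n \<subseteq> fconj u i)"
proof -
  note sg = H[unfolded solvable_tower_def, THEN conjunct1, rule_format]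
  have "\<exists>n. \<forall>a\<in>H n. ell a"
  proof (rule ccontr)
    assume "\<not> ?thesis"
    then have hyp: "\<exists>g\<in>H n. T.hyp g" for n
      using hyp_if_not_ell subgroup.mem_carrier[OF sg] by metis
    show False
    proof (cases "\<exists>m. \<forall>r\<in>H m. \<forall>q\<in>H m. T.hyp r \<longrightarrow> T.hyp q \<longrightarrow> r \<otimes>\<^bsub>F\<^esub> q = q \<otimes>\<^bsub>F\<^esub> r")
      case True
      then obtain m where m: "\<And>r q. r \<in> H m \<Longrightarrow> q \<in> H m \<Longrightarrow> T.hyp r \<Longrightarrow> T.hyp q \<Longrightarrow> r \<otimes>\<^bsub>F\<^esub> q = q \<otimes>\<^bsub>F\<^esub> r" by blast
      show False
        by (rule solvable_tower_commuting[OF solvable_tower_shift[OF H, of m]]) (use hyp m in auto)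
    next
      case False
      then show False using solvable_tower_noncommuting[OF H] by blast
    qed
  qed
  then obtain n where n: "\<And>a. a \<in> H n \<Longrightarrow> ell a" by blast
  show ?thesis
  proof (cases "H n \<subseteq> {\<one>\<^bsub>F\<^esub>}")
    case False
    then obtain a where a: "a \<in> H n" "a \<noteq> \<one>\<^bsub>F\<^esub>" by blast
    then obtain u i where u: "u \<in> carrier F" "i \<in> I" "a \<in> fconj u i" using n unfolding ell_def by blast
    have "b \<in> fconj u i" if "b \<in> H n" for b
      using ell_mult_fconj[OF u a(2) n[OF that]] n subgroup.m_closed[OF sg a(1) that] by blast
    then show ?thesis using u by blast
  qed blast
qed

end

section \<open>Infinite concatenations of loops\<close>

text \<open>Concatenating, reversing and inserting fixed loops have this form: at each time the
  result is a fixed point or the value of \<open>q\<close> at a time independent of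
  \<open>q\<close>. So a recursion between loops can be unfolded at each time separately.\<close>

definition pointwise_map :: "((real \<Rightarrow> 'a) \<Rightarrow> real \<Rightarrow> 'a) \<Rightarrow> bool" where
  "pointwise_map E \<longleftrightarrow> (\<forall>t\<in>{0..1}. (\<exists>v. \<forall>q. E q t = v) \<or> (\<exists>t'\<in>{0..1}. \<forall>q. E q t = q t'))"

lemma pointwise_map_const: "pointwise_map (\<lambda>q. p)"
  by (auto simp: pointwise_map_def)

lemma pointwise_map_id: "pointwise_map (\<lambda>q. q)"
  by (auto simp: pointwise_map_def)

lemma pointwise_map_reverse: "pointwise_map (\<lambda>q. reversepath q)"
  unfolding pointwise_map_def reversepath_def
proof (intro ballI disjI2)
  fix t :: real assume "t \<in> {0..1}"
  then show "\<exists>t'\<in>{0..1}. \<forall>q. q (1 - t) = q t'" by (intro bexI[of _ "1 - t"]) auto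
qed

lemma pointwise_map_join:
  assumes "pointwise_map E" "pointwise_map E'"
  shows "pointwise_map (\<lambda>q. E q +++ E' q)"
  unfolding pointwise_map_def
proof
  fix t :: real assume t: "t \<in> {0..1}"
  show "(\<exists>v. \<forall>q. (E q +++ E' q) t = v) \<or> (\<exists>t'\<in>{0..1}. \<forall>q. (E q +++ E' q) t = q t')"
  proof (cases "t \<le> 1/2")
    case True
    then have "2 * t \<in> {0..1}" using t by auto
    then show ?thesis using assms(1)[unfolded pointwise_map_def, rule_format, of "2 * t"] True
      by (simp add: joinpaths_def)
  next
    case False
    then have "2 * t - 1 \<in> {0..1}" using t by auto
    then show ?thesis using assms(2)[unfolded pointwise_map_def, rule_format, of "2 * t - 1"] False
      by (simp add: joinpaths_def)
  qed
qed

primrec loop_power :: "'a::topological_space \<Rightarrow> (real \<Rightarrow> 'a) \<Rightarrow> nat \<Rightarrow> real \<Rightarrow> 'a" where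
  "loop_power y p 0 = (\<lambda>_. y)"
| "loop_power y p (Suc n) = loop_power y p n +++ p"

lemma pointwise_map_power:
  fixes E :: "(real \<Rightarrow> 'a::topological_space) \<Rightarrow> real \<Rightarrow> 'a"
  shows "pointwise_map E \<Longrightarrow> pointwise_map (\<lambda>q. loop_power y (E q) n)"
  by (induction n) (simp_all add: pointwise_map_const pointwise_map_join)

lemma is_loop_power: "y \<in> X \<Longrightarrow> is_loop X y p \<Longrightarrow> is_loop X y (loop_power y p n)"
  by (induction n) (simp_all add: is_loop_const is_loop_join)

lemma is_loop_subset: "is_loop X y p \<Longrightarrow> X \<subseteq> Y \<Longrightarrow> is_loop Y y p"
  by (auto simp: is_loop_def)

lemma is_loop_mem: "is_loop X y p \<Longrightarrow> t \<in> {0..1} \<Longrightarrow> p t \<in> X"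
  by (auto simp: is_loop_def path_image_def)

definition small_nbhd :: "'a::metric_space set \<Rightarrow> 'a \<Rightarrow> nat \<Rightarrow> 'a set" where
  "small_nbhd X y n = X \<inter> ball y (inverse (real (Suc n)))"

lemma small_nbhd_mem: "y \<in> X \<Longrightarrow> y \<in> small_nbhd X y n"
  by (simp add: small_nbhd_def)

lemma small_nbhd_mono: "m \<le> n \<Longrightarrow> small_nbhd X y n \<subseteq> small_nbhd X y m"
proof -
  assume "m \<le> n"
  then have "inverse (real (Suc n)) \<le> inverse (real (Suc m))" by (intro le_imp_inverse_le) auto
  from subset_ball[OF this, of y] show ?thesis unfolding small_nbhd_def by blast
qed

lemma small_nbhd_dist: "u \<in> small_nbhd X y n \<Longrightarrow> v \<in> small_nbhd X y n \<Longrightarrow> dist u v \<le> 2 * inverse (real (Suc n))"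
  using dist_triangle2[of u v y] by (auto simp: small_nbhd_def dist_commute)

text \<open>Pointwise, unfolding the recursion \<open>p n = E n (p (n + 1))\<close> either ends in a constant or goes on
  for ever inside shrinking neighbourhoods of \<open>y\<close>.\<close>

lemma infinite_word_close:
  assumes E: "\<And>n. pointwise_map (E n)"
    and p: "\<And>n. is_loop (small_nbhd X y n) y (p n)" "\<And>n t. t \<in> {0..1} \<Longrightarrow> p n t = E n (p (Suc n)) t"
    and p': "\<And>n. is_loop (small_nbhd X y n) y (p' n)" "\<And>n t. t \<in> {0..1} \<Longrightarrow> p' n t = E' n (p' (Suc n)) t"
    and same: "\<And>n. m \<le> n \<Longrightarrow> n < m + N \<Longrightarrow> E n = E' n"
    and t: "t \<in> {0..1}"
  shows "p m t = p' m t \<or> p m t \<in> small_nbhd X y (m + N) \<and> p' m t \<in> small_nbhd X y (m + N)"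
  using same t
proof (induction N arbitrary: m t)
  case 0
  then show ?case using is_loop_mem[OF p(1)] is_loop_mem[OF p'(1)] by simp
next
  case (Suc N)
  have eq: "E m = E' m" using Suc.prems(1) by simp
  from E[of m, unfolded pointwise_map_def, rule_format, OF Suc.prems(2)] show ?case
  proof
    assume "\<exists>v. \<forall>q. E m q t = v"
    then show ?thesis using p(2)[OF Suc.prems(2)] p'(2)[OF Suc.prems(2)] eq by metis
  next
    assume "\<exists>t'\<in>{0..1}. \<forall>q. E m q t = q t'"
    then obtain t' where t': "t' \<in> {0..1}" "\<And>q. E m q t = q t'" by blast
    have "p (Suc m) t' = p' (Suc m) t' \<or> p (Suc m) t' \<in> small_nbhd X y (Suc m + N) \<and> p' (Suc m) t' \<in> small_nbhd X y (Suc m + N)"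
      using Suc.prems(1) t'(1) by (intro Suc.IH) auto
    then show ?thesis using p(2)[OF Suc.prems(2)] p'(2)[OF Suc.prems(2)] eq t'(2) by simp
  qed
qed

text \<open>Unfolding \<open>m\<close> times and ending with the constant loop gives
  \<open>A m n\<close>. Any deeper unfolding has the same value at a given time, or both values lie
  in \<open>small_nbhd X y (n + m)\<close>; hence the convergence is uniform.\<close>

lemma infinite_word:
  assumes y: "y \<in> X" and E: "\<And>n. pointwise_map (E n)"
    and loop: "\<And>n q. is_loop (small_nbhd X y (Suc n)) y q \<Longrightarrow> is_loop (small_nbhd X y n) y (E n q)"
  obtains p where "\<And>n. is_loop (small_nbhd X y n) y (p n)" "\<And>n t. t \<in> {0..1} \<Longrightarrow> p n t = E n (p (Suc n)) t"
proof -
  define A where "A = rec_nat (\<lambda>n _. y) (\<lambda>m f n. E n (f (Suc n)))"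
  have A: "A 0 n = (\<lambda>_. y)" "A (Suc m) n = E n (A m (Suc n))" for m n by (simp_all add: A_def)
  have A_loop: "is_loop (small_nbhd X y n) y (A m n)" for m n
    by (induction m arbitrary: n) (simp_all add: A is_loop_const small_nbhd_mem y loop)
  have close: "A m n t = A m' n t \<or> A m n t \<in> small_nbhd X y (n + m) \<and> A m' n t \<in> small_nbhd X y (n + m)"
    if "t \<in> {0..1}" "m \<le> m'" for m m' n t
    using that
  proof (induction m arbitrary: n t m')
    case 0
    then show ?case using is_loop_mem[OF A_loop] by simp
  next
    case (Suc m)
    then obtain k where k: "m' = Suc k" "m \<le> k" by (cases m') auto
    from E[of n, unfolded pointwise_map_def, rule_format, OF Suc.prems(1)] show ?case
    proof
      assume "\<exists>v. \<forall>q. E n q t = v"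
      then show ?thesis using k A by metis
    next
      assume "\<exists>t'\<in>{0..1}. \<forall>q. E n q t = q t'"
      then obtain t' where "t' \<in> {0..1}" "\<And>q. E n q t = q t'" by blast
      then show ?thesis using Suc.IH[of t' k "Suc n"] k A by simp
    qed
  qed
  \<comment> \<open>Either the values at \<open>t\<close> are eventually constant, or they keep
    changing and lie in ever smaller neighbourhoods, with limit \<open>y\<close>.\<close>
  have "\<exists>v. \<forall>m. A m n t = v \<or> A m n t \<in> small_nbhd X y (n + m) \<and> v \<in> small_nbhd X y (n + m)" if t: "t \<in> {0..1}" for n t
  proof (cases "\<exists>m0. \<forall>m\<ge>m0. A m n t = A m0 n t")
    case True
    then obtain m0 where m0: "\<And>m. m0 \<le> m \<Longrightarrow> A m n t = A m0 n t" by blast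
    have "A m n t = A m0 n t \<or> A m n t \<in> small_nbhd X y (n + m) \<and> A m0 n t \<in> small_nbhd X y (n + m)" for m
      using close[OF t, of m "max m m0" n] m0[of "max m m0"] by simp
    then show ?thesis by blast
  next
    case False
    then have "\<exists>m'\<ge>m. A m' n t \<noteq> A m n t" for m by blast
    then have "A m n t \<in> small_nbhd X y (n + m)" for m using close[OF t] by metis
    then show ?thesis using small_nbhd_mem[OF y] by blast
  qed
  then have "\<forall>n t. \<exists>v. t \<in> {0..1} \<longrightarrow> (\<forall>m. A m n t = v \<or> A m n t \<in> small_nbhd X y (n + m) \<and> v \<in> small_nbhd X y (n + m))" by blast
  then obtain P where "\<forall>n t. t \<in> {0..1} \<longrightarrow> (\<forall>m. A m n t = P n t \<or> A m n t \<in> small_nbhd X y (n + m) \<and> P n t \<in> small_nbhd X y (n + m))"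
    unfolding choice_iff by blast
  then have P: "\<And>n t m. t \<in> {0..1} \<Longrightarrow> A m n t = P n t \<or> A m n t \<in> small_nbhd X y (n + m) \<and> P n t \<in> small_nbhd X y (n + m)"
    by blast
  have bound: "dist (A m n t) (P n t) \<le> 2 * inverse (real (Suc m))" if "t \<in> {0..1}" for n t m
  proof -
    have "small_nbhd X y (n + m) \<subseteq> small_nbhd X y m" by (rule small_nbhd_mono) simp
    then have "A m n t = P n t \<or> A m n t \<in> small_nbhd X y m \<and> P n t \<in> small_nbhd X y m"
      using P[OF that, of m n] by blast
    then show ?thesis
    proof
      assume "A m n t = P n t"
      then show ?thesis by simp
    qed (rule small_nbhd_dist, auto)
  qed
  have lim0: "(\<lambda>m. 2 * inverse (real (Suc m))) \<longlonglongrightarrow> 0"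
    using tendsto_mult_right_zero[OF LIMSEQ_inverse_real_of_nat] by blast
  have lim: "(\<lambda>m. A m n t) \<longlonglongrightarrow> P n t" if "t \<in> {0..1}" for n t
    using bound[OF that] by (intro metric_tendsto_imp_tendsto[OF lim0] always_eventually) (simp add: dist_commute)
  have unif: "uniform_limit {0..1} (\<lambda>m. A m n) (P n) sequentially" for n
  proof (rule uniform_limitI)
    fix e :: real assume "0 < e"
    then have "\<forall>\<^sub>F m in sequentially. 2 * inverse (real (Suc m)) < e" using order_tendstoD(2)[OF lim0] by blast
    then show "\<forall>\<^sub>F m in sequentially. \<forall>t\<in>{0..1}. dist (A m n t) (P n t) < e"
      by eventually_elim (use bound le_less_trans in blast)
  qed
  have "is_loop (small_nbhd X y n) y (P n)" for n
  proof -
    have "continuous_on {0..1} (P n)"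
      by (rule uniform_limit_theorem[OF _ unif]) (use A_loop in \<open>auto simp: is_loop_def path_def\<close>)
    moreover have "P n t \<in> small_nbhd X y n" if "t \<in> {0..1}" for t
      using P[OF that, of 0 n] is_loop_mem[OF A_loop[of n 0] that] by auto
    moreover have "P n t = y" if "t = 0 \<or> t = 1" for t
    proof -
      have "A m n t = y" for m using that A_loop[of n m] by (auto simp: is_loop_def pathstart_def pathfinish_def)
      then show ?thesis using lim[of t n] that LIMSEQ_unique[of "\<lambda>m. A m n t" "P n t" y] by auto
    qed
    ultimately show ?thesis by (auto simp: is_loop_def path_def path_image_def pathstart_def pathfinish_def)
  qed
  \<comment> \<open>At time \<open>t\<close> the operation \<open>E n\<close> copies a single value
    or is constant, so the recursion passes to the pointwise limit.\<close>
  moreover have "P n t = E n (P (Suc n)) t" if t: "t \<in> {0..1}" for n t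
    using E[of n, unfolded pointwise_map_def, rule_format, OF t]
  proof
    have lim': "(\<lambda>m. A (Suc m) n t) \<longlonglongrightarrow> P n t" using lim[OF t] by (rule LIMSEQ_Suc)
    {
      assume "\<exists>v. \<forall>q. E n q t = v"
      then obtain v where v: "\<And>q. E n q t = v" by blast
      have "(\<lambda>m::nat. v) \<longlonglongrightarrow> P n t" using lim' unfolding A v .
      then show ?thesis unfolding v by (rule LIMSEQ_unique[OF _ tendsto_const])
    next
      assume "\<exists>t'\<in>{0..1}. \<forall>q. E n q t = q t'"
      then obtain t' where t': "t' \<in> {0..1}" "\<And>q. E n q t = q t'" by blast
      have "(\<lambda>m. A m (Suc n) t') \<longlonglongrightarrow> P n t" using lim' unfolding A t'(2) .
      then show ?thesis unfolding t'(2) by (rule LIMSEQ_unique[OF _ lim[OF t'(1)]])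
    }
  qed
  ultimately show ?thesis by (rule that)
qed

section \<open>Classes of arbitrary paths in the fundamental group\<close>

lemma homotopic_const_join:
  assumes "path p" "path_image p \<subseteq> X" "pathstart p = z"
  shows "homotopic_paths X ((\<lambda>_. z) +++ p) p"
proof (rule homotopic_paths_sym,
    rule homotopic_paths_reparametrize[where f = "\<lambda>t. if t \<le> 1/2 then 0 else 2 * t - 1"])
  show "continuous_on {0..1} (\<lambda>t::real. if t \<le> 1/2 then 0 else 2 * t - 1)"
    unfolding split_01 by (rule continuous_on_cases continuous_intros | force)+
qed (use assms in \<open>auto simp: joinpaths_def pathstart_def\<close>)

lemma homotopic_reverse_join:
  assumes "path p" "path_image p \<subseteq> X" "pathfinish p = z"
  shows "homotopic_paths X (reversepath p +++ p) (\<lambda>_. z)"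
proof -
  have c: "continuous_on {0..1} p" and sub: "p ` {0..1} \<subseteq> X" and e: "p 1 = z"
    using assms by (auto simp: path_def path_image_def pathstart_def pathfinish_def)
  let ?k = "\<lambda>y::real \<times> real. if snd y \<le> 1/2 then 1 - (1 - fst y) * (2 * snd y)
                     else 1 - (1 - fst y) * (2 - 2 * snd y)"
  have k: "continuous_on ({0..1} \<times> {0..1}) ?k"
    by (rule continuous_on_cases_le) (auto intro!: continuous_intros simp: algebra_simps)
  have kin: "?k y \<in> {0..1}" if "y \<in> {0..1} \<times> {0..1}" for y
    using that by (auto simp: mult_le_one)
  have "continuous_on ({0..1} \<times> {0..1}) (p \<circ> ?k)"
    by (rule continuous_on_compose[OF k continuous_on_subset[OF c]]) (use kin in blast)
  moreover have "p \<circ> ?k \<in> ({0..1} \<times> {0..1}) \<rightarrow> X" using kin sub by auto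
  ultimately show ?thesis
    unfolding homotopic_paths
    by (intro exI[of _ "p \<circ> ?k"])
      (auto simp: joinpaths_def reversepath_def pathstart_def pathfinish_def e algebra_simps)
qed

abbreviation path_in :: "'a::topological_space set \<Rightarrow> (real \<Rightarrow> 'a) \<Rightarrow> bool" where
  "path_in X p \<equiv> path p \<and> path_image p \<subseteq> X"

lemma homotopic_cancel_middle:
  assumes "path_in X p" "path_in X u" "path_in X r" "pathfinish p = pathfinish u" "pathfinish p = pathstart r"
  shows "homotopic_paths X ((p +++ reversepath u) +++ (u +++ r)) (p +++ r)"
proof -
  have 1: "homotopic_paths X ((p +++ reversepath u) +++ (u +++ r)) (p +++ (reversepath u +++ (u +++ r)))"
    using assms by (intro homotopic_paths_sym[OF homotopic_paths_assoc]) (auto simp: path_image_join)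
  have 2: "homotopic_paths X (reversepath u +++ (u +++ r)) ((reversepath u +++ u) +++ r)"
    using assms by (intro homotopic_paths_assoc) auto
  have 3: "homotopic_paths X ((reversepath u +++ u) +++ r) ((\<lambda>_. pathstart r) +++ r)"
    using assms by (intro homotopic_paths_join homotopic_reverse_join) (auto simp: pathstart_def)
  have 4: "homotopic_paths X ((\<lambda>_. pathstart r) +++ r) r"
    using assms by (intro homotopic_const_join) auto
  have "homotopic_paths X (p +++ (reversepath u +++ (u +++ r))) (p +++ r)"
    using assms by (intro homotopic_paths_join homotopic_paths_trans[OF 2 homotopic_paths_trans[OF 3 4]]) auto
  with 1 show ?thesis by (rule homotopic_paths_trans)
qed

locale pointed_space =
  fixes X :: "'a::metric_space set" and x :: 'a
  assumes conn: "path_connected X" and xX: "x \<in> X"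
begin

abbreviation "\<pi> \<equiv> fundamental_group X x"

text \<open>The path is constant at \<open>x\<close> itself, so that closing up a loop at
  \<open>x\<close> leaves its class unchanged.\<close>

definition \<theta> :: "'a \<Rightarrow> real \<Rightarrow> 'a" where
  "\<theta> z = (if z = x then (\<lambda>_. x) else SOME p. path p \<and> path_image p \<subseteq> X \<and> pathstart p = x \<and> pathfinish p = z)"

lemma \<theta>: 
  assumes "z \<in> X"
  shows "path (\<theta> z)" "path_image (\<theta> z) \<subseteq> X" "pathstart (\<theta> z) = x" "pathfinish (\<theta> z) = z"
proof -
  have "\<exists>p. path p \<and> path_image p \<subseteq> X \<and> pathstart p = x \<and> pathfinish p = z"
    using conn xX assms unfolding path_connected_def by blast
  from someI_ex[OF this] is_loop_const[OF xX]
  have "path (\<theta> z) \<and> path_image (\<theta> z) \<subseteq> X \<and> pathstart (\<theta> z) = x \<and> pathfinish (\<theta> z) = z"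
    by (auto simp: \<theta>_def is_loop_def)
  then show "path (\<theta> z)" "path_image (\<theta> z) \<subseteq> X" "pathstart (\<theta> z) = x" "pathfinish (\<theta> z) = z" by auto
qed

definition close_up :: "(real \<Rightarrow> 'a) \<Rightarrow> real \<Rightarrow> 'a" where
  "close_up p = \<theta> (pathstart p) +++ (p +++ reversepath (\<theta> (pathfinish p)))"

text \<open>A homomorphism from the fundamental groupoid to the fundamental group: pieces of a loop
  get classes in one group, whatever their end points, and concatenation becomes
  multiplication.\<close>

definition W :: "(real \<Rightarrow> 'a) \<Rightarrow> (real \<Rightarrow> 'a) set" where
  "W p = loop_class X x (close_up p)"

lemma path_ends_in: "path_in X p \<Longrightarrow> pathstart p \<in> X \<and> pathfinish p \<in> X"
  using pathstart_in_path_image pathfinish_in_path_image by blast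

lemma close_up_loop: "path_in X p \<Longrightarrow> is_loop X x (close_up p)"
  using path_ends_in[of p] \<theta>[of "pathstart p"] \<theta>[of "pathfinish p"]
  by (auto simp: close_up_def is_loop_def path_image_join)

lemma W_carrier [simp]: "path_in X p \<Longrightarrow> W p \<in> carrier \<pi>"
  using close_up_loop by (auto simp: W_def carrier_fundamental_group)

lemma group_pi: "group \<pi>" using group_fundamental_group[OF xX] .

sublocale P: group \<pi> by (rule group_pi)

lemma W_homotopic: "homotopic_paths X p q \<Longrightarrow> W p = W q"
proof -
  assume h: "homotopic_paths X p q"
  have p: "path_in X p" and q: "path_in X q"
    using homotopic_paths_imp_path[OF h] homotopic_paths_imp_subset[OF h] by auto
  have e: "pathstart q = pathstart p" "pathfinish q = pathfinish p"
    using homotopic_paths_imp_pathstart[OF h] homotopic_paths_imp_pathfinish[OF h] by auto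
  note t = path_ends_in[OF p] \<theta>[of "pathstart p"] \<theta>[of "pathfinish p"]
  have "homotopic_paths X (close_up p) (close_up q)"
    unfolding close_up_def e using t h p by (intro homotopic_paths_join) auto
  then show ?thesis
    unfolding W_def using loop_class_eq_iff[OF close_up_loop[OF p] close_up_loop[OF q]] by simp
qed

lemma W_cong: "path_in X p \<Longrightarrow> (\<And>t. t \<in> {0..1} \<Longrightarrow> p t = q t) \<Longrightarrow> W p = W q"
  by (intro W_homotopic homotopic_paths_eq) auto

lemma W_join:
  assumes p: "path_in X p" and q: "path_in X q" and pq: "pathfinish p = pathstart q"
  shows "W (p +++ q) = W p \<otimes>\<^bsub>\<pi>\<^esub> W q"
proof -
  let ?a = "\<theta> (pathstart p)" and ?b = "\<theta> (pathfinish p)" and ?c = "\<theta> (pathfinish q)"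
  note t = path_ends_in[OF p] path_ends_in[OF q] \<theta>[of "pathstart p"] \<theta>[of "pathfinish p"] \<theta>[of "pathfinish q"]
  let ?r = "q +++ reversepath ?c"
  have pj: "path_in X (p +++ q)" using p q pq by (auto simp: path_image_join)
  have 1: "homotopic_paths X ((?a +++ (p +++ reversepath ?b)) +++ (?b +++ ?r)) (?a +++ ((p +++ reversepath ?b) +++ (?b +++ ?r)))"
    using t p q pq by (intro homotopic_paths_sym[OF homotopic_paths_assoc]) (auto simp: path_image_join)
  have 2: "homotopic_paths X ((p +++ reversepath ?b) +++ (?b +++ ?r)) (p +++ ?r)"
    using t p q pq by (intro homotopic_cancel_middle) (auto simp: path_image_join)
  have 3: "homotopic_paths X (p +++ ?r) ((p +++ q) +++ reversepath ?c)"
    using t p q pq by (intro homotopic_paths_assoc) auto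
  have 4: "homotopic_paths X (?a +++ ((p +++ reversepath ?b) +++ (?b +++ ?r))) (?a +++ ((p +++ q) +++ reversepath ?c))"
    using t p q pq by (intro homotopic_paths_join homotopic_paths_trans[OF 2 3]) auto
  have "homotopic_paths X (close_up p +++ close_up q) (close_up (p +++ q))"
    using homotopic_paths_trans[OF 1 4] pq by (simp add: close_up_def)
  then have "loop_class X x (close_up p +++ close_up q) = loop_class X x (close_up (p +++ q))"
    using loop_class_eq_iff is_loop_join close_up_loop p q pj by metis
  then show ?thesis
    using mult_fundamental_group[OF close_up_loop[OF p] close_up_loop[OF q]] by (simp add: W_def)
qed

lemma path_in_const: "z \<in> X \<Longrightarrow> path_in X (\<lambda>_. z)"
  using is_loop_const[of z X] by (simp add: is_loop_def)

lemma idem_one: "g \<in> carrier \<pi> \<Longrightarrow> g \<otimes>\<^bsub>\<pi>\<^esub> g = g \<Longrightarrow> g = \<one>\<^bsub>\<pi>\<^esub>"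
  by (metis P.l_cancel_one')

lemma W_const: "z \<in> X \<Longrightarrow> W (\<lambda>_. z) = \<one>\<^bsub>\<pi>\<^esub>"
proof -
  assume z: "z \<in> X"
  have "(\<lambda>_. z) +++ (\<lambda>_. z) = (\<lambda>_. z)" by (auto simp: joinpaths_def)
  then have "W (\<lambda>_. z) \<otimes>\<^bsub>\<pi>\<^esub> W (\<lambda>_. z) = W (\<lambda>_. z)"
    using W_join[of "\<lambda>_. z" "\<lambda>_. z"] path_in_const[OF z] by (simp add: pathstart_def pathfinish_def)
  then show ?thesis using idem_one path_in_const[OF z] by simp
qed

lemma W_reverse:
  assumes p: "path_in X p" shows "W (reversepath p) = inv\<^bsub>\<pi>\<^esub> (W p)"
proof -
  have "W (reversepath p +++ p) = \<one>\<^bsub>\<pi>\<^esub>"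
    using W_homotopic[OF homotopic_reverse_join, of p "pathfinish p"] p W_const path_ends_in by metis
  then have "W (reversepath p) \<otimes>\<^bsub>\<pi>\<^esub> W p = \<one>\<^bsub>\<pi>\<^esub>"
    using W_join[of "reversepath p" p] p by simp
  then show ?thesis using p by (intro P.inv_equality[symmetric]) auto
qed

definition piece :: "real \<Rightarrow> real \<Rightarrow> (real \<Rightarrow> 'a) \<Rightarrow> real \<Rightarrow> 'a" where
  "piece u v p = p \<circ> linepath u v"

lemma piece_simps [simp]: "pathstart (piece u v p) = p u" "pathfinish (piece u v p) = p v"
  by (simp_all add: piece_def pathstart_def pathfinish_def linepath_def)

lemma path_image_piece: "path_image (piece u v p) = p ` closed_segment u v"
  by (simp add: piece_def path_image_compose)

lemma path_piece:
  assumes "path p" "u \<in> {0..1}" "v \<in> {0..1}" shows "path (piece u v p)"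
proof -
  have "closed_segment u v \<subseteq> {0..1}" using assms by (intro closed_segment_subset) auto
  then show ?thesis
    unfolding piece_def using assms(1) by (intro path_continuous_image) (auto simp: path_def intro: continuous_on_subset)
qed

lemma piece_path_in:
  assumes "path_in X p" "u \<in> {0..1}" "v \<in> {0..1}" shows "path_in X (piece u v p)"
proof -
  have "closed_segment u v \<subseteq> {0..1}" using assms by (intro closed_segment_subset) auto
  then have "p ` closed_segment u v \<subseteq> p ` {0..1}" by (rule image_mono)
  also have "\<dots> \<subseteq> X" using assms(1) by (simp add: path_image_def)
  finally show ?thesis using path_piece assms unfolding path_image_piece by blast
qed

text \<open>The three times may come in any order, since the homotopy takes place in the convex set
  \<open>{0..1}\<close>. This permits steps backwards along a loop.\<close>

lemma W_piece_join:
  assumes p: "path_in X p" and uvw: "u \<in> {0..1}" "v \<in> {0..1}" "w \<in> {0..1}"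
  shows "W (piece u w p) = W (piece u v p) \<otimes>\<^bsub>\<pi>\<^esub> W (piece v w p)"
proof -
  have cs: "closed_segment a b \<subseteq> {0..1}" if "a \<in> {0..1}" "b \<in> {0..1}" for a b :: real
    using that by (intro closed_segment_subset) auto
  have "homotopic_paths {0..1} (linepath u v +++ linepath v w) (linepath u w)"
  proof (rule homotopic_paths_linear)
    fix t :: real assume t: "t \<in> {0..1}"
    have "(linepath u v +++ linepath v w) t \<in> path_image (linepath u v +++ linepath v w)"
      using t by (auto simp: path_image_def)
    also have "\<dots> \<subseteq> {0..1}" using cs uvw by (simp add: path_image_join)
    finally have 1: "(linepath u v +++ linepath v w) t \<in> {0..1}" .
    have "linepath u w t \<in> path_image (linepath u w)" using t unfolding path_image_def by blast
    then have "linepath u w t \<in> {0..1}" using cs[of u w] uvw by auto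
    with 1 show "closed_segment ((linepath u v +++ linepath v w) t) (linepath u w t) \<subseteq> {0..1}" by (rule cs)
  qed simp_all
  then have "homotopic_paths X (p \<circ> (linepath u v +++ linepath v w)) (p \<circ> linepath u w)"
    using p by (intro homotopic_paths_continuous_image[where S = "{0..1}"]) (auto simp: path_def path_image_def)
  then have "W (piece u v p +++ piece v w p) = W (piece u w p)"
    by (intro W_homotopic) (simp add: piece_def path_compose_join)
  then show ?thesis using W_join[of "piece u v p" "piece v w p"] piece_path_in[OF p] uvw by simp
qed

lemma piece_0_1: "piece 0 1 p = p" by (auto simp: piece_def linepath_def)

lemma W_loop: "is_loop X x p \<Longrightarrow> W p = loop_class X x p"
proof -
  assume p: "is_loop X x p"
  have \<theta>x: "\<theta> x = (\<lambda>_. x)" by (simp add: \<theta>_def)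
  have r: "reversepath (\<lambda>_. x) = (\<lambda>_. x)" by (simp add: reversepath_def)
  have c: "is_loop X x (\<lambda>_. x)" by (rule is_loop_const[OF xX])
  have "W p = \<one>\<^bsub>\<pi>\<^esub> \<otimes>\<^bsub>\<pi>\<^esub> (loop_class X x p \<otimes>\<^bsub>\<pi>\<^esub> \<one>\<^bsub>\<pi>\<^esub>)"
    using p c by (simp add: W_def close_up_def \<theta>x r is_loop_def[of X x p] one_fundamental_group
        mult_fundamental_group is_loop_join)
  moreover have "loop_class X x p \<in> carrier \<pi>" using p by (auto simp: carrier_fundamental_group)
  ultimately show ?thesis by simp
qed

lemma carrier_pi_W: "carrier \<pi> = W ` {p. is_loop X x p}"
  unfolding carrier_fundamental_group using W_loop by (intro image_cong) auto

lemma W_power: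
  assumes "y \<in> X" "is_loop X y p"
  shows "W (loop_power y p n) = W p [^]\<^bsub>\<pi>\<^esub> n"
proof (induction n)
  case 0
  then show ?case using W_const assms by simp
next
  case (Suc n)
  then show ?case using W_join[of "loop_power y p n" p] assms is_loop_power[OF assms]
    by (simp add: is_loop_def)
qed

definition local_group :: "'a set \<Rightarrow> 'a \<Rightarrow> (real \<Rightarrow> 'a) set set" where
  "local_group U y = W ` {p. is_loop U y p}"

lemma is_loop_path_in: "is_loop U y p \<Longrightarrow> U \<subseteq> X \<Longrightarrow> path_in X p"
  by (auto simp: is_loop_def)

lemma subgroup_local_group:
  assumes "U \<subseteq> X" "y \<in> U"
  shows "subgroup (local_group U y) \<pi>"
proof
  note pin = is_loop_path_in[OF _ assms(1)]
  show "local_group U y \<subseteq> carrier \<pi>" using pin by (auto simp: local_group_def)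
  show "\<one>\<^bsub>\<pi>\<^esub> \<in> local_group U y"
    using W_const[of y] assms is_loop_const[OF assms(2)] unfolding local_group_def by (metis (mono_tags) image_eqI mem_Collect_eq subsetD)
  fix a assume "a \<in> local_group U y"
  then obtain p where p: "is_loop U y p" "a = W p" by (auto simp: local_group_def)
  then show "inv\<^bsub>\<pi>\<^esub> a \<in> local_group U y"
    using W_reverse[OF pin] is_loop_reverse[OF p(1)] unfolding local_group_def by (metis (mono_tags) image_eqI mem_Collect_eq)
  fix b assume "b \<in> local_group U y"
  then obtain q where q: "is_loop U y q" "b = W q" by (auto simp: local_group_def)
  have "W (p +++ q) = a \<otimes>\<^bsub>\<pi>\<^esub> b"
    using W_join[OF pin[OF p(1)] pin[OF q(1)]] p q by (simp add: is_loop_def)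
  then show "a \<otimes>\<^bsub>\<pi>\<^esub> b \<in> local_group U y"
    using is_loop_join[OF p(1) q(1)] unfolding local_group_def by (metis (mono_tags) image_eqI mem_Collect_eq)
qed

lemma local_group_mono: "U \<subseteq> V \<Longrightarrow> local_group U y \<subseteq> local_group V y"
  unfolding local_group_def using is_loop_subset by (intro image_mono) auto

end

section \<open>Generation by countably many local groups\<close>

locale tame_space = pointed_space +
  assumes lpc: "locally path_connected X"
    and sc: "second_countable (top_of_set X)"
begin

lemma path_connected_nbhd:
  assumes "openin (top_of_set X) V" "z \<in> V"
  obtains U where "openin (top_of_set X) U" "path_connected U" "z \<in> U" "U \<subseteq> V"
  using lpc assms unfolding locally_path_connected by blast

lemma openin_subset_X: "openin (top_of_set X) U \<Longrightarrow> U \<subseteq> X"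
  using openin_subset by fastforce

lemma countable_dense:
  obtains D where "countable D" "D \<subseteq> X" "\<And>U. openin (top_of_set X) U \<Longrightarrow> U \<noteq> {} \<Longrightarrow> D \<inter> U \<noteq> {}"
proof -
  have "separable_space (top_of_set X)" using sc second_countable_imp_separable_space by blast
  then obtain D where D: "countable D" "D \<subseteq> X" "top_of_set X closure_of D = X"
    by (auto simp: separable_space_def)
  have "D \<inter> U \<noteq> {}" if "openin (top_of_set X) U" "U \<noteq> {}" for U
    using that D(3) dense_intersects_open[of "top_of_set X" D] D(2) by (auto simp: Int_commute)
  then show ?thesis by (rule that[OF D(1,2)])
qed

text \<open>Subdivide a loop into pieces lying in members of a countable cover by path connected open sets,
  and join the division points to a countable dense set inside the pairwise intersections.\<close>

lemma countable_generation:
  assumes V: "\<And>y. y \<in> X \<Longrightarrow> openin (top_of_set X) (V y)" "\<And>y. y \<in> X \<Longrightarrow> y \<in> V y"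
  obtains Y C where "countable Y" "Y \<subseteq> X" "countable C" "C \<subseteq> carrier \<pi>"
    "\<And>S. subgroup S \<pi> \<Longrightarrow> C \<subseteq> S \<Longrightarrow> (\<And>y. y \<in> Y \<Longrightarrow> local_group (V y) y \<subseteq> S) \<Longrightarrow> carrier \<pi> \<subseteq> S"
proof -
  have "\<exists>U. openin (top_of_set X) U \<and> path_connected U \<and> y \<in> U \<and> U \<subseteq> V y" if "y \<in> X" for y
    using path_connected_nbhd[OF V(1)[OF that] V(2)[OF that]] by blast
  then have "\<forall>y\<in>X. \<exists>U. openin (top_of_set X) U \<and> path_connected U \<and> y \<in> U \<and> U \<subseteq> V y" by blast
  then obtain U where "\<forall>y\<in>X. openin (top_of_set X) (U y) \<and> path_connected (U y) \<and> y \<in> U y \<and> U y \<subseteq> V y"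
    unfolding bchoice_iff by blast
  then have U: "\<And>y. y \<in> X \<Longrightarrow> openin (top_of_set X) (U y)" "\<And>y. y \<in> X \<Longrightarrow> path_connected (U y)"
    "\<And>y. y \<in> X \<Longrightarrow> y \<in> U y" "\<And>y. y \<in> X \<Longrightarrow> U y \<subseteq> V y" by blast+
  have UX: "U y \<subseteq> X" if "y \<in> X" for y using openin_subset_X U(1)[OF that] by blast
  have "Lindelof_space (top_of_set X)" using sc second_countable_imp_Lindelof_space by blast
  then have "\<exists>\<V>. countable \<V> \<and> \<V> \<subseteq> U ` X \<and> \<Union>\<V> = topspace (top_of_set X)"
  proof (rule Lindelof_spaceD)
    show "openin (top_of_set X) W" if "W \<in> U ` X" for W using U(1) that by blast
    show "\<Union>(U ` X) = topspace (top_of_set X)" using U(3) UX by (simp add: set_eq_iff subset_iff) blast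
  qed
  then obtain \<V> where \<V>: "countable \<V> \<and> \<V> \<subseteq> U ` X" "\<Union>\<V> = X" by (elim exE conjE) simp
  from \<V>(1)[unfolded countable_subset_image] obtain Y where Y: "countable Y" "Y \<subseteq> X" "\<V> = U ` Y"
    by (elim exE conjE)
  note Y = Y(1,2) \<V>(2)[unfolded Y(3)]
  obtain D where D: "countable D" "D \<subseteq> X" "\<And>W. openin (top_of_set X) W \<Longrightarrow> W \<noteq> {} \<Longrightarrow> D \<inter> W \<noteq> {}"
    by (rule countable_dense) blast
  have "\<exists>p. path p \<and> path_image p \<subseteq> U y \<and> pathstart p = y \<and> pathfinish p = z" if "y \<in> X" "z \<in> U y" for y z
    using U(2,3)[OF that(1)] that(2) unfolding path_connected_def by blast
  then have "\<forall>y z. \<exists>p. y \<in> X \<longrightarrow> z \<in> U y \<longrightarrow> path p \<and> path_image p \<subseteq> U y \<and> pathstart p = y \<and> pathfinish p = z" by blast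
  then obtain \<beta> where "\<forall>y z. y \<in> X \<longrightarrow> z \<in> U y \<longrightarrow> path (\<beta> y z) \<and> path_image (\<beta> y z) \<subseteq> U y
      \<and> pathstart (\<beta> y z) = y \<and> pathfinish (\<beta> y z) = z" unfolding choice_iff by blast
  then have \<beta>: "path_in (U y) (\<beta> y z)" "pathstart (\<beta> y z) = y" "pathfinish (\<beta> y z) = z" if "y \<in> X" "z \<in> U y" for y z
    using that by auto
  have pX: "path_in X p" if "path_in (U y) p" "y \<in> X" for p y using that UX by blast
  note \<beta>X = pX[OF \<beta>(1)]
  define C where "C = (\<lambda>(y, y', z). W (\<beta> y z) \<otimes>\<^bsub>\<pi>\<^esub> inv\<^bsub>\<pi>\<^esub> (W (\<beta> y' z))) ` {(y, y', z). y \<in> Y \<and> y' \<in> Y \<and> z \<in> D \<and> z \<in> U y \<inter> U y'}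
    \<union> (\<lambda>y. W (\<beta> y x)) ` {y \<in> Y. x \<in> U y}"
  have "countable C"
  proof -
    have "{(y, y', z). y \<in> Y \<and> y' \<in> Y \<and> z \<in> D \<and> z \<in> U y \<inter> U y'} \<subseteq> Y \<times> Y \<times> D" by blast
    moreover have "countable (Y \<times> Y \<times> D)" by (intro countable_SIGMA Y(1) D(1))
    ultimately have 1: "countable {(y, y', z). y \<in> Y \<and> y' \<in> Y \<and> z \<in> D \<and> z \<in> U y \<inter> U y'}" by (rule countable_subset)
    have 2: "countable {y \<in> Y. x \<in> U y}" by (rule countable_subset[OF _ Y(1)]) blast
    show ?thesis unfolding C_def by (intro countable_Un countable_image 1 2)
  qed
  moreover have "C \<subseteq> carrier \<pi>"
  proof
    fix g assume "g \<in> C"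
    then consider y y' z where "y \<in> Y" "y' \<in> Y" "z \<in> U y" "z \<in> U y'" "g = W (\<beta> y z) \<otimes>\<^bsub>\<pi>\<^esub> inv\<^bsub>\<pi>\<^esub> (W (\<beta> y' z))"
      | y where "y \<in> Y" "x \<in> U y" "g = W (\<beta> y x)"
      unfolding C_def by blast
    then show "g \<in> carrier \<pi>"
    proof cases
      case (1 y y' z)
      then show ?thesis using W_carrier[OF \<beta>X[of y z]] W_carrier[OF \<beta>X[of y' z]] Y(2) by (simp add: subset_iff)
    next
      case (2 y)
      then show ?thesis using W_carrier[OF \<beta>X[of y x]] Y(2) by (simp add: subset_iff)
    qed
  qed
  moreover have "carrier \<pi> \<subseteq> S"
    if S: "subgroup S \<pi>" and CS: "C \<subseteq> S" and loc: "\<And>y. y \<in> Y \<Longrightarrow> local_group (V y) y \<subseteq> S" for S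
  proof -
    interpret S: subgroup S \<pi> by (rule S)
    have loc': "W p \<in> S" if "y \<in> Y" "is_loop (U y) y p" for y p
    proof -
      have "is_loop (V y) y p" using is_loop_subset[OF that(2)] U(4) Y(2) that(1) by blast
      then show ?thesis using loc[OF that(1)] unfolding local_group_def by blast
    qed
    have C1: "W (\<beta> y z) \<otimes>\<^bsub>\<pi>\<^esub> inv\<^bsub>\<pi>\<^esub> (W (\<beta> y' z)) \<in> S" if "y \<in> Y" "y' \<in> Y" "z \<in> D" "z \<in> U y" "z \<in> U y'" for y y' z
    proof -
      have "(y, y', z) \<in> {(y, y', z). y \<in> Y \<and> y' \<in> Y \<and> z \<in> D \<and> z \<in> U y \<inter> U y'}" using that by simp
      then have "W (\<beta> y z) \<otimes>\<^bsub>\<pi>\<^esub> inv\<^bsub>\<pi>\<^esub> (W (\<beta> y' z)) \<in> C" unfolding C_def by (intro UnI1) force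
      then show ?thesis using CS by blast
    qed
    have C2: "W (\<beta> y x) \<in> S" if "y \<in> Y" "x \<in> U y" for y
      using that CS unfolding C_def by blast
    have "W p \<in> S" if p: "is_loop X x p" for p
    proof -
      have pp: "path_in X p" using p by (simp add: is_loop_def)
      have p01: "p 0 = x" "p 1 = x" using p by (auto simp: is_loop_def pathstart_def pathfinish_def)
      have pt: "p t \<in> X" if "t \<in> {0..1}" for t using is_loop_mem[OF p that] .
      \<comment> \<open>The initial segment up to \<open>t\<close> is completed by a path to the
        base point of a cover member around \<open>p t\<close>. Quantifying over all such
        \<open>y\<close> and \<open>b\<close> makes the property independent of choices.\<close>
      define Q where "Q t \<longleftrightarrow> (\<forall>y\<in>Y. \<forall>b. path_in (U y) b \<longrightarrow> pathstart b = p t \<longrightarrow> pathfinish b = y \<longrightarrow>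
        W (piece 0 t p) \<otimes>\<^bsub>\<pi>\<^esub> W b \<in> S)" for t
      have step: "Q t"
        if st: "s \<in> {0..1}" "t \<in> {0..1}" and y: "y \<in> Y" "p ` closed_segment s t \<subseteq> U y" and Q: "Q s" for s t y
        unfolding Q_def
      proof (intro ballI allI impI)
        fix y' b' assume y': "y' \<in> Y" and b': "path_in (U y') b'" "pathstart b' = p t" "pathfinish b' = y'"
        have yX: "y \<in> X" "y' \<in> X" using y y' Y by auto
        have ptU: "p t \<in> U y" "p s \<in> U y" using y by auto
        have "p t \<in> U y'" using b' pathstart_in_path_image[of b'] by auto
        then have ptO: "p t \<in> U y \<inter> U y'" using ptU by blast
        have "openin (top_of_set X) (U y \<inter> U y')" using U(1) yX by blast
        \<comment> \<open>\<open>p t\<close> need not belong to \<open>D\<close>, so the change of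
          base point is made at a nearby \<open>z\<close> of \<open>D\<close>, which
          \<open>\<eta>\<close> reaches inside both cover members.\<close>
        then obtain N where N: "openin (top_of_set X) N" "path_connected N" "p t \<in> N" "N \<subseteq> U y \<inter> U y'"
          by (rule path_connected_nbhd[OF _ ptO])
        then obtain z where z: "z \<in> D" "z \<in> N" using D(3) by blast
        obtain \<eta> where \<eta>: "path \<eta>" "path_image \<eta> \<subseteq> N" "pathstart \<eta> = p t" "pathfinish \<eta> = z"
          using N z unfolding path_connected_def by blast
        have zU: "z \<in> U y" "z \<in> U y'" using z N by auto
        obtain b where b: "path_in (U y) b" "pathstart b = p s" "pathfinish b = y"
          using U(2,3)[OF yX(1)] ptU unfolding path_connected_def by blast
        define m where "m = piece s t p"
        have m: "path_in (U y) m" "pathstart m = p s" "pathfinish m = p t"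
          using y path_piece[of p s t] st pp by (auto simp: m_def path_image_piece)
        let ?l1 = "reversepath b +++ (m +++ (\<eta> +++ reversepath (\<beta> y z)))"
        let ?l2 = "\<beta> y' z +++ (reversepath \<eta> +++ b')"
        note ends = b m \<eta> b' \<beta>[OF yX(1) zU(1)] \<beta>[OF yX(2) zU(2)]
        have \<eta>U: "path_in (U y) \<eta>" "path_in (U y') \<eta>" using \<eta> N by auto
        have yy: "y \<in> U y" "y' \<in> U y'" using U(3) yX by auto
        have "is_loop (U y) y ?l1" using ends \<eta>U by (simp add: is_loop_def path_image_join)
        then have l1: "W ?l1 \<in> S" by (rule loc'[OF y(1)])
        have "is_loop (U y') y' ?l2" using ends \<eta>U by (simp add: is_loop_def path_image_join)
        then have l2: "W ?l2 \<in> S" by (rule loc'[OF y'])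
        note inX = pX[OF b(1) yX(1)] pX[OF m(1) yX(1)] pX[OF \<eta>U(1) yX(1)] pX[OF b'(1) yX(2)] \<beta>X[OF yX(1) zU(1) yX(1)] \<beta>X[OF yX(2) zU(2) yX(2)]
        have W1: "W ?l1 = inv\<^bsub>\<pi>\<^esub> (W b) \<otimes>\<^bsub>\<pi>\<^esub> (W m \<otimes>\<^bsub>\<pi>\<^esub> (W \<eta> \<otimes>\<^bsub>\<pi>\<^esub> inv\<^bsub>\<pi>\<^esub> (W (\<beta> y z))))"
          using inX ends by (simp add: W_join W_reverse path_image_join)
        have W2: "W ?l2 = W (\<beta> y' z) \<otimes>\<^bsub>\<pi>\<^esub> (inv\<^bsub>\<pi>\<^esub> (W \<eta>) \<otimes>\<^bsub>\<pi>\<^esub> W b')"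
          using inX ends by (simp add: W_join W_reverse path_image_join)
        have p0s: "path_in X (piece 0 s p)" by (rule piece_path_in[OF pp]) (use st in auto)
        have W3: "W (piece 0 t p) = W (piece 0 s p) \<otimes>\<^bsub>\<pi>\<^esub> W m"
          unfolding m_def by (rule W_piece_join[OF pp]) (use st in auto)
        have "W (piece 0 s p) \<otimes>\<^bsub>\<pi>\<^esub> W b \<in> S" using Q[unfolded Q_def] y(1) b by blast
        \<comment> \<open>The product telescopes: up to \<open>s\<close> and over to
          \<open>y\<close>, along \<open>?l1\<close> through \<open>t\<close> and \<open>z\<close>
          back to \<open>y\<close>, across to \<open>y'\<close>, and along \<open>?l2\<close>
          through \<open>z\<close> and \<open>t\<close> back to \<open>y'\<close>.\<close>
        then have "(W (piece 0 s p) \<otimes>\<^bsub>\<pi>\<^esub> W b) \<otimes>\<^bsub>\<pi>\<^esub> W ?l1 \<otimes>\<^bsub>\<pi>\<^esub> (W (\<beta> y z) \<otimes>\<^bsub>\<pi>\<^esub> inv\<^bsub>\<pi>\<^esub> (W (\<beta> y' z))) \<otimes>\<^bsub>\<pi>\<^esub> W ?l2 \<in> S"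
          by (intro S.m_closed[OF S.m_closed[OF S.m_closed[OF _ l1] C1[OF y(1) y' z(1) zU]] l2])
        moreover have "(W (piece 0 s p) \<otimes>\<^bsub>\<pi>\<^esub> W b) \<otimes>\<^bsub>\<pi>\<^esub> W ?l1 \<otimes>\<^bsub>\<pi>\<^esub> (W (\<beta> y z) \<otimes>\<^bsub>\<pi>\<^esub> inv\<^bsub>\<pi>\<^esub> (W (\<beta> y' z))) \<otimes>\<^bsub>\<pi>\<^esub> W ?l2
            = W (piece 0 t p) \<otimes>\<^bsub>\<pi>\<^esub> W b'"
          unfolding W1 W2 W3 using inX p0s by (simp add: P.word_simps)
        ultimately show "W (piece 0 t p) \<otimes>\<^bsub>\<pi>\<^esub> W b' \<in> S" by simp
      qed
      have Q0: "Q 0"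
        unfolding Q_def
      proof (intro ballI allI impI)
        fix y b assume y: "y \<in> Y" and b: "path_in (U y) b" "pathstart b = p 0" "pathfinish b = y"
        have yX: "y \<in> X" using y Y by auto
        have xU: "x \<in> U y" using b pathstart_in_path_image[of b] p01 by auto
        note \<beta>x = \<beta>[OF yX xU] and bX = pX[OF b(1) yX] and \<beta>xX = \<beta>X[OF yX xU yX]
        have "is_loop (U y) y (\<beta> y x +++ b)" using b \<beta>x p01 by (simp add: is_loop_def path_image_join)
        then have "W (\<beta> y x +++ b) \<in> S" by (rule loc'[OF y])
        moreover have "W (\<beta> y x +++ b) = W (\<beta> y x) \<otimes>\<^bsub>\<pi>\<^esub> W b" using b \<beta>x bX \<beta>xX p01 by (simp add: W_join)
        ultimately have "inv\<^bsub>\<pi>\<^esub> (W (\<beta> y x)) \<otimes>\<^bsub>\<pi>\<^esub> (W (\<beta> y x) \<otimes>\<^bsub>\<pi>\<^esub> W b) \<in> S"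
          using C2[OF y xU] by simp
        then have "W b \<in> S" using bX \<beta>xX by (simp add: P.word_simps)
        moreover have "piece 0 0 p = (\<lambda>_. x)" using p01 by (auto simp: piece_def linepath_def)
        ultimately show "W (piece 0 0 p) \<otimes>\<^bsub>\<pi>\<^esub> W b \<in> S" using W_const[OF xX] bX by simp
      qed
      \<comment> \<open>Connectedness of the interval replaces a finite subdivision;
        \<open>Q\<close> is locally constant because \<open>step\<close> works in both
        directions.\<close>
      have "Q 0 \<longleftrightarrow> Q 1"
      proof (rule connected_equivalence_relation[of "{0..1::real}" 0 1 "\<lambda>s t. Q s \<longleftrightarrow> Q t"])
        fix t :: real assume t: "t \<in> {0..1}"
        then obtain y where y: "y \<in> Y" "p t \<in> U y" using pt Y(3) by blast
        then have "openin (top_of_set X) (U y)" using U(1) Y(2) by blast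
        moreover have "continuous_on {0..1} p" "p \<in> {0..1} \<rightarrow> X" using pp pt by (auto simp: path_def)
        ultimately have "openin (top_of_set {0..1}) ({0..1} \<inter> p -` U y)" by (metis continuous_on_open_gen)
        then obtain e where e: "0 < e" "ball t e \<inter> {0..1} \<subseteq> {0..1} \<inter> p -` U y"
          using t y(2) unfolding openin_contains_ball by blast
        have "Q t \<longleftrightarrow> Q s" if s: "s \<in> ball t e \<inter> {0..1}" for s
        proof -
          have "closed_segment s t \<subseteq> ball t e" "closed_segment s t \<subseteq> {0..1}"
            using s t e(1) by (intro closed_segment_subset; auto)+
          then have seg: "p ` closed_segment s t \<subseteq> U y" using e(2) by blast
          then have "p ` closed_segment t s \<subseteq> U y" by (simp add: closed_segment_commute)
          then show ?thesis using step[of s t y] step[of t s y] seg s t y(1) by blast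
        qed
        then show "\<exists>T. openin (top_of_set {0..1}) T \<and> t \<in> T \<and> (\<forall>s\<in>T. Q t \<longleftrightarrow> Q s)"
          using t e(1) openin_open_Int[OF open_ball, of "{0..1}" t e]
          by (intro exI[of _ "{0..1} \<inter> ball t e"]) auto
      qed auto
      then have Q1: "Q 1" using Q0 by simp
      obtain y where y: "y \<in> Y" "x \<in> U y" using Y(3) xX by blast
      then have yX: "y \<in> X" using Y by auto
      note \<beta>x = \<beta>[OF yX y(2)] and \<beta>xX = \<beta>X[OF yX y(2) yX]
      have "W (piece 0 1 p) \<otimes>\<^bsub>\<pi>\<^esub> W (reversepath (\<beta> y x)) \<in> S"
        using Q1[unfolded Q_def] y(1) \<beta>x p01 by simp
      then have "(W p \<otimes>\<^bsub>\<pi>\<^esub> inv\<^bsub>\<pi>\<^esub> (W (\<beta> y x))) \<otimes>\<^bsub>\<pi>\<^esub> W (\<beta> y x) \<in> S"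
        using C2[OF y] \<beta>xX by (simp add: piece_0_1 W_reverse)
      then show "W p \<in> S" using \<beta>xX pp by (simp add: P.word_simps)
    qed
    then show ?thesis using carrier_pi_W by auto
  qed
  ultimately show ?thesis by (rule that[OF Y(1,2)])
qed

end

section \<open>Closure properties of Polish spaces and analytic sets\<close>

lemma metrizable_separable_imp_second_countable:
  assumes "metrizable_space T" "separable_space T"
  shows "second_countable T"
proof -
  obtain M d where M: "Metric_space M d" "T = Metric_space.mtopology M d"
    using assms by (auto simp: metrizable_space_def)
  interpret Metric_space M d by (rule M)
  obtain C where C: "countable C" "C \<subseteq> M" "mtopology closure_of C = M"
    using assms M by (auto simp: separable_space_def)
  define B where "B = (\<lambda>(c, n). mball c (inverse (real (Suc n)))) ` (C \<times> UNIV)"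
  have "\<exists>V\<in>B. x \<in> V \<and> V \<subseteq> U" if "openin mtopology U" "x \<in> U" for U x
  proof -
    have UM: "U \<subseteq> M" "\<exists>r>0. mball x r \<subseteq> U" using that unfolding openin_mtopology by auto
    then obtain r where r: "0 < r" "mball x r \<subseteq> U" "U \<subseteq> M" by blast
    have xM: "x \<in> M" using that r by auto
    obtain n where n: "inverse (real (Suc n)) < r / 2" using reals_Archimedean[of "r / 2"] r by auto
    have "x \<in> mtopology closure_of C" using C xM by simp
    then have "\<forall>\<epsilon>>0. \<exists>y\<in>C. y \<in> mball x \<epsilon>" unfolding metric_closure_of by blast
    then obtain c where "c \<in> C" "c \<in> mball x (inverse (real (Suc n)))"
      by (metis inverse_positive_iff_positive of_nat_0_less_iff zero_less_Suc)
    then have c: "c \<in> C" "c \<in> M" "d x c < inverse (real (Suc n))" by auto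
    have "mball c (inverse (real (Suc n))) \<subseteq> mball x r"
    proof
      fix z assume z: "z \<in> mball c (inverse (real (Suc n)))"
      then have zM: "z \<in> M" and dz: "d c z < inverse (real (Suc n))" by (simp_all only: in_mball)
      have "d x z \<le> d x c + d c z" by (rule triangle[OF xM c(2) zM])
      then have "d x z < r" using dz c(3) n by linarith
      then show "z \<in> mball x r" using zM xM by (simp only: in_mball simp_thms)
    qed
    moreover have "x \<in> mball c (inverse (real (Suc n)))" using c xM commute[of c x] by (simp only: in_mball simp_thms)
    moreover have "mball c (inverse (real (Suc n))) \<in> B" unfolding B_def using c by blast
    ultimately show ?thesis using r by blast
  qed
  moreover have "countable B" "\<forall>V\<in>B. openin mtopology V" using C by (auto simp: B_def)
  ultimately show ?thesis unfolding M second_countable_def by blast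
qed

lemma polish_second_countable: "polish_topology T \<Longrightarrow> second_countable T"
  by (simp add: polish_topology_def metrizable_separable_imp_second_countable completely_metrizable_imp_metrizable_space)

lemma polish_Hausdorff: "polish_topology T \<Longrightarrow> Hausdorff_space T"
  by (simp add: polish_topology_def metrizable_imp_Hausdorff_space completely_metrizable_imp_metrizable_space)

lemma polish_subtopology:
  assumes "polish_topology T" "closedin T S \<or> openin T S"
  shows "polish_topology (subtopology T S)"
proof -
  have "separable_space (subtopology T S)"
    using second_countable_imp_separable_space second_countable_subtopology polish_second_countable assms by blast
  then show ?thesis
    using assms completely_metrizable_space_closedin completely_metrizable_space_openin
    unfolding polish_topology_def by blast
qed

lemma separable_space_denseI:
  assumes "countable C" "C \<subseteq> topspace T" "\<And>U. openin T U \<Longrightarrow> U \<noteq> {} \<Longrightarrow> C \<inter> U \<noteq> {}"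
  shows "separable_space T"
  unfolding separable_space_def
proof (intro exI[of _ C] conjI)
  show "T closure_of C = topspace T"
    using assms(3) by (subst dense_intersects_open) auto
qed (use assms in auto)

lemma separable_space_denseE:
  assumes "separable_space T"
  obtains C where "countable C" "C \<subseteq> topspace T" "\<And>U. openin T U \<Longrightarrow> U \<noteq> {} \<Longrightarrow> C \<inter> U \<noteq> {}"
proof -
  obtain C where C: "countable C" "C \<subseteq> topspace T" "T closure_of C = topspace T"
    using assms by (auto simp: separable_space_def)
  have "\<forall>U. openin T U \<and> U \<noteq> {} \<longrightarrow> C \<inter> U \<noteq> {}"
    using C(3) dense_intersects_open[of T C] by blast
  then show ?thesis by (intro that[OF C(1,2)]) blast
qed

lemma polish_prod:
  assumes "polish_topology S" "polish_topology T"
  shows "polish_topology (prod_topology S T)"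
proof -
  obtain C where C: "countable C" "C \<subseteq> topspace S" "\<And>U. openin S U \<Longrightarrow> U \<noteq> {} \<Longrightarrow> C \<inter> U \<noteq> {}"
    using assms(1) separable_space_denseE unfolding polish_topology_def by blast
  obtain D where D: "countable D" "D \<subseteq> topspace T" "\<And>U. openin T U \<Longrightarrow> U \<noteq> {} \<Longrightarrow> D \<inter> U \<noteq> {}"
    using assms(2) separable_space_denseE unfolding polish_topology_def by blast
  have "separable_space (prod_topology S T)"
  proof (rule separable_space_denseI)
    show "countable (C \<times> D)" using C D by blast
    show "C \<times> D \<subseteq> topspace (prod_topology S T)" using C D by auto
    fix U assume U: "openin (prod_topology S T) U" "U \<noteq> {}"
    then obtain x y where "(x, y) \<in> U" by auto
    then obtain V W where "openin S V" "openin T W" "x \<in> V" "y \<in> W" "V \<times> W \<subseteq> U"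
      using U(1) unfolding openin_prod_topology_alt by meson
    then show "C \<times> D \<inter> U \<noteq> {}" using C(3)[of V] D(3)[of W] by blast
  qed
  then show ?thesis using assms by (simp add: polish_topology_def completely_metrizable_space_prod_topology)
qed

lemma polish_discrete: "countable U \<Longrightarrow> polish_topology (discrete_topology U)"
  by (simp add: polish_topology_def completely_metrizable_space_discrete_topology separable_space_discrete_topology)

lemma polish_product:
  fixes T :: "nat \<Rightarrow> 'b topology"
  assumes T: "\<And>n. polish_topology (T n)" and ne: "\<And>n. topspace (T n) \<noteq> {}"
  shows "polish_topology (product_topology T UNIV)"
proof -
  have "\<exists>C. countable C \<and> C \<subseteq> topspace (T n) \<and> (\<forall>U. openin (T n) U \<longrightarrow> U \<noteq> {} \<longrightarrow> C \<inter> U \<noteq> {})" for n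
  proof -
    have "separable_space (T n)" using T[of n] by (simp add: polish_topology_def)
    then show ?thesis by (rule separable_space_denseE) blast
  qed
  then have "\<forall>n. \<exists>C. countable C \<and> C \<subseteq> topspace (T n) \<and> (\<forall>U. openin (T n) U \<longrightarrow> U \<noteq> {} \<longrightarrow> C \<inter> U \<noteq> {})" by (rule allI)
  then obtain C where "\<forall>n. countable (C n) \<and> C n \<subseteq> topspace (T n) \<and> (\<forall>U. openin (T n) U \<longrightarrow> U \<noteq> {} \<longrightarrow> C n \<inter> U \<noteq> {})"
    unfolding choice_iff by (rule exE)
  then have C: "\<And>n. countable (C n)" "\<And>n. C n \<subseteq> topspace (T n)"
    "\<And>n U. openin (T n) U \<Longrightarrow> U \<noteq> {} \<Longrightarrow> C n \<inter> U \<noteq> {}" by simp_all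
  have "C n \<noteq> {}" for n using C(3)[OF openin_topspace ne, of n] by blast
  define c where "c n = (SOME x. x \<in> C n)" for n
  have c: "c n \<in> C n" for n unfolding c_def using \<open>\<And>n. C n \<noteq> {}\<close>[of n] by (intro some_in_eq[THEN iffD2])
  \<comment> \<open>All sequences from the dense sets could be uncountably many; ending in the
    default \<open>c\<close> keeps the dense set countable.\<close>
  define E where "E = (\<Union>N. (\<lambda>f n. if n < N then f n else c n) ` PiE {..<N} C)"
  have "separable_space (product_topology T UNIV)"
  proof (rule separable_space_denseI)
    show "countable E" unfolding E_def using C(1) by (intro countable_UN countable_image countable_PiE) auto
    show "E \<subseteq> topspace (product_topology T UNIV)"
    proof
      fix h assume "h \<in> E"
      then obtain N f where f: "f \<in> PiE {..<N} C" "h = (\<lambda>n. if n < N then f n else c n)" unfolding E_def by blast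
      have "h n \<in> C n" for n using f c[of n] by (auto simp: PiE_iff)
      then have "h n \<in> topspace (T n)" for n using C(2)[of n] by blast
      then show "h \<in> topspace (product_topology T UNIV)" by (simp add: PiE_iff)
    qed
    fix U assume U: "openin (product_topology T UNIV) U" "U \<noteq> {}"
    then obtain x where "x \<in> U" by auto
    then obtain V where V: "finite {i. V i \<noteq> topspace (T i)}" "\<And>i. openin (T i) (V i)" "x \<in> PiE UNIV V" "PiE UNIV V \<subseteq> U"
      using U(1) unfolding openin_product_topology_alt by auto
    obtain N where N: "\<And>i. V i \<noteq> topspace (T i) \<Longrightarrow> i < N"
      using V(1) unfolding finite_nat_set_iff_bounded by blast
    have ne': "C i \<inter> V i \<noteq> {}" for i
    proof (rule C(3)[OF V(2)])
      show "V i \<noteq> {}" using V(3) by (auto simp: PiE_iff)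
    qed
    define f where "f i = (SOME x. x \<in> C i \<inter> V i)" for i
    have f: "f i \<in> C i \<inter> V i" for i unfolding f_def using ne'[of i] by (intro some_in_eq[THEN iffD2])
    define g where "g n = (if n < N then restrict f {..<N} n else c n)" for n
    have "g \<in> E" unfolding E_def g_def using f by (intro UN_I[of N] image_eqI[of _ _ "restrict f {..<N}"]) auto
    moreover have "g i \<in> V i" for i
    proof (cases "i < N")
      case False
      then have "V i = topspace (T i)" using N by blast
      then show ?thesis using False c C(2) by (auto simp: g_def)
    qed (use f in \<open>simp add: g_def\<close>)
    ultimately show "E \<inter> U \<noteq> {}" using V(4) by (auto simp: PiE_iff)
  qed
  moreover have "completely_metrizable_space (product_topology T UNIV)"
    unfolding completely_metrizable_space_product_topology using T by (auto simp: polish_topology_def)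
  ultimately show ?thesis by (simp add: polish_topology_def)
qed

lemma analyticE:
  assumes "analytic_in Y A"
  obtains Z :: "(nat \<Rightarrow> real) topology" and f where "polish_topology Z" "continuous_map Z Y f" "f ` topspace Z = A"
  using assms unfolding analytic_in_def by blast

lemma analytic_image:
  assumes "analytic_in Y A" "continuous_map (subtopology Y A) Y' g"
  shows "analytic_in Y' (g ` A)"
proof -
  obtain Z :: "(nat \<Rightarrow> real) topology" and f where Z: "polish_topology Z" "continuous_map Z Y f" "f ` topspace Z = A"
    using assms(1) by (rule analyticE)
  have "continuous_map Z (subtopology Y A) f" using Z by (auto simp: continuous_map_in_subtopology)
  then have "continuous_map Z Y' (g \<circ> f)" using assms(2) by (rule continuous_map_compose)
  from analytic_inI[OF Z(1) this] show ?thesis unfolding Z(3)[symmetric] by (simp add: image_image)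
qed

lemma analytic_Times:
  assumes "analytic_in Y A" "analytic_in Y' B"
  shows "analytic_in (prod_topology Y Y') (A \<times> B)"
proof -
  obtain Z :: "(nat \<Rightarrow> real) topology" and f where Z: "polish_topology Z" "continuous_map Z Y f" "f ` topspace Z = A"
    using assms(1) by (rule analyticE)
  obtain Z' :: "(nat \<Rightarrow> real) topology" and f' where Z': "polish_topology Z'" "continuous_map Z' Y' f'" "f' ` topspace Z' = B"
    using assms(2) by (rule analyticE)
  have "continuous_map (prod_topology Z Z') (prod_topology Y Y') (\<lambda>(x, y). (f x, f' y))"
    using continuous_map_prod_top Z Z' by blast
  from analytic_inI[OF polish_prod[OF Z(1) Z'(1)] this]
  show ?thesis using Z(3) Z'(3) by (simp add: map_prod_def[symmetric] map_prod_image)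
qed

lemma analytic_Int_closed:
  assumes "analytic_in Y A" "closedin Y C"
  shows "analytic_in Y (A \<inter> C)"
proof -
  obtain Z :: "(nat \<Rightarrow> real) topology" and f where Z: "polish_topology Z" "continuous_map Z Y f" "f ` topspace Z = A"
    using assms(1) by (rule analyticE)
  let ?S = "{z \<in> topspace Z. f z \<in> C}"
  have "closedin Z ?S" using closedin_continuous_map_preimage[OF Z(2) assms(2)] .
  then have "polish_topology (subtopology Z ?S)" using polish_subtopology Z(1) by blast
  moreover have "continuous_map (subtopology Z ?S) Y f" using Z(2) continuous_map_from_subtopology by blast
  ultimately have "analytic_in Y (f ` topspace (subtopology Z ?S))" by (rule analytic_inI)
  moreover have "f ` topspace (subtopology Z ?S) = A \<inter> C" using Z(3) by auto
  ultimately show ?thesis by simp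
qed

lemma analytic_empty: "analytic_in Y {}"
proof -
  have "analytic_in Y (undefined ` topspace (discrete_topology ({} :: nat set)))"
    by (rule analytic_inI[OF polish_discrete]) (simp_all add: continuous_map_def)
  then show ?thesis by simp
qed

text \<open>A parameter is an index \<open>n\<close> together with a point of the product of all
  parameter spaces, of which only coordinate \<open>n\<close> is read; this avoids a disjoint sum of
  spaces. Empty members are replaced by a nonempty one, as an empty factor would make the product
  empty.\<close>

lemma analytic_UN_nat:
  fixes A :: "nat \<Rightarrow> 'b set"
  assumes "\<And>n. analytic_in Y (A n)"
  shows "analytic_in Y (\<Union>n. A n)"
proof (cases "\<exists>n. A n \<noteq> {}")
  case True
  then obtain m where m: "A m \<noteq> {}" by blast
  define B where "B n = (if A n = {} then A m else A n)" for n
  have B: "\<And>n. analytic_in Y (B n)" "\<And>n. B n \<noteq> {}" "(\<Union>n. B n) = (\<Union>n. A n)"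
    using assms m by (auto simp: B_def split: if_splits)
  have "\<forall>n. \<exists>(Z :: (nat \<Rightarrow> real) topology) f. polish_topology Z \<and> continuous_map Z Y f \<and> f ` topspace Z = B n"
    using B(1) unfolding analytic_in_def by blast
  then obtain Z :: "nat \<Rightarrow> (nat \<Rightarrow> real) topology" and f
    where "\<forall>n. polish_topology (Z n) \<and> continuous_map (Z n) Y (f n) \<and> f n ` topspace (Z n) = B n"
    unfolding choice_iff by (elim exE)
  then have Z: "\<And>n. polish_topology (Z n)" "\<And>n. continuous_map (Z n) Y (f n)" "\<And>n. f n ` topspace (Z n) = B n"
    by simp_all
  let ?P = "prod_topology (discrete_topology (UNIV :: nat set)) (product_topology Z UNIV)"
  have ne: "topspace (Z n) \<noteq> {}" for n
  proof
    assume e: "topspace (Z n) = {}"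
    show False using Z(3)[of n, unfolded e] B(2)[of n] by simp
  qed
  have P: "polish_topology ?P"
    using ne Z(1) by (intro polish_prod polish_discrete polish_product) auto
  have "continuous_map ?P Y (\<lambda>(n, z). f n (z n))"
  proof -
    have c: "continuous_map (product_topology Z UNIV) Y (\<lambda>z. f n (z n))" for n
    proof -
      have "continuous_map (product_topology Z UNIV) (Z n) (\<lambda>z. z n)" by (rule continuous_map_product_projection) simp
      from continuous_map_compose[OF this Z(2)] show ?thesis by (simp add: o_def)
    qed
    show ?thesis
      unfolding continuous_map_def
    proof (rule conjI, goal_cases)
      case 1
      show "(\<lambda>(n, z). f n (z n)) \<in> topspace ?P \<rightarrow> topspace Y"
        using c unfolding continuous_map_def by auto
    next
      case 2
      show ?case
      proof (intro allI impI)
      fix U assume U: "openin Y U"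
      have eq: "{x \<in> topspace ?P. (case x of (n, z) \<Rightarrow> f n (z n)) \<in> U}
          = \<Union>(range (\<lambda>n. {n} \<times> {z \<in> topspace (product_topology Z UNIV). f n (z n) \<in> U}))" by auto
      have "openin (product_topology Z UNIV) {z \<in> topspace (product_topology Z UNIV). f n (z n) \<in> U}" for n
        using c[of n] U unfolding continuous_map_def by blast
      then show "openin ?P {x \<in> topspace ?P. (case x of (n, z) \<Rightarrow> f n (z n)) \<in> U}"
        unfolding eq by (intro openin_Union) (auto simp: openin_prod_Times_iff)
      qed
    qed
  qed
  from analytic_inI[OF P this] have "analytic_in Y ((\<lambda>(n, z). f n (z n)) ` topspace ?P)" .
  moreover have "(\<lambda>(n, z). f n (z n)) ` topspace ?P = (\<Union>n. B n)"
  proof (intro equalityI subsetI)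
    fix y assume "y \<in> (\<lambda>(n, z). f n (z n)) ` topspace ?P"
    then obtain n z where z: "z \<in> topspace (product_topology Z UNIV)" "y = f n (z n)" by auto
    have "z n \<in> topspace (Z n)" using z(1) by (simp add: PiE_iff)
    then have "y \<in> B n" unfolding z(2) Z(3)[of n, symmetric] by (rule imageI)
    then show "y \<in> (\<Union>n. B n)" by blast
  next
    fix y assume "y \<in> (\<Union>n. B n)"
    then obtain n where "y \<in> B n" by blast
    then obtain w where w: "w \<in> topspace (Z n)" "y = f n w" using Z(3)[of n] by auto
    define e where "e k = (SOME x. x \<in> topspace (Z k))" for k
    have "e k \<in> topspace (Z k)" for k unfolding e_def using ne[of k] by (intro some_in_eq[THEN iffD2])
    then have "(n, e(n := w)) \<in> topspace ?P" using w by (auto simp: PiE_iff)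
    then show "y \<in> (\<lambda>(n, z). f n (z n)) ` topspace ?P" using w by (intro image_eqI[of _ _ "(n, e(n := w))"]) auto
  qed
  ultimately show ?thesis using B(3) by simp
qed (simp add: analytic_empty)

lemma analytic_UN:
  assumes "countable I" "\<And>i. i \<in> I \<Longrightarrow> analytic_in Y (A i)"
  shows "analytic_in Y (\<Union>i\<in>I. A i)"
proof (cases "I = {}")
  case False
  have "(\<Union>i\<in>I. A i) = (\<Union>n. A (from_nat_into I n))"
    using range_from_nat_into[OF False assms(1)] by (metis UN_simps(10))
  then show ?thesis using analytic_UN_nat[of Y "\<lambda>n. A (from_nat_into I n)"] assms(2) from_nat_into[OF False] by simp
qed (simp add: analytic_empty)

text \<open>The parameters are sequences on which all maps \<open>f n\<close> take one value; in a
  Hausdorff space this is a closed condition on the product.\<close>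

lemma analytic_INT:
  fixes A :: "nat \<Rightarrow> 'b set"
  assumes Y: "Hausdorff_space Y" and A: "\<And>n. analytic_in Y (A n)"
  shows "analytic_in Y (\<Inter>n. A n)"
proof (cases "\<exists>n. A n = {}")
  case True
  then have "(\<Inter>n. A n) = {}" by auto
  then show ?thesis by (simp add: analytic_empty)
next
  case False
  have "\<forall>n. \<exists>(Z :: (nat \<Rightarrow> real) topology) f. polish_topology Z \<and> continuous_map Z Y f \<and> f ` topspace Z = A n"
    using A unfolding analytic_in_def by blast
  then obtain Z :: "nat \<Rightarrow> (nat \<Rightarrow> real) topology" and f
    where "\<forall>n. polish_topology (Z n) \<and> continuous_map (Z n) Y (f n) \<and> f n ` topspace (Z n) = A n"
    unfolding choice_iff by (elim exE)
  then have Z: "\<And>n. polish_topology (Z n)" "\<And>n. continuous_map (Z n) Y (f n)" "\<And>n. f n ` topspace (Z n) = A n"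
    by simp_all
  let ?P = "product_topology Z UNIV"
  have ne: "topspace (Z n) \<noteq> {}" for n
  proof
    assume e: "topspace (Z n) = {}"
    show False using Z(3)[of n, unfolded e] False by auto
  qed
  have P: "polish_topology ?P" using ne Z(1) by (intro polish_product) auto
  have c: "continuous_map ?P Y (\<lambda>z. f n (z n))" for n
  proof -
    have "continuous_map ?P (Z n) (\<lambda>z. z n)" by (rule continuous_map_product_projection) simp
    from continuous_map_compose[OF this Z(2)] show ?thesis by (simp add: o_def)
  qed
  let ?S = "topspace ?P \<inter> (\<Inter>n. {z \<in> topspace ?P. f n (z n) = f 0 (z 0)})"
  have "closedin ?P {z \<in> topspace ?P. f n (z n) = f 0 (z 0)}" for n
    by (rule closedin_continuous_maps_eq[OF Y c c])
  then have "closedin ?P ?S" by (intro closedin_Int closedin_topspace closedin_INT) auto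
  then have "analytic_in Y ((\<lambda>z. f 0 (z 0)) ` topspace (subtopology ?P ?S))"
    using polish_subtopology[OF P] continuous_map_from_subtopology[OF c] by (intro analytic_inI) auto
  moreover have "(\<lambda>z. f 0 (z 0)) ` topspace (subtopology ?P ?S) = (\<Inter>n. A n)"
  proof (intro equalityI subsetI)
    fix y assume "y \<in> (\<lambda>z. f 0 (z 0)) ` topspace (subtopology ?P ?S)"
    then obtain z where z: "z \<in> topspace ?P" "\<And>n. f n (z n) = f 0 (z 0)" "y = f 0 (z 0)" by auto
    show "y \<in> (\<Inter>n. A n)"
    proof
      fix n
      have "z n \<in> topspace (Z n)" using z(1) by (simp add: PiE_iff)
      then show "y \<in> A n" unfolding z(3) z(2)[of n, symmetric] Z(3)[of n, symmetric] by (rule imageI)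
    qed
  next
    fix y assume "y \<in> (\<Inter>n. A n)"
    then have "y \<in> f n ` topspace (Z n)" for n unfolding Z(3) by blast
    then have "\<forall>n. \<exists>w. w \<in> topspace (Z n) \<and> y = f n w" by blast
    then obtain z where "\<forall>n. z n \<in> topspace (Z n) \<and> y = f n (z n)" unfolding choice_iff by (rule exE)
    then show "y \<in> (\<lambda>z. f 0 (z 0)) ` topspace (subtopology ?P ?S)" by (intro image_eqI[of _ _ z]) (auto simp: PiE_iff)
  qed
  ultimately show ?thesis by simp
qed

text \<open>Function spaces over a compact set, with the metric of uniform convergence.\<close>

definition CK :: "'b::metric_space set \<Rightarrow> 'a::metric_space set \<Rightarrow> ('b \<Rightarrow> 'a) set" where
  "CK K U = {f \<in> extensional K. continuous_on K f \<and> f ` K \<subseteq> U}"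

text \<open>The target is the whole type with its given metric, so that loops and homotopies in
  different subsets live in one space.\<close>

definition CT :: "'b::metric_space set \<Rightarrow> ('b \<Rightarrow> 'a::metric_space) metric" where
  "CT K = cfunspace (top_of_set K) euclidean_metric"

lemma mspace_CT:
  fixes K :: "'b::metric_space set"
  assumes "compact K" shows "mspace (CT K :: ('b \<Rightarrow> 'a::metric_space) metric) = CK K UNIV"
proof -
  have "Metric_space.mbounded UNIV dist (f ` K)" if "continuous_on K f" for f :: "'b \<Rightarrow> 'a"
    using compact_continuous_image[OF that assms]
    by (metis Met_TC.compactin_imp_mbounded mtopology_is_euclidean compactin_euclidean_iff)
  then show ?thesis by (auto simp: CT_def CK_def)
qed

lemma mdist_CT_le: "0 \<le> B \<Longrightarrow> (\<And>t. t \<in> K \<Longrightarrow> dist (f t) (g t) \<le> B) \<Longrightarrow> mdist (CT K) f g \<le> B"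
  unfolding CT_def using mdist_cfunspace_le[of B "top_of_set K" euclidean_metric f g] by simp

lemma dist_le_mdist_CT:
  assumes "compact K" "f \<in> CK K UNIV" "g \<in> CK K UNIV" "t \<in> K"
  shows "dist (f t) (g t) \<le> mdist (CT K) f g"
proof -
  have "f \<in> mspace (CT K)" "g \<in> mspace (CT K)" using assms mspace_CT[OF assms(1)] by auto
  then have "mdist euclidean_metric (f t) (g t) \<le> mdist (CT K) f g"
    unfolding CT_def by (rule mdist_cfunspace_imp_mdist_le) (use assms in auto)
  then show ?thesis by simp
qed

lemma compact_ball_cover:
  fixes K :: "'b::metric_space set"
  assumes "compact K" "\<And>s. s \<in> K \<Longrightarrow> 0 < r s"
  shows "\<exists>F. finite F \<and> F \<subseteq> K \<and> K \<subseteq> (\<Union>s\<in>F. ball s (r s))"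
proof -
  have "\<And>s. s \<in> K \<Longrightarrow> open (ball s (r s))" by simp
  moreover have "K \<subseteq> (\<Union>s\<in>K. ball s (r s))" using assms(2) by force
  ultimately show ?thesis using compactE_image[OF assms(1), of K "\<lambda>s. ball s (r s)"] by metis
qed

lemma finite_positive_lower_bound:
  fixes r :: "'b \<Rightarrow> real"
  assumes "finite F" "\<And>s. s \<in> F \<Longrightarrow> 0 < r s"
  shows "\<exists>e>0. \<forall>s\<in>F. e \<le> r s"
  using assms
proof (induction F)
  case empty
  then show ?case by (intro exI[of _ 1]) auto
next
  case (insert a F)
  then obtain e where "0 < e" "\<forall>s\<in>F. e \<le> r s" by auto
  then show ?case using insert by (intro exI[of _ "min e (r a)"]) auto
qed

lemma continuous_into_metricD:
  assumes m: "Metric_space U d" "top_of_set U = Metric_space.mtopology U d"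
    and f: "continuous_on K f" "f ` K \<subseteq> U" and s: "s \<in> K" and e: "0 < e"
  shows "\<exists>r>0. \<forall>t\<in>K. dist s t < r \<longrightarrow> d (f s) (f t) < e"
proof -
  interpret Metric_space U d by (rule m(1))
  have fs: "f s \<in> U" using f(2) s by blast
  have "openin (top_of_set U) (mball (f s) e)" unfolding m(2) by (rule openin_mball)
  moreover have "f \<in> K \<rightarrow> U" using f(2) by blast
  ultimately have "openin (top_of_set K) (K \<inter> f -` mball (f s) e)"
    using f(1) continuous_on_open_gen[of f K U] by blast
  moreover have "s \<in> K \<inter> f -` mball (f s) e" using s fs e by simp
  ultimately obtain r where r: "0 < r" "ball s r \<inter> K \<subseteq> K \<inter> f -` mball (f s) e"
    unfolding openin_contains_ball by blast
  have "d (f s) (f t) < e" if "t \<in> K" "dist s t < r" for t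
  proof -
    have "t \<in> ball s r \<inter> K" using that by simp
    then have "f t \<in> mball (f s) e" using r(2) by blast
    then show ?thesis by simp
  qed
  then show ?thesis using r(1) by blast
qed

text \<open>For each precision, modulus of continuity and assignment of points of \<open>D\<close>
  to a finite net, one fitting member of \<open>CK K U\<close> is chosen, if there is any. Choosing
  among existing functions replaces interpolation, which a general metric space does not
  offer.\<close>

lemma separable_CK:
  fixes K :: "'b::metric_space set" and U :: "'a::metric_space set"
  assumes K: "compact K" and m: "Metric_space U d" "top_of_set U = Metric_space.mtopology U d"
    and sep: "separable_space (top_of_set U)"
  shows "\<exists>C. countable C \<and> C \<subseteq> CK K U \<and> (\<forall>f\<in>CK K U. \<forall>e>0. \<exists>g\<in>C. \<forall>t\<in>K. d (f t) (g t) < e)"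
proof -
  interpret Metric_space U d by (rule m(1))
  obtain D where D: "countable D" "D \<subseteq> topspace (top_of_set U)" "\<And>V. openin (top_of_set U) V \<Longrightarrow> V \<noteq> {} \<Longrightarrow> D \<inter> V \<noteq> {}"
    using separable_space_denseE[OF sep] by metis
  have DU: "D \<subseteq> U" using D(2) by simp
  have dense: "\<exists>c\<in>D. d u c < e" if "u \<in> U" "0 < e" for u e
  proof -
    have "openin (top_of_set U) (mball u e)" unfolding m(2) by (rule openin_mball)
    moreover have "mball u e \<noteq> {}" using that by auto
    ultimately have "D \<inter> mball u e \<noteq> {}" by (rule D(3))
    then show ?thesis by auto
  qed
  have "\<forall>m. \<exists>N. finite N \<and> N \<subseteq> K \<and> K \<subseteq> (\<Union>s\<in>N. ball s (inverse (real (Suc m))))"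
    using compact_ball_cover[OF K] by simp
  then obtain N where N: "\<forall>m. finite (N m) \<and> N m \<subseteq> K \<and> K \<subseteq> (\<Union>s\<in>N m. ball s (inverse (real (Suc m))))"
    unfolding choice_iff by (rule exE)
  define good where "good n m \<sigma> g \<longleftrightarrow> g \<in> CK K U
      \<and> (\<forall>s\<in>K. \<forall>t\<in>K. dist s t < inverse (real (Suc m)) \<longrightarrow> d (g s) (g t) < inverse (real (Suc n)))
      \<and> (\<forall>k\<in>N m. d (g k) (\<sigma> k) < inverse (real (Suc n)))" for n m \<sigma> g
  define I where "I = (SIGMA nm:UNIV. {\<sigma> \<in> PiE (N (snd nm)) (\<lambda>_. D). \<exists>g. good (fst nm) (snd nm) \<sigma> g})"
  define G where "G = (\<lambda>(nm, \<sigma>). SOME g. good (fst nm) (snd nm) \<sigma> g)"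
  have "countable I"
  proof -
    have "countable (SIGMA nm:(UNIV :: (nat \<times> nat) set). PiE (N (snd nm)) (\<lambda>_. D))"
      using N D(1) by (intro countable_SIGMA countable_PiE) auto
    then show ?thesis by (rule countable_subset[rotated]) (auto simp: I_def)
  qed
  moreover have G: "good (fst nm) (snd nm) \<sigma> (G (nm, \<sigma>))" if "(nm, \<sigma>) \<in> I" for nm \<sigma>
  proof -
    have "\<exists>g. good (fst nm) (snd nm) \<sigma> g" using that unfolding I_def by auto
    from someI_ex[OF this] show ?thesis by (simp add: G_def)
  qed
  have "G ` I \<subseteq> CK K U"
  proof
    fix g assume "g \<in> G ` I"
    then obtain nm \<sigma> where "(nm, \<sigma>) \<in> I" "g = G (nm, \<sigma>)" by auto
    then show "g \<in> CK K U" using G by (simp add: good_def)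
  qed
  moreover have "\<exists>g\<in>G ` I. \<forall>t\<in>K. d (f t) (g t) < e" if f: "f \<in> CK K U" and e: "0 < e" for f e
  proof -
    have fc: "continuous_on K f" "f ` K \<subseteq> U" using f by (auto simp: CK_def)
    \<comment> \<open>Four errors add up: \<open>f\<close> between \<open>t\<close> and a net point,
      the approximations of \<open>f\<close> and of \<open>g\<close> by \<open>\<sigma>\<close>
      there, and \<open>g\<close> back to \<open>t\<close>.\<close>
    obtain n where n: "inverse (real (Suc n)) < e / 4" using reals_Archimedean[of "e / 4"] e by auto
    define \<eta> where "\<eta> = inverse (real (Suc n))"
    have \<eta>: "0 < \<eta>" "4 * \<eta> < e" using n by (auto simp: \<eta>_def)
    have "\<forall>s\<in>K. \<exists>r>0. \<forall>t\<in>K. dist s t < r \<longrightarrow> d (f s) (f t) < \<eta> / 2"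
      using \<eta> by (intro ballI continuous_into_metricD[OF m fc]) simp_all
    then obtain r where r: "\<forall>s\<in>K. 0 < r s \<and> (\<forall>t\<in>K. dist s t < r s \<longrightarrow> d (f s) (f t) < \<eta> / 2)"
      unfolding bchoice_iff by (rule exE)
    obtain P where P: "finite P" "P \<subseteq> K" "K \<subseteq> (\<Union>s\<in>P. ball s (r s / 2))"
      using compact_ball_cover[OF K, of "\<lambda>s. r s / 2"] r by auto
    obtain \<delta> where \<delta>: "0 < \<delta>" "\<forall>s\<in>P. \<delta> \<le> r s / 2"
      using finite_positive_lower_bound[OF P(1), of "\<lambda>s. r s / 2"] r P(2) by auto
    have uc: "d (f s) (f t) < \<eta>" if "s \<in> K" "t \<in> K" "dist s t < \<delta>" for s t
    proof -
      have "s \<in> (\<Union>s\<in>P. ball s (r s / 2))" using P(3) that(1) by blast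
      then obtain q where q: "q \<in> P" "dist q s < r q / 2" by auto
      have "q \<in> K" using q P by auto
      have "dist q t \<le> dist q s + dist s t" by (rule dist_triangle)
      also have "\<dots> < r q" using q \<delta> that(3) by fastforce
      finally have "d (f q) (f t) < \<eta> / 2" using r \<open>q \<in> K\<close> that(2) by blast
      moreover have "d (f q) (f s) < \<eta> / 2" using r \<open>q \<in> K\<close> that(1) q \<delta>(1) by fastforce
      moreover have "d (f s) (f t) \<le> d (f s) (f q) + d (f q) (f t)"
        using fc(2) \<open>q \<in> K\<close> that by (intro triangle) auto
      ultimately show ?thesis using commute[of "f s" "f q"] by linarith
    qed
    obtain m where m': "inverse (real (Suc m)) < \<delta>" using reals_Archimedean[OF \<delta>(1)] by auto
    have "\<forall>k\<in>N m. \<exists>c. c \<in> D \<and> d (f k) c < \<eta>"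
    proof
      fix k assume "k \<in> N m"
      then have "f k \<in> U" using N fc(2) by blast
      then show "\<exists>c. c \<in> D \<and> d (f k) c < \<eta>" using dense \<eta> by blast
    qed
    then obtain \<sigma> where \<sigma>: "\<forall>k\<in>N m. \<sigma> k \<in> D \<and> d (f k) (\<sigma> k) < \<eta>" unfolding bchoice_iff by (rule exE)
    have "good n m (restrict \<sigma> (N m)) f"
      unfolding good_def \<eta>_def[symmetric] using f \<sigma> uc m' by auto
    then have I: "((n, m), restrict \<sigma> (N m)) \<in> I" using \<sigma> unfolding I_def by auto
    define g where "g = G ((n, m), restrict \<sigma> (N m))"
    have g: "good n m (restrict \<sigma> (N m)) g" using G[OF I] by (simp add: g_def)
    have gc: "g ` K \<subseteq> U" using g by (auto simp: good_def CK_def)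
    have "d (f t) (g t) < e" if t: "t \<in> K" for t
    proof -
      have "t \<in> (\<Union>s\<in>N m. ball s (inverse (real (Suc m))))" using N t by blast
      then obtain k where k: "k \<in> N m" "dist k t < inverse (real (Suc m))" by auto
      then have kK: "k \<in> K" using N by blast
      have U: "f t \<in> U" "f k \<in> U" "g t \<in> U" "g k \<in> U" "\<sigma> k \<in> U" using fc gc t kK \<sigma> k DU by auto
      have 1: "d (f t) (f k) < \<eta>" using uc[OF t kK] k m' by (simp add: dist_commute)
      have 2: "d (f k) (\<sigma> k) < \<eta>" using \<sigma> k by blast
      have 3: "d (g k) (\<sigma> k) < \<eta>" using g k unfolding good_def \<eta>_def by auto
      have 4: "d (g k) (g t) < \<eta>" using g k kK t unfolding good_def \<eta>_def by auto
      have "d (f t) (g t) \<le> d (f t) (f k) + d (f k) (g t)" using U by (intro triangle)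
      moreover have "d (f k) (g t) \<le> d (f k) (\<sigma> k) + d (\<sigma> k) (g t)" using U by (intro triangle)
      moreover have "d (\<sigma> k) (g t) \<le> d (\<sigma> k) (g k) + d (g k) (g t)" using U by (intro triangle)
      ultimately show ?thesis using 1 2 3 4 commute[of "\<sigma> k" "g k"] \<eta>(2) by linarith
    qed
    then show ?thesis using I g_def by blast
  qed
  ultimately show ?thesis by (intro exI[of _ "G ` I"]) (simp add: countable_image)
qed

lemma continuous_map_CT:
  fixes K :: "'b::metric_space set" and \<Phi> :: "'c \<Rightarrow> 'b \<Rightarrow> 'a::metric_space"
  assumes K: "compact K" and \<Phi>: "\<And>z. z \<in> topspace T \<Longrightarrow> \<Phi> z \<in> CK K UNIV"
    and cont: "\<And>z e. z \<in> topspace T \<Longrightarrow> 0 < e \<Longrightarrow> \<exists>V. openin T V \<and> z \<in> V \<and> (\<forall>w\<in>V. \<forall>t\<in>K. dist (\<Phi> z t) (\<Phi> w t) \<le> e)"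
  shows "continuous_map T (mtopology_of (CT K)) \<Phi>"
proof -
  interpret C: Metric_space "mspace (CT K :: ('b \<Rightarrow> 'a) metric)" "mdist (CT K)" by (rule Metric_space_mspace_mdist)
  show ?thesis
    unfolding mtopology_of_def C.continuous_map_to_metric
  proof (intro ballI allI impI)
    fix z and e :: real assume z: "z \<in> topspace T" and e: "0 < e"
    obtain V where V: "openin T V" "z \<in> V" "\<forall>w\<in>V. \<forall>t\<in>K. dist (\<Phi> z t) (\<Phi> w t) \<le> e / 2"
      using cont[OF z, of "e / 2"] e by auto
    have "\<Phi> w \<in> C.mball (\<Phi> z) e" if w: "w \<in> V" for w
    proof -
      have "w \<in> topspace T" using openin_subset[OF V(1)] w by blast
      moreover have "mdist (CT K) (\<Phi> z) (\<Phi> w) \<le> e / 2" using V(3) w e by (intro mdist_CT_le) auto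
      moreover have "\<Phi> z \<in> mspace (CT K)" "\<Phi> w \<in> mspace (CT K)"
        unfolding mspace_CT[OF K] using \<Phi>[OF z] \<Phi>[OF \<open>w \<in> topspace T\<close>] by auto
      ultimately show ?thesis unfolding C.in_mball using e by (intro conjI) auto
    qed
    then show "\<exists>U. openin T U \<and> z \<in> U \<and> (\<forall>y\<in>U. \<Phi> y \<in> C.mball (\<Phi> z) e)" using V by blast
  qed
qed

text \<open>The ambient metric need not be complete on \<open>U\<close>. With a complete metric
  \<open>d\<close> of \<open>U\<close> the same functions form a Polish space \<open>S\<close>, and
  the identity from it into \<open>CT K\<close> is continuous, which presents \<open>CK K U\<close>
  as an image.\<close>

lemma analytic_CK:
  fixes K :: "'b::metric_space set" and U :: "'a::metric_space set"
  assumes K: "compact K" and U: "polish_topology (top_of_set U)"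
  shows "analytic_in (mtopology_of (CT K)) (CK K U)"
proof -
  obtain M d where Md: "Metric_space M d" "Metric_space.mcomplete M d" "top_of_set U = Metric_space.mtopology M d"
    using U unfolding polish_topology_def completely_metrizable_space_def by blast
  interpret M: Metric_space M d by (rule Md(1))
  have "M = U" using arg_cong[OF Md(3), of topspace] by simp
  note m = Md(1,3)[unfolded \<open>M = U\<close>]
  define S where "S = cfunspace (top_of_set K) M.Self"
  have UM: "u \<in> U \<longleftrightarrow> u \<in> M" for u by (simp add: \<open>M = U\<close>)
  have ms: "mspace M.Self = U" by (rule trans[OF M.mspace_Self \<open>M = U\<close>])
  have mt: "mtopology_of M.Self = top_of_set U" using Md(3) by (simp add: mtopology_of_def)
  have "compactin (top_of_set K) (topspace (top_of_set K))" using K by (simp add: compactin_subtopology)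
  then have mS: "mspace S = CK K U"
    unfolding S_def by (subst compactin_mspace_cfunspace) (simp_all only: mt ms, auto simp: CK_def)
  interpret S: Metric_space "mspace S" "mdist S" by (rule Metric_space_mspace_mdist)
  have "mcomplete_of S" unfolding S_def by (rule M.mcomplete_cfunspace[OF Md(2)])
  then have cm: "completely_metrizable_space S.mtopology"
    using S.completely_metrizable_space_mtopology by (simp add: mcomplete_of_def)
  have Sle: "mdist S f g \<le> B" if "0 \<le> B" "\<And>t. t \<in> K \<Longrightarrow> d (f t) (g t) \<le> B" for f g B
    unfolding S_def using that by (intro mdist_cfunspace_le) auto
  have leS: "d (f t) (g t) \<le> mdist S f g" if "f \<in> mspace S" "g \<in> mspace S" "t \<in> K" for f g t
    using mdist_cfunspace_imp_mdist_le[of f "top_of_set K" M.Self g "mdist S f g" t] that by (simp add: S_def)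
  obtain C where C: "countable C" "C \<subseteq> CK K U" "\<forall>f\<in>CK K U. \<forall>e>0. \<exists>g\<in>C. \<forall>t\<in>K. d (f t) (g t) < e"
    using separable_CK[OF K m] U unfolding polish_topology_def by blast
  have "separable_space S.mtopology"
  proof (rule separable_space_denseI[OF C(1)])
    show "C \<subseteq> topspace S.mtopology" unfolding S.topspace_mtopology using C(2) mS by blast
    fix V assume V: "openin S.mtopology V" "V \<noteq> {}"
    then obtain f where f: "f \<in> V" by blast
    have fS: "f \<in> mspace S" using openin_subset[OF V(1)] f by auto
    obtain e where e: "0 < e" "S.mball f e \<subseteq> V" using V(1) f unfolding S.openin_mtopology by blast
    obtain g where g: "g \<in> C" "\<forall>t\<in>K. d (f t) (g t) < e / 2"
      using C(3)[rule_format, of f "e / 2"] fS mS e(1) by auto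
    have "mdist S f g \<le> e / 2" using g(2) e(1) by (intro Sle) auto
    moreover have "g \<in> mspace S" using g(1) C(2) mS by blast
    ultimately have "g \<in> S.mball f e" using fS e(1) unfolding S.in_mball by simp
    then show "C \<inter> V \<noteq> {}" using g(1) e(2) by blast
  qed
  with cm have pol: "polish_topology S.mtopology" by (simp add: polish_topology_def)
  have "continuous_map S.mtopology (mtopology_of (CT K)) (\<lambda>f. f)"
  proof (rule continuous_map_CT[OF K])
    fix f assume "f \<in> topspace S.mtopology"
    then have fS: "f \<in> mspace S" by simp
    then have fc: "continuous_on K f" "f ` K \<subseteq> U" using mS by (auto simp: CK_def)
    show "f \<in> CK K UNIV" using fS mS by (auto simp: CK_def)
    fix e :: real assume e: "0 < e"
    \<comment> \<open>The two metrics need not be uniformly equivalent, but along the compact image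
      of \<open>f\<close> finitely many radii suffice. The factor 2 leaves room for moving from
      \<open>f s\<close> to \<open>f t\<close>.\<close>
    have "\<forall>s\<in>K. \<exists>r>0. \<forall>u\<in>U. d (f s) u < 2 * r \<longrightarrow> dist (f s) u < e / 2"
    proof
      fix s assume s: "s \<in> K"
      have "openin (top_of_set U) (U \<inter> ball (f s) (e / 2))" by (rule openin_open_Int) simp
      moreover have "f s \<in> U \<inter> ball (f s) (e / 2)" using fc s e by auto
      ultimately obtain r where r: "0 < r" "M.mball (f s) r \<subseteq> U \<inter> ball (f s) (e / 2)"
        unfolding Md(3) M.openin_mtopology by blast
      have "dist (f s) u < e / 2" if "u \<in> U" "d (f s) u < 2 * (r / 2)" for u
      proof -
        have "u \<in> M.mball (f s) r" using that fc(2) s UM by (auto simp: image_subset_iff)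
        then show ?thesis using r(2) by auto
      qed
      then show "\<exists>r>0. \<forall>u\<in>U. d (f s) u < 2 * r \<longrightarrow> dist (f s) u < e / 2" using r(1) by (intro exI[of _ "r / 2"]) auto
    qed
    then obtain r where r: "\<forall>s\<in>K. 0 < r s \<and> (\<forall>u\<in>U. d (f s) u < 2 * r s \<longrightarrow> dist (f s) u < e / 2)"
      unfolding bchoice_iff by (rule exE)
    have "\<forall>s\<in>K. \<exists>p>0. \<forall>t\<in>K. dist s t < p \<longrightarrow> d (f s) (f t) < r s"
      using r by (intro ballI continuous_into_metricD[OF m fc]) simp_all
    then obtain p where p: "\<forall>s\<in>K. 0 < p s \<and> (\<forall>t\<in>K. dist s t < p s \<longrightarrow> d (f s) (f t) < r s)"
      unfolding bchoice_iff by (rule exE)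
    obtain P where P: "finite P" "P \<subseteq> K" "K \<subseteq> (\<Union>s\<in>P. ball s (p s))"
      using compact_ball_cover[OF K, of p] p by auto
    obtain \<delta> where \<delta>: "0 < \<delta>" "\<forall>s\<in>P. \<delta> \<le> r s" using finite_positive_lower_bound[OF P(1), of r] r P(2) by auto
    have "dist (f t) (g t) \<le> e" if g: "g \<in> S.mball f \<delta>" and t: "t \<in> K" for g t
    proof -
      have gS: "g \<in> mspace S" "mdist S f g < \<delta>" using g by auto
      have gU: "g t \<in> U" using gS(1) t mS by (auto simp: CK_def)
      have ft: "f t \<in> U" using fc t by auto
      have "t \<in> (\<Union>s\<in>P. ball s (p s))" using P(3) t by blast
      then obtain s where s: "s \<in> P" "dist s t < p s" by auto
      then have sK: "s \<in> K" "f s \<in> U" using P fc by auto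
      have 1: "d (f s) (f t) < r s" using p sK s t by blast
      have "d (f t) (g t) < \<delta>" using leS[OF fS gS(1) t] gS(2) by simp
      moreover have "\<delta> \<le> r s" using \<delta> s by blast
      moreover have "d (f s) (g t) \<le> d (f s) (f t) + d (f t) (g t)"
        using ft gU sK \<open>M = U\<close> by (intro M.triangle) auto
      ultimately have "d (f s) (g t) < 2 * r s" using 1 by linarith
      then have "dist (f s) (g t) < e / 2" using r sK gU by blast
      moreover have "dist (f s) (f t) < e / 2"
      proof -
        have "d (f s) (f t) < 2 * r s" using 1 r sK by fastforce
        then show ?thesis using r sK ft by blast
      qed
      moreover have "dist (f t) (g t) \<le> dist (f s) (f t) + dist (f s) (g t)" by (rule dist_triangle3)
      ultimately show ?thesis by linarith
    qed
    then show "\<exists>V. openin S.mtopology V \<and> f \<in> V \<and> (\<forall>g\<in>V. \<forall>t\<in>K. dist (f t) (g t) \<le> e)"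
      using fS \<delta>(1) by (intro exI[of _ "S.mball f \<delta>"]) auto
  qed
  from analytic_inI[OF pol this, unfolded S.topspace_mtopology image_ident, unfolded mS] show ?thesis .
qed

lemma topspace_CT: "compact K \<Longrightarrow> topspace (mtopology_of (CT K :: ('b::metric_space \<Rightarrow> 'a::metric_space) metric)) = CK K UNIV"
  by (simp add: mspace_CT)

lemma Hausdorff_CT: "Hausdorff_space (mtopology_of (CT K))"
  unfolding mtopology_of_def by (rule Metric_space.Hausdorff_space_mtopology) (rule Metric_space_mspace_mdist)

lemma continuous_map_eval:
  assumes K: "compact K" and t: "t \<in> K"
  shows "continuous_map (mtopology_of (CT K)) euclidean (\<lambda>f :: 'b::metric_space \<Rightarrow> 'a::metric_space. f t)"
proof -
  interpret C: Metric_space "mspace (CT K :: ('b \<Rightarrow> 'a) metric)" "mdist (CT K)" by (rule Metric_space_mspace_mdist)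
  have "continuous_map C.mtopology Met_TC.mtopology (\<lambda>f :: 'b \<Rightarrow> 'a. f t)"
    unfolding Met_TC.continuous_map_to_metric
  proof (intro ballI allI impI)
    fix f and e :: real assume f: "f \<in> topspace C.mtopology" and e: "0 < e"
    have "g t \<in> Met_TC.mball (f t) e" if g: "g \<in> C.mball f e" for g
    proof -
      have fg: "f \<in> mspace (CT K)" "g \<in> mspace (CT K)" "mdist (CT K) f g < e" using g unfolding C.in_mball by blast+
      have "dist (f t) (g t) \<le> mdist (CT K) f g"
        by (rule dist_le_mdist_CT[OF K fg(1,2)[unfolded mspace_CT[OF K]] t])
      then show ?thesis using fg(3) by simp
    qed
    then show "\<exists>V. openin C.mtopology V \<and> f \<in> V \<and> (\<forall>g\<in>V. g t \<in> Met_TC.mball (f t) e)"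
      using f e by (intro exI[of _ "C.mball f e"] conjI C.openin_mball ballI) auto
  qed
  then show ?thesis unfolding mtopology_of_def mtopology_is_euclidean .
qed

lemma closedin_CT_eq:
  fixes K :: "'b::metric_space set" and v :: "'a::metric_space"
  assumes "compact K" "s \<in> K"
  shows "closedin (mtopology_of (CT K)) {f \<in> CK K UNIV. f s = v}"
proof -
  have "closedin (mtopology_of (CT K)) {f \<in> topspace (mtopology_of (CT K)). f s = v}"
    by (rule closedin_continuous_maps_eq[OF _ continuous_map_eval[OF assms]]) simp_all
  then show ?thesis unfolding topspace_CT[OF assms(1)] .
qed

text \<open>Maps that rearrange the values of continuous functions are continuous.\<close>

lemma continuous_map_rearrange:
  fixes K :: "'b::metric_space set" and K1 :: "'c::metric_space set" and K2 :: "'d::metric_space set"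
    and \<Phi> :: "'e \<Rightarrow> 'b \<Rightarrow> 'a::metric_space"
  assumes K: "compact K" "compact K1" "compact K2"
    and p1: "continuous_map T (mtopology_of (CT K1)) p1" and p2: "continuous_map T (mtopology_of (CT K2)) p2"
    and \<Phi>: "\<And>z. z \<in> topspace T \<Longrightarrow> \<Phi> z \<in> CK K UNIV"
    and re: "\<And>t. t \<in> K \<Longrightarrow> (\<exists>v. \<forall>z\<in>topspace T. \<Phi> z t = v) \<or> (\<exists>s\<in>K1. \<forall>z\<in>topspace T. \<Phi> z t = p1 z s)
       \<or> (\<exists>s\<in>K2. \<forall>z\<in>topspace T. \<Phi> z t = p2 z s)"
  shows "continuous_map T (mtopology_of (CT K)) \<Phi>"
proof (rule continuous_map_CT[OF K(1) \<Phi>])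
  fix z and e :: real assume z: "z \<in> topspace T" and e: "0 < e"
  have nb: "\<exists>V. openin T V \<and> z \<in> V \<and> (\<forall>w\<in>V. \<forall>s\<in>L. dist (p z s) (p w s) < e)"
    if L: "compact L" and p: "continuous_map T (mtopology_of (CT L)) p" for L :: "'x::metric_space set" and p :: "'e \<Rightarrow> 'x \<Rightarrow> 'a"
  proof -
    interpret C: Metric_space "mspace (CT L :: ('x \<Rightarrow> 'a) metric)" "mdist (CT L)" by (rule Metric_space_mspace_mdist)
    obtain V where V: "openin T V" "z \<in> V" "\<forall>w\<in>V. p w \<in> C.mball (p z) e"
      using p z e unfolding mtopology_of_def C.continuous_map_to_metric by blast
    have "dist (p z s) (p w s) < e" if "w \<in> V" "s \<in> L" for w s
    proof -
      have "p w \<in> C.mball (p z) e" using V that by blast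
      then have w: "p z \<in> mspace (CT L)" "p w \<in> mspace (CT L)" "mdist (CT L) (p z) (p w) < e" unfolding C.in_mball by blast+
      have "dist (p z s) (p w s) \<le> mdist (CT L) (p z) (p w)"
        by (rule dist_le_mdist_CT[OF L w(1,2)[unfolded mspace_CT[OF L]] that(2)])
      then show ?thesis using w(3) by simp
    qed
    then show ?thesis using V by blast
  qed
  obtain V1 where V1: "openin T V1" "z \<in> V1" "\<forall>w\<in>V1. \<forall>s\<in>K1. dist (p1 z s) (p1 w s) < e" using nb[OF K(2) p1] by blast
  obtain V2 where V2: "openin T V2" "z \<in> V2" "\<forall>w\<in>V2. \<forall>s\<in>K2. dist (p2 z s) (p2 w s) < e" using nb[OF K(3) p2] by blast
  have "dist (\<Phi> z t) (\<Phi> w t) \<le> e" if w: "w \<in> V1 \<inter> V2" and t: "t \<in> K" for w t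
  proof -
    have wT: "w \<in> topspace T" using openin_subset[OF V1(1)] w by blast
    from re[OF t] show ?thesis
    proof (elim disjE exE bexE)
      fix v assume "\<forall>z\<in>topspace T. \<Phi> z t = v"
      then show ?thesis using z wT e by simp
    next
      fix s assume "s \<in> K1" "\<forall>z\<in>topspace T. \<Phi> z t = p1 z s"
      then show ?thesis using z wT V1(3) w by (simp add: less_imp_le)
    next
      fix s assume "s \<in> K2" "\<forall>z\<in>topspace T. \<Phi> z t = p2 z s"
      then show ?thesis using z wT V2(3) w by (simp add: less_imp_le)
    qed
  qed
  then show "\<exists>V. openin T V \<and> z \<in> V \<and> (\<forall>w\<in>V. \<forall>t\<in>K. dist (\<Phi> z t) (\<Phi> w t) \<le> e)"
    using V1(1,2) V2(1,2) by (intro exI[of _ "V1 \<inter> V2"]) auto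
qed

section \<open>Analytic sets of loops\<close>

lemma mtopology_loop_metric: "mtopology_of (loop_metric X x) = subtopology (mtopology_of (CT {0..1})) (loops X x)"
  by (simp add: loop_metric_def CT_def mtopology_of_submetric)

lemma analytic_in_subtopology: "analytic_in T A \<Longrightarrow> A \<subseteq> S \<Longrightarrow> analytic_in (subtopology T S) A"
  unfolding analytic_in_def by (auto simp: continuous_map_in_subtopology image_subset_iff)

lemma loops_CK: "loops U y = CK {0..1} U \<inter> {f \<in> CK {0..1} UNIV. f 0 = y} \<inter> {f \<in> CK {0..1} UNIV. f 1 = y}"
  by (auto simp: loops_def CK_def path_def path_image_def pathstart_def pathfinish_def)

lemma loops_subset_CK: "loops U y \<subseteq> CK {0..1} UNIV"
  by (auto simp: loops_CK)

lemma analytic_loops: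
  assumes "polish_topology (top_of_set U)"
  shows "analytic_in (mtopology_of (CT {0..1})) (loops U y)"
  unfolding loops_CK by (intro analytic_Int_closed analytic_CK closedin_CT_eq assms) auto

lemma is_loop_iff_restrict: "is_loop X x p \<longleftrightarrow> restrict p {0..1} \<in> loops X x"
proof -
  have "continuous_on {0..1} (restrict p {0..1}) \<longleftrightarrow> continuous_on {0..1} p" by (rule continuous_on_cong) auto
  then show ?thesis
    by (auto simp: loops_def is_loop_def path_def path_image_def pathstart_def pathfinish_def)
qed

text \<open>Pairs of a loop in \<open>T\<close> and a homotopy starting at it form an analytic set,
  and the end of the homotopy depends continuously on the pair. Homotopies are functions from the
  square to \<open>X\<close>, so \<open>analytic_CK\<close> applies to them.\<close>

lemma analytic_saturation:
  fixes X :: "'a::metric_space set"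
  assumes X: "polish_topology (top_of_set X)" and T: "analytic_in (mtopology_of (CT {0..1})) T" "T \<subseteq> loops X x"
  shows "analytic_in (mtopology_of (CT {0..1})) {q \<in> loops X x. \<exists>p\<in>T. homotopic_paths X p q}"
proof -
  let ?I = "{0..1::real}" and ?Q = "{0..1::real} \<times> {0..1::real}"
  have I: "compact ?I" and Q: "compact ?Q" by (auto intro: compact_Times)
  let ?L = "mtopology_of (CT ?I :: (real \<Rightarrow> 'a) metric)" and ?H = "mtopology_of (CT ?Q :: (real \<times> real \<Rightarrow> 'a) metric)"
  define HH where "HH = CK ?Q X \<inter> (\<Inter>t\<in>?I. {h \<in> CK ?Q UNIV. h (t, 0) = x}) \<inter> (\<Inter>t\<in>?I. {h \<in> CK ?Q UNIV. h (t, 1) = x})"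
  have "analytic_in ?H HH"
    unfolding HH_def
    by (intro analytic_Int_closed analytic_CK X Q closedin_INT closedin_CT_eq[OF Q]) auto
  then have TH: "analytic_in (prod_topology ?L ?H) (T \<times> HH)" by (rule analytic_Times[OF T(1)])
  let ?P = "prod_topology ?L ?H"
  \<comment> \<open>Agreement of the loop with the initial edge of the homotopy is tested time by
    time; each test is closed.\<close>
  define Cl where "Cl = (\<Inter>s\<in>?I. {z \<in> topspace ?P. fst z s = snd z (0, s)})"
  have cl1: "closedin ?P {z \<in> topspace ?P. fst z s = snd z (0, s)}" if s: "s \<in> ?I" for s
  proof -
    have "continuous_map ?P euclidean ((\<lambda>f. f s) \<circ> fst)"
      by (rule continuous_map_compose[OF continuous_map_fst continuous_map_eval[OF I s]])
    moreover have "continuous_map ?P euclidean ((\<lambda>f. f (0, s)) \<circ> snd)"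
      by (rule continuous_map_compose[OF continuous_map_snd continuous_map_eval[OF Q]]) (use s in auto)
    ultimately show ?thesis
      using closedin_continuous_maps_eq[of euclidean ?P "(\<lambda>f. f s) \<circ> fst" "(\<lambda>f. f (0, s)) \<circ> snd"] by simp
  qed
  have "closedin ?P Cl" unfolding Cl_def by (rule closedin_INT) (use cl1 in auto)
  then have A: "analytic_in ?P (T \<times> HH \<inter> Cl)" by (rule analytic_Int_closed[OF TH])
  define \<Phi> where "\<Phi> z = restrict (\<lambda>s. snd z (1, s)) ?I" for z :: "(real \<Rightarrow> 'a) \<times> (real \<times> real \<Rightarrow> 'a)"
  have \<Phi>_loop: "\<Phi> z \<in> loops X x" if z: "z \<in> T \<times> HH" for z
  proof -
    have h: "continuous_on ?Q (snd z)" "snd z ` ?Q \<subseteq> X" "snd z (1, 0) = x" "snd z (1, 1) = x"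
      using z by (auto simp: HH_def CK_def)
    have "continuous_on ?I (\<lambda>s. snd z (1, s))"
      by (rule continuous_on_compose2[OF h(1)]) (auto intro!: continuous_intros)
    then have "continuous_on ?I (\<Phi> z)" by (rule continuous_on_eq) (simp add: \<Phi>_def)
    then show ?thesis using h by (auto simp: loops_CK CK_def \<Phi>_def)
  qed
  have sub: "topspace (subtopology ?P (T \<times> HH \<inter> Cl)) \<subseteq> T \<times> HH" by auto
  have "continuous_map (subtopology ?P (T \<times> HH \<inter> Cl)) ?L \<Phi>"
  proof (rule continuous_map_rearrange[OF I I Q])
    show "continuous_map (subtopology ?P (T \<times> HH \<inter> Cl)) ?L fst" by (intro continuous_map_from_subtopology continuous_map_fst)
    show "continuous_map (subtopology ?P (T \<times> HH \<inter> Cl)) ?H snd" by (intro continuous_map_from_subtopology continuous_map_snd)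
    show "\<Phi> z \<in> CK ?I UNIV" if "z \<in> topspace (subtopology ?P (T \<times> HH \<inter> Cl))" for z
      using \<Phi>_loop[OF subsetD[OF sub that]] loops_subset_CK by blast
    fix t assume "t \<in> ?I"
    then have "\<exists>s\<in>?Q. \<forall>z\<in>topspace (subtopology ?P (T \<times> HH \<inter> Cl)). \<Phi> z t = snd z s"
      by (intro bexI[of _ "(1, t)"]) (auto simp: \<Phi>_def)
    then show "(\<exists>v. \<forall>z\<in>topspace (subtopology ?P (T \<times> HH \<inter> Cl)). \<Phi> z t = v) \<or>
       (\<exists>s\<in>?I. \<forall>z\<in>topspace (subtopology ?P (T \<times> HH \<inter> Cl)). \<Phi> z t = fst z s) \<or>
       (\<exists>s\<in>?Q. \<forall>z\<in>topspace (subtopology ?P (T \<times> HH \<inter> Cl)). \<Phi> z t = snd z s)" by blast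
  qed
  then have "analytic_in ?L (\<Phi> ` (T \<times> HH \<inter> Cl))" by (rule analytic_image[OF A])
  moreover have "\<Phi> ` (T \<times> HH \<inter> Cl) = {q \<in> loops X x. \<exists>p\<in>T. homotopic_paths X p q}"
  proof (intro equalityI subsetI)
    fix q assume "q \<in> \<Phi> ` (T \<times> HH \<inter> Cl)"
    then obtain p h where z: "p \<in> T" "h \<in> HH" "(p, h) \<in> Cl" "q = \<Phi> (p, h)" by auto
    have ql: "q \<in> loops X x" using \<Phi>_loop[of "(p, h)"] z by simp
    have p: "p 0 = x" "p 1 = x" using z(1) T(2) by (auto simp: loops_CK)
    have ph: "p s = h (0, s)" if "s \<in> ?I" for s using z(3) that by (auto simp: Cl_def)
    have "homotopic_paths X p q"
      unfolding homotopic_paths using z(2) ph p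
      by (intro exI[of _ h]) (auto simp: HH_def CK_def z(4) \<Phi>_def pathstart_def pathfinish_def)
    then show "q \<in> {q \<in> loops X x. \<exists>p\<in>T. homotopic_paths X p q}" using ql z(1) by blast
  next
    fix q assume "q \<in> {q \<in> loops X x. \<exists>p\<in>T. homotopic_paths X p q}"
    then obtain p where q: "q \<in> loops X x" and p: "p \<in> T" "homotopic_paths X p q" by blast
    have p01: "p 0 = x" "p 1 = x" using p(1) T(2) by (auto simp: loops_CK)
    obtain h where h: "continuous_on ?Q h" "h \<in> ?Q \<rightarrow> X" "\<forall>s\<in>?I. h (0, s) = p s" "\<forall>s\<in>?I. h (1, s) = q s"
      "\<forall>t\<in>?I. pathstart (h \<circ> Pair t) = pathstart p \<and> pathfinish (h \<circ> Pair t) = pathfinish p"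
      using p(2) unfolding homotopic_paths by blast
    let ?h = "restrict h ?Q"
    have hc: "continuous_on ?Q ?h" using h(1) by (rule continuous_on_eq) simp
    have h1: "?h \<in> CK ?Q X" using hc h(2) by (auto simp: CK_def)
    then have h2: "?h \<in> CK ?Q UNIV" by (auto simp: CK_def)
    have hH: "?h \<in> HH" using h1 h2 h(5) p01 by (auto simp: HH_def pathstart_def pathfinish_def)
    have "p \<in> CK ?I UNIV" using p(1) T(2) loops_subset_CK by blast
    then have "(p, ?h) \<in> topspace ?P" using h2 by (simp add: mspace_CT[OF I] mspace_CT[OF Q])
    then have "(p, ?h) \<in> Cl" using h(3) by (auto simp: Cl_def)
    moreover have "q = \<Phi> (p, ?h)"
    proof
      fix t show "q t = \<Phi> (p, ?h) t"
        using h(4) q by (cases "t \<in> ?I") (auto simp: \<Phi>_def loops_def extensional_def)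
    qed
    ultimately show "q \<in> \<Phi> ` (T \<times> HH \<inter> Cl)" using p(1) hH by (intro image_eqI[of _ _ "(p, ?h)"]) auto
  qed
  ultimately show ?thesis by simp
qed

text \<open>The version of \<open>pointwise_map\<close> with two arguments. The uniform distance of
  two results is at most the larger of the distances of the arguments, hence continuity.\<close>

definition rearranging :: "((real \<Rightarrow> 'a) \<Rightarrow> (real \<Rightarrow> 'a) \<Rightarrow> real \<Rightarrow> 'a) \<Rightarrow> bool" where
  "rearranging E \<longleftrightarrow> (\<forall>t\<in>{0..1}. (\<exists>v. \<forall>p q. E p q t = v) \<or> (\<exists>s\<in>{0..1}. \<forall>p q. E p q t = p s) \<or> (\<exists>s\<in>{0..1}. \<forall>p q. E p q t = q s))"

lemma rearranging_const: "rearranging (\<lambda>p q. r)" by (auto simp: rearranging_def)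
lemma rearranging_fst: "rearranging (\<lambda>p q. p)" by (auto simp: rearranging_def)
lemma rearranging_snd: "rearranging (\<lambda>p q. q)" by (auto simp: rearranging_def)

lemma rearranging_reverse: "rearranging E \<Longrightarrow> rearranging (\<lambda>p q. reversepath (E p q))"
  unfolding rearranging_def reversepath_def
proof
  fix t :: real
  assume E: "\<forall>t\<in>{0..1}. (\<exists>v. \<forall>p q. E p q t = v) \<or> (\<exists>s\<in>{0..1}. \<forall>p q. E p q t = p s) \<or> (\<exists>s\<in>{0..1}. \<forall>p q. E p q t = q s)"
    and "t \<in> {0..1}"
  then have "1 - t \<in> {0..1}" by simp
  from E[rule_format, OF this]
  show "(\<exists>v. \<forall>p q. E p q (1 - t) = v) \<or> (\<exists>s\<in>{0..1}. \<forall>p q. E p q (1 - t) = p s) \<or> (\<exists>s\<in>{0..1}. \<forall>p q. E p q (1 - t) = q s)" .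
qed

lemma rearranging_join:
  fixes E E' :: "(real \<Rightarrow> 'a::topological_space) \<Rightarrow> (real \<Rightarrow> 'a) \<Rightarrow> real \<Rightarrow> 'a"
  assumes "rearranging E" "rearranging E'"
  shows "rearranging (\<lambda>p q. E p q +++ E' p q)"
  unfolding rearranging_def
proof
  fix t :: real assume t: "t \<in> {0..1}"
  show "(\<exists>v. \<forall>p q. (E p q +++ E' p q) t = v) \<or> (\<exists>s\<in>{0..1}. \<forall>p q. (E p q +++ E' p q) t = p s) \<or> (\<exists>s\<in>{0..1}. \<forall>p q. (E p q +++ E' p q) t = q s)"
  proof (cases "t \<le> 1/2")
    case True
    then have "2 * t \<in> {0..1}" using t by auto
    from assms(1)[unfolded rearranging_def, rule_format, OF this] show ?thesis using True by (simp only: joinpaths_def if_True)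
  next
    case False
    then have "2 * t - 1 \<in> {0..1}" using t by auto
    from assms(2)[unfolded rearranging_def, rule_format, OF this] show ?thesis using False by (simp only: joinpaths_def if_False)
  qed
qed

lemma continuous_map_rearranging:
  fixes E :: "(real \<Rightarrow> 'a::metric_space) \<Rightarrow> (real \<Rightarrow> 'a) \<Rightarrow> real \<Rightarrow> 'a"
  assumes E: "rearranging E" and p: "continuous_map T (mtopology_of (CT {0..1})) p" "continuous_map T (mtopology_of (CT {0..1})) p'"
    and path: "\<And>z. z \<in> topspace T \<Longrightarrow> path (E (p z) (p' z))"
  shows "continuous_map T (mtopology_of (CT {0..1})) (\<lambda>z. restrict (E (p z) (p' z)) {0..1})"
proof (rule continuous_map_rearrange[OF _ _ _ p])
  fix z assume z: "z \<in> topspace T"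
  have "continuous_on {0..1} (restrict (E (p z) (p' z)) {0..1})"
    using path[OF z] unfolding path_def by (rule continuous_on_eq) simp
  then show "restrict (E (p z) (p' z)) {0..1} \<in> CK {0..1} UNIV" by (simp add: CK_def)
next
  fix t :: real assume t: "t \<in> {0..1}"
  from E[unfolded rearranging_def, rule_format, OF t]
  show "(\<exists>v. \<forall>z\<in>topspace T. restrict (E (p z) (p' z)) {0..1} t = v) \<or> (\<exists>s\<in>{0..1}. \<forall>z\<in>topspace T. restrict (E (p z) (p' z)) {0..1} t = p z s)
       \<or> (\<exists>s\<in>{0..1}. \<forall>z\<in>topspace T. restrict (E (p z) (p' z)) {0..1} t = p' z s)"
    unfolding restrict_apply'[OF t] by blast
qed auto

lemma analytic_rearranging:
  fixes E :: "(real \<Rightarrow> 'a::metric_space) \<Rightarrow> (real \<Rightarrow> 'a) \<Rightarrow> real \<Rightarrow> 'a"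
  assumes E: "rearranging E" and A: "analytic_in (mtopology_of (CT {0..1})) A" "analytic_in (mtopology_of (CT {0..1})) B"
    and path: "\<And>p q. p \<in> A \<Longrightarrow> q \<in> B \<Longrightarrow> path (E p q)"
  shows "analytic_in (mtopology_of (CT {0..1})) ((\<lambda>(p, q). restrict (E p q) {0..1}) ` (A \<times> B))"
proof -
  let ?L = "mtopology_of (CT {0..1} :: (real \<Rightarrow> 'a) metric)"
  let ?T = "subtopology (prod_topology ?L ?L) (A \<times> B)"
  have "continuous_map ?T ?L (\<lambda>z. restrict (E (fst z) (snd z)) {0..1})"
  proof (rule continuous_map_rearranging[OF E])
    show "continuous_map ?T ?L fst" by (intro continuous_map_from_subtopology continuous_map_fst)
    show "continuous_map ?T ?L snd" by (intro continuous_map_from_subtopology continuous_map_snd)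
    show "path (E (fst z) (snd z))" if "z \<in> topspace ?T" for z using path that by auto
  qed
  from analytic_image[OF analytic_Times[OF A] this] show ?thesis by (simp add: case_prod_unfold)
qed

section \<open>Kernels of idempotent endomorphisms that are locally inner or trivial\<close>

context tame_space
begin

lemma W_restrict: "is_loop X x p \<Longrightarrow> W (restrict p {0..1}) = W p"
  using W_homotopic[OF restrict_loop(2)] by simp

lemma W_close_up: "path_in X p \<Longrightarrow> W (close_up p) = W p"
  using W_loop[OF close_up_loop] by (simp add: W_def)

definition rep :: "(real \<Rightarrow> 'a) set \<Rightarrow> real \<Rightarrow> 'a" where
  "rep a = (SOME p. is_loop X x p \<and> W p = a)"

lemma rep:
  assumes "a \<in> carrier \<pi>"
  shows "is_loop X x (rep a) \<and> W (rep a) = a"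
proof -
  obtain p where "a = W p" "p \<in> {p. is_loop X x p}" using assms unfolding carrier_pi_W by (rule imageE)
  then have "is_loop X x p \<and> W p = a" by simp
  then show ?thesis unfolding rep_def by (rule someI[of "\<lambda>p. is_loop X x p \<and> W p = a"])
qed

lemma W_eq_homotopic: "p \<in> loops X x \<Longrightarrow> q \<in> loops X x \<Longrightarrow> W p = W q \<Longrightarrow> homotopic_paths X p q"
  using loop_class_eq_iff[of X x p q] W_loop is_loop_if_loops by metis

lemma Union_classes:
  assumes "K \<subseteq> carrier \<pi>"
  shows "\<Union>K = {q \<in> loops X x. W q \<in> K}"
proof (intro equalityI subsetI)
  fix q assume "q \<in> \<Union>K"
  then obtain a where a: "a \<in> K" "q \<in> a" by blast
  then obtain p where p: "is_loop X x p" "a = loop_class X x p" using assms by (auto simp: carrier_fundamental_group)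
  have q: "q \<in> loops X x" "homotopic_paths X p q" using a(2) p(2) by (auto simp: loop_class_def)
  have "W q = a" using W_homotopic[OF q(2)] W_loop[OF p(1)] p(2) by simp
  then show "q \<in> {q \<in> loops X x. W q \<in> K}" using q(1) a(1) by simp
next
  fix q assume q: "q \<in> {q \<in> loops X x. W q \<in> K}"
  then have l: "is_loop X x q" "path_in X q" using is_loop_if_loops is_loop_def by fastforce+
  then have "q \<in> W q" using q W_loop[OF l(1)] by (auto simp: loop_class_def)
  then show "q \<in> \<Union>K" using q by blast
qed

text \<open>Since \<open>\<rho>\<close> is idempotent, its kernel consists of the elements \<open>g \<rho>(g)\<^sup>-\<^sup>1\<close>. Writing \<open>g\<close> as a product of
  generators \<open>g = a b\<close> gives \<open>g \<rho>(g)\<^sup>-\<^sup>1 = a (b \<rho>(b)\<^sup>-\<^sup>1) \<rho>(a)\<^sup>-\<^sup>1\<close>, and on each generating piece \<open>\<rho>(a)\<close> is a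
  continuous function of a loop representing \<open>a\<close>.\<close>

theorem analytic_kernel:
  assumes pol: "polish_topology (top_of_set X)"
    and hom: "\<rho> \<in> hom \<pi> \<pi>" and idem: "\<And>a. a \<in> carrier \<pi> \<Longrightarrow> \<rho> (\<rho> a) = \<rho> a"
    and loc: "\<And>y. y \<in> X \<Longrightarrow> \<exists>V. openin (top_of_set X) V \<and> y \<in> V \<and>
      ((\<exists>D\<in>carrier \<pi>. \<forall>a\<in>local_group V y. \<rho> a = D \<otimes>\<^bsub>\<pi>\<^esub> a \<otimes>\<^bsub>\<pi>\<^esub> inv\<^bsub>\<pi>\<^esub> D) \<or> (\<forall>a\<in>local_group V y. \<rho> a = \<one>\<^bsub>\<pi>\<^esub>))"
  shows "analytic_in (mtopology_of (loop_metric X x)) (\<Union>(kernel \<pi> \<pi> \<rho>))"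
proof -
  interpret \<rho>: group_hom \<pi> \<pi> \<rho> by (unfold_locales) (rule hom)
  let ?L = "mtopology_of (CT {0..1} :: (real \<Rightarrow> 'a) metric)"
  from loc have "\<forall>y\<in>X. \<exists>V. openin (top_of_set X) V \<and> y \<in> V \<and>
      ((\<exists>D\<in>carrier \<pi>. \<forall>a\<in>local_group V y. \<rho> a = D \<otimes>\<^bsub>\<pi>\<^esub> a \<otimes>\<^bsub>\<pi>\<^esub> inv\<^bsub>\<pi>\<^esub> D) \<or> (\<forall>a\<in>local_group V y. \<rho> a = \<one>\<^bsub>\<pi>\<^esub>))" by blast
  then obtain V where V: "\<forall>y\<in>X. openin (top_of_set X) (V y) \<and> y \<in> V y \<and>
      ((\<exists>D\<in>carrier \<pi>. \<forall>a\<in>local_group (V y) y. \<rho> a = D \<otimes>\<^bsub>\<pi>\<^esub> a \<otimes>\<^bsub>\<pi>\<^esub> inv\<^bsub>\<pi>\<^esub> D) \<or> (\<forall>a\<in>local_group (V y) y. \<rho> a = \<one>\<^bsub>\<pi>\<^esub>))"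
    unfolding bchoice_iff by (rule exE)
  have VX: "V y \<subseteq> X" if "y \<in> X" for y using V that openin_subset_X by blast
  \<comment> \<open>Multiplication by \<open>W p\<close> on the left and by the inverse of
    \<open>\<rho> (W p)\<close> on the right is realised on loops. This works because
    \<open>\<rho> (W p)\<close> is trivial or represented by a fixed conjugation applied to
    \<open>p\<close> itself.\<close>
  have "\<forall>y\<in>X. \<exists>E. rearranging E \<and> (\<forall>p q. p \<in> loops (V y) y \<longrightarrow> q \<in> loops X x \<longrightarrow> is_loop X x (E p q)
      \<and> W (E p q) = W p \<otimes>\<^bsub>\<pi>\<^esub> (W q \<otimes>\<^bsub>\<pi>\<^esub> inv\<^bsub>\<pi>\<^esub> (\<rho> (W p))))"
  proof
    fix y assume y: "y \<in> X"
    define cu where "cu p = \<theta> y +++ (p +++ reversepath (\<theta> y))" for p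
    have cu: "is_loop X x (cu p)" "W (cu p) = W p" "path_in X p" "W p \<in> local_group (V y) y" if p: "p \<in> loops (V y) y" for p
    proof -
      have l: "is_loop (V y) y p" using is_loop_if_loops[OF p] .
      show pp: "path_in X p" by (rule is_loop_path_in[OF l VX[OF y]])
      have "close_up p = cu p" using l by (simp add: close_up_def cu_def is_loop_def)
      then show "is_loop X x (cu p)" "W (cu p) = W p" using close_up_loop[OF pp] W_close_up[OF pp] by simp_all
      show "W p \<in> local_group (V y) y" using l unfolding local_group_def by blast
    qed
    have cur: "rearranging (\<lambda>p q. cu p)"
      unfolding cu_def by (intro rearranging_join rearranging_const rearranging_fst)
    note loop_path = is_loop_def[of X x]
    consider D where "D \<in> carrier \<pi>" "\<forall>a\<in>local_group (V y) y. \<rho> a = D \<otimes>\<^bsub>\<pi>\<^esub> a \<otimes>\<^bsub>\<pi>\<^esub> inv\<^bsub>\<pi>\<^esub> D"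
      | "\<forall>a\<in>local_group (V y) y. \<rho> a = \<one>\<^bsub>\<pi>\<^esub>" using V y by blast
    then show "\<exists>E. rearranging E \<and> (\<forall>p q. p \<in> loops (V y) y \<longrightarrow> q \<in> loops X x \<longrightarrow> is_loop X x (E p q)
      \<and> W (E p q) = W p \<otimes>\<^bsub>\<pi>\<^esub> (W q \<otimes>\<^bsub>\<pi>\<^esub> inv\<^bsub>\<pi>\<^esub> (\<rho> (W p))))"
    proof cases
      case (1 D)
      let ?E = "\<lambda>p q. cu p +++ (q +++ (rep D +++ (reversepath (cu p) +++ reversepath (rep D))))"
      have "rearranging ?E"
        by (intro rearranging_join rearranging_reverse cur rearranging_snd rearranging_const)
      moreover have "is_loop X x (?E p q) \<and> W (?E p q) = W p \<otimes>\<^bsub>\<pi>\<^esub> (W q \<otimes>\<^bsub>\<pi>\<^esub> inv\<^bsub>\<pi>\<^esub> (\<rho> (W p)))"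
        if p: "p \<in> loops (V y) y" and q: "q \<in> loops X x" for p q
      proof -
        note l = cu(1)[OF p] is_loop_if_loops[OF q] conjunct1[OF rep[OF 1(1)]]
        have "is_loop X x (?E p q)" by (intro is_loop_join is_loop_reverse l)
        moreover have "W (?E p q) = W (cu p) \<otimes>\<^bsub>\<pi>\<^esub> (W q \<otimes>\<^bsub>\<pi>\<^esub> (W (rep D) \<otimes>\<^bsub>\<pi>\<^esub> (inv\<^bsub>\<pi>\<^esub> (W (cu p)) \<otimes>\<^bsub>\<pi>\<^esub> inv\<^bsub>\<pi>\<^esub> (W (rep D)))))"
          using l by (simp add: W_join W_reverse loop_path path_image_join)
        ultimately show ?thesis
          using cu[OF p] rep[OF 1(1)] 1 W_carrier[OF cu(3)[OF p]] by (simp add: P.word_simps)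
      qed
      ultimately show ?thesis by (intro exI[of _ ?E]) blast
    next
      case 2
      let ?E = "\<lambda>p q. cu p +++ q"
      have "rearranging ?E" by (intro rearranging_join cur rearranging_snd)
      moreover have "is_loop X x (?E p q) \<and> W (?E p q) = W p \<otimes>\<^bsub>\<pi>\<^esub> (W q \<otimes>\<^bsub>\<pi>\<^esub> inv\<^bsub>\<pi>\<^esub> (\<rho> (W p)))"
        if p: "p \<in> loops (V y) y" and q: "q \<in> loops X x" for p q
      proof -
        note l = cu(1)[OF p] is_loop_if_loops[OF q]
        have "is_loop X x (?E p q)" by (intro is_loop_join l)
        moreover have "W (?E p q) = W (cu p) \<otimes>\<^bsub>\<pi>\<^esub> W q" using l by (simp add: W_join loop_path)
        moreover have "W q \<in> carrier \<pi>" using l(2) by (intro W_carrier) (simp add: loop_path)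
        ultimately show ?thesis using cu[OF p] 2 by simp
      qed
      ultimately show ?thesis by (intro exI[of _ ?E]) blast
    qed
  qed
  then obtain E where E: "\<forall>y\<in>X. rearranging (E y) \<and> (\<forall>p q. p \<in> loops (V y) y \<longrightarrow> q \<in> loops X x \<longrightarrow> is_loop X x (E y p q)
      \<and> W (E y p q) = W p \<otimes>\<^bsub>\<pi>\<^esub> (W q \<otimes>\<^bsub>\<pi>\<^esub> inv\<^bsub>\<pi>\<^esub> (\<rho> (W p))))"
    unfolding bchoice_iff by (rule exE)
  obtain Y C where Y: "countable Y" "Y \<subseteq> X" "countable C" "C \<subseteq> carrier \<pi>"
    and gen: "\<And>S. subgroup S \<pi> \<Longrightarrow> C \<subseteq> S \<Longrightarrow> (\<And>y. y \<in> Y \<Longrightarrow> local_group (V y) y \<subseteq> S) \<Longrightarrow> carrier \<pi> \<subseteq> S"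
    using V by (rule_tac countable_generation[of V]) auto
  \<comment> \<open>The set \<open>S\<close> below is only a monoid, so inverses of \<open>C\<close>
    are added; local groups contain their inverses anyway.\<close>
  define C' where "C' = C \<union> m_inv \<pi> ` C"
  have C': "countable C'" "C' \<subseteq> carrier \<pi>" using Y by (auto simp: C'_def)
  \<comment> \<open>The set of the constant loop at \<open>x\<close>, written as a loop space; it
    starts the recursion and fills the first argument of \<open>Ec\<close>.\<close>
  define T0 where "T0 = loops {x} x"
  have T0: "T0 = {restrict (\<lambda>_. x) {0..1}}"
  proof -
    have "is_loop {x} x (\<lambda>_. x)" by (rule is_loop_const) simp
    then have "restrict (\<lambda>_. x) {0..1} \<in> loops {x} x" by (simp add: is_loop_iff_restrict)
    moreover have "p = restrict (\<lambda>_. x) {0..1}" if "p \<in> loops {x} x" for p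
    proof
      fix t show "p t = restrict (\<lambda>_. x) {0..1} t"
        using that by (cases "t \<in> {0..1}") (auto simp: loops_CK CK_def extensional_def image_subset_iff)
    qed
    ultimately show ?thesis unfolding T0_def by blast
  qed
  have T0_an: "analytic_in ?L T0"
    unfolding T0_def
  proof (rule analytic_loops)
    have "top_of_set {x} = discrete_topology {x}" by (simp add: subtopology_eq_discrete_topology_sing)
    then show "polish_topology (top_of_set {x})" by (simp add: polish_discrete)
  qed
  define Ec where "Ec g = (\<lambda>(p :: real \<Rightarrow> 'a) (q :: real \<Rightarrow> 'a). rep g +++ (q +++ rep (inv\<^bsub>\<pi>\<^esub> (\<rho> g))))" for g
  have Ec: "is_loop X x (Ec g p q)" "W (Ec g p q) = g \<otimes>\<^bsub>\<pi>\<^esub> (W q \<otimes>\<^bsub>\<pi>\<^esub> inv\<^bsub>\<pi>\<^esub> (\<rho> g))"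
    if g: "g \<in> carrier \<pi>" and q: "q \<in> loops X x" for g p q
  proof -
    have g': "inv\<^bsub>\<pi>\<^esub> (\<rho> g) \<in> carrier \<pi>" using g by simp
    note l = is_loop_if_loops[OF q] conjunct1[OF rep[OF g]] conjunct1[OF rep[OF g']]
    show "is_loop X x (Ec g p q)" unfolding Ec_def by (intro is_loop_join l)
    show "W (Ec g p q) = g \<otimes>\<^bsub>\<pi>\<^esub> (W q \<otimes>\<^bsub>\<pi>\<^esub> inv\<^bsub>\<pi>\<^esub> (\<rho> g))"
      unfolding Ec_def using l rep[OF g] rep[OF g'] by (simp add: W_join is_loop_def[of X x] path_image_join)
  qed
  have Ec_re: "rearranging (Ec g)" for g unfolding Ec_def by (intro rearranging_join rearranging_const rearranging_snd)
  \<comment> \<open>\<open>T m\<close> represents the elements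
    \<open>a \<rho>(a)\<^sup>-\<^sup>1\<close> for products \<open>a\<close> of \<open>m\<close>
    generators: each further generator is wrapped around the previous result.\<close>
  define T where "T = rec_nat T0 (\<lambda>_ T. (\<Union>g\<in>C'. (\<lambda>(p, q). restrict (Ec g p q) {0..1}) ` (T0 \<times> T))
    \<union> (\<Union>y\<in>Y. (\<lambda>(p, q). restrict (E y p q) {0..1}) ` (loops (V y) y \<times> T)))"
  have T_0: "T 0 = T0" and T_Suc: "T (Suc m) = (\<Union>g\<in>C'. (\<lambda>(p, q). restrict (Ec g p q) {0..1}) ` (T0 \<times> T m))
    \<union> (\<Union>y\<in>Y. (\<lambda>(p, q). restrict (E y p q) {0..1}) ` (loops (V y) y \<times> T m))" for m
    by (simp_all add: T_def)
  have W1: "W (restrict (\<lambda>_. x) {0..1}) = \<one>\<^bsub>\<pi>\<^esub>" using W_restrict[OF is_loop_const[OF xX]] W_const[OF xX] by simp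
  have E': "is_loop X x (E y p q)" "W (E y p q) = W p \<otimes>\<^bsub>\<pi>\<^esub> (W q \<otimes>\<^bsub>\<pi>\<^esub> inv\<^bsub>\<pi>\<^esub> (\<rho> (W p)))" "rearranging (E y)" "W p \<in> carrier \<pi>"
    if "y \<in> Y" "p \<in> loops (V y) y" "q \<in> loops X x" for y p q
  proof -
    have y: "y \<in> X" using that Y by blast
    show "is_loop X x (E y p q)" "W (E y p q) = W p \<otimes>\<^bsub>\<pi>\<^esub> (W q \<otimes>\<^bsub>\<pi>\<^esub> inv\<^bsub>\<pi>\<^esub> (\<rho> (W p)))" "rearranging (E y)"
      using E y that by blast+
    show "W p \<in> carrier \<pi>" by (rule W_carrier, rule is_loop_path_in[OF is_loop_if_loops[OF that(2)] VX[OF y]])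
  qed
  \<comment> \<open>Idempotence enters here: \<open>\<rho>\<close> maps the last factor to itself,
    and it cancels the image of \<open>a\<close>.\<close>
  have ker_step: "\<rho> (a \<otimes>\<^bsub>\<pi>\<^esub> (b \<otimes>\<^bsub>\<pi>\<^esub> inv\<^bsub>\<pi>\<^esub> (\<rho> a))) = \<one>\<^bsub>\<pi>\<^esub>" if "a \<in> carrier \<pi>" "b \<in> carrier \<pi>" "\<rho> b = \<one>\<^bsub>\<pi>\<^esub>" for a b
    using that idem by (simp add: \<rho>.hom_mult \<rho>.hom_inv)
  have W_loops: "W q \<in> carrier \<pi>" if "q \<in> loops X x" for q
    using is_loop_if_loops[OF that] by (intro W_carrier) (simp add: is_loop_def)
  have T_ker: "t \<in> loops X x \<and> \<rho> (W t) = \<one>\<^bsub>\<pi>\<^esub>" if "t \<in> T m" for t m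
    using that
  proof (induction m arbitrary: t)
    case 0
    then have "t = restrict (\<lambda>_. x) {0..1}" unfolding T_0 T0 by blast
    moreover have "restrict (\<lambda>_. x) {0..1} \<in> loops X x" by (rule restrict_loop(1)[OF is_loop_const[OF xX]])
    ultimately show ?case using W1 \<rho>.hom_one by metis
  next
    case (Suc m)
    from Suc.prems[unfolded T_Suc] show ?case
    proof (rule UnE)
      assume "t \<in> (\<Union>g\<in>C'. (\<lambda>(p, q). restrict (Ec g p q) {0..1}) ` (T0 \<times> T m))"
      then obtain g where g': "g \<in> C'" "t \<in> (\<lambda>(p, q). restrict (Ec g p q) {0..1}) ` (T0 \<times> T m)" by (rule UN_E)
      from g'(2) obtain z where z: "t = (\<lambda>(p, q). restrict (Ec g p q) {0..1}) z" "z \<in> T0 \<times> T m" by (rule imageE)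
      define p q where "p = fst z" and "q = snd z"
      have 1: "t = restrict (Ec g p q) {0..1}" "q \<in> T m" using z by (auto simp: p_def q_def)
      have q: "q \<in> loops X x" "\<rho> (W q) = \<one>\<^bsub>\<pi>\<^esub>" using Suc.IH[OF 1(2)] by auto
      have g: "g \<in> carrier \<pi>" using g'(1) C' by blast
      note e = Ec[OF g q(1), of p]
      have "W t = g \<otimes>\<^bsub>\<pi>\<^esub> (W q \<otimes>\<^bsub>\<pi>\<^esub> inv\<^bsub>\<pi>\<^esub> (\<rho> g))" unfolding 1(1) W_restrict[OF e(1)] by (rule e(2))
      then show ?thesis
        using restrict_loop(1)[OF e(1)] ker_step[OF g W_loops[OF q(1)] q(2)] 1(1) by metis
    next
      assume "t \<in> (\<Union>y\<in>Y. (\<lambda>(p, q). restrict (E y p q) {0..1}) ` (loops (V y) y \<times> T m))"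
      then obtain y where y: "y \<in> Y" "t \<in> (\<lambda>(p, q). restrict (E y p q) {0..1}) ` (loops (V y) y \<times> T m)" by (rule UN_E)
      from y(2) obtain z where z: "t = (\<lambda>(p, q). restrict (E y p q) {0..1}) z" "z \<in> loops (V y) y \<times> T m" by (rule imageE)
      define p q where "p = fst z" and "q = snd z"
      have 1: "t = restrict (E y p q) {0..1}" "p \<in> loops (V y) y" "q \<in> T m" using z by (auto simp: p_def q_def)
      have q: "q \<in> loops X x" "\<rho> (W q) = \<one>\<^bsub>\<pi>\<^esub>" using Suc.IH[OF 1(3)] by auto
      note e = E'[OF y(1) 1(2) q(1)]
      have "W t = W p \<otimes>\<^bsub>\<pi>\<^esub> (W q \<otimes>\<^bsub>\<pi>\<^esub> inv\<^bsub>\<pi>\<^esub> (\<rho> (W p)))" unfolding 1(1) W_restrict[OF e(1)] by (rule e(2))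
      then show ?thesis
        using restrict_loop(1)[OF e(1)] ker_step[OF e(4) W_loops[OF q(1)] q(2)] 1(1) by metis
    qed
  qed
  have T_an: "analytic_in ?L (T m)" for m
  proof (induction m)
    case 0
    then show ?case using T0_an by (simp add: T_0)
  next
    case (Suc m)
    have 1: "analytic_in ?L ((\<lambda>(p, q). restrict (Ec g p q) {0..1}) ` (T0 \<times> T m))" if "g \<in> C'" for g
    proof (rule analytic_rearranging[OF Ec_re T0_an Suc])
      fix p q assume "q \<in> T m"
      then have "is_loop X x (Ec g p q)" using Ec(1) T_ker C' that by blast
      then show "path (Ec g p q)" by (simp add: is_loop_def)
    qed
    have 2: "analytic_in ?L ((\<lambda>(p, q). restrict (E y p q) {0..1}) ` (loops (V y) y \<times> T m))" if y: "y \<in> Y" for y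
    proof (rule analytic_rearranging[OF _ _ Suc])
      show "rearranging (E y)" using E y Y by blast
      have "openin (top_of_set X) (V y)" using V y Y by blast
      then have "polish_topology (subtopology (top_of_set X) (V y))" using polish_subtopology[OF pol] by blast
      moreover have "X \<inter> V y = V y" using VX y Y by blast
      ultimately show "analytic_in ?L (loops (V y) y)" by (intro analytic_loops) (simp add: subtopology_subtopology)
      fix p q assume "p \<in> loops (V y) y" "q \<in> T m"
      then have "is_loop X x (E y p q)" using E'(1)[OF y] T_ker by blast
      then show "path (E y p q)" by (simp add: is_loop_def)
    qed
    have "analytic_in ?L (\<Union>b\<in>{True, False}. if b then (\<Union>g\<in>C'. (\<lambda>(p, q). restrict (Ec g p q) {0..1}) ` (T0 \<times> T m))
       else (\<Union>y\<in>Y. (\<lambda>(p, q). restrict (E y p q) {0..1}) ` (loops (V y) y \<times> T m)))"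
      using analytic_UN[OF C'(1) 1] analytic_UN[OF Y(1) 2] by (intro analytic_UN) auto
    moreover have "T (Suc m) = (\<Union>b\<in>{True, False}. if b then (\<Union>g\<in>C'. (\<lambda>(p, q). restrict (Ec g p q) {0..1}) ` (T0 \<times> T m))
       else (\<Union>y\<in>Y. (\<lambda>(p, q). restrict (E y p q) {0..1}) ` (loops (V y) y \<times> T m)))"
      unfolding T_Suc by (simp only: UN_insert UN_empty if_True if_False Un_empty_right)
    ultimately show ?case by metis
  qed
  define TT where "TT = (\<Union>m. T m)"
  have TT: "analytic_in ?L TT" "TT \<subseteq> loops X x" unfolding TT_def using T_an analytic_UN_nat T_ker by blast+
  define B where "B = W ` TT"
  have B_elim: "\<exists>t m. t \<in> T m \<and> b = W t" if b: "b \<in> B" for b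
  proof -
    from b[unfolded B_def] obtain t where t: "b = W t" "t \<in> TT" by (rule imageE)
    from t(2)[unfolded TT_def] obtain m where "t \<in> T m" by (rule UN_E)
    then show ?thesis using t(1) by (intro exI conjI)
  qed
  have B_carrier: "b \<in> carrier \<pi>" if "b \<in> B" for b using that TT(2) W_loops unfolding B_def by blast
  have B1: "\<one>\<^bsub>\<pi>\<^esub> \<in> B"
  proof -
    have "restrict (\<lambda>_. x) {0..1} \<in> TT" unfolding TT_def using T_0 T0 by blast
    then show ?thesis unfolding B_def using W1 by (metis image_eqI)
  qed
  \<comment> \<open>The elements whose twisted multiplication preserves \<open>B\<close>. They are
    closed under products but not visibly under inverses, so \<open>gen\<close> is applied to those
    \<open>a\<close> for which both \<open>a\<close> and its inverse belong to
    \<open>S\<close>.\<close>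
  define S where "S = {a \<in> carrier \<pi>. \<forall>b\<in>B. a \<otimes>\<^bsub>\<pi>\<^esub> (b \<otimes>\<^bsub>\<pi>\<^esub> inv\<^bsub>\<pi>\<^esub> (\<rho> a)) \<in> B}"
  have S1: "\<one>\<^bsub>\<pi>\<^esub> \<in> S" using B_carrier by (simp add: S_def)
  have S2: "a \<otimes>\<^bsub>\<pi>\<^esub> b \<in> S" if "a \<in> S" "b \<in> S" for a b
  proof -
    have c: "a \<in> carrier \<pi>" "b \<in> carrier \<pi>" using that by (auto simp: S_def)
    have "(a \<otimes>\<^bsub>\<pi>\<^esub> b) \<otimes>\<^bsub>\<pi>\<^esub> (e \<otimes>\<^bsub>\<pi>\<^esub> inv\<^bsub>\<pi>\<^esub> (\<rho> (a \<otimes>\<^bsub>\<pi>\<^esub> b))) \<in> B" if e: "e \<in> B" for e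
    proof -
      have "b \<otimes>\<^bsub>\<pi>\<^esub> (e \<otimes>\<^bsub>\<pi>\<^esub> inv\<^bsub>\<pi>\<^esub> (\<rho> b)) \<in> B" using \<open>b \<in> S\<close> e by (simp add: S_def)
      then have "a \<otimes>\<^bsub>\<pi>\<^esub> ((b \<otimes>\<^bsub>\<pi>\<^esub> (e \<otimes>\<^bsub>\<pi>\<^esub> inv\<^bsub>\<pi>\<^esub> (\<rho> b))) \<otimes>\<^bsub>\<pi>\<^esub> inv\<^bsub>\<pi>\<^esub> (\<rho> a)) \<in> B" using \<open>a \<in> S\<close> by (simp add: S_def)
      then show ?thesis using c B_carrier[OF e] by (simp add: P.word_simps)
    qed
    then show ?thesis using c by (simp add: S_def)
  qed
  have SC: "g \<in> S" if g: "g \<in> C'" for g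
  proof -
    have gc: "g \<in> carrier \<pi>" using g C' by blast
    have "g \<otimes>\<^bsub>\<pi>\<^esub> (b \<otimes>\<^bsub>\<pi>\<^esub> inv\<^bsub>\<pi>\<^esub> (\<rho> g)) \<in> B" if "b \<in> B" for b
    proof -
      from B_elim[OF that] obtain t where "\<exists>m. t \<in> T m \<and> b = W t" by (rule exE)
      then obtain m where "t \<in> T m \<and> b = W t" by (rule exE)
      then have t: "t \<in> T m" "b = W t" by (rule conjunct1, rule conjunct2)
      have tl: "t \<in> loops X x" using T_ker[OF t(1)] by simp
      let ?p = "restrict (\<lambda>_. x) {0..1}"
      have "restrict (Ec g ?p t) {0..1} \<in> T (Suc m)" unfolding T_Suc using g t(1) T0 by (intro UnI1 UN_I[of g] image_eqI[of _ _ "(?p, t)"]) auto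
      then have "W (restrict (Ec g ?p t) {0..1}) \<in> B" unfolding B_def TT_def by blast
      then show ?thesis using W_restrict[OF Ec(1)[OF gc tl, of ?p]] Ec(2)[OF gc tl, of ?p] t(2) by simp
    qed
    then show ?thesis using gc by (simp add: S_def)
  qed
  have SY: "a \<in> S" if y: "y \<in> Y" and a: "a \<in> local_group (V y) y" for a y
  proof -
    have yX: "y \<in> X" using y Y by blast
    obtain p0 where p0: "is_loop (V y) y p0" "a = W p0" using a unfolding local_group_def by blast
    define p where "p = restrict p0 {0..1}"
    have p: "p \<in> loops (V y) y" "a = W p"
    proof -
      show "p \<in> loops (V y) y" unfolding p_def by (rule restrict_loop(1)[OF p0(1)])
      have "homotopic_paths X p0 p"
        unfolding p_def using homotopic_paths_subset[OF restrict_loop(2)[OF p0(1)] VX[OF yX]] .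
      then show "a = W p" using W_homotopic p0(2) by simp
    qed
    have "a \<otimes>\<^bsub>\<pi>\<^esub> (b \<otimes>\<^bsub>\<pi>\<^esub> inv\<^bsub>\<pi>\<^esub> (\<rho> a)) \<in> B" if "b \<in> B" for b
    proof -
      from B_elim[OF that] obtain t where "\<exists>m. t \<in> T m \<and> b = W t" by (rule exE)
      then obtain m where "t \<in> T m \<and> b = W t" by (rule exE)
      then have t: "t \<in> T m" "b = W t" by (rule conjunct1, rule conjunct2)
      have tl: "t \<in> loops X x" using T_ker[OF t(1)] by simp
      have "restrict (E y p t) {0..1} \<in> T (Suc m)" unfolding T_Suc using y t(1) p(1) by (intro UnI2 UN_I[of y] image_eqI[of _ _ "(p, t)"]) auto
      then have "W (restrict (E y p t) {0..1}) \<in> B" unfolding B_def TT_def by blast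
      then show ?thesis using W_restrict[OF E'(1)[OF y p(1) tl]] E'(2)[OF y p(1) tl] t(2) p(2) by simp
    qed
    moreover have "a \<in> carrier \<pi>" using E'(4)[OF y p(1)] T_ker[of _ 0] T_0 T0 p(2) by blast
    ultimately show ?thesis by (simp add: S_def)
  qed
  have "carrier \<pi> \<subseteq> {a \<in> S. inv\<^bsub>\<pi>\<^esub> a \<in> S}"
  proof (rule gen)
    have Sc: "S \<subseteq> carrier \<pi>" by (auto simp: S_def)
    show "subgroup {a \<in> S. inv\<^bsub>\<pi>\<^esub> a \<in> S} \<pi>"
    proof
      show "{a \<in> S. inv\<^bsub>\<pi>\<^esub> a \<in> S} \<subseteq> carrier \<pi>" using Sc by blast
      show "\<one>\<^bsub>\<pi>\<^esub> \<in> {a \<in> S. inv\<^bsub>\<pi>\<^esub> a \<in> S}" using S1 by simp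
      fix a assume a: "a \<in> {a \<in> S. inv\<^bsub>\<pi>\<^esub> a \<in> S}"
      then have ac: "a \<in> carrier \<pi>" using Sc by blast
      then show "inv\<^bsub>\<pi>\<^esub> a \<in> {a \<in> S. inv\<^bsub>\<pi>\<^esub> a \<in> S}" using a by simp
      fix b assume b: "b \<in> {a \<in> S. inv\<^bsub>\<pi>\<^esub> a \<in> S}"
      then have bc: "b \<in> carrier \<pi>" using Sc by blast
      show "a \<otimes>\<^bsub>\<pi>\<^esub> b \<in> {a \<in> S. inv\<^bsub>\<pi>\<^esub> a \<in> S}" using a b S2 ac bc by (simp add: P.inv_mult_group)
    qed
    show "C \<subseteq> {a \<in> S. inv\<^bsub>\<pi>\<^esub> a \<in> S}" using SC unfolding C'_def by blast
    show "local_group (V y) y \<subseteq> {a \<in> S. inv\<^bsub>\<pi>\<^esub> a \<in> S}" if y: "y \<in> Y" for y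
    proof
      fix a assume a: "a \<in> local_group (V y) y"
      have "y \<in> V y" using V y Y by blast
      then have "subgroup (local_group (V y) y) \<pi>" using subgroup_local_group VX y Y by blast
      then have "inv\<^bsub>\<pi>\<^esub> a \<in> local_group (V y) y" using a by (rule subgroup.m_inv_closed)
      then show "a \<in> {a \<in> S. inv\<^bsub>\<pi>\<^esub> a \<in> S}" using SY[OF y] a by blast
    qed
  qed
  \<comment> \<open>Starting from the identity in \<open>B\<close>, every
    \<open>a \<rho>(a)\<^sup>-\<^sup>1\<close> is reached; for \<open>a\<close> in the kernel this
    is \<open>a\<close> itself.\<close>
  then have all: "a \<otimes>\<^bsub>\<pi>\<^esub> (\<one>\<^bsub>\<pi>\<^esub> \<otimes>\<^bsub>\<pi>\<^esub> inv\<^bsub>\<pi>\<^esub> (\<rho> a)) \<in> B" if "a \<in> carrier \<pi>" for a using that B1 unfolding S_def by blast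
  have kerc: "kernel \<pi> \<pi> \<rho> \<subseteq> carrier \<pi>" by (auto simp: kernel_def)
  \<comment> \<open>\<open>TT\<close> meets every class of the kernel but need not contain all loops
    of a class; homotopy supplies the others.\<close>
  have "\<Union>(kernel \<pi> \<pi> \<rho>) = {q \<in> loops X x. \<exists>p\<in>TT. homotopic_paths X p q}"
    unfolding Union_classes[OF kerc]
  proof (intro equalityI subsetI)
    fix q assume q: "q \<in> {q \<in> loops X x. W q \<in> kernel \<pi> \<pi> \<rho>}"
    then have k: "W q \<in> carrier \<pi>" "\<rho> (W q) = \<one>\<^bsub>\<pi>\<^esub>" by (auto simp: kernel_def)
    have "W q \<in> B" using all[OF k(1)] k by simp
    then obtain p where p: "p \<in> TT" "W p = W q" unfolding B_def by force
    then have "homotopic_paths X p q" using W_eq_homotopic TT(2) q by blast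
    then show "q \<in> {q \<in> loops X x. \<exists>p\<in>TT. homotopic_paths X p q}" using q p by blast
  next
    fix q assume "q \<in> {q \<in> loops X x. \<exists>p\<in>TT. homotopic_paths X p q}"
    then obtain p m where q: "q \<in> loops X x" and p: "p \<in> T m" "homotopic_paths X p q" unfolding TT_def by blast
    have "W q = W p" using W_homotopic[OF p(2)] by simp
    then show "q \<in> {q \<in> loops X x. W q \<in> kernel \<pi> \<pi> \<rho>}" using q T_ker[OF p(1)] W_loops[OF q] by (simp add: kernel_def)
  qed
  moreover have "analytic_in ?L {q \<in> loops X x. \<exists>p\<in>TT. homotopic_paths X p q}"
    by (rule analytic_saturation[OF pol TT])
  ultimately show ?thesis
    unfolding mtopology_loop_metric by (intro analytic_in_subtopology) auto
qed

end

section \<open>Category and the Baire property of analytic sets\<close>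

definition meager :: "'b topology \<Rightarrow> 'b set \<Rightarrow> bool" where
  "meager T A \<longleftrightarrow> (\<exists>F. (\<forall>n::nat. closedin T (F n) \<and> T interior_of F n = {}) \<and> A \<subseteq> (\<Union>n. F n))"

lemma meager_subset: "meager T B \<Longrightarrow> A \<subseteq> B \<Longrightarrow> meager T A"
  unfolding meager_def by (meson subset_trans)

lemma meager_closedin: "closedin T F \<Longrightarrow> T interior_of F = {} \<Longrightarrow> meager T F"
  unfolding meager_def by (intro exI[of _ "\<lambda>_. F"]) auto

lemma meager_UN_nat:
  assumes "\<And>n::nat. meager T (A n)" shows "meager T (\<Union>n. A n)"
proof -
  have "\<forall>n. \<exists>F. (\<forall>k::nat. closedin T (F k) \<and> T interior_of F k = {}) \<and> A n \<subseteq> (\<Union>k. F k)"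
    using assms unfolding meager_def by blast
  then obtain F where F: "\<forall>n. (\<forall>k::nat. closedin T (F n k) \<and> T interior_of F n k = {}) \<and> A n \<subseteq> (\<Union>k. F n k)"
    unfolding choice_iff by (rule exE)
  have "A n \<subseteq> (\<Union>m. F (fst (prod_decode m)) (snd (prod_decode m)))" for n
  proof
    fix a assume "a \<in> A n"
    then obtain k where "a \<in> F n k" using F by blast
    then have "a \<in> F (fst (prod_decode (prod_encode (n, k)))) (snd (prod_decode (prod_encode (n, k))))" by simp
    then show "a \<in> (\<Union>m. F (fst (prod_decode m)) (snd (prod_decode m)))" by blast
  qed
  then show ?thesis
    unfolding meager_def using F
    by (intro exI[of _ "\<lambda>m. F (fst (prod_decode m)) (snd (prod_decode m))"]) blast
qed

lemma meager_empty: "meager T {}"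
  by (rule meager_closedin) auto

lemma meager_UN:
  assumes "countable I" "\<And>i. i \<in> I \<Longrightarrow> meager T (A i)" shows "meager T (\<Union>i\<in>I. A i)"
proof (cases "I = {}")
  case True
  then show ?thesis by (simp add: meager_empty)
next
  case False
  have m: "meager T (\<Union>n. A (from_nat_into I n))"
    by (rule meager_UN_nat) (use assms(2) from_nat_into[OF False] in blast)
  have "(\<Union>i\<in>I. A i) = (\<Union>n. A (from_nat_into I n))"
    using range_from_nat_into[OF False assms(1)] by (metis UN_simps(10))
  then show ?thesis using m by simp
qed

lemma meager_Un: "meager T A \<Longrightarrow> meager T B \<Longrightarrow> meager T (A \<union> B)"
  using meager_UN[of "{True, False}" T "\<lambda>b. if b then A else B"] by (simp add: Un_commute)

lemma not_meager_open:
  assumes T: "completely_metrizable_space T" and U: "openin T U" "U \<noteq> {}" shows "\<not> meager T U"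
proof
  assume "meager T U"
  then obtain F where F: "\<forall>n::nat. closedin T (F n) \<and> T interior_of F n = {}" "U \<subseteq> (\<Union>n. F n)"
    unfolding meager_def by blast
  have "T interior_of \<Union>(range F) = {}"
    by (rule Baire_category_alt) (use T F(1) in auto)
  then show False using interior_of_maximal[OF F(2) U(1)] U(2) by simp
qed

lemma meager_vimage_involution:
  assumes h: "continuous_map T T h" "\<And>z. z \<in> topspace T \<Longrightarrow> h (h z) = z" and A: "meager T A"
  shows "meager T {z \<in> topspace T. h z \<in> A}"
proof -
  obtain F where F: "\<forall>n::nat. closedin T (F n) \<and> T interior_of F n = {}" "A \<subseteq> (\<Union>n. F n)"
    using A unfolding meager_def by blast
  let ?G = "\<lambda>n. {z \<in> topspace T. h z \<in> F n}"
  have ht: "h z \<in> topspace T" if "z \<in> topspace T" for z using h(1) that by (auto simp: continuous_map_def)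
  have "T interior_of ?G n = {}" for n
    unfolding interior_of_eq_empty
  proof (intro allI impI)
    fix U assume U: "openin T U \<and> U \<subseteq> ?G n"
    let ?V = "{z \<in> topspace T. h z \<in> U}"
    have "openin T ?V" using openin_continuous_map_preimage[OF h(1)] U by blast
    moreover have "?V \<subseteq> F n"
    proof
      fix z assume "z \<in> ?V"
      then have "z \<in> topspace T" "h (h z) \<in> F n" using U by blast+
      then show "z \<in> F n" using h(2) by simp
    qed
    ultimately have V: "?V = {}" using F(1) unfolding interior_of_eq_empty by blast
    have "h u \<in> ?V" if "u \<in> U" for u
    proof -
      have u: "u \<in> topspace T" using that U openin_subset by blast
      then show ?thesis using that ht h(2)[OF u] by simp
    qed
    then show "U = {}" using V by blast
  qed
  moreover have "closedin T (?G n)" for n using closedin_continuous_map_preimage[OF h(1)] F(1) by blast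
  moreover have "{z \<in> topspace T. h z \<in> A} \<subseteq> (\<Union>n. ?G n)" using F(2) by blast
  ultimately show ?thesis unfolding meager_def by (intro exI[of _ ?G]) blast
qed

text \<open>Kuratowski's operation: the points at which \<open>A\<close> is locally of second
  category. An analytic set differs from this closed set by a meager set, which is the Baire
  property.\<close>

definition nonmeager_points :: "'b topology \<Rightarrow> 'b set \<Rightarrow> 'b set" where
  "nonmeager_points T A = {z \<in> topspace T. \<forall>U. openin T U \<and> z \<in> U \<longrightarrow> \<not> meager T (A \<inter> U)}"

lemma closedin_nonmeager_points: "closedin T (nonmeager_points T A)"
proof -
  have "topspace T - nonmeager_points T A = \<Union>{U. openin T U \<and> meager T (A \<inter> U)}"
    unfolding nonmeager_points_def using openin_subset by blast
  moreover have "openin T (\<Union>{U. openin T U \<and> meager T (A \<inter> U)})" by (rule openin_Union) blast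
  ultimately show ?thesis unfolding closedin_def nonmeager_points_def by auto
qed

text \<open>Countably many basic open sets cover the points at which \<open>A\<close> is locally
  meager.\<close>

lemma meager_minus_nonmeager_points:
  assumes sc: "second_countable T" and A: "A \<subseteq> topspace T"
  shows "meager T (A - nonmeager_points T A)"
proof -
  obtain B where B: "countable B" "\<forall>V\<in>B. openin T V" "\<forall>U x. openin T U \<and> x \<in> U \<longrightarrow> (\<exists>V\<in>B. x \<in> V \<and> V \<subseteq> U)"
    using sc unfolding second_countable_def by blast
  let ?B = "{V \<in> B. meager T (A \<inter> V)}"
  have m: "meager T (\<Union>V\<in>?B. A \<inter> V)" by (rule meager_UN) (use B(1) in auto)
  have "A - nonmeager_points T A \<subseteq> (\<Union>V\<in>?B. A \<inter> V)"
  proof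
    fix z assume z: "z \<in> A - nonmeager_points T A"
    then obtain U where U: "openin T U" "z \<in> U" "meager T (A \<inter> U)" using A unfolding nonmeager_points_def by blast
    then obtain V where V: "V \<in> B" "z \<in> V" "V \<subseteq> U" using B(3) by blast
    have "meager T (A \<inter> V)" by (rule meager_subset[OF U(3)]) (use V(3) in blast)
    then show "z \<in> (\<Union>V\<in>?B. A \<inter> V)" using V z by blast
  qed
  then show ?thesis using m by (rule meager_subset[rotated])
qed

text \<open>On an open \<open>U\<close> inside the closure of the difference, every nonempty open
  subset meets the difference, hence is contained in no \<open>nonmeager_points T (A n)\<close>.
  These closed sets are then nowhere dense in \<open>U\<close>, which makes the union of the
  \<open>A n\<close> meager in \<open>U\<close>, although \<open>U\<close> contains one of its
  nonmeager points.\<close>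

lemma nonmeager_points_countable_union:
  fixes A :: "nat \<Rightarrow> 'b set"
  assumes sc: "second_countable T" and A: "\<And>n. A n \<subseteq> topspace T"
  shows "meager T (nonmeager_points T (\<Union>n. A n) - (\<Union>n. nonmeager_points T (A n)))" (is "meager T ?C")
proof -
  have cl: "closedin T (T closure_of ?C)" by simp
  have "T interior_of (T closure_of ?C) = {}"
    unfolding interior_of_eq_empty
  proof (intro allI impI, rule ccontr)
    fix U assume U: "openin T U \<and> U \<subseteq> T closure_of ?C" and ne: "U \<noteq> {}"
    have hit: "V \<inter> ?C \<noteq> {}" if V: "openin T V" "V \<subseteq> U" "V \<noteq> {}" for V
    proof -
      obtain v where "v \<in> V" using V by blast
      then have "v \<in> T closure_of ?C" using V U by blast
      then show ?thesis using V(1) \<open>v \<in> V\<close> unfolding in_closure_of by blast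
    qed
    have 1: "meager T (nonmeager_points T (A n) \<inter> U)" for n
    proof (rule meager_subset[OF meager_closedin])
      let ?F = "T closure_of (nonmeager_points T (A n) \<inter> U)"
      have sub: "?F \<subseteq> nonmeager_points T (A n)"
        by (rule closure_of_minimal) (use closedin_nonmeager_points in auto)
      show "T interior_of ?F = {}"
        unfolding interior_of_eq_empty
      proof (intro allI impI, rule ccontr)
        fix V assume V: "openin T V \<and> V \<subseteq> ?F" and "V \<noteq> {}"
        then obtain v where v: "v \<in> V" by blast
        then have "v \<in> ?F" using V by blast
        then have "V \<inter> U \<noteq> {}" using V v unfolding in_closure_of by blast
        moreover have "openin T (V \<inter> U)" using V U by blast
        ultimately have "(V \<inter> U) \<inter> ?C \<noteq> {}" by (intro hit) auto
        then show False using V sub by blast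
      qed
      show "nonmeager_points T (A n) \<inter> U \<subseteq> ?F"
        by (rule closure_of_subset) (use U openin_subset in blast)
    qed simp
    have "meager T ((\<Union>n. A n - nonmeager_points T (A n)) \<union> (\<Union>n. nonmeager_points T (A n) \<inter> U))"
      by (intro meager_Un meager_UN_nat meager_minus_nonmeager_points[OF sc A] 1)
    then have m: "meager T ((\<Union>n. A n) \<inter> U)" by (rule meager_subset) blast
    have "U \<inter> ?C \<noteq> {}" by (rule hit) (use U ne in auto)
    then show False using m U unfolding nonmeager_points_def by blast
  qed
  then show ?thesis
    by (intro meager_subset[OF meager_closedin[OF cl] closure_of_subset]) (auto simp: nonmeager_points_def)
qed

text \<open>Follow the Souslin scheme of \<open>A\<close> along pieces whose nonmeager points still contain \<open>z\<close>.\<close>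

lemma meager_nonmeager_points_minus_analytic:
  assumes T: "second_countable T" "Hausdorff_space T" and A: "analytic_in T A"
  shows "meager T (nonmeager_points T A - A)"
proof -
  obtain Z :: "(nat \<Rightarrow> real) topology" and f where Z: "polish_topology Z" "continuous_map Z T f" "f ` topspace Z = A"
    using A by (rule analyticE)
  obtain M d where Md: "Metric_space M d" "Metric_space.mcomplete M d" "Z = Metric_space.mtopology M d"
    using Z(1) unfolding polish_topology_def completely_metrizable_space_def by blast
  interpret Metric_space M d by (rule Md(1))
  have tZ: "topspace Z = M" unfolding Md(3) by simp
  have fM: "f ` M = A" using Z(3) tZ by simp
  have fT: "f z \<in> topspace T" if "z \<in> M" for z using Z(2) that tZ by (auto simp: continuous_map_def)
  show ?thesis
  proof (cases "M = {}")
    case True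
    then have "A = {}" using fM by simp
    then have "nonmeager_points T A = {}" using meager_empty openin_topspace unfolding nonmeager_points_def by fastforce
    then show ?thesis by (simp add: meager_empty)
  next
    case False
    have "separable_space Z" using Z(1) by (simp add: polish_topology_def)
    then obtain C where C: "countable C" "C \<subseteq> topspace Z" "\<And>U. openin Z U \<Longrightarrow> U \<noteq> {} \<Longrightarrow> C \<inter> U \<noteq> {}"
      by (rule separable_space_denseE) blast
    have Cne: "C \<noteq> {}" using C(3)[OF openin_topspace] False tZ by blast
    define q where "q = from_nat_into C"
    have rq: "range q = C" unfolding q_def by (rule range_from_nat_into[OF Cne C(1)])
    have near: "\<exists>k. z \<in> mcball (q k) e" if z: "z \<in> M" and e: "0 < e" for z e
    proof -
      have "C \<inter> mball z e \<noteq> {}" by (rule C(3)) (use z e centre_in_mball_iff in \<open>auto simp: Md(3)\<close>)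
      then obtain k where "q k \<in> mball z e" using rq by blast
      then show ?thesis using commute[of z "q k"] by (intro exI[of _ k]) (auto simp: in_mball in_mcball)
    qed
    \<comment> \<open>A Souslin scheme of closed pieces of the parameter space, indexed by finite
      sequences with the newest entry first; the radii shrink with the length.\<close>
    define P where "P = rec_list M (\<lambda>k s Y. Y \<inter> mcball (q k) (inverse (real (Suc (length s)))))"
    have P_Nil: "P [] = M" and P_Cons: "P (k # s) = P s \<inter> mcball (q k) (inverse (real (Suc (length s))))" for k s
      by (simp_all add: P_def)
    have P_UN: "P s = (\<Union>k. P (k # s))" and PM: "P s \<subseteq> M" and Pcl: "closedin mtopology (P s)" for s
    proof -
      show PM: "P s \<subseteq> M" by (induction s) (auto simp: P_Nil P_Cons)
      show "P s = (\<Union>k. P (k # s))" using near[of _ "inverse (real (Suc (length s)))"] PM by (auto simp: P_Cons)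
      show "closedin mtopology (P s)"
        by (induction s) (auto simp: P_Nil P_Cons intro!: closedin_Int closedin_mcball)
    qed
    let ?D = "nonmeager_points T"
    \<comment> \<open>Off this meager set, a nonmeager point of the image of a piece is a nonmeager
      point of the image of one of its subpieces.\<close>
    define N where "N = (\<Union>s. ?D (f ` P s) - (\<Union>k. ?D (f ` P (k # s))))"
    have "meager T (?D (f ` P s) - (\<Union>k. ?D (f ` P (k # s))))" for s
    proof -
      have "f ` P s = (\<Union>k. f ` P (k # s))" using P_UN[of s] by blast
      moreover have "f ` P (k # s) \<subseteq> topspace T" for k using PM[of "k # s"] fT by blast
      ultimately show ?thesis using nonmeager_points_countable_union[OF T(1), of "\<lambda>k. f ` P (k # s)"] by simp
    qed
    then have "meager T N" unfolding N_def by (intro meager_UN) auto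
    moreover have "?D A - A \<subseteq> N"
    proof (rule ccontr)
      assume "\<not> ?D A - A \<subseteq> N"
      then obtain z where z: "z \<in> ?D A" "z \<notin> A" "z \<notin> N" by blast
      have step: "\<exists>k. z \<in> ?D (f ` P (k # s))" if "z \<in> ?D (f ` P s)" for s
        using that z(3) unfolding N_def by blast
      define nx where "nx s = (SOME k. z \<in> ?D (f ` P (k # s)))" for s
      define b where "b = rec_nat [] (\<lambda>_ s. nx s # s)"
      have b: "b 0 = []" "b (Suc n) = nx (b n) # b n" for n by (simp_all add: b_def)
      have bl: "length (b n) = n" for n by (induction n) (simp_all add: b)
      have bz: "z \<in> ?D (f ` P (b n))" for n
      proof (induction n)
        case 0
        then show ?case using z(1) fM by (simp add: b P_Nil)
      next
        case (Suc n)
        then show ?case unfolding b nx_def by (rule someI_ex[OF step])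
      qed
      have ne: "P (b n) \<noteq> {}" for n
      proof
        assume "P (b n) = {}"
        then have "meager T (f ` P (b n) \<inter> topspace T)" by (simp add: meager_empty)
        then show False using bz[of n] unfolding nonmeager_points_def by blast
      qed
      have small: "P (b (Suc n)) \<subseteq> mcball (q (nx (b n))) (inverse (real (Suc n)))" for n
        by (simp add: b P_Cons bl)
      have dec: "decseq (\<lambda>n. P (b n))" by (intro decseq_SucI) (auto simp: b P_Cons)
      have cover: "\<exists>n a. P (b n) \<subseteq> mcball a e" if e: "0 < e" for e
      proof -
        obtain n where n: "inverse (real (Suc n)) < e" using reals_Archimedean[OF e] by blast
        have "mcball (q (nx (b n))) (inverse (real (Suc n))) \<subseteq> mcball (q (nx (b n))) e"
          by (rule mcball_subset_concentric) (use n in simp)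
        then show ?thesis using small[of n] by blast
      qed
      have "\<Inter>(range (\<lambda>n. P (b n))) \<noteq> {}"
        using Md(2)[unfolded mcomplete_nest, rule_format, of "\<lambda>n. P (b n)"] Pcl ne dec cover by blast
      then obtain w where w: "\<And>n. w \<in> P (b n)" by blast
      have wM: "w \<in> M" using w PM by blast
      \<comment> \<open>The pieces along the branch shrink to \<open>w\<close>. Since
        \<open>f w\<close> differs from \<open>z\<close>, a late piece is mapped off a neighbourhood
        of \<open>z\<close>, so \<open>z\<close> is not a nonmeager point of its image.\<close>
      have "f w \<noteq> z" using wM fM z(2) by blast
      moreover have "z \<in> topspace T" using z(1) by (simp add: nonmeager_points_def)
      ultimately obtain U V where UV: "openin T U" "openin T V" "f w \<in> U" "z \<in> V" "disjnt U V"
        using T(2) fT[OF wM] unfolding Hausdorff_space_def by metis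
      have "openin mtopology {y \<in> M. f y \<in> U}"
        using openin_continuous_map_preimage[OF Z(2) UV(1)] unfolding tZ unfolding Md(3) .
      then obtain r where r: "0 < r" "mball w r \<subseteq> {y \<in> M. f y \<in> U}"
        using wM UV(3) unfolding openin_mtopology by blast
      obtain n where n: "inverse (real (Suc n)) < r / 2" using reals_Archimedean[of "r / 2"] r(1) by auto
      have "P (b (Suc n)) \<subseteq> mball w r"
      proof
        fix y assume y: "y \<in> P (b (Suc n))"
        have yM: "y \<in> M" using y PM by blast
        have "y \<in> mcball (q (nx (b n))) (inverse (real (Suc n)))" "w \<in> mcball (q (nx (b n))) (inverse (real (Suc n)))"
          using y w[of "Suc n"] small[of n] by blast+
        then have d: "q (nx (b n)) \<in> M" "d (q (nx (b n))) y \<le> inverse (real (Suc n))" "d (q (nx (b n))) w \<le> inverse (real (Suc n))"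
          by (simp_all only: in_mcball)
        have "d w y \<le> d w (q (nx (b n))) + d (q (nx (b n))) y" by (rule triangle[OF wM d(1) yM])
        also have "\<dots> < r" using d commute[of w "q (nx (b n))"] n by linarith
        finally show "y \<in> mball w r" using wM yM by (simp only: in_mball simp_thms)
      qed
      then have "f ` P (b (Suc n)) \<subseteq> U" using r(2) by blast
      then have "f ` P (b (Suc n)) \<inter> V = {}" using UV(5) unfolding disjnt_def by blast
      then have "meager T (f ` P (b (Suc n)) \<inter> V)" by (simp add: meager_empty)
      then show False using bz[of "Suc n"] UV(2,4) unfolding nonmeager_points_def by blast
    qed
    ultimately show ?thesis by (rule meager_subset)
  qed
qed

section \<open>Meager equivalence relations on Cantor space\<close>

abbreviation cantor_space :: "(nat \<Rightarrow> bool) topology" where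
  "cantor_space \<equiv> product_topology (\<lambda>_. discrete_topology UNIV) UNIV"

lemma topspace_cantor [simp]: "topspace cantor_space = UNIV" by auto

lemma polish_cantor: "polish_topology cantor_space"
  by (rule polish_product) (auto intro: polish_discrete)

lemma openin_cantor_cylinder: "openin cantor_space {\<xi>. \<forall>i<n. \<xi> i = \<alpha> i}"
proof (induction n)
  case 0
  then show ?case using openin_topspace[of cantor_space] by simp
next
  case (Suc n)
  have "openin cantor_space {\<xi> \<in> topspace cantor_space. \<xi> n \<in> {\<alpha> n}}"
    by (rule openin_continuous_map_preimage[OF continuous_map_product_projection]) auto
  then have "openin cantor_space ({\<xi>. \<forall>i<n. \<xi> i = \<alpha> i} \<inter> {\<xi>. \<xi> n = \<alpha> n})" using Suc by (intro openin_Int) simp_all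
  moreover have "{\<xi>. \<forall>i<n. \<xi> i = \<alpha> i} \<inter> {\<xi>. \<xi> n = \<alpha> n} = {\<xi>. \<forall>i<Suc n. \<xi> i = \<alpha> i}" by (auto simp: less_Suc_eq)
  ultimately show ?case by simp
qed

lemma cantor_cylinder_nbhd:
  assumes "openin cantor_space U" "\<alpha> \<in> U"
  obtains n where "\<And>\<xi>. (\<And>i. i < n \<Longrightarrow> \<xi> i = \<alpha> i) \<Longrightarrow> \<xi> \<in> U"
proof -
  obtain B where B: "finite {i \<in> UNIV. B i \<noteq> topspace (discrete_topology (UNIV :: bool set))}" "\<alpha> \<in> Pi\<^sub>E UNIV B" "Pi\<^sub>E UNIV B \<subseteq> U"
    using assms unfolding openin_product_topology_alt by blast
  have "finite {i. B i \<noteq> UNIV}" using B(1) by simp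
  then obtain n where n: "\<And>i. B i \<noteq> UNIV \<Longrightarrow> i < n" unfolding finite_nat_set_iff_bounded by blast
  show thesis
  proof (rule that)
    fix \<xi> assume \<xi>: "\<And>i. i < n \<Longrightarrow> \<xi> i = \<alpha> i"
    have "\<xi> i \<in> B i" for i
      using \<xi>[of i] n[of i] B(2) by (cases "i < n") (auto simp: PiE_def Pi_iff)
    then show "\<xi> \<in> U" using B(3) by (auto simp: PiE_def Pi_iff)
  qed
qed

lemma cantor_box_nbhd:
  assumes "openin (prod_topology cantor_space cantor_space) U" "(\<alpha>, \<beta>) \<in> U"
  obtains n where "\<And>\<xi> \<eta>. (\<And>i. i < n \<Longrightarrow> \<xi> i = \<alpha> i \<and> \<eta> i = \<beta> i) \<Longrightarrow> (\<xi>, \<eta>) \<in> U"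
proof -
  from assms(1)[unfolded openin_prod_topology_alt, rule_format, OF assms(2)]
  obtain V W where VW: "openin cantor_space V \<and> openin cantor_space W \<and> \<alpha> \<in> V \<and> \<beta> \<in> W \<and> V \<times> W \<subseteq> U"
    by (elim exE)
  then have V: "openin cantor_space V" "\<alpha> \<in> V" and W: "openin cantor_space W" "\<beta> \<in> W" and sub: "V \<times> W \<subseteq> U"
    by simp_all
  obtain n where n: "\<And>\<xi>. (\<And>i. i < n \<Longrightarrow> \<xi> i = \<alpha> i) \<Longrightarrow> \<xi> \<in> V" by (rule cantor_cylinder_nbhd[OF V]) (rule that, blast)
  obtain m where m: "\<And>\<xi>. (\<And>i. i < m \<Longrightarrow> \<xi> i = \<beta> i) \<Longrightarrow> \<xi> \<in> W" by (rule cantor_cylinder_nbhd[OF W]) (rule that, blast)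
  show thesis
  proof (rule that[of "max n m"])
    fix \<xi> \<eta> :: "nat \<Rightarrow> bool" assume e: "\<And>i. i < max n m \<Longrightarrow> \<xi> i = \<alpha> i \<and> \<eta> i = \<beta> i"
    have "\<xi> \<in> V" by (rule n) (use e in simp)
    moreover have "\<eta> \<in> W" by (rule m) (use e in simp)
    ultimately show "(\<xi>, \<eta>) \<in> U" using sub by blast
  qed
qed

text \<open>If \<open>E\<close> were not meager, it would be comeager in a box that fixes finitely
  many coordinates. Flipping a free coordinate of the first component is a homeomorphism of the box,
  so some pair stays in \<open>E\<close> under the flip, which relates two sequences differing at
  one place.\<close>

lemma flip_inequivalent_meager:
  assumes E: "analytic_in (prod_topology cantor_space cantor_space) E" "E = {(\<sigma>, \<tau>). h \<sigma> = h \<tau>}"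
    and flip: "\<And>\<sigma> n. h (\<sigma>(n := \<not> \<sigma> n)) \<noteq> h \<sigma>"
  shows "meager (prod_topology cantor_space cantor_space) E"
proof (rule ccontr)
  let ?P = "prod_topology cantor_space cantor_space"
  assume nm: "\<not> meager ?P E"
  have pP: "polish_topology ?P" by (intro polish_prod polish_cantor)
  note sc = polish_second_countable[OF pP] and hs = polish_Hausdorff[OF pP]
  have cm: "completely_metrizable_space ?P" using pP by (simp add: polish_topology_def)
  let ?D = "nonmeager_points ?P E"
  define U where "U = ?P interior_of ?D"
  have "U \<noteq> {}"
  proof
    assume "U = {}"
    then have "meager ?P ?D" unfolding U_def by (intro meager_closedin closedin_nonmeager_points)
    then have "meager ?P ((E - ?D) \<union> ?D)" by (intro meager_Un meager_minus_nonmeager_points[OF sc]) auto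
    then show False using nm meager_subset by blast
  qed
  then obtain \<alpha> \<beta> where ab: "(\<alpha>, \<beta>) \<in> U" by auto
  have Uo: "openin ?P U" unfolding U_def by simp
  obtain n where n: "\<And>\<xi> \<eta>. (\<And>i. i < n \<Longrightarrow> \<xi> i = \<alpha> i \<and> \<eta> i = \<beta> i) \<Longrightarrow> (\<xi>, \<eta>) \<in> U"
    by (rule cantor_box_nbhd[OF Uo ab]) (rule that, blast)
  let ?B = "{\<xi>. \<forall>i<n. \<xi> i = \<alpha> i} \<times> {\<xi>. \<forall>i<n. \<xi> i = \<beta> i}"
  have BU: "?B \<subseteq> U" using n by auto
  have Bo: "openin ?P ?B" unfolding openin_prod_Times_iff using openin_cantor_cylinder by blast
  have Bne: "?B \<noteq> {}" by auto
  have "U \<subseteq> ?D" unfolding U_def by (rule interior_of_subset)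
  then have "?B - E \<subseteq> ?D - E" using BU by blast
  then have m1: "meager ?P (?B - E)" by (rule meager_subset[OF meager_nonmeager_points_minus_analytic[OF sc hs E(1)]])
  \<comment> \<open>The box fixes only coordinates below \<open>n\<close>, so this flip preserves
    it.\<close>
  define g where "g z = ((fst z)(n := \<not> fst z n), snd z)" for z :: "(nat \<Rightarrow> bool) \<times> (nat \<Rightarrow> bool)"
  have "continuous_map cantor_space cantor_space (\<lambda>\<xi>. \<xi>(n := \<not> \<xi> n))"
    unfolding continuous_map_componentwise_UNIV
  proof
    fix i
    have "continuous_map cantor_space (discrete_topology UNIV) (Not \<circ> (\<lambda>\<xi>. \<xi> n))"
      by (rule continuous_map_compose[OF continuous_map_product_projection]) (auto simp: continuous_map_def)
    moreover have "continuous_map cantor_space (discrete_topology UNIV) (\<lambda>\<xi>. \<xi> i)"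
      by (rule continuous_map_product_projection) simp
    ultimately show "continuous_map cantor_space (discrete_topology UNIV) (\<lambda>\<xi>. (\<xi>(n := \<not> \<xi> n)) i)"
      by (cases "i = n") (simp_all add: comp_def)
  qed
  then have "continuous_map ?P cantor_space ((\<lambda>\<xi>. \<xi>(n := \<not> \<xi> n)) \<circ> fst)"
    by (rule continuous_map_compose[OF continuous_map_fst])
  then have gc: "continuous_map ?P ?P g"
    unfolding g_def continuous_map_pairwise by (simp add: comp_def continuous_map_snd)
  have m2: "meager ?P {z \<in> topspace ?P. g z \<in> ?B - E}"
    by (rule meager_vimage_involution[OF gc _ m1]) (simp add: g_def)
  have "\<not> ?B \<subseteq> (?B - E) \<union> {z \<in> topspace ?P. g z \<in> ?B - E}"
    using not_meager_open[OF cm Bo Bne] meager_subset[OF meager_Un[OF m1 m2]] by blast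
  then obtain z where z: "z \<in> ?B" "z \<in> E" "\<not> (z \<in> topspace ?P \<and> g z \<in> ?B - E)" by blast
  have gB: "g z \<in> ?B" using z(1) by (auto simp: g_def)
  have zt: "z \<in> topspace ?P" by simp
  have gE: "g z \<in> E"
  proof (rule ccontr)
    assume "g z \<notin> E"
    then have "g z \<in> ?B - E" by (rule DiffI[OF gB])
    then have "z \<in> topspace ?P \<and> g z \<in> ?B - E" by (rule conjI[OF zt])
    then show False by (rule notE[OF z(3)])
  qed
  have "h (fst z) = h (snd z)" using z(2) unfolding E(2) by (auto simp: case_prod_unfold)
  moreover have "h ((fst z)(n := \<not> fst z n)) = h (snd z)" using gE unfolding E(2) g_def by simp
  ultimately show False using flip[of "fst z" n] by simp
qed

text \<open>The initial segments in \<open>S\<close> are treated one after another, each time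
  extending the block already found. Since \<open>F\<close> is closed, being outside it is decided
  by finitely many coordinates.\<close>

lemma avoid_nowhere_dense:
  assumes F: "closedin (prod_topology cantor_space cantor_space) F" "prod_topology cantor_space cantor_space interior_of F = {}"
    and S: "finite S"
  shows "\<exists>m'\<ge>m. \<exists>\<alpha> \<beta>. \<forall>(a, b)\<in>S. \<forall>\<xi> \<eta>. (\<forall>i<m. \<xi> i = a i \<and> \<eta> i = b i) \<longrightarrow> (\<forall>i. m \<le> i \<and> i < m' \<longrightarrow> \<xi> i = \<alpha> i \<and> \<eta> i = \<beta> i) \<longrightarrow> (\<xi>, \<eta>) \<notin> F"
  using S
proof (induction S)
  case empty
  then show ?case by auto
next
  case (insert p S)
  let ?P = "prod_topology cantor_space cantor_space"
  let ?Q = "\<lambda>m' \<alpha> \<beta>. \<forall>(a, b)\<in>S. \<forall>\<xi> \<eta>. (\<forall>i<m. \<xi> i = a i \<and> \<eta> i = b i) \<longrightarrow> (\<forall>i. m \<le> i \<and> i < m' \<longrightarrow> \<xi> i = \<alpha> i \<and> \<eta> i = \<beta> i) \<longrightarrow> (\<xi>, \<eta>) \<notin> F"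
  from insert.IH obtain m' where 1: "m \<le> m' \<and> (\<exists>\<alpha> \<beta>. ?Q m' \<alpha> \<beta>)" by (rule exE)
  note m' = conjunct1[OF 1]
  from conjunct2[OF 1] obtain \<alpha> where 2: "\<exists>\<beta>. ?Q m' \<alpha> \<beta>" by (rule exE)
  from 2 obtain \<beta> where 3: "?Q m' \<alpha> \<beta>" by (rule exE)
  have IH: "(\<xi>, \<eta>) \<notin> F" if "(a, b) \<in> S" "\<forall>i<m. \<xi> i = a i \<and> \<eta> i = b i"
    "\<forall>i. m \<le> i \<and> i < m' \<longrightarrow> \<xi> i = \<alpha> i \<and> \<eta> i = \<beta> i" for a b \<xi> \<eta>
    by (rule mp[OF mp[OF bspec[OF 3 that(1), unfolded prod.case, THEN spec, of \<xi>, THEN spec, of \<eta>] that(2)] that(3)])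
  obtain a b where p: "p = (a, b)" by fastforce
  define \<alpha>0 \<beta>0 where "\<alpha>0 = (\<lambda>i. if i < m then a i else \<alpha> i)" and "\<beta>0 = (\<lambda>i. if i < m then b i else \<beta> i)"
  let ?B = "{\<xi>. \<forall>i<m'. \<xi> i = \<alpha>0 i} \<times> {\<xi>. \<forall>i<m'. \<xi> i = \<beta>0 i}"
  have "openin ?P ?B" unfolding openin_prod_Times_iff using openin_cantor_cylinder by blast
  moreover have "?B \<noteq> {}" by auto
  ultimately have "\<not> ?B \<subseteq> F" using F(2) unfolding interior_of_eq_empty by blast
  then obtain \<xi>1 \<eta>1 where x1: "\<And>i. i < m' \<Longrightarrow> \<xi>1 i = \<alpha>0 i" "\<And>i. i < m' \<Longrightarrow> \<eta>1 i = \<beta>0 i" "(\<xi>1, \<eta>1) \<notin> F" by auto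
  have Fo: "openin ?P (topspace ?P - F)" using F(1) by blast
  have x1F: "(\<xi>1, \<eta>1) \<in> topspace ?P - F" using x1(3) by simp
  obtain n where n: "\<And>\<xi> \<eta>. (\<And>i. i < n \<Longrightarrow> \<xi> i = \<xi>1 i \<and> \<eta> i = \<eta>1 i) \<Longrightarrow> (\<xi>, \<eta>) \<in> topspace ?P - F"
    by (rule cantor_box_nbhd[OF Fo x1F]) (rule that, blast)
  have "(\<xi>, \<eta>) \<notin> F" if cd: "(c, d) \<in> insert p S" and lo: "\<forall>i<m. \<xi> i = c i \<and> \<eta> i = d i"
    and hi: "\<forall>i. m \<le> i \<and> i < max m' n \<longrightarrow> \<xi> i = \<xi>1 i \<and> \<eta> i = \<eta>1 i" for c d \<xi> \<eta>
  proof (cases "(c, d) \<in> S")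
    case True
    show ?thesis
    proof (rule IH[OF True lo], intro allI impI)
      fix i assume i: "m \<le> i \<and> i < m'"
      then have "m \<le> i \<and> i < max m' n" by (simp add: less_max_iff_disj)
      then have "\<xi> i = \<xi>1 i \<and> \<eta> i = \<eta>1 i" by (rule hi[THEN spec, THEN mp])
      then show "\<xi> i = \<alpha> i \<and> \<eta> i = \<beta> i" using x1(1,2)[of i] i by (simp add: \<alpha>0_def \<beta>0_def)
    qed
  next
    case False
    then have cd: "c = a" "d = b" using cd p by auto
    have "\<xi> i = \<xi>1 i \<and> \<eta> i = \<eta>1 i" if "i < n" for i
    proof (cases "i < m")
      case True
      have "\<xi> i = c i \<and> \<eta> i = d i" by (rule lo[THEN spec, THEN mp, OF True])
      then show ?thesis using True cd x1(1,2)[of i] m' by (simp add: \<alpha>0_def \<beta>0_def)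
    next
      case False
      then have "m \<le> i \<and> i < max m' n" using that by (simp add: less_max_iff_disj)
      then show ?thesis by (rule hi[THEN spec, THEN mp])
    qed
    then have "(\<xi>, \<eta>) \<in> topspace ?P - F" by (rule n)
    then show ?thesis by (simp only: Diff_iff simp_thms)
  qed
  note key = this
  have le: "m \<le> max m' n" using m' by simp
  show ?case
  proof (rule exI[of _ "max m' n"], rule conjI[OF le], rule exI[of _ \<xi>1], rule exI[of _ \<eta>1], rule ballI)
    fix z assume z: "z \<in> insert p S"
    obtain c d where cd: "z = (c, d)" by fastforce
    show "case z of (a, b) \<Rightarrow> \<forall>\<xi> \<eta>. (\<forall>i<m. \<xi> i = a i \<and> \<eta> i = b i) \<longrightarrow>
        (\<forall>i. m \<le> i \<and> i < max m' n \<longrightarrow> \<xi> i = \<xi>1 i \<and> \<eta> i = \<eta>1 i) \<longrightarrow> (\<xi>, \<eta>) \<notin> F"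
      unfolding cd prod.case by (intro allI impI) (rule key[OF z[unfolded cd]], assumption, assumption)
  qed
qed

text \<open>Two points of Cantor space are used as alternatives on consecutive blocks; a sequence of block choices
  is repeated infinitely often, so that different sequences disagree on infinitely many blocks.\<close>

lemma meager_avoiding_family:
  assumes E: "meager (prod_topology cantor_space cantor_space) E"
  shows "\<exists>x :: (nat \<Rightarrow> bool) \<Rightarrow> nat \<Rightarrow> bool. \<forall>\<sigma> \<tau>. \<sigma> \<noteq> \<tau> \<longrightarrow> (x \<sigma>, x \<tau>) \<notin> E \<or> (x \<tau>, x \<sigma>) \<notin> E"
proof -
  let ?P = "prod_topology cantor_space cantor_space"
  obtain F where F: "\<And>n::nat. closedin ?P (F n) \<and> ?P interior_of F n = {}" "E \<subseteq> (\<Union>n. F n)"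
    using E unfolding meager_def by blast
  define G where "G n = (\<Union>k\<le>n. F k)" for n :: nat
  have Gcl: "closedin ?P (G n)" for n unfolding G_def by (rule closedin_Union) (use F in auto)
  have Gint: "?P interior_of (G n) = {}" for n
  proof (induction n)
    case 0
    then show ?case using F(1) by (simp add: G_def)
  next
    case (Suc n)
    have "G (Suc n) = G n \<union> F (Suc n)" unfolding G_def by (auto simp: le_Suc_eq)
    then show ?case using interior_of_closedin_union_empty_interior_of[OF Gcl, of "F (Suc n)" n] F(1) Suc by simp
  qed
  have FG: "F k \<subseteq> G n" if "k \<le> n" for k n using that unfolding G_def by blast
  define R where "R m n m' \<alpha> \<beta> \<longleftrightarrow> m < m' \<and> (\<forall>\<xi> \<eta>. (\<forall>i. m \<le> i \<and> i < m' \<longrightarrow> \<xi> i = \<alpha> i \<and> \<eta> i = \<beta> i) \<longrightarrow> (\<xi>, \<eta>) \<notin> G n)"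
    for m n m' :: nat and \<alpha> \<beta> :: "nat \<Rightarrow> bool"
  have "\<exists>t. R m n (fst t) (fst (snd t)) (snd (snd t))" for m n
  proof -
    \<comment> \<open>All initial segments of length \<open>m\<close>, so that the block works
      whatever precedes it.\<close>
    let ?S = "(\<lambda>A i. i \<in> A) ` Pow {..<m}"
    have fin: "finite (?S \<times> ?S)" by (intro finite_cartesian_product finite_imageI) auto
    let ?Q = "\<lambda>m' \<alpha> \<beta>. \<forall>(a, b)\<in>?S \<times> ?S. \<forall>\<xi> \<eta>. (\<forall>i<m. \<xi> i = a i \<and> \<eta> i = b i) \<longrightarrow> (\<forall>i. m \<le> i \<and> i < m' \<longrightarrow> \<xi> i = \<alpha> i \<and> \<eta> i = \<beta> i) \<longrightarrow> (\<xi>, \<eta>) \<notin> G n"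
    from avoid_nowhere_dense[OF Gcl[of n] Gint[of n] fin, where m = m]
    obtain m' where 1: "m \<le> m' \<and> (\<exists>\<alpha> \<beta>. ?Q m' \<alpha> \<beta>)" by (rule exE)
    from conjunct2[OF 1] obtain \<alpha> where 2: "\<exists>\<beta>. ?Q m' \<alpha> \<beta>" by (rule exE)
    from 2 obtain \<beta> where a: "?Q m' \<alpha> \<beta>" by (rule exE)
    note m' = conjunct1[OF 1]
    have "(\<xi>, \<eta>) \<notin> G n" if h: "\<forall>i. m \<le> i \<and> i < Suc m' \<longrightarrow> \<xi> i = \<alpha> i \<and> \<eta> i = \<beta> i" for \<xi> \<eta>
    proof -
      have S: "(\<lambda>i. i < m \<and> \<zeta> i) \<in> ?S" for \<zeta> :: "nat \<Rightarrow> bool"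
        by (rule image_eqI[of _ _ "{i. i < m \<and> \<zeta> i}"]) auto
      have lo: "\<forall>i<m. \<xi> i = (i < m \<and> \<xi> i) \<and> \<eta> i = (i < m \<and> \<eta> i)" by simp
      have hi: "\<forall>i. m \<le> i \<and> i < m' \<longrightarrow> \<xi> i = \<alpha> i \<and> \<eta> i = \<beta> i"
      proof (intro allI impI)
        fix i assume "m \<le> i \<and> i < m'"
        then have "m \<le> i \<and> i < Suc m'" by simp
        then show "\<xi> i = \<alpha> i \<and> \<eta> i = \<beta> i" by (rule h[THEN spec, THEN mp])
      qed
      show ?thesis
        by (rule mp[OF mp[OF bspec[OF a SigmaI[OF S[of \<xi>] S[of \<eta>]], unfolded prod.case, THEN spec, of \<xi>, THEN spec, of \<eta>] lo] hi])
    qed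
    \<comment> \<open>One more coordinate ensures that the block is not empty.\<close>
    then have "R m n (Suc m') \<alpha> \<beta>" unfolding R_def using m' by simp
    then show ?thesis by (intro exI[of _ "(Suc m', \<alpha>, \<beta>)"]) simp
  qed
  then have "\<forall>m n. \<exists>t. R m n (fst t) (fst (snd t)) (snd (snd t))" by blast
  then obtain t where t: "\<forall>m n. R m n (fst (t m n)) (fst (snd (t m n))) (snd (snd (t m n)))"
    unfolding choice_iff by (rule exE)
  define ms where "ms = rec_nat 0 (\<lambda>n m. fst (t m n))"
  have ms: "ms 0 = 0" "ms (Suc n) = fst (t (ms n) n)" for n by (simp_all add: ms_def)
  have ms_less: "ms n < ms (Suc n)" for n unfolding ms(2) by (rule t[THEN spec, THEN spec, unfolded R_def, THEN conjunct1])
  have ms_mono: "ms n \<le> ms k" if "n \<le> k" for n k by (rule lift_Suc_mono_le[OF _ that]) (use ms_less less_imp_le in blast)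
  define bl where "bl i = (LEAST n. i < ms (Suc n))" for i
  have bl: "bl i = n" if "ms n \<le> i" "i < ms (Suc n)" for i n
    unfolding bl_def
  proof (rule Least_equality)
    show "i < ms (Suc n)" by (rule that)
    fix k assume k: "i < ms (Suc k)"
    show "n \<le> k"
    proof (rule ccontr)
      assume "\<not> n \<le> k"
      then have "ms (Suc k) \<le> ms n" by (intro ms_mono) simp
      then show False using k that by simp
    qed
  qed
  \<comment> \<open>The number of a block codes a pair: the bit of \<open>\<sigma>\<close> at the
    first component selects the alternative used in the block. Each bit is thus used again for every
    value of the second component.\<close>
  define x where "x \<sigma> i = (if \<sigma> (fst (prod_decode (bl i))) then fst (snd (t (ms (bl i)) (bl i))) i
       else snd (snd (t (ms (bl i)) (bl i))) i)" for \<sigma> :: "nat \<Rightarrow> bool" and i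
  \<comment> \<open>The block coded by \<open>(i, k)\<close> has a number at least \<open>k\<close>,
    so its two alternatives, taken in this order, avoid \<open>F k\<close>. The order matters, which
    explains the disjunction in the statement.\<close>
  have avoid: "(x \<sigma>, x \<tau>) \<notin> E" if i: "\<sigma> i" "\<not> \<tau> i" for \<sigma> \<tau> i
  proof
    assume "(x \<sigma>, x \<tau>) \<in> E"
    then obtain k where k: "(x \<sigma>, x \<tau>) \<in> F k" using F(2) by blast
    let ?n = "prod_encode (i, k)"
    have "k \<le> ?n" by (rule le_prod_encode_2)
    then have inG: "(x \<sigma>, x \<tau>) \<in> G ?n" using k FG by blast
    have "x \<sigma> j = fst (snd (t (ms ?n) ?n)) j \<and> x \<tau> j = snd (snd (t (ms ?n) ?n)) j" if j: "ms ?n \<le> j \<and> j < fst (t (ms ?n) ?n)" for j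
    proof -
      have "bl j = ?n" by (rule bl) (use j in \<open>simp_all add: ms\<close>)
      then show ?thesis using i by (simp add: x_def)
    qed
    then have "\<forall>j. ms ?n \<le> j \<and> j < fst (t (ms ?n) ?n) \<longrightarrow> x \<sigma> j = fst (snd (t (ms ?n) ?n)) j \<and> x \<tau> j = snd (snd (t (ms ?n) ?n)) j"
      by (intro allI impI)
    then have "(x \<sigma>, x \<tau>) \<notin> G ?n"
      by (rule t[THEN spec, of "ms ?n", THEN spec, of ?n, unfolded R_def, THEN conjunct2, THEN spec, THEN spec, THEN mp])
    then show False using inG by blast
  qed
  show ?thesis
  proof (rule exI[of _ x], intro allI impI)
    fix \<sigma> \<tau> :: "nat \<Rightarrow> bool" assume "\<sigma> \<noteq> \<tau>"
    then obtain i where "\<sigma> i \<noteq> \<tau> i" by blast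
    then show "(x \<sigma>, x \<tau>) \<notin> E \<or> (x \<tau>, x \<sigma>) \<notin> E" using avoid[of \<sigma> i \<tau>] avoid[of \<tau> i \<sigma>] by blast
  qed
qed

text \<open>Equality of values of \<open>h\<close> is symmetric, so leaving the relation in one of
  the two orders is enough.\<close>

theorem flip_inequivalent_continuum:
  assumes E: "analytic_in (prod_topology cantor_space cantor_space) {(\<sigma>, \<tau>). h \<sigma> = h \<tau>}"
    and flip: "\<And>\<sigma> n. h (\<sigma>(n := \<not> \<sigma> n)) \<noteq> h \<sigma>"
  obtains x :: "(nat \<Rightarrow> bool) \<Rightarrow> nat \<Rightarrow> bool" where "inj (\<lambda>\<sigma>. h (x \<sigma>))"
proof -
  from meager_avoiding_family[OF flip_inequivalent_meager[OF E refl flip]]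
  obtain x :: "(nat \<Rightarrow> bool) \<Rightarrow> nat \<Rightarrow> bool" where x: "\<forall>\<sigma> \<tau>. \<sigma> \<noteq> \<tau> \<longrightarrow> (x \<sigma>, x \<tau>) \<notin> {(\<sigma>, \<tau>). h \<sigma> = h \<tau>} \<or> (x \<tau>, x \<sigma>) \<notin> {(\<sigma>, \<tau>). h \<sigma> = h \<tau>}"
    by (rule exE)
  have "inj (\<lambda>\<sigma>. h (x \<sigma>))"
  proof (rule injI, rule ccontr)
    fix \<sigma> \<tau> :: "nat \<Rightarrow> bool" assume e: "h (x \<sigma>) = h (x \<tau>)" and "\<sigma> \<noteq> \<tau>"
    then show False using x[THEN spec, of \<sigma>, THEN spec, of \<tau>] by simp
  qed
  then show thesis by (rule that)
qed

section \<open>Cardinality of images of homomorphisms with analytic kernel\<close>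

text \<open>The fibre product of \<open>g\<close> with a parametrisation of \<open>A\<close> is
  closed because \<open>Y\<close> is Hausdorff; its projection to \<open>T\<close> is the
  preimage.\<close>

lemma analytic_preimage:
  assumes T: "polish_topology T" and g: "continuous_map T Y g" and Y: "Hausdorff_space Y" and A: "analytic_in Y A"
  shows "analytic_in T {z \<in> topspace T. g z \<in> A}"
proof -
  obtain Z :: "(nat \<Rightarrow> real) topology" and f where Z: "polish_topology Z" "continuous_map Z Y f" "f ` topspace Z = A"
    using A by (rule analyticE)
  let ?P = "prod_topology T Z"
  let ?S = "{w \<in> topspace ?P. (g \<circ> fst) w = (f \<circ> snd) w}"
  have "closedin ?P ?S"
    by (rule closedin_continuous_maps_eq[OF Y continuous_map_compose[OF continuous_map_fst g] continuous_map_compose[OF continuous_map_snd Z(2)]])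
  then have "polish_topology (subtopology ?P ?S)" using polish_subtopology[OF polish_prod[OF T Z(1)]] by blast
  moreover have "continuous_map (subtopology ?P ?S) T fst" by (intro continuous_map_from_subtopology continuous_map_fst)
  ultimately have "analytic_in T (fst ` topspace (subtopology ?P ?S))" by (rule analytic_inI)
  moreover have "fst ` topspace (subtopology ?P ?S) = {z \<in> topspace T. g z \<in> A}"
  proof (intro equalityI subsetI)
    fix z assume "z \<in> {z \<in> topspace T. g z \<in> A}"
    then obtain w where "z \<in> topspace T" "w \<in> topspace Z" "g z = f w" using Z(3) by blast
    then show "z \<in> fst ` topspace (subtopology ?P ?S)" by (intro image_eqI[of _ _ "(z, w)"]) auto
  qed (use Z(3) in auto)
  ultimately show ?thesis by simp
qed

lemma (in group) countable_generate:
  assumes A: "A \<subseteq> carrier G" "countable A" shows "countable (generate G A)"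
proof -
  let ?B = "A \<union> m_inv G ` A" and ?m = "\<lambda>w. foldr (\<otimes>) w \<one>"
  have B: "?B \<subseteq> carrier G" using A(1) by auto
  have cl: "?m w \<in> carrier G" if "w \<in> lists ?B" for w using that B by (induction w) auto
  have app: "?m (u @ v) = ?m u \<otimes> ?m v" if "u \<in> lists ?B" "v \<in> lists ?B" for u v
    using that(1)
  proof (induction u)
    case Nil
    then show ?case using cl[OF that(2)] by simp
  next
    case (Cons a u)
    then have "a \<in> carrier G" "u \<in> lists ?B" using B by auto
    then show ?case using Cons.IH cl[of u] cl[OF that(2)] by (simp add: m_assoc)
  qed
  have "a \<in> ?m ` lists ?B" if "a \<in> generate G A" for a
    using that
  proof (induction rule: generate.induct)
    case one
    show ?case by (rule image_eqI[of _ _ "[]"]) simp_all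
  next
    case (incl h)
    then show ?case using A(1) by (intro image_eqI[of _ _ "[h]"]) auto
  next
    case (inv h)
    then show ?case using A(1) by (intro image_eqI[of _ _ "[inv h]"]) auto
  next
    case (eng h1 h2)
    then obtain u v where "u \<in> lists ?B" "v \<in> lists ?B" "h1 = ?m u" "h2 = ?m v" by blast
    then show ?case using app[of u v] by (intro image_eqI[of _ _ "u @ v"]) simp_all
  qed
  then have "generate G A \<subseteq> ?m ` lists ?B" by blast
  moreover have "countable (?m ` lists ?B)" using A(2) by simp
  ultimately show ?thesis by (rule countable_subset)
qed

lemma paths_eq_if_rational:
  fixes p q :: "real \<Rightarrow> 'a::metric_space"
  assumes "path p" "path q" "\<And>t. t \<in> {0..1} \<Longrightarrow> t \<in> \<rat> \<Longrightarrow> p t = q t" "t \<in> {0..1}"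
  shows "p t = q t"
proof -
  let ?S = "{0<..<1} \<inter> \<rat> :: real set"
  have "closure ?S = closure {0<..<1::real}"
    by (rule closure_open_Int_superset) (simp_all add: Rats_closure_real)
  then have cl: "closure ?S = {0..1}" by simp
  have "dist (p t) (q t) = 0"
  proof (rule continuous_constant_on_closure[of ?S "\<lambda>t. dist (p t) (q t)" 0 t])
    show "continuous_on (closure ?S) (\<lambda>t. dist (p t) (q t))"
      unfolding cl using assms(1,2) unfolding path_def by (rule continuous_on_dist)
    show "dist (p s) (q s) = 0" if "s \<in> ?S" for s using assms(3)[of s] that by simp
    show "t \<in> closure ?S" unfolding cl by (rule assms(4))
  qed
  then show ?thesis by simp
qed

text \<open>A loop is determined by its values at rational times, and a value by the rational cuts
  of countably many reals; so loops inject into the subsets of a countable set.\<close>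

lemma loops_lepoll:
  fixes X :: "'a::metric_space set"
  assumes "polish_topology (top_of_set X)"
  shows "loops X x \<lesssim> (UNIV :: nat set set)"
proof -
  obtain h :: "'a \<Rightarrow> nat \<Rightarrow> real" where h: "inj_on h (topspace (top_of_set X))"
    using polish_topology_inj[OF assms] .
  define S where "S p = {(s :: rat, n, r :: rat). of_rat s \<in> {0..1::real} \<and> of_rat r < h (p (of_rat s)) n}" for p :: "real \<Rightarrow> 'a"
  have "inj_on S (loops X x)"
  proof (rule inj_onI)
    fix p q assume p: "p \<in> loops X x" and q: "q \<in> loops X x" and pq: "S p = S q"
    have rat: "p t = q t" if t: "t \<in> {0..1}" "t \<in> \<rat>" for t
    proof -
      obtain s where s: "t = of_rat s" using t(2) by (auto elim: Rats_cases)
      have "of_rat r < h (p t) n \<longleftrightarrow> of_rat r < h (q t) n" for r n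
      proof -
        have "(s, n, r) \<in> S p \<longleftrightarrow> (s, n, r) \<in> S q" using pq by simp
        then show ?thesis using t(1) unfolding S_def s by simp
      qed
      then have "h (p t) n = h (q t) n" for n
        using of_rat_dense[of "h (p t) n" "h (q t) n"] of_rat_dense[of "h (q t) n" "h (p t) n"]
        by (metis linorder_neqE_linordered_idom order_less_asym)
      then have "h (p t) = h (q t)" by blast
      moreover have "p t \<in> X" "q t \<in> X" using p q t(1) by (auto simp: loops_def path_image_def)
      ultimately show ?thesis using h by (auto dest: inj_onD)
    qed
    show "p = q"
    proof
      fix t show "p t = q t"
      proof (cases "t \<in> {0..1}")
        case True
        have "path p" "path q" using p q by (auto simp: loops_def)
        then show ?thesis using rat True by (rule paths_eq_if_rational)
      next
        case False
        then show ?thesis using p q by (auto simp: loops_def extensional_def)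
      qed
    qed
  qed
  moreover have "inj (image to_nat :: (rat \<times> nat \<times> rat) set \<Rightarrow> nat set)" by (rule inj_on_image) simp
  ultimately have "inj_on (image to_nat \<circ> S) (loops X x)" by (intro comp_inj_on) (auto intro: inj_on_subset)
  then show ?thesis unfolding lepoll_def by blast
qed

context tame_space
begin

lemma carrier_lepoll:
  assumes "polish_topology (top_of_set X)"
  shows "carrier \<pi> \<lesssim> (UNIV :: nat set set)"
proof -
  have r: "W (restrict (rep a) {0..1}) = a" "restrict (rep a) {0..1} \<in> loops X x" if "a \<in> carrier \<pi>" for a
    using rep[OF that] W_restrict[of "rep a"] restrict_loop(1)[of X x "rep a"] by simp_all
  have "inj_on (\<lambda>a. restrict (rep a) {0..1}) (carrier \<pi>)" by (rule inj_on_inverseI[where g = W]) (rule r(1))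
  moreover have "(\<lambda>a. restrict (rep a) {0..1}) ` carrier \<pi> \<subseteq> loops X x" using r(2) by blast
  ultimately have "carrier \<pi> \<lesssim> loops X x" unfolding lepoll_def by blast
  then show ?thesis using loops_lepoll[OF assms] by (rule lepoll_trans)
qed

text \<open>The local groups disappear under \<open>f\<close>, so the images of the countable set
  \<open>C\<close> generate the image.\<close>

lemma countable_image_if_locally_trivial:
  assumes H: "group H" and hom: "f \<in> hom \<pi> H"
    and V: "\<forall>y\<in>X. openin (top_of_set X) (V y) \<and> y \<in> V y \<and> (\<forall>a\<in>local_group (V y) y. f a = \<one>\<^bsub>H\<^esub>)"
  shows "countable (f ` carrier \<pi>)"
proof -
  interpret f: group_hom \<pi> H f using H hom by (intro group_hom.intro group_hom_axioms.intro) (rule group_pi)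
  obtain Y C where Y: "countable Y" "Y \<subseteq> X" "countable C" "C \<subseteq> carrier \<pi>"
    and gen: "\<And>S. subgroup S \<pi> \<Longrightarrow> C \<subseteq> S \<Longrightarrow> (\<And>y. y \<in> Y \<Longrightarrow> local_group (V y) y \<subseteq> S) \<Longrightarrow> carrier \<pi> \<subseteq> S"
    using V by (rule_tac countable_generation[of V]) auto
  have fC: "f ` C \<subseteq> carrier H" using Y(4) by auto
  have cg: "countable (generate H (f ` C))" using f.H.countable_generate[OF fC] Y(3) by simp
  have sg: "subgroup (generate H (f ` C)) H" by (rule f.H.generate_is_subgroup[OF fC])
  let ?S = "{a \<in> carrier \<pi>. f a \<in> generate H (f ` C)}"
  have "carrier \<pi> \<subseteq> ?S"
  proof (rule gen)
    show "subgroup ?S \<pi>"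
    proof
      show "\<one>\<^bsub>\<pi>\<^esub> \<in> ?S" using subgroup.one_closed[OF sg] by simp
      show "a \<otimes>\<^bsub>\<pi>\<^esub> b \<in> ?S" if "a \<in> ?S" "b \<in> ?S" for a b
        using that subgroup.m_closed[OF sg] by simp
      show "inv\<^bsub>\<pi>\<^esub> a \<in> ?S" if "a \<in> ?S" for a
        using that subgroup.m_inv_closed[OF sg] by simp
    qed auto
    show "C \<subseteq> ?S" using Y(4) by (auto intro: generate.incl)
    show "local_group (V y) y \<subseteq> ?S" if y: "y \<in> Y" for y
    proof
      fix a assume a: "a \<in> local_group (V y) y"
      have yX: "y \<in> X" using y Y(2) by blast
      have "V y \<subseteq> X" "y \<in> V y" using V yX openin_subset_X by blast+
      then have "a \<in> carrier \<pi>" using subgroup.subset[OF subgroup_local_group] a by blast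
      moreover have "f a = \<one>\<^bsub>H\<^esub>" using V yX a by blast
      ultimately show "a \<in> ?S" using subgroup.one_closed[OF sg] by simp
    qed
  qed
  then have "f ` carrier \<pi> \<subseteq> generate H (f ` C)" by blast
  then show ?thesis using cg by (rule countable_subset)
qed

lemma continuum_image_if_not_locally_trivial:
  assumes H: "group H" and hom: "f \<in> hom \<pi> H"
    and an: "analytic_in (mtopology_of (loop_metric X x)) (\<Union>(kernel \<pi> H f))"
    and y: "y \<in> X" and nt: "\<And>V. openin (top_of_set X) V \<Longrightarrow> y \<in> V \<Longrightarrow> \<exists>a\<in>local_group V y. f a \<noteq> \<one>\<^bsub>H\<^esub>"
  shows "\<exists>g :: (nat \<Rightarrow> bool) \<Rightarrow> _. inj g \<and> range g \<subseteq> f ` carrier \<pi>"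
proof -
  interpret f: group_hom \<pi> H f using H hom by (intro group_hom.intro group_hom_axioms.intro) (rule group_pi)
  let ?L = "mtopology_of (CT {0..1} :: (real \<Rightarrow> 'a) metric)"
  have "\<exists>\<gamma>. is_loop (small_nbhd X y n) y \<gamma> \<and> f (W \<gamma>) \<noteq> \<one>\<^bsub>H\<^esub>" for n
  proof -
    have "openin (top_of_set X) (small_nbhd X y n)" unfolding small_nbhd_def by blast
    then obtain a where a: "a \<in> local_group (small_nbhd X y n) y" "f a \<noteq> \<one>\<^bsub>H\<^esub>" using nt small_nbhd_mem[OF y] by blast
    from a(1) obtain \<gamma> where "a = W \<gamma>" "\<gamma> \<in> {p. is_loop (small_nbhd X y n) y p}" unfolding local_group_def by (rule imageE)
    then show ?thesis using a(2) by (intro exI[of _ \<gamma>]) simp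
  qed
  then have "\<forall>n. \<exists>\<gamma>. is_loop (small_nbhd X y n) y \<gamma> \<and> f (W \<gamma>) \<noteq> \<one>\<^bsub>H\<^esub>" by (rule allI)
  then obtain \<gamma> where \<gamma>: "\<forall>n. is_loop (small_nbhd X y n) y (\<gamma> n) \<and> f (W (\<gamma> n)) \<noteq> \<one>\<^bsub>H\<^esub>"
    unfolding choice_iff by (rule exE)
  \<comment> \<open>Omitted members of the null sequence are replaced by the constant loop, so that
    each member keeps its place in the concatenation for all \<open>\<sigma>\<close>.\<close>
  define c where "c \<sigma> n = (if \<sigma> n then \<gamma> n else (\<lambda>_. y))" for \<sigma> :: "nat \<Rightarrow> bool" and n
  define E where "E \<sigma> n q = c \<sigma> n +++ q" for \<sigma> :: "nat \<Rightarrow> bool" and n and q :: "real \<Rightarrow> 'a"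
  have c: "is_loop (small_nbhd X y n) y (c \<sigma> n)" for \<sigma> n
    using \<gamma> is_loop_const[OF small_nbhd_mem[OF y]] by (simp add: c_def)
  have Ep: "pointwise_map (E \<sigma> n)" for \<sigma> n
    unfolding E_def by (intro pointwise_map_join pointwise_map_const pointwise_map_id)
  have El: "is_loop (small_nbhd X y n) y (E \<sigma> n q)" if "is_loop (small_nbhd X y (Suc n)) y q" for \<sigma> n q
    unfolding E_def using c is_loop_subset[OF that small_nbhd_mono[of n "Suc n"]] by (intro is_loop_join) simp_all
  have "\<forall>\<sigma>. \<exists>p. \<forall>n. is_loop (small_nbhd X y n) y (p n) \<and> (\<forall>t\<in>{0..1}. p n t = E \<sigma> n (p (Suc n)) t)"
  proof
    fix \<sigma>
    obtain p where p: "\<And>n. is_loop (small_nbhd X y n) y (p n)" "\<And>n t. t \<in> {0..1} \<Longrightarrow> p n t = E \<sigma> n (p (Suc n)) t"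
      by (rule infinite_word[where E = "E \<sigma>", OF y Ep El], assumption, rule that, blast, blast)
    show "\<exists>p. \<forall>n. is_loop (small_nbhd X y n) y (p n) \<and> (\<forall>t\<in>{0..1}. p n t = E \<sigma> n (p (Suc n)) t)"
      by (intro exI[of _ p] allI conjI ballI p)
  qed
  then obtain p where "\<forall>\<sigma> n. is_loop (small_nbhd X y n) y (p \<sigma> n) \<and> (\<forall>t\<in>{0..1}. p \<sigma> n t = E \<sigma> n (p \<sigma> (Suc n)) t)"
    unfolding choice_iff by (rule exE)
  then have p: "is_loop (small_nbhd X y n) y (p \<sigma> n)" and pE: "t \<in> {0..1} \<Longrightarrow> p \<sigma> n t = E \<sigma> n (p \<sigma> (Suc n)) t" for \<sigma> n t
    by blast+
  have sX: "small_nbhd X y n \<subseteq> X" for n by (simp add: small_nbhd_def)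
  note pX = is_loop_path_in[OF p sX] and cX = is_loop_path_in[OF c sX]
  have close: "p \<sigma> m t = p \<tau> m t \<or> p \<sigma> m t \<in> small_nbhd X y (m + N) \<and> p \<tau> m t \<in> small_nbhd X y (m + N)"
    if same: "\<And>n. m \<le> n \<Longrightarrow> n < m + N \<Longrightarrow> \<sigma> n = \<tau> n" and t: "t \<in> {0..1}" for \<sigma> \<tau> m N t
  proof (rule infinite_word_close[where E = "E \<sigma>" and E' = "E \<tau>" and p = "p \<sigma>" and p' = "p \<tau>" and X = X and y = y])
    show "pointwise_map (E \<sigma> n)" for n by (rule Ep)
    show "is_loop (small_nbhd X y n) y (p \<sigma> n)" "is_loop (small_nbhd X y n) y (p \<tau> n)" for n by (rule p)+
    show "p \<sigma> n s = E \<sigma> n (p \<sigma> (Suc n)) s" "p \<tau> n s = E \<tau> n (p \<tau> (Suc n)) s" if "s \<in> {0..1}" for n s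
      using that by (rule pE)+
    show "t \<in> {0..1}" by (rule t)
    fix n assume "m \<le> n" "n < m + N"
    then have "\<sigma> n = \<tau> n" by (rule same)
    then show "E \<sigma> n = E \<tau> n" by (simp add: E_def c_def fun_eq_iff)
  qed
  have dist_close: "dist (p \<sigma> m t) (p \<tau> m t) \<le> 2 * inverse (real (Suc (m + N)))"
    if same: "\<And>n. m \<le> n \<Longrightarrow> n < m + N \<Longrightarrow> \<sigma> n = \<tau> n" and t: "t \<in> {0..1}" for \<sigma> \<tau> m N t
  proof -
    have "p \<sigma> m t = p \<tau> m t \<or> p \<sigma> m t \<in> small_nbhd X y (m + N) \<and> p \<tau> m t \<in> small_nbhd X y (m + N)"
      by (rule close[OF _ t]) (rule same)
    then show ?thesis
    proof (elim disjE conjE)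
      assume "p \<sigma> m t = p \<tau> m t"
      then show ?thesis by simp
    next
      assume "p \<sigma> m t \<in> small_nbhd X y (m + N)" "p \<tau> m t \<in> small_nbhd X y (m + N)"
      then show ?thesis by (rule small_nbhd_dist)
    qed
  qed
  have W_step: "W (p \<sigma> n) = W (c \<sigma> n) \<otimes>\<^bsub>\<pi>\<^esub> W (p \<sigma> (Suc n))" for \<sigma> n
  proof -
    have "W (p \<sigma> n) = W (c \<sigma> n +++ p \<sigma> (Suc n))"
      by (rule W_cong[OF pX]) (simp add: pE E_def)
    also have "\<dots> = W (c \<sigma> n) \<otimes>\<^bsub>\<pi>\<^esub> W (p \<sigma> (Suc n))"
      by (rule W_join[OF cX pX]) (use c p in \<open>simp add: is_loop_def\<close>)
    finally show ?thesis .
  qed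
  \<comment> \<open>With equal tails \<open>dist_close\<close> applies for every \<open>N\<close>,
    so the two loops coincide pointwise.\<close>
  have W_tail: "W (p \<sigma> m) = W (p \<tau> m)" if "\<And>n. m \<le> n \<Longrightarrow> \<sigma> n = \<tau> n" for \<sigma> \<tau> m
  proof (rule W_cong[OF pX], rule ccontr)
    fix t :: real assume t: "t \<in> {0..1}" and ne: "p \<sigma> m t \<noteq> p \<tau> m t"
    then have "0 < dist (p \<sigma> m t) (p \<tau> m t) / 2" by simp
    then obtain N where N: "inverse (real (Suc N)) < dist (p \<sigma> m t) (p \<tau> m t) / 2" using reals_Archimedean by blast
    have "dist (p \<sigma> m t) (p \<tau> m t) \<le> 2 * inverse (real (Suc (m + N)))" by (rule dist_close[OF _ t]) (rule that)
    moreover have "inverse (real (Suc (m + N))) \<le> inverse (real (Suc N))" by (intro le_imp_inverse_le) auto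
    ultimately show False using N by linarith
  qed
  define h where "h \<sigma> = f (W (p \<sigma> 0))" for \<sigma>
  have flip: "h (\<sigma>(n := \<not> \<sigma> n)) \<noteq> h \<sigma>" for \<sigma> n
  proof -
    define \<tau> where "\<tau> = \<sigma>(n := \<not> \<sigma> n)"
    have fc: "f (W (c \<upsilon> k)) \<in> carrier H" and fp: "f (W (p \<upsilon> k)) \<in> carrier H" for \<upsilon> k
      using f.hom_closed[OF W_carrier[OF cX]] f.hom_closed[OF W_carrier[OF pX]] by blast+
    have st: "f (W (p \<upsilon> k)) = f (W (c \<upsilon> k)) \<otimes>\<^bsub>H\<^esub> f (W (p \<upsilon> (Suc k)))" for \<upsilon> k
      unfolding W_step[of \<upsilon> k] by (rule f.hom_mult[OF W_carrier[OF cX] W_carrier[OF pX]])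
    have tail: "f (W (p \<tau> (Suc n))) = f (W (p \<sigma> (Suc n)))" by (subst W_tail[of "Suc n" \<tau> \<sigma>]) (auto simp: \<tau>_def)
    have cn: "f (W (c \<tau> n)) \<noteq> f (W (c \<sigma> n))"
      using \<gamma>[THEN spec, of n, THEN conjunct2] not_sym[OF \<gamma>[THEN spec, of n, THEN conjunct2]]
      by (cases "\<sigma> n") (simp_all add: c_def \<tau>_def W_const[OF y])
    \<comment> \<open>Downward induction from \<open>n\<close>: at \<open>n\<close> the first
      factors differ and the tails agree, below \<open>n\<close> a common factor is
      cancelled.\<close>
    have main: "f (W (p \<tau> m)) \<noteq> f (W (p \<sigma> m))" if "m \<le> n" for m
      using that
    proof (induction rule: inc_induct)
      case base
      show ?case
      proof
        assume "f (W (p \<tau> n)) = f (W (p \<sigma> n))"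
        then have "f (W (c \<tau> n)) \<otimes>\<^bsub>H\<^esub> f (W (p \<sigma> (Suc n))) = f (W (c \<sigma> n)) \<otimes>\<^bsub>H\<^esub> f (W (p \<sigma> (Suc n)))"
          unfolding st[of \<tau> n] st[of \<sigma> n] tail .
        then have "f (W (c \<tau> n)) = f (W (c \<sigma> n))"
          by (simp only: f.H.right_cancel[OF fp[of \<sigma> "Suc n"] fc[of \<tau> n] fc[of \<sigma> n]])
        then show False by (rule notE[OF cn])
      qed
    next
      case (step k)
      have "k \<noteq> n" using step.hyps by simp
      then have cc: "c \<tau> k = c \<sigma> k" by (simp add: c_def \<tau>_def)
      show ?case
      proof
        assume "f (W (p \<tau> k)) = f (W (p \<sigma> k))"
        then have "f (W (c \<sigma> k)) \<otimes>\<^bsub>H\<^esub> f (W (p \<tau> (Suc k))) = f (W (c \<sigma> k)) \<otimes>\<^bsub>H\<^esub> f (W (p \<sigma> (Suc k)))"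
          unfolding st[of \<tau> k] st[of \<sigma> k] cc .
        then have "f (W (p \<tau> (Suc k))) = f (W (p \<sigma> (Suc k)))"
          using fc[of \<sigma> k] fp[of \<tau> "Suc k"] fp[of \<sigma> "Suc k"]
          by (metis f.H.inv_closed f.H.l_inv f.H.l_one f.H.m_assoc)
        then show False by (rule notE[OF step.IH])
      qed
    qed
    show ?thesis unfolding h_def \<tau>_def[symmetric] by (rule main[OF le0])
  qed
  have rp_cont: "continuous_map cantor_space ?L (\<lambda>\<sigma>. restrict (p \<sigma> 0) {0..1})"
  proof (rule continuous_map_CT)
    fix \<sigma> :: "nat \<Rightarrow> bool"
    have "continuous_on {0..1} (p \<sigma> 0)" using conjunct1[OF pX[of \<sigma> 0]] unfolding path_def .
    then have "continuous_on {0..1} (restrict (p \<sigma> 0) {0..1})" by (rule continuous_on_eq) simp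
    then show "restrict (p \<sigma> 0) {0..1} \<in> CK {0..1} UNIV" by (simp add: CK_def)
    fix e :: real assume "0 < e"
    then obtain N where N: "inverse (real (Suc N)) < e / 2" using reals_Archimedean[of "e / 2"] by auto
    show "\<exists>V. openin cantor_space V \<and> \<sigma> \<in> V \<and> (\<forall>\<tau>\<in>V. \<forall>t\<in>{0..1}. dist (restrict (p \<sigma> 0) {0..1} t) (restrict (p \<tau> 0) {0..1} t) \<le> e)"
    proof (intro exI[of _ "{\<tau>. \<forall>i<N. \<tau> i = \<sigma> i}"] conjI ballI)
      fix \<tau> and t :: real assume \<tau>: "\<tau> \<in> {\<tau>. \<forall>i<N. \<tau> i = \<sigma> i}" and t: "t \<in> {0..1}"
      have "dist (p \<sigma> 0 t) (p \<tau> 0 t) \<le> 2 * inverse (real (Suc (0 + N)))" by (rule dist_close[OF _ t]) (use \<tau> in simp)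
      then have "dist (p \<sigma> 0 t) (p \<tau> 0 t) \<le> 2 * inverse (real (Suc N))" by (simp only: add_0_left)
      then show "dist (restrict (p \<sigma> 0) {0..1} t) (restrict (p \<tau> 0) {0..1} t) \<le> e"
        unfolding restrict_apply'[OF t] using N by linarith
    qed (simp_all add: openin_cantor_cylinder)
  qed simp
  let ?P = "prod_topology cantor_space cantor_space"
  \<comment> \<open>A loop at \<open>x\<close> whose class is the quotient of the classes of
    \<open>q\<close> and \<open>q'\<close>; equality of values of \<open>h\<close> becomes
    membership of such a loop in the union of the kernel.\<close>
  define R where "R q q' = \<theta> y +++ ((q +++ reversepath q') +++ reversepath (\<theta> y))" for q q' :: "real \<Rightarrow> 'a"
  define r where "r z = restrict (R (restrict (p (fst z) 0) {0..1}) (restrict (p (snd z) 0) {0..1})) {0..1}"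
    for z :: "(nat \<Rightarrow> bool) \<times> (nat \<Rightarrow> bool)"
  have R: "is_loop X x (R q q')" "W (R q q') = W q \<otimes>\<^bsub>\<pi>\<^esub> inv\<^bsub>\<pi>\<^esub> (W q')" if q: "is_loop X y q" "is_loop X y q'" for q q'
  proof -
    have j: "is_loop X y (q +++ reversepath q')" using q by (intro is_loop_join is_loop_reverse)
    have jX: "path_in X (q +++ reversepath q')" by (rule is_loop_path_in[OF j order_refl])
    have cu: "close_up (q +++ reversepath q') = R q q'" using j by (simp add: close_up_def R_def is_loop_def)
    show "is_loop X x (R q q')" using close_up_loop[OF jX] unfolding cu .
    have "W (R q q') = W (q +++ reversepath q')" using W_close_up[OF jX] unfolding cu .
    also have "\<dots> = W q \<otimes>\<^bsub>\<pi>\<^esub> inv\<^bsub>\<pi>\<^esub> (W q')"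
      using q by (simp add: W_join W_reverse is_loop_def[of X y])
    finally show "W (R q q') = W q \<otimes>\<^bsub>\<pi>\<^esub> inv\<^bsub>\<pi>\<^esub> (W q')" .
  qed
  have rp: "is_loop X y (restrict (p \<sigma> 0) {0..1})" "W (restrict (p \<sigma> 0) {0..1}) = W (p \<sigma> 0)" for \<sigma>
  proof -
    have "is_loop X y (p \<sigma> 0)" by (rule is_loop_subset[OF p sX])
    note rl = restrict_loop[OF this]
    show "is_loop X y (restrict (p \<sigma> 0) {0..1})" by (rule is_loop_if_loops[OF rl(1)])
    show "W (restrict (p \<sigma> 0) {0..1}) = W (p \<sigma> 0)" using W_homotopic[OF rl(2)] by simp
  qed
  have Rr: "rearranging R"
    unfolding R_def by (intro rearranging_join rearranging_reverse rearranging_const rearranging_fst rearranging_snd)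
  have r_eq: "r = (\<lambda>z. restrict (R (restrict (p (fst z) 0) {0..1}) (restrict (p (snd z) 0) {0..1})) {0..1})"
    by (rule ext) (rule r_def)
  have r_cont: "continuous_map ?P ?L r"
    unfolding r_eq
  proof (rule continuous_map_rearranging[OF Rr])
    show "continuous_map ?P ?L (\<lambda>z. restrict (p (fst z) 0) {0..1})"
      by (rule continuous_map_compose[OF continuous_map_fst rp_cont, unfolded comp_def])
    show "continuous_map ?P ?L (\<lambda>z. restrict (p (snd z) 0) {0..1})"
      by (rule continuous_map_compose[OF continuous_map_snd rp_cont, unfolded comp_def])
    show "path (R (restrict (p (fst z) 0) {0..1}) (restrict (p (snd z) 0) {0..1}))" for z
      using R(1)[OF rp(1)[of "fst z"] rp(1)[of "snd z"]] unfolding is_loop_def by (rule conjunct1)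
  qed
  have rK: "r z \<in> \<Union>(kernel \<pi> H f) \<longleftrightarrow> h (fst z) = h (snd z)" for z
  proof -
    note Rz = R[OF rp(1)[of "fst z"] rp(1)[of "snd z"]]
    have rl: "r z \<in> loops X x" unfolding r_def by (rule restrict_loop(1)[OF Rz(1)])
    have Wr: "W (r z) = W (p (fst z) 0) \<otimes>\<^bsub>\<pi>\<^esub> inv\<^bsub>\<pi>\<^esub> (W (p (snd z) 0))"
      unfolding r_def W_restrict[OF Rz(1)] unfolding Rz(2) unfolding rp(2) ..
    note Wc = W_carrier[OF pX[of "fst z" 0]] W_carrier[OF pX[of "snd z" 0]]
    have kc: "kernel \<pi> H f \<subseteq> carrier \<pi>" by (auto simp: kernel_def)
    have "r z \<in> \<Union>(kernel \<pi> H f) \<longleftrightarrow> W (r z) \<in> kernel \<pi> H f" unfolding Union_classes[OF kc] using rl by simp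
    also have "\<dots> \<longleftrightarrow> f (W (r z)) = \<one>\<^bsub>H\<^esub>" unfolding kernel_def Wr using Wc by simp
    also have "\<dots> \<longleftrightarrow> h (fst z) \<otimes>\<^bsub>H\<^esub> inv\<^bsub>H\<^esub> (h (snd z)) = \<one>\<^bsub>H\<^esub>"
      unfolding Wr h_def using Wc by (simp add: f.hom_mult f.hom_inv)
    also have "\<dots> \<longleftrightarrow> h (fst z) = h (snd z)"
    proof
      have c1: "h (fst z) \<in> carrier H" "h (snd z) \<in> carrier H" unfolding h_def by (rule f.hom_closed[OF Wc(1)], rule f.hom_closed[OF Wc(2)])
      show "h (fst z) = h (snd z)" if "h (fst z) \<otimes>\<^bsub>H\<^esub> inv\<^bsub>H\<^esub> (h (snd z)) = \<one>\<^bsub>H\<^esub>"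
      proof -
        have "h (fst z) = h (fst z) \<otimes>\<^bsub>H\<^esub> inv\<^bsub>H\<^esub> (h (snd z)) \<otimes>\<^bsub>H\<^esub> h (snd z)" using c1 by (simp add: f.H.m_assoc)
        then show ?thesis unfolding that using c1 by simp
      qed
      show "h (fst z) \<otimes>\<^bsub>H\<^esub> inv\<^bsub>H\<^esub> (h (snd z)) = \<one>\<^bsub>H\<^esub>" if "h (fst z) = h (snd z)"
        unfolding that by (rule f.H.r_inv[OF c1(2)])
    qed
    finally show ?thesis .
  qed
  have "analytic_in ?L (\<Union>(kernel \<pi> H f))"
  proof -
    obtain Z :: "(nat \<Rightarrow> real) topology" and g
      where Z: "polish_topology Z" "continuous_map Z (mtopology_of (loop_metric X x)) g" "g ` topspace Z = \<Union>(kernel \<pi> H f)"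
      using an by (rule analyticE)
    have g: "continuous_map Z ?L g"
      using Z(2) unfolding mtopology_loop_metric continuous_map_in_subtopology by (rule conjunct1)
    show ?thesis unfolding analytic_in_def by (rule exI[of _ Z], rule exI[of _ g]) (intro conjI Z(1) g Z(3))
  qed
  then have "analytic_in ?P {z \<in> topspace ?P. r z \<in> \<Union>(kernel \<pi> H f)}"
    by (rule analytic_preimage[OF polish_prod[OF polish_cantor polish_cantor] r_cont Hausdorff_CT])
  moreover have "{z \<in> topspace ?P. r z \<in> \<Union>(kernel \<pi> H f)} = {(\<sigma>, \<tau>). h \<sigma> = h \<tau>}"
    unfolding rK by auto
  ultimately have hE: "analytic_in ?P {(\<sigma>, \<tau>). h \<sigma> = h \<tau>}" by (simp only:)
  obtain u :: "(nat \<Rightarrow> bool) \<Rightarrow> nat \<Rightarrow> bool" where u: "inj (\<lambda>\<sigma>. h (u \<sigma>))" by (rule flip_inequivalent_continuum[where h = h, OF hE flip])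
  have "range (\<lambda>\<sigma>. h (u \<sigma>)) \<subseteq> f ` carrier \<pi>"
    by (rule image_subsetI) (unfold h_def, rule imageI, rule W_carrier, rule pX)
  with u show ?thesis by (intro exI[of _ "\<lambda>\<sigma>. h (u \<sigma>)"] conjI)
qed

text \<open>Either \<open>f\<close> kills the small loops around every point, or a null sequence of
  loops with nontrivial image survives at one point. The number of loops bounds the image from
  above.\<close>

theorem image_countable_or_continuum:
  assumes pol: "polish_topology (top_of_set X)" and H: "group H" and hom: "f \<in> hom \<pi> H"
    and an: "analytic_in (mtopology_of (loop_metric X x)) (\<Union>(kernel \<pi> H f))"
  shows "countable (f ` carrier \<pi>) \<or> f ` carrier \<pi> \<approx> (UNIV :: nat set set)"
proof -
  define Q where "Q y V \<longleftrightarrow> openin (top_of_set X) V \<and> y \<in> V \<and> (\<forall>a\<in>local_group V y. f a = \<one>\<^bsub>H\<^esub>)" for y V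
  show ?thesis
  proof (cases "\<forall>y\<in>X. \<exists>V. Q y V")
  case True
  then obtain V where "\<forall>y\<in>X. Q y (V y)"
    unfolding bchoice_iff by (rule exE)
  then show ?thesis unfolding Q_def using countable_image_if_locally_trivial[OF H hom] by (intro disjI1)
next
  case False
  then obtain y where y: "y \<in> X" and nQ: "\<not> (\<exists>V. Q y V)" by blast
  have nt: "\<exists>a\<in>local_group V y. f a \<noteq> \<one>\<^bsub>H\<^esub>" if "openin (top_of_set X) V" "y \<in> V" for V
    using nQ that unfolding Q_def by blast
  have "\<exists>g :: (nat \<Rightarrow> bool) \<Rightarrow> _. inj g \<and> range g \<subseteq> f ` carrier \<pi>"
    by (rule continuum_image_if_not_locally_trivial[OF H hom an y]) (rule nt)
  then obtain g :: "(nat \<Rightarrow> bool) \<Rightarrow> _" where "inj g \<and> range g \<subseteq> f ` carrier \<pi>" by (rule exE)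
  then have g: "inj g" "range g \<subseteq> f ` carrier \<pi>" by simp_all
  have "inj (\<lambda>A. g (\<lambda>i. i \<in> A))"
    using g(1) by (intro injI) (metis injD Collect_mem_eq)
  moreover have "range (\<lambda>A. g (\<lambda>i. i \<in> A)) \<subseteq> f ` carrier \<pi>" using g(2) by blast
  ultimately have "(UNIV :: nat set set) \<lesssim> f ` carrier \<pi>" unfolding lepoll_def by blast
  moreover have "f ` carrier \<pi> \<lesssim> (UNIV :: nat set set)"
    using image_lepoll carrier_lepoll[OF pol] by (rule lepoll_trans)
  ultimately show ?thesis using lepoll_antisym by blast
  qed
qed

end

section \<open>Fundamental groups that are free products\<close>

locale free_product_pi1 = tame_space X x + free_product_groups I G
  for X :: "'a::metric_space set" and x :: 'a and I :: "'i set" and G :: "'i \<Rightarrow> ('g, 'm) monoid_scheme" +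
  fixes \<phi> :: "(real \<Rightarrow> 'a) set \<Rightarrow> ('i \<times> 'g) list set"
  assumes iso: "\<phi> \<in> iso \<pi> F"
    and pol: "polish_topology (top_of_set X)"
    and nontrivial: "\<And>i. i \<in> I \<Longrightarrow> \<not> trivial_group (G i)"
begin

abbreviation "retr \<equiv> free_product_retraction G"

definition \<psi> :: "('i \<times> 'g) list set \<Rightarrow> (real \<Rightarrow> 'a) set" where
  "\<psi> = inv_into (carrier \<pi>) \<phi>"

lemma \<phi>_hom: "\<phi> \<in> hom \<pi> F" using iso by (simp add: iso_def)

sublocale \<phi>: group_hom \<pi> F \<phi>
  using group_pi group_F \<phi>_hom by (intro group_hom.intro group_hom_axioms.intro)

lemma \<phi>_bij: "bij_betw \<phi> (carrier \<pi>) (carrier F)" using iso by (simp add: iso_def)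

lemma \<psi>_closed: "b \<in> carrier F \<Longrightarrow> \<psi> b \<in> carrier \<pi>"
  unfolding \<psi>_def using \<phi>_bij by (metis bij_betw_def inv_into_into)

lemma \<phi>_\<psi>: "b \<in> carrier F \<Longrightarrow> \<phi> (\<psi> b) = b"
  unfolding \<psi>_def by (rule bij_betw_inv_into_right[OF \<phi>_bij])

lemma \<phi>_eqD: "a \<in> carrier \<pi> \<Longrightarrow> b \<in> carrier \<pi> \<Longrightarrow> \<phi> a = \<phi> b \<Longrightarrow> a = b"
  using \<phi>_bij by (auto simp: bij_betw_def dest: inj_onD)

lemma retr_hom: "j \<in> I \<Longrightarrow> retr j \<in> hom F (G j)"
  by (rule free_product_retraction(1)[of I G, OF groups])

lemma retr_incl: "j \<in> I \<Longrightarrow> i \<in> I \<Longrightarrow> g \<in> carrier (G i) \<Longrightarrow> retr j (incl i g) = (if i = j then g else \<one>\<^bsub>G j\<^esub>)"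
  by (rule free_product_retraction(2)[of I G, OF groups])

lemma retr_group_hom: "j \<in> I \<Longrightarrow> group_hom F (G j) (retr j)"
  using group_F groups retr_hom by (intro group_hom.intro group_hom_axioms.intro)

lemma retr_\<phi>_hom: "j \<in> I \<Longrightarrow> group_hom \<pi> (G j) (retr j \<circ> \<phi>)"
  using group_pi groups hom_compose[OF \<phi>_hom retr_hom] by (intro group_hom.intro group_hom_axioms.intro)

lemma cls_Cons: "fst z \<in> I \<Longrightarrow> snd z \<in> carrier (G (fst z)) \<Longrightarrow> w \<in> fp_words I G \<Longrightarrow> cls (z # w) = incl (fst z) (snd z) \<otimes>\<^bsub>F\<^esub> cls w"
  unfolding incl_cls by (subst mult_cls) simp_all

lemma W_loop_join: "is_loop X y p \<Longrightarrow> is_loop X y q \<Longrightarrow> W (p +++ q) = W p \<otimes>\<^bsub>\<pi>\<^esub> W q"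
  by (rule W_join) (auto simp: is_loop_def)

text \<open>The right side of equation \<open>n\<close> becomes an operation \<open>E n\<close> on a
  loop representing \<open>a (Suc n)\<close>. It maps loops of one neighbourhood to loops of the
  next larger one, so \<open>infinite_word\<close> provides representatives of all
  \<open>a n\<close> at once.\<close>

lemma solvable_tower_local_groups:
  assumes y: "y \<in> X"
  shows "solvable_tower (\<lambda>n. \<phi> ` local_group (small_nbhd X y n) y)" (is "solvable_tower ?H")
  unfolding solvable_tower_def
proof (intro conjI allI impI)
  have sX: "small_nbhd X y n \<subseteq> X" for n by (simp add: small_nbhd_def)
  show "subgroup (?H n) F" for n
    by (rule \<phi>.subgroup_img_is_subgroup[OF subgroup_local_group[OF sX small_nbhd_mem[OF y]]])
  show "?H (Suc n) \<subseteq> ?H n" for n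
    by (intro image_mono local_group_mono small_nbhd_mono) simp
  fix c r e and k l :: "nat \<Rightarrow> nat"
  assume cre: "\<forall>n. c n \<in> ?H n \<and> r n \<in> ?H n \<and> e n \<in> ?H n"
  have rep_loop: "\<exists>p. \<forall>n. is_loop (small_nbhd X y n) y (p n) \<and> \<phi> (W (p n)) = b n" if b: "\<forall>n. b n \<in> ?H n" for b
  proof -
    have "\<exists>p. is_loop (small_nbhd X y n) y p \<and> \<phi> (W p) = b n" for n
    proof -
      from b have "b n \<in> ?H n" by (rule spec)
      then obtain a where a: "b n = \<phi> a" "a \<in> local_group (small_nbhd X y n) y" by (rule imageE)
      from a(2) obtain p where "a = W p" "p \<in> {p. is_loop (small_nbhd X y n) y p}" unfolding local_group_def by (rule imageE)
      then show ?thesis using a(1) by (intro exI[of _ p] conjI) simp_all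
    qed
    then have "\<forall>n. \<exists>p. is_loop (small_nbhd X y n) y p \<and> \<phi> (W p) = b n" by (rule allI)
    then show ?thesis unfolding choice_iff .
  qed
  have "\<forall>n. c n \<in> ?H n" "\<forall>n. r n \<in> ?H n" "\<forall>n. e n \<in> ?H n" using cre by simp_all
  note rep_loop[OF this(1)] rep_loop[OF this(2)] rep_loop[OF this(3)]
  from this(1) obtain gc where gc: "\<forall>n. is_loop (small_nbhd X y n) y (gc n) \<and> \<phi> (W (gc n)) = c n" by (rule exE)
  from \<open>\<exists>p. \<forall>n. is_loop (small_nbhd X y n) y (p n) \<and> \<phi> (W (p n)) = r n\<close>
  obtain gr where gr: "\<forall>n. is_loop (small_nbhd X y n) y (gr n) \<and> \<phi> (W (gr n)) = r n" by (rule exE)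
  from \<open>\<exists>p. \<forall>n. is_loop (small_nbhd X y n) y (p n) \<and> \<phi> (W (p n)) = e n\<close>
  obtain ge where ge: "\<forall>n. is_loop (small_nbhd X y n) y (ge n) \<and> \<phi> (W (ge n)) = e n" by (rule exE)
  define E where "E n q = gc n +++ (loop_power y q (k n) +++ (gr n +++ (loop_power y (reversepath q) (l n) +++ ge n)))"
    for n and q :: "real \<Rightarrow> 'a"
  have Ep: "pointwise_map (E n)" for n
    unfolding E_def by (intro pointwise_map_join pointwise_map_const pointwise_map_power pointwise_map_reverse pointwise_map_id)
  have El: "is_loop (small_nbhd X y n) y (E n q)" if "is_loop (small_nbhd X y (Suc n)) y q" for n q
  proof -
    have "is_loop (small_nbhd X y n) y q" by (rule is_loop_subset[OF that]) (simp add: small_nbhd_mono)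
    then show ?thesis
      unfolding E_def using gc gr ge by (intro is_loop_join is_loop_power is_loop_reverse small_nbhd_mem[OF y]) simp_all
  qed
  obtain p where p: "\<And>n. is_loop (small_nbhd X y n) y (p n)" "\<And>n t. t \<in> {0..1} \<Longrightarrow> p n t = E n (p (Suc n)) t"
    by (rule infinite_word[OF y Ep El], assumption, rule that, blast, blast)
  have lX: "is_loop X y q" if "is_loop (small_nbhd X y n) y q" for q n by (rule is_loop_subset[OF that sX])
  have WX: "W q \<in> carrier \<pi>" if "is_loop X y q" for q by (rule W_carrier[OF is_loop_path_in[OF that order_refl]])
  show "\<exists>a. \<forall>n. a n \<in> ?H n \<and> a n = c n \<otimes>\<^bsub>F\<^esub> a (Suc n) [^]\<^bsub>F\<^esub> k n \<otimes>\<^bsub>F\<^esub> r n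
         \<otimes>\<^bsub>F\<^esub> (inv\<^bsub>F\<^esub> (a (Suc n))) [^]\<^bsub>F\<^esub> l n \<otimes>\<^bsub>F\<^esub> e n"
  proof (intro exI[of _ "\<lambda>n. \<phi> (W (p n))"] allI conjI)
    fix n
    show "\<phi> (W (p n)) \<in> ?H n" unfolding local_group_def using p(1) by blast
    let ?q = "p (Suc n)"
    have l: "is_loop X y (gc n)" "is_loop X y (gr n)" "is_loop X y (ge n)" "is_loop X y ?q"
      using lX[OF conjunct1[OF gc[rule_format]]] lX[OF conjunct1[OF gr[rule_format]]] lX[OF conjunct1[OF ge[rule_format]]] lX[OF p(1)] by blast+
    note lr = is_loop_reverse[OF l(4)]
    note lp = is_loop_power[OF y l(4), of "k n"] is_loop_power[OF y lr, of "l n"]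
    have rev: "W (reversepath ?q) = inv\<^bsub>\<pi>\<^esub> (W ?q)" by (rule W_reverse[OF is_loop_path_in[OF l(4) order_refl]])
    have "W (p n) = W (E n ?q)" by (rule W_cong[OF is_loop_path_in[OF p(1) sX]]) (rule p(2))
    also have "\<dots> = W (gc n) \<otimes>\<^bsub>\<pi>\<^esub> (W ?q [^]\<^bsub>\<pi>\<^esub> k n \<otimes>\<^bsub>\<pi>\<^esub> (W (gr n) \<otimes>\<^bsub>\<pi>\<^esub> ((inv\<^bsub>\<pi>\<^esub> (W ?q)) [^]\<^bsub>\<pi>\<^esub> l n \<otimes>\<^bsub>\<pi>\<^esub> W (ge n))))"
      unfolding E_def
      by (simp only: W_loop_join[OF l(1) is_loop_join[OF lp(1) is_loop_join[OF l(2) is_loop_join[OF lp(2) l(3)]]]]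
          W_loop_join[OF lp(1) is_loop_join[OF l(2) is_loop_join[OF lp(2) l(3)]]]
          W_loop_join[OF l(2) is_loop_join[OF lp(2) l(3)]] W_loop_join[OF lp(2) l(3)]
          W_power[OF y l(4)] W_power[OF y lr] rev)
    finally have Wp: "W (p n) = \<dots>" .
    note Wl = WX[OF l(1)] WX[OF l(2)] WX[OF l(3)] WX[OF l(4)]
    have pw: "\<phi> (a [^]\<^bsub>\<pi>\<^esub> m) = \<phi> a [^]\<^bsub>F\<^esub> m" if "a \<in> carrier \<pi>" for a and m :: nat by (rule \<phi>.hom_nat_pow[OF that])
    have cr: "c n = \<phi> (W (gc n))" "r n = \<phi> (W (gr n))" "e n = \<phi> (W (ge n))" using gc gr ge by simp_all
    show "\<phi> (W (p n)) = c n \<otimes>\<^bsub>F\<^esub> \<phi> (W ?q) [^]\<^bsub>F\<^esub> k n \<otimes>\<^bsub>F\<^esub> r n \<otimes>\<^bsub>F\<^esub> (inv\<^bsub>F\<^esub> (\<phi> (W ?q))) [^]\<^bsub>F\<^esub> l n \<otimes>\<^bsub>F\<^esub> e n"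
      unfolding Wp cr using Wl by (simp add: \<phi>.hom_mult pw \<phi>.hom_inv F.m_assoc)
  qed
qed

lemma locally_elliptic:
  assumes y: "y \<in> X"
  shows "\<exists>V. openin (top_of_set X) V \<and> y \<in> V \<and> (\<phi> ` local_group V y \<subseteq> {\<one>\<^bsub>F\<^esub>} \<or> (\<exists>u\<in>carrier F. \<exists>i\<in>I. \<phi> ` local_group V y \<subseteq> fconj u i))"
proof -
  obtain n where n: "\<phi> ` local_group (small_nbhd X y n) y \<subseteq> {\<one>\<^bsub>F\<^esub>} \<or> (\<exists>u\<in>carrier F. \<exists>i\<in>I. \<phi> ` local_group (small_nbhd X y n) y \<subseteq> fconj u i)"
    using solvable_tower_elliptic[OF solvable_tower_local_groups[OF y]] by (rule exE)
  have "openin (top_of_set X) (small_nbhd X y n)" unfolding small_nbhd_def by blast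
  then show ?thesis using n small_nbhd_mem[OF y] by (intro exI[of _ "small_nbhd X y n"] conjI)
qed

lemma retr_fconj:
  assumes "j \<in> I" "u \<in> carrier F" "i \<in> I" "g \<in> carrier (G i)"
  shows "retr j (u \<otimes>\<^bsub>F\<^esub> incl i g \<otimes>\<^bsub>F\<^esub> inv\<^bsub>F\<^esub> u) = retr j u \<otimes>\<^bsub>G j\<^esub> (if i = j then g else \<one>\<^bsub>G j\<^esub>) \<otimes>\<^bsub>G j\<^esub> inv\<^bsub>G j\<^esub> (retr j u)"
proof -
  interpret r: group_hom F "G j" "retr j" by (rule retr_group_hom[OF assms(1)])
  show ?thesis using assms by (simp only: r.hom_mult r.hom_inv incl_closed F.inv_closed F.m_closed retr_incl)
qed

text \<open>The neighbourhood and the only factor visible in it are packed into one pair, so that a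
  single choice function yields both.\<close>

lemma locally_one_factor:
  assumes y: "y \<in> X"
  shows "\<exists>z. openin (top_of_set X) (fst z) \<and> y \<in> fst z \<and> (\<forall>j\<in>I. j \<noteq> snd z \<longrightarrow> (\<forall>a\<in>local_group (fst z) y. retr j (\<phi> a) = \<one>\<^bsub>G j\<^esub>))"
proof -
  obtain V where V: "openin (top_of_set X) V" "y \<in> V"
    and lo: "\<phi> ` local_group V y \<subseteq> {\<one>\<^bsub>F\<^esub>} \<or> (\<exists>u\<in>carrier F. \<exists>i\<in>I. \<phi> ` local_group V y \<subseteq> fconj u i)"
    using locally_elliptic[OF y] by (elim exE conjE)
  from lo show ?thesis
  proof (elim disjE bexE)
    assume 1: "\<phi> ` local_group V y \<subseteq> {\<one>\<^bsub>F\<^esub>}"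
    have "retr j (\<phi> a) = \<one>\<^bsub>G j\<^esub>" if "j \<in> I" "a \<in> local_group V y" for j a
    proof -
      have "\<phi> a \<in> {\<one>\<^bsub>F\<^esub>}" by (rule subsetD[OF 1 imageI[OF that(2)]])
      then have "\<phi> a = \<one>\<^bsub>F\<^esub>" by (rule singletonD)
      then show ?thesis using group_hom.hom_one[OF retr_group_hom[OF that(1)]] by (simp only:)
    qed
    \<comment> \<open>No factor is visible here, so any index serves.\<close>
    then show ?thesis using V by (intro exI[of _ "(V, undefined)"]) simp
  next
    fix u i assume u: "u \<in> carrier F" "i \<in> I" "\<phi> ` local_group V y \<subseteq> fconj u i"
    have "retr j (\<phi> a) = \<one>\<^bsub>G j\<^esub>" if j: "j \<in> I" "j \<noteq> i" and a: "a \<in> local_group V y" for j a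
    proof -
      interpret Gj: group "G j" by (rule groups[OF j(1)])
      have "\<phi> a \<in> fconj u i" by (rule subsetD[OF u(3) imageI[OF a]])
      then obtain g where g: "\<phi> a = u \<otimes>\<^bsub>F\<^esub> incl i g \<otimes>\<^bsub>F\<^esub> inv\<^bsub>F\<^esub> u" "g \<in> carrier (G i)" unfolding fconj_def by (rule imageE)
      have "retr j u \<in> carrier (G j)" by (rule hom_in_carrier[OF retr_hom[OF j(1)] u(1)])
      then show ?thesis unfolding g(1) retr_fconj[OF j(1) u(1,2) g(2)] using j(2) by simp
    qed
    then show ?thesis using V by (intro exI[of _ "(V, i)"]) simp
  qed
qed

lemma retr_trivial:
  assumes "j \<in> I" "w \<in> fp_words I G" "j \<notin> fst ` set w"
  shows "retr j (cls w) = \<one>\<^bsub>G j\<^esub>"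
  using assms(2,3)
proof (induction w)
  case Nil
  show ?case unfolding one_F[symmetric] by (rule group_hom.hom_one[OF retr_group_hom[OF assms(1)]])
next
  case (Cons z w)
  interpret r: group_hom F "G j" "retr j" by (rule retr_group_hom[OF assms(1)])
  have z: "fst z \<in> I" "snd z \<in> carrier (G (fst z))" "w \<in> fp_words I G" using Cons.prems(1) by simp_all
  have "retr j (cls (z # w)) = retr j (incl (fst z) (snd z)) \<otimes>\<^bsub>G j\<^esub> retr j (cls w)"
    unfolding cls_Cons[OF z] by (rule r.hom_mult[OF incl_closed[OF z(1,2)] cls_carrier[OF z(3)]])
  moreover have "retr j (incl (fst z) (snd z)) = \<one>\<^bsub>G j\<^esub>" using retr_incl[OF assms(1) z(1,2)] Cons.prems(2) by auto
  moreover have "retr j (cls w) = \<one>\<^bsub>G j\<^esub>" using Cons.IH[OF z(3)] Cons.prems(2) by simp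
  ultimately show ?case by simp
qed

lemma retr_\<phi>_surj:
  assumes "j \<in> I" "g \<in> carrier (G j)"
  shows "\<psi> (incl j g) \<in> carrier \<pi>" "retr j (\<phi> (\<psi> (incl j g))) = g"
  using \<psi>_closed[OF incl_closed[OF assms]] retr_incl[OF assms(1,1,2)] by (simp_all only: \<phi>_\<psi>[OF incl_closed[OF assms]] simp_thms if_True)

theorem countable_index: "countable I"
proof -
  have "\<forall>y\<in>X. \<exists>z. openin (top_of_set X) (fst z) \<and> y \<in> fst z \<and> (\<forall>j\<in>I. j \<noteq> snd z \<longrightarrow> (\<forall>a\<in>local_group (fst z) y. retr j (\<phi> a) = \<one>\<^bsub>G j\<^esub>))"
    by (intro ballI locally_one_factor)
  then obtain z where z: "\<forall>y\<in>X. openin (top_of_set X) (fst (z y)) \<and> y \<in> fst (z y) \<and> (\<forall>j\<in>I. j \<noteq> snd (z y) \<longrightarrow> (\<forall>a\<in>local_group (fst (z y)) y. retr j (\<phi> a) = \<one>\<^bsub>G j\<^esub>))"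
    unfolding bchoice_iff by (rule exE)
  obtain Y C where Y: "countable Y" "Y \<subseteq> X" "countable C" "C \<subseteq> carrier \<pi>"
    and gen: "\<And>S. subgroup S \<pi> \<Longrightarrow> C \<subseteq> S \<Longrightarrow> (\<And>y. y \<in> Y \<Longrightarrow> local_group (fst (z y)) y \<subseteq> S) \<Longrightarrow> carrier \<pi> \<subseteq> S"
    using z by (rule_tac countable_generation[of "\<lambda>y. fst (z y)"]) auto
  \<comment> \<open>The factors visible in the chosen local groups or in the normal forms of
    \<open>C\<close>. The retraction onto any other factor would be trivial on generators, although
    it is onto a nontrivial group.\<close>
  let ?J = "(\<lambda>y. snd (z y)) ` Y \<union> (\<Union>c\<in>C. fst ` set (nf (\<phi> c)))"
  have "I \<subseteq> ?J"
  proof (rule subsetI, rule ccontr)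
    fix j assume j: "j \<in> I" and jJ: "j \<notin> ?J"
    interpret r: group_hom \<pi> "G j" "retr j \<circ> \<phi>" by (rule retr_\<phi>_hom[OF j])
    have "carrier \<pi> \<subseteq> kernel \<pi> (G j) (retr j \<circ> \<phi>)"
    proof (rule gen)
      show "subgroup (kernel \<pi> (G j) (retr j \<circ> \<phi>)) \<pi>" by (rule r.subgroup_kernel)
      show "C \<subseteq> kernel \<pi> (G j) (retr j \<circ> \<phi>)"
      proof
        fix c assume c: "c \<in> C"
        then have cc: "c \<in> carrier \<pi>" using Y(4) by blast
        have "retr j (cls (nf (\<phi> c))) = \<one>\<^bsub>G j\<^esub>"
          by (rule retr_trivial[OF j reduced_words[OF carrierE(1)[OF \<phi>.hom_closed[OF cc]]]]) (use jJ c in blast)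
        then have "retr j (\<phi> c) = \<one>\<^bsub>G j\<^esub>" by (simp only: cls_nf[OF \<phi>.hom_closed[OF cc]])
        then show "c \<in> kernel \<pi> (G j) (retr j \<circ> \<phi>)" using cc by (simp add: kernel_def)
      qed
      show "local_group (fst (z y)) y \<subseteq> kernel \<pi> (G j) (retr j \<circ> \<phi>)" if y: "y \<in> Y" for y
      proof
        fix a assume a: "a \<in> local_group (fst (z y)) y"
        have yX: "y \<in> X" using y Y(2) by blast
        note zy = z[rule_format, OF yX]
        have "fst (z y) \<subseteq> X" "y \<in> fst (z y)" using zy openin_subset_X by blast+
        then have "a \<in> carrier \<pi>" using subgroup.subset[OF subgroup_local_group] a by blast
        moreover have "j \<noteq> snd (z y)" using jJ y by blast
        then have "retr j (\<phi> a) = \<one>\<^bsub>G j\<^esub>" using zy j a by blast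
        ultimately show "a \<in> kernel \<pi> (G j) (retr j \<circ> \<phi>)" by (simp add: kernel_def)
      qed
    qed
    then have all: "retr j (\<phi> a) = \<one>\<^bsub>G j\<^esub>" if "a \<in> carrier \<pi>" for a using that by (auto simp: kernel_def)
    have "g = \<one>\<^bsub>G j\<^esub>" if g: "g \<in> carrier (G j)" for g
      using all[OF retr_\<phi>_surj(1)[OF j g]] retr_\<phi>_surj(2)[OF j g] by simp
    then have "carrier (G j) = {\<one>\<^bsub>G j\<^esub>}" using r.H.one_closed by blast
    then show False using nontrivial[OF j] groups[OF j] by (simp add: trivial_group_def)
  qed
  moreover have "countable ?J" using Y(1,3) by (auto intro: countable_finite)
  ultimately show ?thesis by (rule countable_subset)
qed

theorem analytic_retraction_kernel:
  assumes j: "j \<in> I"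
  shows "analytic_in (mtopology_of (loop_metric X x)) (\<Union>(kernel \<pi> (G j) (retr j \<circ> \<phi>)))"
proof -
  interpret r: group_hom F "G j" "retr j" by (rule retr_group_hom[OF j])
  \<comment> \<open>The retraction turned into an idempotent endomorphism of the fundamental group.
    Its kernel is that of the retraction, since \<open>incl j\<close> and \<open>\<psi>\<close> are
    injective.\<close>
  define \<rho> where "\<rho> a = \<psi> (incl j (retr j (\<phi> a)))" for a
  have ic: "incl j (retr j (\<phi> a)) \<in> carrier F" if "a \<in> carrier \<pi>" for a
    by (rule incl_closed[OF j r.hom_closed[OF \<phi>.hom_closed[OF that]]])
  have \<phi>\<rho>: "\<phi> (\<rho> a) = incl j (retr j (\<phi> a))" and \<rho>c: "\<rho> a \<in> carrier \<pi>" if "a \<in> carrier \<pi>" for a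
    unfolding \<rho>_def by (rule \<phi>_\<psi>[OF ic[OF that]], rule \<psi>_closed[OF ic[OF that]])
  have hom: "\<rho> \<in> hom \<pi> \<pi>"
  proof (rule homI)
    fix a b assume a: "a \<in> carrier \<pi>" and b: "b \<in> carrier \<pi>"
    have ab: "a \<otimes>\<^bsub>\<pi>\<^esub> b \<in> carrier \<pi>" using a b by simp
    show "\<rho> (a \<otimes>\<^bsub>\<pi>\<^esub> b) = \<rho> a \<otimes>\<^bsub>\<pi>\<^esub> \<rho> b"
    proof (rule \<phi>_eqD)
      note fa = \<phi>.hom_closed[OF a] \<phi>.hom_closed[OF b]
      have "\<phi> (\<rho> (a \<otimes>\<^bsub>\<pi>\<^esub> b)) = incl j (retr j (\<phi> a) \<otimes>\<^bsub>G j\<^esub> retr j (\<phi> b))"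
        unfolding \<phi>\<rho>[OF ab] \<phi>.hom_mult[OF a b] r.hom_mult[OF fa] ..
      also have "\<dots> = incl j (retr j (\<phi> a)) \<otimes>\<^bsub>F\<^esub> incl j (retr j (\<phi> b))"
        by (rule hom_mult[OF incl_hom[OF j] r.hom_closed[OF fa(1)] r.hom_closed[OF fa(2)]])
      also have "\<dots> = \<phi> (\<rho> a \<otimes>\<^bsub>\<pi>\<^esub> \<rho> b)" unfolding \<phi>.hom_mult[OF \<rho>c[OF a] \<rho>c[OF b]] \<phi>\<rho>[OF a] \<phi>\<rho>[OF b] ..
      finally show "\<phi> (\<rho> (a \<otimes>\<^bsub>\<pi>\<^esub> b)) = \<phi> (\<rho> a \<otimes>\<^bsub>\<pi>\<^esub> \<rho> b)" .
    qed (use \<rho>c a b ab in auto)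
  qed (rule \<rho>c)
  have idem: "\<rho> (\<rho> a) = \<rho> a" if a: "a \<in> carrier \<pi>" for a
  proof -
    have "retr j (\<phi> (\<rho> a)) = retr j (\<phi> a)"
      unfolding \<phi>\<rho>[OF a] using retr_incl[OF j j r.hom_closed[OF \<phi>.hom_closed[OF a]]] by (simp only: simp_thms if_True)
    then show ?thesis unfolding \<rho>_def[of "\<rho> a"] unfolding \<rho>_def[of a] by (simp only:)
  qed
  have \<rho>1: "\<rho> a = \<one>\<^bsub>\<pi>\<^esub> \<longleftrightarrow> retr j (\<phi> a) = \<one>\<^bsub>G j\<^esub>" if a: "a \<in> carrier \<pi>" for a
  proof -
    have "\<rho> a = \<one>\<^bsub>\<pi>\<^esub> \<longleftrightarrow> \<phi> (\<rho> a) = \<phi> \<one>\<^bsub>\<pi>\<^esub>" using \<phi>_eqD[OF \<rho>c[OF a] P.one_closed] by metis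
    then show ?thesis unfolding \<phi>.hom_one \<phi>\<rho>[OF a] incl_eq_one_iff[OF j r.hom_closed[OF \<phi>.hom_closed[OF a]]] .
  qed
  have loc: "\<exists>V. openin (top_of_set X) V \<and> y \<in> V \<and>
      ((\<exists>D\<in>carrier \<pi>. \<forall>a\<in>local_group V y. \<rho> a = D \<otimes>\<^bsub>\<pi>\<^esub> a \<otimes>\<^bsub>\<pi>\<^esub> inv\<^bsub>\<pi>\<^esub> D) \<or> (\<forall>a\<in>local_group V y. \<rho> a = \<one>\<^bsub>\<pi>\<^esub>))"
    if y: "y \<in> X" for y
  proof -
    obtain V where V: "openin (top_of_set X) V" "y \<in> V"
      and lo: "\<phi> ` local_group V y \<subseteq> {\<one>\<^bsub>F\<^esub>} \<or> (\<exists>u\<in>carrier F. \<exists>i\<in>I. \<phi> ` local_group V y \<subseteq> fconj u i)"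
      using locally_elliptic[OF y] by (elim exE conjE)
    have lc: "a \<in> carrier \<pi>" if "a \<in> local_group V y" for a
      using subgroup.subset[OF subgroup_local_group[OF openin_subset_X[OF V(1)] V(2)]] that by blast
    have "(\<exists>D\<in>carrier \<pi>. \<forall>a\<in>local_group V y. \<rho> a = D \<otimes>\<^bsub>\<pi>\<^esub> a \<otimes>\<^bsub>\<pi>\<^esub> inv\<^bsub>\<pi>\<^esub> D) \<or> (\<forall>a\<in>local_group V y. \<rho> a = \<one>\<^bsub>\<pi>\<^esub>)"
      using lo
    proof (elim disjE bexE)
      assume 1: "\<phi> ` local_group V y \<subseteq> {\<one>\<^bsub>F\<^esub>}"
      have "\<rho> a = \<one>\<^bsub>\<pi>\<^esub>" if a: "a \<in> local_group V y" for a
      proof -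
        have "\<phi> a \<in> {\<one>\<^bsub>F\<^esub>}" by (rule subsetD[OF 1 imageI[OF a]])
        then have "\<phi> a = \<one>\<^bsub>F\<^esub>" by (rule singletonD)
        then have "retr j (\<phi> a) = \<one>\<^bsub>G j\<^esub>" using r.hom_one by (simp only:)
        then show ?thesis using \<rho>1[OF lc[OF a]] by blast
      qed
      then show ?thesis by blast
    next
      fix u i assume u: "u \<in> carrier F" "i \<in> I" "\<phi> ` local_group V y \<subseteq> fconj u i"
      have form: "\<exists>g\<in>carrier (G i). \<phi> a = u \<otimes>\<^bsub>F\<^esub> incl i g \<otimes>\<^bsub>F\<^esub> inv\<^bsub>F\<^esub> u" if a: "a \<in> local_group V y" for a
      proof -
        have "\<phi> a \<in> fconj u i" by (rule subsetD[OF u(3) imageI[OF a]])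
        then obtain g where g: "\<phi> a = u \<otimes>\<^bsub>F\<^esub> incl i g \<otimes>\<^bsub>F\<^esub> inv\<^bsub>F\<^esub> u" "g \<in> carrier (G i)" unfolding fconj_def by (rule imageE)
        then show ?thesis by (intro bexI[of _ g])
      qed
      have ru: "retr j u \<in> carrier (G j)" by (rule r.hom_closed[OF u(1)])
      show ?thesis
      proof (cases "i = j")
        case False
        have "\<rho> a = \<one>\<^bsub>\<pi>\<^esub>" if a: "a \<in> local_group V y" for a
        proof -
          obtain g where g: "g \<in> carrier (G i)" "\<phi> a = u \<otimes>\<^bsub>F\<^esub> incl i g \<otimes>\<^bsub>F\<^esub> inv\<^bsub>F\<^esub> u" using form[OF a] by (rule bexE)
          have "retr j (\<phi> a) = \<one>\<^bsub>G j\<^esub>" unfolding g(2) retr_fconj[OF j u(1,2) g(1)] using False ru by simp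
          then show ?thesis using \<rho>1[OF lc[OF a]] by blast
        qed
        then show ?thesis by blast
      next
        case True
        let ?v = "incl j (retr j u)"
        have v: "?v \<in> carrier F" by (rule incl_closed[OF j ru])
        \<comment> \<open>On the conjugate of factor \<open>j\<close> by \<open>u\<close>,
          \<open>\<rho>\<close> replaces the conjugator \<open>u\<close> by its retraction
          \<open>?v\<close>; conjugation by the product of \<open>?v\<close> with the inverse of
          \<open>u\<close> has the same effect.\<close>
        let ?D = "\<psi> (?v \<otimes>\<^bsub>F\<^esub> inv\<^bsub>F\<^esub> u)"
        have D0: "?v \<otimes>\<^bsub>F\<^esub> inv\<^bsub>F\<^esub> u \<in> carrier F" by (rule F.m_closed[OF v F.inv_closed[OF u(1)]])
        have D: "?D \<in> carrier \<pi>" by (rule \<psi>_closed[OF D0])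
        have "\<rho> a = ?D \<otimes>\<^bsub>\<pi>\<^esub> a \<otimes>\<^bsub>\<pi>\<^esub> inv\<^bsub>\<pi>\<^esub> ?D" if a: "a \<in> local_group V y" for a
        proof (rule \<phi>_eqD)
          note ac = lc[OF a]
          show "\<rho> a \<in> carrier \<pi>" by (rule \<rho>c[OF ac])
          show "?D \<otimes>\<^bsub>\<pi>\<^esub> a \<otimes>\<^bsub>\<pi>\<^esub> inv\<^bsub>\<pi>\<^esub> ?D \<in> carrier \<pi>" by (intro P.m_closed P.inv_closed D ac)
          obtain g where g: "g \<in> carrier (G j)" "\<phi> a = u \<otimes>\<^bsub>F\<^esub> incl j g \<otimes>\<^bsub>F\<^esub> inv\<^bsub>F\<^esub> u" using form[OF a] unfolding True by (rule bexE)
          have ig: "incl j g \<in> carrier F" by (rule incl_closed[OF j g(1)])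
          interpret ij: group_hom "G j" F "free_product_incl I G j"
            using groups[OF j] group_F incl_hom[OF j] by (intro group_hom.intro group_hom_axioms.intro)
          have rg: "retr j (\<phi> a) = retr j u \<otimes>\<^bsub>G j\<^esub> g \<otimes>\<^bsub>G j\<^esub> inv\<^bsub>G j\<^esub> (retr j u)"
            unfolding g(2) retr_fconj[OF j u(1) j g(1)] by (simp only: simp_thms if_True)
          have "\<phi> (\<rho> a) = ?v \<otimes>\<^bsub>F\<^esub> incl j g \<otimes>\<^bsub>F\<^esub> inv\<^bsub>F\<^esub> ?v"
            unfolding \<phi>\<rho>[OF ac] rg using ru g(1) by (simp only: ij.hom_mult ij.hom_inv r.H.m_closed r.H.inv_closed)
          also have "\<dots> = (?v \<otimes>\<^bsub>F\<^esub> inv\<^bsub>F\<^esub> u) \<otimes>\<^bsub>F\<^esub> (u \<otimes>\<^bsub>F\<^esub> incl j g \<otimes>\<^bsub>F\<^esub> inv\<^bsub>F\<^esub> u) \<otimes>\<^bsub>F\<^esub> inv\<^bsub>F\<^esub> (?v \<otimes>\<^bsub>F\<^esub> inv\<^bsub>F\<^esub> u)"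
            using v u(1) ig by (simp add: F.word_simps)
          also have "\<dots> = \<phi> (?D \<otimes>\<^bsub>\<pi>\<^esub> a \<otimes>\<^bsub>\<pi>\<^esub> inv\<^bsub>\<pi>\<^esub> ?D)"
            unfolding \<phi>.hom_mult[OF P.m_closed[OF D ac] P.inv_closed[OF D]] \<phi>.hom_mult[OF D ac] \<phi>.hom_inv[OF D] \<phi>_\<psi>[OF D0] g(2) ..
          finally show "\<phi> (\<rho> a) = \<phi> (?D \<otimes>\<^bsub>\<pi>\<^esub> a \<otimes>\<^bsub>\<pi>\<^esub> inv\<^bsub>\<pi>\<^esub> ?D)" .
        qed
        then show ?thesis using D by (intro disjI1 bexI[of _ ?D]) blast+
      qed
    qed
    then show ?thesis using V by (intro exI[of _ V] conjI)
  qed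
  have "kernel \<pi> (G j) (retr j \<circ> \<phi>) = kernel \<pi> \<pi> \<rho>"
    unfolding kernel_def using \<rho>1 by (intro Collect_cong) (auto simp: comp_def)
  then show ?thesis using analytic_kernel[OF pol hom idem loc] by simp
qed

lemma to_sum_hom: "free_product_to_sum I G \<in> hom F (sum_group I G)"
  by (rule free_product_to_sum(1)[of I G, OF groups])

lemma to_sum_incl:
  "i \<in> I \<Longrightarrow> g \<in> carrier (G i) \<Longrightarrow> free_product_to_sum I G (incl i g) = (\<lambda>k\<in>I. if k = i then g else \<one>\<^bsub>G k\<^esub>)"
  by (rule free_product_to_sum(2)[of I G, OF groups])

lemma to_sum_component:
  assumes "b \<in> carrier F" "j \<in> I"
  shows "free_product_to_sum I G b j = retr j b"
proof -
  have gS: "group (sum_group I G)" by (rule sum_group) (rule groups)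
  interpret s: group_hom F "sum_group I G" "free_product_to_sum I G"
    using group_F gS to_sum_hom by (intro group_hom.intro group_hom_axioms.intro)
  interpret r: group_hom F "G j" "retr j" by (rule retr_group_hom[OF assms(2)])
  have "free_product_to_sum I G (cls w) j = retr j (cls w)" if "w \<in> fp_words I G" for w
    using that
  proof (induction w)
    case Nil
    show ?case unfolding one_F[symmetric] s.hom_one r.hom_one using assms(2) by simp
  next
    case (Cons z w)
    have z: "fst z \<in> I" "snd z \<in> carrier (G (fst z))" "w \<in> fp_words I G" using Cons.prems(1) by simp_all
    note c = incl_closed[OF z(1,2)] cls_carrier[OF z(3)]
    show ?case
      unfolding cls_Cons[OF z] s.hom_mult[OF c] r.hom_mult[OF c] to_sum_incl[OF z(1,2)] retr_incl[OF assms(2) z(1,2)] Cons.IH[OF z(3), symmetric]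
      using assms(2) by auto
  qed
  from this[OF reduced_words[OF carrierE(1)[OF assms(1)]]] show ?thesis unfolding cls_nf[OF assms(1)] .
qed

lemma kernel_to_sum:
  "kernel \<pi> (sum_group I G) (free_product_to_sum I G \<circ> \<phi>) = {a \<in> carrier \<pi>. \<forall>j\<in>I. retr j (\<phi> a) = \<one>\<^bsub>G j\<^esub>}"
  unfolding kernel_def
proof (rule Collect_cong, rule conj_cong[OF refl])
  fix a assume a: "a \<in> carrier \<pi>"
  have b: "\<phi> a \<in> carrier F" by (rule \<phi>.hom_closed[OF a])
  let ?s = "free_product_to_sum I G (\<phi> a)"
  have "?s \<in> carrier (sum_group I G)" by (rule hom_in_carrier[OF to_sum_hom b])
  then have ext: "?s \<in> extensional I" using carrier_sum_group[of I G, OF groups] by (auto simp: PiE_def)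
  have "?s = \<one>\<^bsub>sum_group I G\<^esub> \<longleftrightarrow> ?s = (\<lambda>j\<in>I. \<one>\<^bsub>G j\<^esub>)" by simp
  also have "\<dots> \<longleftrightarrow> (\<forall>j\<in>I. ?s j = \<one>\<^bsub>G j\<^esub>)"
    using ext by (auto intro!: extensionalityI[of _ I])
  also have "\<dots> \<longleftrightarrow> (\<forall>j\<in>I. retr j (\<phi> a) = \<one>\<^bsub>G j\<^esub>)" using to_sum_component[OF b] by simp
  finally show "(free_product_to_sum I G \<circ> \<phi>) a = \<one>\<^bsub>sum_group I G\<^esub> \<longleftrightarrow> (\<forall>j\<in>I. retr j (\<phi> a) = \<one>\<^bsub>G j\<^esub>)" by (simp only: comp_def)
qed

text \<open>An element of the direct sum is trivial as soon as all its components are, so this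
  kernel is the intersection of the kernels of the retractions, countably many by
  \<open>countable_index\<close>.\<close>

theorem analytic_to_sum_kernel:
  "analytic_in (mtopology_of (loop_metric X x)) (\<Union>(kernel \<pi> (sum_group I G) (free_product_to_sum I G \<circ> \<phi>)))"
proof -
  let ?T = "mtopology_of (loop_metric X x)"
  let ?K = "\<lambda>j. kernel \<pi> (G j) (retr j \<circ> \<phi>)"
  \<comment> \<open>The intersection is indexed by all natural numbers. For empty \<open>I\<close>
    the kernel is the whole group, so every member is then the set of all loops.\<close>
  define A where "A n = (if I = {} then loops X x else \<Union>(?K (from_nat_into I n)))" for n :: nat
  have Wc: "W q \<in> carrier \<pi>" if "q \<in> loops X x" for q
    using is_loop_if_loops[OF that] by (intro W_carrier) (simp add: is_loop_def)
  have UK: "\<Union>(?K j) = {q \<in> loops X x. retr j (\<phi> (W q)) = \<one>\<^bsub>G j\<^esub>}" for j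
  proof -
    have "?K j \<subseteq> carrier \<pi>" by (auto simp: kernel_def)
    then show ?thesis unfolding Union_classes[OF \<open>?K j \<subseteq> carrier \<pi>\<close>] using Wc by (auto simp: kernel_def)
  qed
  have kc: "{a \<in> carrier \<pi>. \<forall>j\<in>I. retr j (\<phi> a) = \<one>\<^bsub>G j\<^esub>} \<subseteq> carrier \<pi>" by blast
  have US: "\<Union>(kernel \<pi> (sum_group I G) (free_product_to_sum I G \<circ> \<phi>)) = {q \<in> loops X x. \<forall>j\<in>I. retr j (\<phi> (W q)) = \<one>\<^bsub>G j\<^esub>}"
    unfolding kernel_to_sum Union_classes[OF kc] using Wc by blast
  have "(\<Inter>n. A n) = {q \<in> loops X x. \<forall>j\<in>I. retr j (\<phi> (W q)) = \<one>\<^bsub>G j\<^esub>}"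
  proof (cases "I = {}")
    case True
    then show ?thesis by (simp add: A_def)
  next
    case False
    then have "(\<Inter>n. A n) = (\<Inter>j\<in>range (from_nat_into I). \<Union>(?K j))" by (simp add: A_def)
    also have "\<dots> = (\<Inter>j\<in>I. {q \<in> loops X x. retr j (\<phi> (W q)) = \<one>\<^bsub>G j\<^esub>})"
      unfolding range_from_nat_into[OF False countable_index] UK ..
    also have "\<dots> = {q \<in> loops X x. \<forall>j\<in>I. retr j (\<phi> (W q)) = \<one>\<^bsub>G j\<^esub>}" using False by blast
    finally show ?thesis .
  qed
  moreover have "analytic_in ?T (\<Inter>n. A n)"
  proof (rule analytic_INT)
    show "Hausdorff_space ?T" unfolding mtopology_loop_metric by (intro Hausdorff_space_subtopology Hausdorff_CT)
    show "analytic_in ?T (A n)" for n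
    proof (cases "I = {}")
      case True
      then show ?thesis unfolding A_def mtopology_loop_metric
        using analytic_in_subtopology[OF analytic_loops[OF pol] order_refl] by simp
    next
      case False
      then show ?thesis unfolding A_def using analytic_retraction_kernel[OF from_nat_into[OF False]] by simp
    qed
  qed
  ultimately show ?thesis unfolding US by simp
qed

end

theorem theorem3:
  fixes X :: "'a::metric_space set" and x :: 'a
    and I :: "'i set" and G :: "'i \<Rightarrow> ('g, 'm) monoid_scheme"
    and \<phi> :: "(real \<Rightarrow> 'a) set \<Rightarrow> ('i \<times> 'g) list set"
  assumes "polish_topology (top_of_set X)"
    and "path_connected X"
    and "locally path_connected X"
    and "x \<in> X"
    and "\<And>i. i \<in> I \<Longrightarrow> group (G i)"
    and "\<And>i. i \<in> I \<Longrightarrow> \<not> trivial_group (G i)"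
    and "\<phi> \<in> iso (fundamental_group X x) (free_product I G)"
  shows "countable I
    \<and> (\<forall>j\<in>I. analytic_subgroup X x
          (kernel (fundamental_group X x) (G j) (free_product_retraction G j \<circ> \<phi>)))
    \<and> (\<forall>j\<in>I. countable (carrier (G j)) \<or> carrier (G j) \<approx> (UNIV :: nat set set))
    \<and> analytic_subgroup X x
          (kernel (fundamental_group X x) (sum_group I G) (free_product_to_sum I G \<circ> \<phi>))"
proof -
  have sc: "second_countable (top_of_set X)" by (rule polish_second_countable[OF assms(1)])
  have pointed: "pointed_space X x" by (intro pointed_space.intro assms(2,4))
  have tame: "tame_space X x" by (intro tame_space.intro tame_space_axioms.intro pointed assms(3) sc)
  have fp: "free_product_groups I G" by (rule free_product_groups.intro) (rule assms(5))
  interpret free_product_pi1 X x I G \<phi>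
    by (rule free_product_pi1.intro[OF tame fp])
      (rule free_product_pi1_axioms.intro, rule assms(7), rule assms(1), rule assms(6))
  show ?thesis
  proof (intro conjI ballI)
    show "countable I" by (rule countable_index)
    fix j assume j: "j \<in> I"
    show "analytic_subgroup X x (kernel (fundamental_group X x) (G j) (free_product_retraction G j \<circ> \<phi>))"
      unfolding analytic_subgroup_def
      by (rule conjI[OF group_hom.subgroup_kernel[OF retr_\<phi>_hom[OF j]] analytic_retraction_kernel[OF j]])
    have sub: "carrier (G j) \<subseteq> (free_product_retraction G j \<circ> \<phi>) ` carrier (fundamental_group X x)"
    proof
      fix g assume "g \<in> carrier (G j)"
      note g = retr_\<phi>_surj[OF j this]
      show "g \<in> (free_product_retraction G j \<circ> \<phi>) ` carrier (fundamental_group X x)"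
        by (rule image_eqI[OF _ g(1)]) (simp only: comp_def g(2))
    qed
    have eq: "(free_product_retraction G j \<circ> \<phi>) ` carrier (fundamental_group X x) = carrier (G j)"
      by (rule equalityI[OF image_subsetI sub]) (rule group_hom.hom_closed[OF retr_\<phi>_hom[OF j]])
    show "countable (carrier (G j)) \<or> carrier (G j) \<approx> (UNIV :: nat set set)"
      using image_countable_or_continuum[OF pol groups[OF j] group_hom.homh[OF retr_\<phi>_hom[OF j]] analytic_retraction_kernel[OF j]]
      by (simp only: eq)
  next
    show "analytic_subgroup X x (kernel (fundamental_group X x) (sum_group I G) (free_product_to_sum I G \<circ> \<phi>))"
      unfolding analytic_subgroup_def
    proof (rule conjI[OF _ analytic_to_sum_kernel])
      have sg: "group (sum_group I G)" by (rule sum_group) (rule groups)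
      have "group_hom (fundamental_group X x) (sum_group I G) (free_product_to_sum I G \<circ> \<phi>)"
        by (intro group_hom.intro group_hom_axioms.intro group_pi sg hom_compose[OF \<phi>_hom to_sum_hom])
      then show "subgroup (kernel (fundamental_group X x) (sum_group I G) (free_product_to_sum I G \<circ> \<phi>)) (fundamental_group X x)"
        by (rule group_hom.subgroup_kernel)
    qed
  qed
qed

end
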